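(* Let $M$ be a complex manifold and $G$ a (possibly discrete) complex Lie group acting holomorphically on $M$ from the right. The simplices of $\mathbf{Tot}(\mathbf{HVB}([M/G]))$ have the following interpretation. (1) A $0$-cell in $\mathbf{Tot}(\mathbf{HVB}([M/G]))$ consists precisely of a $G$-equivariant holomorphic vector bundle $E\to M$ with a holomorphic connection $\nabla$, where $\nabla$ is not required to satisfy any condition with respect to the $G$-action. (2) An $n$-cell in $\mathbf{Tot}(\mathbf{HVB}([M/G]))$ consists precisely of a sequence of $G$-equivariant holomorphic vector bundles $E^{(0)},\dots,E^{(n)}$ over $M$ and $G$-equivariant bundle isomorphisms $\alpha_0,\dots,\alpha_{n-1}$, $$E^{(0)}\xrightarrow{\alpha_0}E^{(1)}\xrightarrow{\alpha_1}\cdots\xrightarrow{\alpha_{n-1}}E^{(n)},$$ where each bundle $E^{(i)}\to M$ has a holomorphic connection $\nabla_i$, and the connections are not required to satisfy any condition with respect to the $G$-action or the bundle maps.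
   Context: $\mathbf{HVB}$: for a complex manifold $U$, $\mathbf{HVB}(U)$ is the nerve of the groupoid whose objects are finite rank holomorphic vector bundles on $U$ with a holomorphic connection and whose morphisms are all holomorphic bundle isomorphisms (over $\mathrm{id}_U$), not required to respect the connections. It is contravariant in $U$ by pullback (pullbacks are treated as strictly functorial, via the canonical identifications). $[M/G]$ is the simplicial complex manifold with $[M/G]_n=M\times G^{\times n}$, face maps $d_0(x,g_1,\dots,g_n)=(x\cdot g_1,g_2,\dots,g_n)$, $d_j(x,g_1,\dots,g_n)=(x,g_1,\dots,g_jg_{j+1},\dots,g_n)$ for $0<j<n$, $d_n(x,g_1,\dots,g_n)=(x,g_1,\dots,g_{n-1})$, and degeneracies $s_j(x,g_1,\dots,g_{n-1})=(x,g_1,\dots,g_j,1,g_{j+1},\dots,g_{n-1})$. $\mathbf{HVB}([M/G])$ is the cosimplicial simplicial set $[\ell]\mapsto\mathbf{HVB}(M\times G^{\times\ell})$. For a cosimplicial simplicial set $X$, $\mathbf{Tot}(X)$ is the simplicial set whose $n$-simplices (cells) are families of simplicial maps $(F_\ell:\Delta^\ell\times\Delta^n\to X^\ell)_{\ell\ge0}$ with $F_m\circ(\rho_*\times\mathrm{id})=X(\rho)\circ F_k$ for all $\rho:[k]\to[m]$ in $\mathbf\Delta$. A $G$-equivariant bundle over $M$ (with action $\rho:M\times G\to M$) is a holomorphic vector bundle $\pi:E\to M$ with a holomorphic right $G$-action $\varphi:E\times G\to E$, linear on fibers, such that $\pi\circ\varphi=\rho\circ(\pi\times\mathrm{id})$.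 A bundle map between $G$-equivariant bundles is $G$-equivariant if it commutes with the actions. *)

theory Defs
  imports "HOL-Analysis.Analysis" "HOL-Algebra.Module" "HOL-Algebra.Group"
begin

section \<open>Complex manifolds\<close>

text \<open>Complex affine space of dimension \<open>d\<close> is realised, as in \<^const>\<open>Euclidean_space\<close>, inside
  \<^typ>\<open>nat \<Rightarrow> complex\<close>, because the dimension of \<open>M \<times> G\<^sup>l\<close> depends on the variable \<open>l\<close>.\<close>

definition cspace :: "nat \<Rightarrow> (nat \<Rightarrow> complex) set"
  where "cspace d = {z. \<forall>i\<ge>d. z i = 0}"

definition copen :: "nat \<Rightarrow> (nat \<Rightarrow> complex) set \<Rightarrow> bool"
  where "copen d S \<longleftrightarrow> openin (top_of_set (cspace d)) S"

text \<open>Holomorphy in \<open>d\<close> variables is complex Frechet differentiability at every point.\<close>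

definition holo :: "nat \<Rightarrow> (nat \<Rightarrow> complex) set \<Rightarrow> ((nat \<Rightarrow> complex) \<Rightarrow> complex) \<Rightarrow> bool"
  where "holo d S f \<longleftrightarrow>
    (\<forall>a\<in>S. \<exists>c. \<forall>\<epsilon>>0. \<exists>\<delta>>0. \<forall>z\<in>S. (\<Sum>i<d. cmod (z i - a i)) < \<delta> \<longrightarrow>
       cmod (f z - f a - (\<Sum>i<d. c i * (z i - a i))) \<le> \<epsilon> * (\<Sum>i<d. cmod (z i - a i)))"

type_synonym 'a chart = "'a set \<times> nat \<times> ('a \<Rightarrow> nat \<Rightarrow> complex)"

text \<open>The topology of a manifold is the one induced by its atlas. The atlas need not be maximal:
  all notions below depend only on the holomorphic structure that it generates.
  Charts carry their own dimension, so a manifold need not be equidimensional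
  (total spaces of bundles whose rank is only locally constant are not). No countability is
  imposed, so that every discrete group is a complex Lie group.\<close>

record 'a cmfd =
  pts :: "'a set"
  charts :: "'a chart set"

definition mtop :: "'a cmfd \<Rightarrow> 'a topology"
  where "mtop X = topology (\<lambda>S. S \<subseteq> pts X \<and> (\<forall>(W, d, \<phi>)\<in>charts X. copen d (\<phi> ` (S \<inter> W))))"

definition complex_manifold :: "'a cmfd \<Rightarrow> bool"
  where "complex_manifold X \<longleftrightarrow>
    (\<Union>(W, d, \<phi>)\<in>charts X. W) = pts X \<and>
    (\<forall>(W, d, \<phi>)\<in>charts X. inj_on \<phi> W \<and> \<phi> ` W \<subseteq> cspace d) \<and>
    (\<forall>(W, d, \<phi>)\<in>charts X. \<forall>(W', d', \<phi>')\<in>charts X.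
       copen d (\<phi> ` (W \<inter> W')) \<and>
       (\<forall>i<d'. holo d (\<phi> ` (W \<inter> W')) (\<lambda>z. \<phi>' (inv_into W \<phi> z) i))) \<and>
    Hausdorff_space (mtop X)"

definition mholo :: "'a cmfd \<Rightarrow> 'a set \<Rightarrow> ('a \<Rightarrow> complex) \<Rightarrow> bool"
  where "mholo X S h \<longleftrightarrow>
    (\<forall>(W, d, \<phi>)\<in>charts X. holo d (\<phi> ` (S \<inter> W)) (\<lambda>z. h (inv_into W \<phi> z)))"

definition holo_map :: "'a cmfd \<Rightarrow> 'b cmfd \<Rightarrow> ('a \<Rightarrow> 'b) \<Rightarrow> bool"
  where "holo_map X Y f \<longleftrightarrow>
    f \<in> pts X \<rightarrow> pts Y \<and> continuous_map (mtop X) (mtop Y) f \<and>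
    (\<forall>(W, d, \<phi>)\<in>charts Y. \<forall>i<d. mholo X (pts X \<inter> f -` W) (\<lambda>x. \<phi> (f x) i))"

definition cat :: "nat \<Rightarrow> (nat \<Rightarrow> complex) \<Rightarrow> (nat \<Rightarrow> complex) \<Rightarrow> nat \<Rightarrow> complex"
  where "cat d z w = (\<lambda>i. if i < d then z i else w (i - d))"

definition prod_mfd :: "'a cmfd \<Rightarrow> 'b cmfd \<Rightarrow> ('a \<times> 'b) cmfd"
  where "prod_mfd X Y = \<lparr>pts = pts X \<times> pts Y,
    charts = {(W \<times> W', d + d', \<lambda>(x, y). cat d (\<phi> x) (\<phi>' y)) |W d \<phi> W' d' \<phi>'.
                (W, d, \<phi>) \<in> charts X \<and> (W', d', \<phi>') \<in> charts Y}\<rparr>"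

fun power_mfd :: "'a cmfd \<Rightarrow> nat \<Rightarrow> 'a list cmfd"
  where
    "power_mfd X 0 = \<lparr>pts = {[]}, charts = {({[]}, 0, \<lambda>_ _. 0)}\<rparr>"
  | "power_mfd X (Suc l) = \<lparr>pts = {x # xs |x xs. x \<in> pts X \<and> xs \<in> pts (power_mfd X l)},
       charts = {({x # xs |x xs. x \<in> W \<and> xs \<in> W'}, d + d', \<lambda>ys. cat d (\<phi> (hd ys)) (\<phi>' (tl ys)))
                   |W d \<phi> W' d' \<phi>'.
                     (W, d, \<phi>) \<in> charts X \<and> (W', d', \<phi>') \<in> charts (power_mfd X l)}\<rparr>"


section \<open>Complex Lie groups and right actions\<close>

definition complex_lie_group :: "'g monoid \<Rightarrow> 'g cmfd \<Rightarrow> bool"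
  where "complex_lie_group G N \<longleftrightarrow>
    group G \<and> complex_manifold N \<and> pts N = carrier G \<and>
    holo_map (prod_mfd N N) N (\<lambda>(g, h). g \<otimes>\<^bsub>G\<^esub> h) \<and> holo_map N N (\<lambda>g. inv\<^bsub>G\<^esub> g)"

definition holo_right_action ::
    "'m cmfd \<Rightarrow> 'g monoid \<Rightarrow> 'g cmfd \<Rightarrow> ('m \<Rightarrow> 'g \<Rightarrow> 'm) \<Rightarrow> bool"
  where "holo_right_action M G N \<rho> \<longleftrightarrow>
    holo_map (prod_mfd M N) M (\<lambda>(x, g). \<rho> x g) \<and>
    (\<forall>x\<in>pts M. \<rho> x \<one>\<^bsub>G\<^esub> = x) \<and>
    (\<forall>x\<in>pts M. \<forall>g\<in>carrier G. \<forall>h\<in>carrier G. \<rho> (\<rho> x g) h = \<rho> x (g \<otimes>\<^bsub>G\<^esub> h))"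


section \<open>Holomorphic vector bundles\<close>

definition complex_ring :: "complex ring"
  where "complex_ring = \<lparr>carrier = UNIV, mult = (*), one = 1, zero = 0, add = (+)\<rparr>"

lemma cring_complex_ring: "cring complex_ring"
  by (rule cringI, rule abelian_groupI, unfold complex_ring_def)
    (auto simp: algebra_simps intro!: comm_monoidI exI[of _ "- _"])

definition clinear :: "(complex, 'e) module \<Rightarrow> (complex, 'f) module \<Rightarrow> ('e \<Rightarrow> 'f) \<Rightarrow> bool"
  where "clinear A B f \<longleftrightarrow>
    f \<in> carrier A \<rightarrow> carrier B \<and>
    (\<forall>a\<in>carrier A. \<forall>b\<in>carrier A. f (a \<oplus>\<^bsub>A\<^esub> b) = f a \<oplus>\<^bsub>B\<^esub> f b) \<and>
    (\<forall>c. \<forall>a\<in>carrier A. f (c \<odot>\<^bsub>A\<^esub> a) = c \<odot>\<^bsub>B\<^esub> f a)"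

text \<open>A bundle over \<open>U\<close> is given by its fibres, with elements in a type \<open>'e\<close>, and the maximal
  collection of its holomorphic local trivialisations \<open>(V, r, \<psi>)\<close>, where \<open>\<psi> x\<close> maps the fibre over
  \<open>x \<in> V\<close> onto \<^term>\<open>cspace r\<close>; the total space is then the disjoint union of the fibres. With
  this encoding the fibre of \<open>f\<^sup>*E\<close> over \<open>u\<close> is literally the fibre of \<open>E\<close> over \<open>f u\<close>, and pullback
  is strictly functorial. (The ring multiplication fields of a \<open>module\<close> record play no role.)\<close>

record ('u, 'e) vbundle =
  fibre :: "'u \<Rightarrow> (complex, 'e) module"
  trivs :: "('u set \<times> nat \<times> ('u \<Rightarrow> 'e \<Rightarrow> nat \<Rightarrow> complex)) set"

definition local_triv ::
    "'u cmfd \<Rightarrow> ('u \<Rightarrow> (complex, 'e) module) \<Rightarrow> 'u set \<times> nat \<times> ('u \<Rightarrow> 'e \<Rightarrow> nat \<Rightarrow> complex) \<Rightarrow> bool"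
  where "local_triv U F = (\<lambda>(V, r, \<psi>). openin (mtop U) V \<and>
    (\<forall>x\<in>V. bij_betw (\<psi> x) (carrier (F x)) (cspace r) \<and>
       (\<forall>a\<in>carrier (F x). \<forall>b\<in>carrier (F x). \<psi> x (a \<oplus>\<^bsub>F x\<^esub> b) = (\<lambda>i. \<psi> x a i + \<psi> x b i)) \<and>
       (\<forall>c. \<forall>a\<in>carrier (F x). \<psi> x (c \<odot>\<^bsub>F x\<^esub> a) = (\<lambda>i. c * \<psi> x a i))))"

text \<open>The transition from the first to the second trivialisation has a holomorphic matrix.\<close>

definition holo_transition ::
    "'u cmfd \<Rightarrow> ('u \<Rightarrow> (complex, 'e) module) \<Rightarrow> 'u set \<times> nat \<times> ('u \<Rightarrow> 'e \<Rightarrow> nat \<Rightarrow> complex)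
      \<Rightarrow> 'u set \<times> nat \<times> ('u \<Rightarrow> 'e \<Rightarrow> nat \<Rightarrow> complex) \<Rightarrow> bool"
  where "holo_transition U F = (\<lambda>(V, r, \<psi>) (V', r', \<psi>').
    \<exists>g. (\<forall>a<r'. \<forall>b<r. mholo U (V \<inter> V') (g a b)) \<and>
        (\<forall>x\<in>V \<inter> V'. \<forall>e\<in>carrier (F x). \<forall>a<r'. \<psi>' x e a = (\<Sum>b<r. g a b x * \<psi> x e b)))"

definition holo_compatible ::
    "'u cmfd \<Rightarrow> ('u \<Rightarrow> (complex, 'e) module) \<Rightarrow> 'u set \<times> nat \<times> ('u \<Rightarrow> 'e \<Rightarrow> nat \<Rightarrow> complex)
      \<Rightarrow> 'u set \<times> nat \<times> ('u \<Rightarrow> 'e \<Rightarrow> nat \<Rightarrow> complex) \<Rightarrow> bool"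
  where "holo_compatible U F t t' \<longleftrightarrow> holo_transition U F t t' \<and> holo_transition U F t' t"

definition holo_bundle :: "'u cmfd \<Rightarrow> ('u, 'e) vbundle \<Rightarrow> bool"
  where "holo_bundle U E \<longleftrightarrow>
    fibre E \<in> extensional (pts U) \<and>
    (\<forall>x\<in>pts U. module complex_ring (fibre E x)) \<and>
    (\<Union>(V, r, \<psi>)\<in>trivs E. V) = pts U \<and>
    (\<forall>t\<in>trivs E. local_triv U (fibre E) t) \<and>
    (\<forall>t\<in>trivs E. \<forall>t'\<in>trivs E. holo_compatible U (fibre E) t t') \<and>
    (\<forall>t. local_triv U (fibre E) t \<and> (\<forall>t'\<in>trivs E. holo_compatible U (fibre E) t t')
         \<longrightarrow> t \<in> trivs E)"

definition total_space :: "'u cmfd \<Rightarrow> ('u, 'e) vbundle \<Rightarrow> ('u \<times> 'e) cmfd"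
  where "total_space U E = \<lparr>pts = (SIGMA x:pts U. carrier (fibre E x)),
    charts = {(SIGMA x:W \<inter> V. carrier (fibre E x), d + r, \<lambda>(x, e). cat d (\<phi> x) (\<psi> x e))
                |W d \<phi> V r \<psi>. (W, d, \<phi>) \<in> charts U \<and> (V, r, \<psi>) \<in> trivs E}\<rparr>"

definition pull_bundle ::
    "'v cmfd \<Rightarrow> 'u cmfd \<Rightarrow> ('v \<Rightarrow> 'u) \<Rightarrow> ('u, 'e) vbundle \<Rightarrow> ('v, 'e) vbundle"
  where "pull_bundle V U f E =
    (let F = (\<lambda>v\<in>pts V. fibre E (f v)) in
     \<lparr>fibre = F,
      trivs = {t. local_triv V F t \<and>
                  (\<forall>(W, r, \<psi>)\<in>trivs E.
                     holo_compatible V F t (pts V \<inter> f -` W, r, \<lambda>v. \<psi> (f v)))}\<rparr>)"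

text \<open>Bundle isomorphisms over the identity of \<open>U\<close>, given by their restrictions to the fibres.\<close>

definition bundle_isos ::
    "'u cmfd \<Rightarrow> ('u, 'e) vbundle \<Rightarrow> ('u, 'e) vbundle \<Rightarrow> ('u \<Rightarrow> 'e \<Rightarrow> 'e) set"
  where "bundle_isos U E E' = {\<alpha>. \<alpha> \<in> extensional (pts U) \<and>
    (\<forall>x\<in>pts U. \<alpha> x \<in> extensional (carrier (fibre E x)) \<and>
       clinear (fibre E x) (fibre E' x) (\<alpha> x) \<and>
       bij_betw (\<alpha> x) (carrier (fibre E x)) (carrier (fibre E' x))) \<and>
    holo_map (total_space U E) (total_space U E') (\<lambda>(x, e). (x, \<alpha> x e)) \<and>
    holo_map (total_space U E') (total_space U E)
      (\<lambda>(x, e). (x, inv_into (carrier (fibre E x)) (\<alpha> x) e))}"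


section \<open>Holomorphic connections\<close>

text \<open>Germs are represented by total functions that are holomorphic near the point.\<close>

definition germ_fun :: "'u cmfd \<Rightarrow> 'u \<Rightarrow> ('u \<Rightarrow> complex) set"
  where "germ_fun U x = {h. \<exists>V. openin (mtop U) V \<and> x \<in> V \<and> mholo U V h}"

definition germ_eq :: "'u cmfd \<Rightarrow> 'u \<Rightarrow> ('u \<Rightarrow> 'b) \<Rightarrow> ('u \<Rightarrow> 'b) \<Rightarrow> bool"
  where "germ_eq U x h k \<longleftrightarrow> (\<exists>V. openin (mtop U) V \<and> x \<in> V \<and> (\<forall>y\<in>V. h y = k y))"

text \<open>Holomorphic tangent vectors are complex derivations of the algebra of holomorphic germs.\<close>

type_synonym 'u tangent = "('u \<Rightarrow> complex) \<Rightarrow> complex"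

definition tangent_space :: "'u cmfd \<Rightarrow> 'u \<Rightarrow> 'u tangent set"
  where "tangent_space U x = {v. v \<in> extensional (germ_fun U x) \<and>
    (\<forall>h\<in>germ_fun U x. \<forall>k\<in>germ_fun U x.
       (germ_eq U x h k \<longrightarrow> v h = v k) \<and>
       v (\<lambda>y. h y + k y) = v h + v k \<and>
       v (\<lambda>y. h y * k y) = v h * k x + h x * v k) \<and>
    (\<forall>c. \<forall>h\<in>germ_fun U x. v (\<lambda>y. c * h y) = c * v h)}"

definition coord_vector :: "'u cmfd \<Rightarrow> 'u chart \<Rightarrow> nat \<Rightarrow> 'u \<Rightarrow> 'u tangent"
  where "coord_vector U = (\<lambda>(W, d, \<phi>) i x. \<lambda>h\<in>germ_fun U x.
    deriv (\<lambda>w. h (inv_into W \<phi> ((\<phi> x)(i := w)))) (\<phi> x i))"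

definition push_tangent :: "'u cmfd \<Rightarrow> ('v \<Rightarrow> 'u) \<Rightarrow> 'v \<Rightarrow> 'v tangent \<Rightarrow> 'u tangent"
  where "push_tangent U f x v = (\<lambda>h\<in>germ_fun U (f x). v (\<lambda>y. h (f y)))"

definition holo_section :: "'u cmfd \<Rightarrow> ('u, 'e) vbundle \<Rightarrow> 'u set \<Rightarrow> ('u \<Rightarrow> 'e) \<Rightarrow> bool"
  where "holo_section U E V s \<longleftrightarrow> openin (mtop U) V \<and> (\<forall>x\<in>V. s x \<in> carrier (fibre E x)) \<and>
    (\<forall>(W, r, \<psi>)\<in>trivs E. \<forall>i<r. mholo U (V \<inter> W) (\<lambda>x. \<psi> x (s x) i))"

definition germ_section :: "'u cmfd \<Rightarrow> ('u, 'e) vbundle \<Rightarrow> 'u \<Rightarrow> ('u \<Rightarrow> 'e) set"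
  where "germ_section U E x = {s. \<exists>V. x \<in> V \<and> holo_section U E V s}"

text \<open>A connection is given by its covariant derivatives: \<open>D x v s\<close> is the derivative of the local
  section \<open>s\<close> at \<open>x\<close> in the direction \<open>v\<close>. Holomorphy of the connection says that it sends a
  holomorphic section to a bundle-valued one-form whose coefficients in charts are holomorphic.\<close>

type_synonym ('u, 'e) connection = "'u \<Rightarrow> 'u tangent \<Rightarrow> ('u \<Rightarrow> 'e) \<Rightarrow> 'e"

definition holo_connection :: "'u cmfd \<Rightarrow> ('u, 'e) vbundle \<Rightarrow> ('u, 'e) connection \<Rightarrow> bool"
  where "holo_connection U E D \<longleftrightarrow>
    D \<in> extensional (pts U) \<and>
    (\<forall>x\<in>pts U. D x \<in> extensional (tangent_space U x) \<and>
       (\<forall>v\<in>tangent_space U x. D x v \<in> germ_section U E x \<rightarrow>\<^sub>E carrier (fibre E x) \<and>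
          (\<forall>s\<in>germ_section U E x. \<forall>t\<in>germ_section U E x.
             (germ_eq U x s t \<longrightarrow> D x v s = D x v t) \<and>
             D x v (\<lambda>y. s y \<oplus>\<^bsub>fibre E y\<^esub> t y) = D x v s \<oplus>\<^bsub>fibre E x\<^esub> D x v t) \<and>
          (\<forall>s\<in>germ_section U E x. \<forall>h\<in>germ_fun U x.
             D x v (\<lambda>y. h y \<odot>\<^bsub>fibre E y\<^esub> s y)
               = v h \<odot>\<^bsub>fibre E x\<^esub> s x \<oplus>\<^bsub>fibre E x\<^esub> h x \<odot>\<^bsub>fibre E x\<^esub> D x v s)) \<and>
       (\<forall>s\<in>germ_section U E x. \<forall>v\<in>tangent_space U x.
          (\<forall>w\<in>tangent_space U x.
             D x (\<lambda>h\<in>germ_fun U x. v h + w h) s = D x v s \<oplus>\<^bsub>fibre E x\<^esub> D x w s) \<and>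
          (\<forall>c. D x (\<lambda>h\<in>germ_fun U x. c * v h) s = c \<odot>\<^bsub>fibre E x\<^esub> D x v s))) \<and>
    (\<forall>V s. holo_section U E V s \<longrightarrow>
       (\<forall>(W, d, \<phi>)\<in>charts U. \<forall>i<d.
          holo_section U E (V \<inter> W) (\<lambda>x. D x (coord_vector U (W, d, \<phi>) i x) s)))"

text \<open>The pullback connection is characterised by its values on pulled back sections.\<close>

definition pull_connection ::
    "'v cmfd \<Rightarrow> 'u cmfd \<Rightarrow> ('v \<Rightarrow> 'u) \<Rightarrow> ('u, 'e) vbundle \<Rightarrow> ('u, 'e) connection
      \<Rightarrow> ('v, 'e) connection"
  where "pull_connection V U f E D =
    (THE D'. holo_connection V (pull_bundle V U f E) D' \<and>
       (\<forall>x\<in>pts V. \<forall>v\<in>tangent_space V x. \<forall>s\<in>germ_section U E (f x).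
          D' x v (\<lambda>y. s (f y)) = D (f x) (push_tangent U f x v) s))"


section \<open>Simplicial sets\<close>

text \<open>The morphisms from \<open>[k]\<close> to \<open>[m]\<close> in the simplex category.\<close>

definition omaps :: "nat \<Rightarrow> nat \<Rightarrow> (nat \<Rightarrow> nat) set"
  where "omaps k m = {\<theta>. \<theta> \<in> {..k} \<rightarrow>\<^sub>E {..m} \<and> mono_on {..k} \<theta>}"

text \<open>For \<open>\<theta> \<in> omaps k m\<close>, \<open>sact X k m \<theta>\<close> is the induced map from \<open>m\<close>-simplices to \<open>k\<close>-simplices.\<close>

record 'a sset =
  simplices :: "nat \<Rightarrow> 'a set"
  sact :: "nat \<Rightarrow> nat \<Rightarrow> (nat \<Rightarrow> nat) \<Rightarrow> 'a \<Rightarrow> 'a"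

definition std_simplex :: "nat \<Rightarrow> (nat \<Rightarrow> nat) sset"
  where "std_simplex l = \<lparr>simplices = (\<lambda>p. omaps p l), sact = (\<lambda>k m \<theta> a. compose {..k} a \<theta>)\<rparr>"

definition prod_sset :: "'a sset \<Rightarrow> 'b sset \<Rightarrow> ('a \<times> 'b) sset"
  where "prod_sset X Y = \<lparr>simplices = (\<lambda>p. simplices X p \<times> simplices Y p),
    sact = (\<lambda>k m \<theta>. map_prod (sact X k m \<theta>) (sact Y k m \<theta>))\<rparr>"

definition smaps :: "'a sset \<Rightarrow> 'b sset \<Rightarrow> (nat \<Rightarrow> 'a \<Rightarrow> 'b) set"
  where "smaps X Y = {F. (\<forall>p. F p \<in> simplices X p \<rightarrow>\<^sub>E simplices Y p) \<and>
    (\<forall>k m. \<forall>\<theta>\<in>omaps k m. \<forall>a\<in>simplices X m. F k (sact X k m \<theta> a) = sact Y k m \<theta> (F m a))}"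

text \<open>For \<open>\<theta> \<in> omaps k m\<close>, \<open>cact X k m \<theta>\<close> is the induced simplicial map from level \<open>k\<close> to level \<open>m\<close>.\<close>

record 'a csset =
  level :: "nat \<Rightarrow> 'a sset"
  cact :: "nat \<Rightarrow> nat \<Rightarrow> (nat \<Rightarrow> nat) \<Rightarrow> nat \<Rightarrow> 'a \<Rightarrow> 'a"

type_synonym 'a tot_cell = "nat \<Rightarrow> nat \<Rightarrow> (nat \<Rightarrow> nat) \<times> (nat \<Rightarrow> nat) \<Rightarrow> 'a"

definition Tot :: "'a csset \<Rightarrow> 'a tot_cell sset"
  where "Tot X = \<lparr>
    simplices = (\<lambda>n. {F.
      (\<forall>l. F l \<in> smaps (prod_sset (std_simplex l) (std_simplex n)) (level X l)) \<and>
      (\<forall>k m. \<forall>\<theta>\<in>omaps k m. \<forall>p. \<forall>a\<in>omaps p k. \<forall>b\<in>omaps p n.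
         F m p (compose {..p} \<theta> a, b) = cact X k m \<theta> p (F k p (a, b)))}),
    sact = (\<lambda>k m \<theta> F l p. \<lambda>(a, b)\<in>omaps p l \<times> omaps p k. F l p (a, compose {..p} \<theta> b))\<rparr>"

record ('o, 'a) cat_data =
  Ob :: "'o set"
  Hom :: "'o \<Rightarrow> 'o \<Rightarrow> 'a set"
  Id :: "'o \<Rightarrow> 'a"
  Comp :: "'o \<Rightarrow> 'o \<Rightarrow> 'o \<Rightarrow> 'a \<Rightarrow> 'a \<Rightarrow> 'a"

definition le_pairs :: "nat \<Rightarrow> (nat \<times> nat) set"
  where "le_pairs n = {(i, j). i \<le> j \<and> j \<le> n}"

text \<open>The \<open>n\<close>-simplices of the nerve are the functors from the poset \<open>[n]\<close>.\<close>

type_synonym ('o, 'a) nerve_simplex = "(nat \<Rightarrow> 'o) \<times> (nat \<times> nat \<Rightarrow> 'a)"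

definition nerve :: "('o, 'a) cat_data \<Rightarrow> ('o, 'a) nerve_simplex sset"
  where "nerve C = \<lparr>
    simplices = (\<lambda>n. {(X, f). X \<in> {..n} \<rightarrow>\<^sub>E Ob C \<and> f \<in> extensional (le_pairs n) \<and>
      (\<forall>(i, j)\<in>le_pairs n. f (i, j) \<in> Hom C (X i) (X j)) \<and>
      (\<forall>i\<le>n. f (i, i) = Id C (X i)) \<and>
      (\<forall>i j k. i \<le> j \<and> j \<le> k \<and> k \<le> n \<longrightarrow>
         f (i, k) = Comp C (X i) (X j) (X k) (f (j, k)) (f (i, j)))}),
    sact = (\<lambda>k m \<theta> (X, f).
      (\<lambda>i\<in>{..k}. X (\<theta> i), \<lambda>(i, j)\<in>le_pairs k. f (\<theta> i, \<theta> j)))\<rparr>"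

definition nerve_map ::
    "('o \<Rightarrow> 'p) \<Rightarrow> ('a \<Rightarrow> 'b) \<Rightarrow> nat \<Rightarrow> ('o, 'a) nerve_simplex \<Rightarrow> ('p, 'b) nerve_simplex"
  where "nerve_map Fo Fa n = (\<lambda>(X, f). (\<lambda>i\<in>{..n}. Fo (X i), \<lambda>q\<in>le_pairs n. Fa (f q)))"


section \<open>The simplicial presheaf \<open>HVB\<close>\<close>

type_synonym ('u, 'e) hvb_object = "('u, 'e) vbundle \<times> ('u, 'e) connection"

definition hvb_groupoid :: "'u cmfd \<Rightarrow> (('u, 'e) hvb_object, 'u \<Rightarrow> 'e \<Rightarrow> 'e) cat_data"
  where "hvb_groupoid U = \<lparr>
    Ob = {(E, D). holo_bundle U E \<and> holo_connection U E D},
    Hom = (\<lambda>(E, D) (E', D'). bundle_isos U E E'),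
    Id = (\<lambda>(E, D). \<lambda>x\<in>pts U. \<lambda>e\<in>carrier (fibre E x). e),
    Comp = (\<lambda>(E, D) _ _ \<beta> \<alpha>. \<lambda>x\<in>pts U. compose (carrier (fibre E x)) (\<beta> x) (\<alpha> x))\<rparr>"

type_synonym ('u, 'e) hvb_simplex = "(('u, 'e) hvb_object, 'u \<Rightarrow> 'e \<Rightarrow> 'e) nerve_simplex"

definition HVB :: "'u cmfd \<Rightarrow> ('u, 'e) hvb_simplex sset"
  where "HVB U = nerve (hvb_groupoid U)"

definition pull_object ::
    "'v cmfd \<Rightarrow> 'u cmfd \<Rightarrow> ('v \<Rightarrow> 'u) \<Rightarrow> ('u, 'e) hvb_object \<Rightarrow> ('v, 'e) hvb_object"
  where "pull_object V U f = (\<lambda>(E, D). (pull_bundle V U f E, pull_connection V U f E D))"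

definition pull_iso :: "'v cmfd \<Rightarrow> ('v \<Rightarrow> 'u) \<Rightarrow> ('u \<Rightarrow> 'e \<Rightarrow> 'e) \<Rightarrow> 'v \<Rightarrow> 'e \<Rightarrow> 'e"
  where "pull_iso V f \<alpha> = (\<lambda>v\<in>pts V. \<alpha> (f v))"

definition HVB_pull ::
    "'v cmfd \<Rightarrow> 'u cmfd \<Rightarrow> ('v \<Rightarrow> 'u) \<Rightarrow> nat \<Rightarrow> ('u, 'e) hvb_simplex \<Rightarrow> ('v, 'e) hvb_simplex"
  where "HVB_pull V U f = nerve_map (pull_object V U f) (pull_iso V f)"


section \<open>The simplicial manifold \<open>[M/G]\<close>\<close>

definition quot_level :: "'m cmfd \<Rightarrow> 'g cmfd \<Rightarrow> nat \<Rightarrow> ('m \<times> 'g list) cmfd"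
  where "quot_level M N l = prod_mfd M (power_mfd N l)"

definition list_mult :: "'g monoid \<Rightarrow> 'g list \<Rightarrow> 'g"
  where "list_mult G gs = foldr (mult G) gs \<one>\<^bsub>G\<^esub>"

text \<open>The structure map \<open>M \<times> G\<^sup>m \<rightarrow> M \<times> G\<^sup>k\<close> induced by \<open>\<theta> \<in> omaps k m\<close> sends
  \<open>(x, g\<^sub>1, \<dots>, g\<^sub>m)\<close> to \<open>(x \<cdot> g\<^sub>1 \<cdots> g\<^bsub>\<theta> 0\<^esub>, h\<^sub>1, \<dots>, h\<^sub>k)\<close>, where \<open>h\<^sub>j\<close> is the product of the \<open>g\<^sub>i\<close>
  with \<open>\<theta> (j - 1) < i \<le> \<theta> j\<close>. The lemmas below identify it on cofaces and codegeneracies.\<close>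

definition quot_map ::
    "'g monoid \<Rightarrow> ('m \<Rightarrow> 'g \<Rightarrow> 'm) \<Rightarrow> nat \<Rightarrow> (nat \<Rightarrow> nat) \<Rightarrow> 'm \<times> 'g list \<Rightarrow> 'm \<times> 'g list"
  where "quot_map G \<rho> k \<theta> = (\<lambda>(x, gs).
    (\<rho> x (list_mult G (take (\<theta> 0) gs)),
     map (\<lambda>j. list_mult G (take (\<theta> (Suc j) - \<theta> j) (drop (\<theta> j) gs))) [0..<k]))"

definition coface :: "nat \<Rightarrow> nat \<Rightarrow> nat \<Rightarrow> nat"
  where "coface n j = (\<lambda>i\<in>{..n}. if i < j then i else Suc i)"

definition codegeneracy :: "nat \<Rightarrow> nat \<Rightarrow> nat \<Rightarrow> nat"
  where "codegeneracy n j = (\<lambda>i\<in>{..n}. if i \<le> j then i else i - 1)"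

lemma coface_omaps: "coface n j \<in> omaps n (Suc n)"
  by (auto simp: omaps_def coface_def mono_on_def)

lemma codegeneracy_omaps: "codegeneracy (Suc n) j \<in> omaps (Suc n) n" if "j \<le> n"
  using that by (auto simp: omaps_def codegeneracy_def mono_on_def)

context
  fixes G :: "'g monoid" and \<rho> :: "'m \<Rightarrow> 'g \<Rightarrow> 'm" and gs :: "'g list" and n :: nat and x :: 'm
  assumes G: "group G" and gs: "set gs \<subseteq> carrier G" and \<rho>: "\<rho> x \<one>\<^bsub>G\<^esub> = x"
begin

lemma list_mult_1: "i < length gs \<Longrightarrow> list_mult G (take (Suc 0) (drop i gs)) = gs ! i"
proof -
  interpret group G by (rule G)
  assume i: "i < length gs"
  then have "gs ! i \<in> carrier G" using gs nth_mem by blast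
  moreover have "take (Suc 0) (drop i gs) = [gs ! i]"
    using i by (simp add: take_Suc hd_drop_conv_nth)
  ultimately show ?thesis by (simp add: list_mult_def)
qed

lemma list_mult_2:
  "Suc i < length gs \<Longrightarrow>
    list_mult G (take (Suc (Suc 0)) (drop i gs)) = gs ! i \<otimes>\<^bsub>G\<^esub> gs ! Suc i"
proof -
  interpret group G by (rule G)
  assume i: "Suc i < length gs"
  then have "gs ! i \<in> carrier G" using gs nth_mem[of i gs] by auto
  moreover have "gs ! Suc i \<in> carrier G" using i gs nth_mem[of "Suc i" gs] by auto
  moreover have "take (Suc (Suc 0)) (drop i gs) = [gs ! i, gs ! Suc i]"
    using i by (metis Cons_nth_drop_Suc Suc_lessD take0 take_Suc_Cons)
  ultimately show ?thesis by (simp add: list_mult_def)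
qed

lemma quot_map_coface_first:
  assumes "length gs = Suc n"
  shows "quot_map G \<rho> n (coface n 0) (x, gs) = (\<rho> x (hd gs), tl gs)"
proof -
  have "gs \<noteq> []" using assms by auto
  then show ?thesis using assms list_mult_1[of 0]
    by (auto simp: quot_map_def coface_def hd_conv_nth nth_tl list_mult_1 intro!: nth_equalityI)
qed

lemma quot_map_coface_middle:
  assumes "length gs = Suc n" "0 < j" "j \<le> n"
  shows "quot_map G \<rho> n (coface n j) (x, gs)
    = (x, take (j - 1) gs @ [gs ! (j - 1) \<otimes>\<^bsub>G\<^esub> gs ! j] @ drop (Suc j) gs)"
proof -
  have "map (\<lambda>i. list_mult G (take (coface n j (Suc i) - coface n j i) (drop (coface n j i) gs)))
      [0..<n] = take (j - 1) gs @ [gs ! (j - 1) \<otimes>\<^bsub>G\<^esub> gs ! j] @ drop (Suc j) gs"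
  proof (rule nth_equalityI)
    fix i assume "i < length (map (\<lambda>i. list_mult G
      (take (coface n j (Suc i) - coface n j i) (drop (coface n j i) gs))) [0..<n])"
    then have i: "i < n" by simp
    consider "Suc i < j" | "Suc i = j" | "j \<le> i" by linarith
    then show "map (\<lambda>i. list_mult G (take (coface n j (Suc i) - coface n j i)
        (drop (coface n j i) gs))) [0..<n] ! i
      = (take (j - 1) gs @ [gs ! (j - 1) \<otimes>\<^bsub>G\<^esub> gs ! j] @ drop (Suc j) gs) ! i"
    proof cases
      case 1
      then have "i < j - Suc 0" by simp
      with 1 show ?thesis using i assms
        by (simp add: coface_def nth_append list_mult_1)
    next
      case 2
      then have "Suc (Suc i) - i = Suc (Suc 0)" by simp
      with 2 show ?thesis using i assms list_mult_2[of i]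
        by (auto simp: coface_def nth_append)
    next
      case 3
      then have "i - (j - 1) = Suc (i - j)" "\<not> i < j - 1" using assms by auto
      with 3 show ?thesis using i assms
        by (simp add: coface_def nth_append list_mult_1 min_def)
    qed
  qed (use assms in auto)
  then show ?thesis using assms \<rho> by (simp add: quot_map_def coface_def list_mult_def)
qed

lemma quot_map_coface_last:
  assumes "length gs = Suc n"
  shows "quot_map G \<rho> n (coface n (Suc n)) (x, gs) = (x, butlast gs)"
proof -
  have "map (\<lambda>i. list_mult G (take (coface n (Suc n) (Suc i) - coface n (Suc n) i)
      (drop (coface n (Suc n) i) gs))) [0..<n] = butlast gs"
  proof (rule nth_equalityI, goal_cases)
    case (2 i)
    then have "i < n" by simp
    then show ?case using assms by (simp add: coface_def nth_butlast list_mult_1)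
  qed (use assms in simp)
  then show ?thesis using \<rho> by (simp add: quot_map_def coface_def list_mult_def)
qed

lemma quot_map_codegeneracy:
  assumes "length gs = n" "j \<le> n"
  shows "quot_map G \<rho> (Suc n) (codegeneracy (Suc n) j) (x, gs)
    = (x, take j gs @ [\<one>\<^bsub>G\<^esub>] @ drop j gs)"
proof -
  define h where "h i = list_mult G (take (codegeneracy (Suc n) j (Suc i) -
    codegeneracy (Suc n) j i) (drop (codegeneracy (Suc n) j i) gs))" for i
  have "map h [0..<Suc n] = take j gs @ [\<one>\<^bsub>G\<^esub>] @ drop j gs"
  proof (rule nth_equalityI)
    fix i assume "i < length (map h [0..<Suc n])"
    then have i: "i < Suc n" by (simp del: upt_Suc)
    have "h i = (take j gs @ [\<one>\<^bsub>G\<^esub>] @ drop j gs) ! i"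
    proof (cases i j rule: linorder_cases)
      case less
      then show ?thesis using i assms
        by (simp add: h_def codegeneracy_def nth_append list_mult_1)
    next
      case equal
      then show ?thesis using i assms
        by (simp add: h_def codegeneracy_def nth_append list_mult_def)
    next
      case greater
      then obtain k where k: "i = Suc k" "j \<le> k" by (cases i) auto
      then have "h i = gs ! k" using i assms list_mult_1[of k]
        by (auto simp: h_def codegeneracy_def)
      moreover have "(take j gs @ [\<one>\<^bsub>G\<^esub>] @ drop j gs) ! i = gs ! k"
        using k i assms by (simp add: nth_append Suc_diff_le)
      ultimately show ?thesis by simp
    qed
    then show "map h [0..<Suc n] ! i = (take j gs @ [\<one>\<^bsub>G\<^esub>] @ drop j gs) ! i"
      using i by (simp del: upt_Suc)
  qed (use assms in auto)
  moreover have "\<rho> x (list_mult G (take (codegeneracy (Suc n) j 0) gs)) = x"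
    using \<rho> by (simp add: codegeneracy_def list_mult_def)
  ultimately show ?thesis by (simp add: quot_map_def h_def[abs_def] del: upt_Suc)
qed

end

definition HVB_quot ::
    "'m cmfd \<Rightarrow> 'g monoid \<Rightarrow> 'g cmfd \<Rightarrow> ('m \<Rightarrow> 'g \<Rightarrow> 'm) \<Rightarrow> ('m \<times> 'g list, 'e) hvb_simplex csset"
  where "HVB_quot M G N \<rho> = \<lparr>
    level = (\<lambda>l. HVB (quot_level M N l)),
    cact = (\<lambda>k m \<theta>. HVB_pull (quot_level M N m) (quot_level M N k) (quot_map G \<rho> k \<theta>))\<rparr>"


section \<open>Equivariant bundles\<close>

definition equivariant_bundle ::
    "'m cmfd \<Rightarrow> 'g monoid \<Rightarrow> 'g cmfd \<Rightarrow> ('m \<Rightarrow> 'g \<Rightarrow> 'm) \<Rightarrow> ('m, 'e) vbundle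
      \<Rightarrow> (('m \<times> 'e) \<times> 'g \<Rightarrow> 'm \<times> 'e) \<Rightarrow> bool"
  where "equivariant_bundle M G N \<rho> E \<Phi> \<longleftrightarrow>
    (let T = total_space M E in
     holo_bundle M E \<and>
     \<Phi> \<in> extensional (pts T \<times> carrier G) \<and>
     holo_map (prod_mfd T N) T \<Phi> \<and>
     (\<forall>p\<in>pts T. \<Phi> (p, \<one>\<^bsub>G\<^esub>) = p) \<and>
     (\<forall>p\<in>pts T. \<forall>g\<in>carrier G. \<forall>h\<in>carrier G. \<Phi> (\<Phi> (p, g), h) = \<Phi> (p, g \<otimes>\<^bsub>G\<^esub> h)) \<and>
     (\<forall>p\<in>pts T. \<forall>g\<in>carrier G. fst (\<Phi> (p, g)) = \<rho> (fst p) g) \<and>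
     (\<forall>x\<in>pts M. \<forall>g\<in>carrier G.
        clinear (fibre E x) (fibre E (\<rho> x g)) (\<lambda>e. snd (\<Phi> ((x, e), g)))))"

type_synonym ('m, 'g, 'e) eqv_data =
  "('m, 'e) vbundle \<times> (('m \<times> 'e) \<times> 'g \<Rightarrow> 'm \<times> 'e) \<times> ('m, 'e) connection"

definition eqv_bundles ::
    "'m cmfd \<Rightarrow> 'g monoid \<Rightarrow> 'g cmfd \<Rightarrow> ('m \<Rightarrow> 'g \<Rightarrow> 'm) \<Rightarrow> ('m, 'g, 'e) eqv_data set"
  where "eqv_bundles M G N \<rho> =
    {(E, \<Phi>, D). equivariant_bundle M G N \<rho> E \<Phi> \<and> holo_connection M E D}"

definition eqv_isos ::
    "'m cmfd \<Rightarrow> 'g monoid \<Rightarrow> ('m, 'g, 'e) eqv_data \<Rightarrow> ('m, 'g, 'e) eqv_data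
      \<Rightarrow> ('m \<Rightarrow> 'e \<Rightarrow> 'e) set"
  where "eqv_isos M G = (\<lambda>(E, \<Phi>, D) (E', \<Phi>', D'). {\<alpha>\<in>bundle_isos M E E'.
    let A = (\<lambda>(x, e). (x, \<alpha> x e)) in
    \<forall>p\<in>pts (total_space M E). \<forall>g\<in>carrier G. A (\<Phi> (p, g)) = \<Phi>' (A p, g)})"

definition eqv_strings ::
    "'m cmfd \<Rightarrow> 'g monoid \<Rightarrow> 'g cmfd \<Rightarrow> ('m \<Rightarrow> 'g \<Rightarrow> 'm) \<Rightarrow> nat
      \<Rightarrow> ((nat \<Rightarrow> ('m, 'g, 'e) eqv_data) \<times> (nat \<Rightarrow> 'm \<Rightarrow> 'e \<Rightarrow> 'e)) set"
  where "eqv_strings M G N \<rho> n =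
    {(B, \<alpha>). B \<in> {..n} \<rightarrow>\<^sub>E eqv_bundles M G N \<rho> \<and> \<alpha> \<in> extensional {..<n} \<and>
       (\<forall>i<n. \<alpha> i \<in> eqv_isos M G (B i) (B (Suc i)))}"


section \<open>The data carried by a cell of the totalisation\<close>

definition const_map :: "nat \<Rightarrow> nat \<Rightarrow> nat \<Rightarrow> nat"
  where "const_map p i = (\<lambda>_\<in>{..p}. i)"

definition edge_map :: "nat \<Rightarrow> nat \<Rightarrow> nat"
  where "edge_map i = (\<lambda>j\<in>{..1}. i + j)"

text \<open>The canonical identification of \<open>M\<close> with \<open>M \<times> G\<^sup>0\<close>.\<close>

definition base_incl :: "'m \<Rightarrow> 'm \<times> 'g list"
  where "base_incl x = (x, [])"

text \<open>The \<open>i\<close>-th bundle and connection are the value of \<open>F\<^sub>0\<close> at the vertex \<open>i\<close> of \<open>\<Delta>\<^sup>0 \<times> \<Delta>\<^sup>n\<close>. The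
  value of \<open>F\<^sub>1\<close> at the edge of \<open>\<Delta>\<^sup>1 \<times> {i}\<close> is an isomorphism over \<open>M \<times> G\<close> from the pullback of this
  bundle along \<open>(x, g) \<mapsto> x\<close> to its pullback along \<open>(x, g) \<mapsto> x \<cdot> g\<close>, that is, the action.\<close>

definition cell_vertex ::
    "'m cmfd \<Rightarrow> 'g monoid \<Rightarrow> 'g cmfd \<Rightarrow> ('m \<Rightarrow> 'g \<Rightarrow> 'm)
      \<Rightarrow> ('m \<times> 'g list, 'e) hvb_simplex tot_cell \<Rightarrow> nat \<Rightarrow> ('m, 'g, 'e) eqv_data"
  where "cell_vertex M G N \<rho> F i =
    (let (E, D) = pull_object M (quot_level M N 0) base_incl
                    (fst (F 0 0 (const_map 0 0, const_map 0 i)) 0);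
         \<beta> = snd (F 1 1 (edge_map 0, const_map 1 i)) (0, 1)
     in (E,
         \<lambda>((x, e), g)\<in>pts (total_space M E) \<times> carrier G. (\<rho> x g, \<beta> (x, [g]) e),
         D))"

definition cell_edge ::
    "'m cmfd \<Rightarrow> ('m \<times> 'g list, 'e) hvb_simplex tot_cell \<Rightarrow> nat \<Rightarrow> 'm \<Rightarrow> 'e \<Rightarrow> 'e"
  where "cell_edge M F i = pull_iso M base_incl (snd (F 0 1 (const_map 1 0, edge_map i)) (0, 1))"

definition cell_string ::
    "'m cmfd \<Rightarrow> 'g monoid \<Rightarrow> 'g cmfd \<Rightarrow> ('m \<Rightarrow> 'g \<Rightarrow> 'm) \<Rightarrow> nat
      \<Rightarrow> ('m \<times> 'g list, 'e) hvb_simplex tot_cell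
      \<Rightarrow> (nat \<Rightarrow> ('m, 'g, 'e) eqv_data) \<times> (nat \<Rightarrow> 'm \<Rightarrow> 'e \<Rightarrow> 'e)"
  where "cell_string M G N \<rho> n F =
    (\<lambda>i\<in>{..n}. cell_vertex M G N \<rho> F i, \<lambda>i\<in>{..<n}. cell_edge M F i)"

end

theory Submission
  imports Defs "HOL-Complex_Analysis.Cauchy_Integral_Formula"
begin

text \<open>A simplex of the totalisation is a compatible family of functors from \<open>[l] \<times> [n]\<close> to the
  groupoids over \<open>M \<times> G\<^sup>l\<close>. The object at \<open>(j, i)\<close> is pulled back from the object \<open>i\<close> over \<open>M \<times> G\<^sup>0\<close> along
  the vertex \<open>j\<close>, and the arrow from \<open>(j, i)\<close> to \<open>(j', i')\<close> factors through \<open>(j', i)\<close>, where the first factor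
  is pulled back from the edge of \<open>[1] \<times> {i}\<close> over \<open>M \<times> G\<close> and the second one from \<open>{0} \<times> [n]\<close>. So the family
  is determined by the bundles, connections and isomorphisms over \<open>M\<close> and by isomorphisms over \<open>M \<times> G\<close> from
  the pullbacks along the projection to the pullbacks along the action. Degenerate edges, triangles and squares
  say that the latter are unital, associative and commute with the isomorphisms over \<open>M\<close>, that is, they are
  \<open>G\<close>-actions. Conversely such data define functors by the same factorisation.

  This needs pullbacks to be strictly functorial. For bundles the encoding yields it; the total space of a
  pullback has the usual universal property, which reduces holomorphy of the maps involved to compositions.
  A pulled back connection is unique because in a trivialisation a connection is the derivative plus a matrix
  of its values on the frame, and the frame is pulled back. The same formula proves existence; its
  coefficients are holomorphic by the chain rule and because partial derivatives of holomorphic functions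
  of several variables are holomorphic.\<close>

section \<open>Complex differentiability in several variables\<close>

text \<open>All charts live in \<open>nat \<Rightarrow> complex\<close>, where
  \<open>cspace d\<close> has empty interior. Openness, limits and differentiability therefore make
  sense only relative to it; the filter \<open>cnhds\<close> encodes this. Manifolds are treated
  pointwise with filters as well, because values outside a chart domain or a carrier are arbitrary
  and functions usually agree only near a point. The pulled back connection is specified by a
  definite description, so nothing can be computed with it before existence and uniqueness are
  known; afterwards its functoriality follows from uniqueness alone. A nerve simplex stores every
  arrow of its functor. Hence naturality in the degree reduces objects to vertices and arrows to
  edges, and triangles serve only for relations. The bijection is one of HOL functions and not of
  isomorphism classes: both composites must be equal as functions, so in every layer (cells, nerve
  simplices, isomorphisms, fibre maps) the default values outside the domain have to match.\<close>

definition cnhds :: "nat \<Rightarrow> (nat \<Rightarrow> complex) \<Rightarrow> (nat \<Rightarrow> complex) filter"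
  where "cnhds d a = inf (nhds a) (principal (cspace d))"

definition cnorm :: "nat \<Rightarrow> (nat \<Rightarrow> complex) \<Rightarrow> real"
  where "cnorm d z = (\<Sum>i<d. cmod (z i))"

lemma cnorm_nonneg [simp]: "0 \<le> cnorm d z"
  by (simp add: cnorm_def sum_nonneg)

lemma cmod_le_cnorm: "i < d \<Longrightarrow> cmod (z i) \<le> cnorm d z"
  unfolding cnorm_def by (rule member_le_sum) auto

lemma tendsto_fun_iff:
  fixes g :: "'a \<Rightarrow> nat \<Rightarrow> complex"
  shows "(g \<longlongrightarrow> a) F \<longleftrightarrow> (\<forall>i. ((\<lambda>x. g x i) \<longlongrightarrow> a i) F)"
proof -
  have "(g \<longlongrightarrow> a) F \<longleftrightarrow> limitin (product_topology (\<lambda>_. euclidean) UNIV) g a F"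
    by (simp add: euclidean_product_topology)
  also have "\<dots> \<longleftrightarrow> (\<forall>i. ((\<lambda>x. g x i) \<longlongrightarrow> a i) F)"
    by (subst limitin_componentwise) auto
  finally show ?thesis .
qed

lemma filterlim_cnhds_iff:
  "filterlim g (cnhds d a) F \<longleftrightarrow> (\<forall>i. ((\<lambda>x. g x i) \<longlongrightarrow> a i) F) \<and> eventually (\<lambda>x. g x \<in> cspace d) F"
  by (simp add: cnhds_def filterlim_inf filterlim_principal tendsto_fun_iff)

lemma tendsto_coord_cnhds: "((\<lambda>z. z i) \<longlongrightarrow> a i) (cnhds d a)"
  using filterlim_cnhds_iff[of "\<lambda>z. z" d a "cnhds d a"] by (auto simp: filterlim_ident)

lemma eventually_cspace_cnhds: "eventually (\<lambda>z. z \<in> cspace d) (cnhds d a)"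
  using filterlim_cnhds_iff[of "\<lambda>z. z" d a "cnhds d a"] by (auto simp: filterlim_ident)

lemma eventually_cnhds_self:
  assumes "a \<in> cspace d" "eventually P (cnhds d a)"
  shows "P a"
  using assms eventually_nhds_x_imp_x[of "\<lambda>z. z \<in> cspace d \<longrightarrow> P z" a]
  by (simp add: cnhds_def eventually_inf_principal)

text \<open>Links the product topology behind \<open>copen\<close> with the balls of the sum norm in
  the definition of \<open>holo\<close>. The two filters agree because on \<open>cspace d\<close>
  the coordinates from \<open>d\<close> on vanish, so only finitely many coordinates matter.\<close>

lemma eventually_cnhds:
  assumes a: "a \<in> cspace d"
  shows "eventually P (cnhds d a) \<longleftrightarrow>
    (\<exists>\<delta>>0. \<forall>z\<in>cspace d. cnorm d (\<lambda>i. z i - a i) < \<delta> \<longrightarrow> P z)"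
proof
  \<comment> \<open>\<open>E\<close> is the filter generated by the sum norm balls. Comparing it
    with \<open>cnhds d a\<close> coordinatewise gives one direction, and continuity of the norm
    gives the other.\<close>
  define E where "E = (INF \<delta>\<in>{0<..}. principal {z\<in>cspace d. cnorm d (\<lambda>i. z i - a i) < \<delta>})"
  have E: "eventually Q E \<longleftrightarrow> (\<exists>\<delta>>0. \<forall>z\<in>cspace d. cnorm d (\<lambda>i. z i - a i) < \<delta> \<longrightarrow> Q z)" for Q
    unfolding E_def
  proof (subst eventually_INF_base)
    fix \<delta>1 \<delta>2 :: real assume "\<delta>1 \<in> {0<..}" "\<delta>2 \<in> {0<..}"
    then show "\<exists>x\<in>{0<..}. principal {z \<in> cspace d. cnorm d (\<lambda>i. z i - a i) < x}
      \<le> inf (principal {z \<in> cspace d. cnorm d (\<lambda>i. z i - a i) < \<delta>1})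
         (principal {z \<in> cspace d. cnorm d (\<lambda>i. z i - a i) < \<delta>2})"
      by (intro bexI[of _ "min \<delta>1 \<delta>2"]) auto
  qed (auto simp: eventually_principal)
  have "filterlim (\<lambda>z. z) (cnhds d a) E"
    unfolding filterlim_cnhds_iff
  proof (intro conjI allI)
    fix i
    show "((\<lambda>z. z i) \<longlongrightarrow> a i) E"
    proof (cases "i < d")
      case True
      show ?thesis
        unfolding tendsto_iff E dist_norm
        using le_less_trans[OF cmod_le_cnorm[OF True]] by blast
    next
      case False
      then show ?thesis using a
        by (intro tendsto_eventually) (auto simp: E cspace_def intro!: exI[of _ 1])
    qed
  qed (auto simp: E intro!: exI[of _ 1])
  then have "E \<le> cnhds d a" by (simp add: filterlim_def filtermap_ident)
  then show "eventually P (cnhds d a) \<Longrightarrow>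
      \<exists>\<delta>>0. \<forall>z\<in>cspace d. cnorm d (\<lambda>i. z i - a i) < \<delta> \<longrightarrow> P z"
    unfolding E[symmetric] by (rule filter_leD)
next
  assume "\<exists>\<delta>>0. \<forall>z\<in>cspace d. cnorm d (\<lambda>i. z i - a i) < \<delta> \<longrightarrow> P z"
  then obtain \<delta> where \<delta>: "\<delta> > 0" "\<And>z. z \<in> cspace d \<Longrightarrow> cnorm d (\<lambda>i. z i - a i) < \<delta> \<Longrightarrow> P z"
    by blast
  have "((\<lambda>z. cnorm d (\<lambda>i. z i - a i)) \<longlongrightarrow> (\<Sum>i<d. cmod (a i - a i))) (cnhds d a)"
    unfolding cnorm_def by (intro tendsto_intros tendsto_coord_cnhds)
  then have "\<forall>\<^sub>F z in cnhds d a. cnorm d (\<lambda>i. z i - a i) < \<delta>"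
    using \<delta>(1) by (auto dest: order_tendstoD(2))
  then show "eventually P (cnhds d a)"
    using eventually_cspace_cnhds by eventually_elim (use \<delta> in blast)
qed

lemma copen_iff:
  "copen d S \<longleftrightarrow> S \<subseteq> cspace d \<and> (\<forall>a\<in>S. eventually (\<lambda>z. z \<in> S) (cnhds d a))"
proof
  assume "copen d S"
  then obtain T where T: "open T" "S = cspace d \<inter> T"
    by (auto simp: copen_def openin_open)
  then show "S \<subseteq> cspace d \<and> (\<forall>a\<in>S. eventually (\<lambda>z. z \<in> S) (cnhds d a))"
    by (auto simp: cnhds_def eventually_inf_principal eventually_nhds)
next
  assume S: "S \<subseteq> cspace d \<and> (\<forall>a\<in>S. eventually (\<lambda>z. z \<in> S) (cnhds d a))"
  show "copen d S"
    unfolding copen_def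
  proof (subst openin_subopen, intro ballI)
    fix a assume "a \<in> S"
    then obtain T where "open T" "a \<in> T" "\<forall>z\<in>T. z \<in> cspace d \<longrightarrow> z \<in> S"
      using S by (auto simp: cnhds_def eventually_inf_principal eventually_nhds)
    then show "\<exists>T. openin (top_of_set (cspace d)) T \<and> a \<in> T \<and> T \<subseteq> S"
      using S \<open>a \<in> S\<close> by (intro exI[of _ "cspace d \<inter> T"]) (auto simp: openin_open)
  qed
qed

lemma copen_subset: "copen d S \<Longrightarrow> S \<subseteq> cspace d"
  and copen_eventually: "copen d S \<Longrightarrow> a \<in> S \<Longrightarrow> eventually (\<lambda>z. z \<in> S) (cnhds d a)"
  by (auto simp: copen_iff)

lemma eventually_eventually_cnhds:
  assumes "eventually P (cnhds d a)"
  shows "eventually (\<lambda>b. eventually P (cnhds d b)) (cnhds d a)"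
proof -
  from assms obtain S where S: "open S" "a \<in> S" "\<And>x. x \<in> S \<Longrightarrow> x \<in> cspace d \<Longrightarrow> P x"
    unfolding cnhds_def eventually_inf_principal eventually_nhds by blast
  then show ?thesis
    unfolding cnhds_def eventually_inf_principal eventually_nhds by blast
qed

text \<open>Caratheodory's form of complex differentiability, which makes the calculus algebraic.\<close>

definition has_cgrad ::
    "nat \<Rightarrow> ((nat \<Rightarrow> complex) \<Rightarrow> complex) \<Rightarrow> (nat \<Rightarrow> complex) \<Rightarrow> (nat \<Rightarrow> complex) \<Rightarrow> bool"
  where "has_cgrad d f a c \<longleftrightarrow> (\<exists>q. (\<forall>i<d. (q i \<longlongrightarrow> c i) (cnhds d a)) \<and>
    eventually (\<lambda>z. f z = f a + (\<Sum>i<d. q i z * (z i - a i))) (cnhds d a))"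

definition cdiff :: "nat \<Rightarrow> ((nat \<Rightarrow> complex) \<Rightarrow> complex) \<Rightarrow> (nat \<Rightarrow> complex) \<Rightarrow> bool"
  where "cdiff d f a \<longleftrightarrow> (\<exists>c. has_cgrad d f a c)"

text \<open>In one direction the slopes differ from their limits by less than any given bound. In
  the other, slope functions are manufactured by distributing the Frechet remainder over the
  coordinates.\<close>

lemma has_cgrad_iff_frechet:
  assumes a: "a \<in> cspace d"
  shows "has_cgrad d f a c \<longleftrightarrow> (\<forall>\<epsilon>>0. eventually (\<lambda>z.
      cmod (f z - f a - (\<Sum>i<d. c i * (z i - a i))) \<le> \<epsilon> * cnorm d (\<lambda>i. z i - a i)) (cnhds d a))"
proof
  assume "has_cgrad d f a c"
  then obtain q where q: "\<And>i. i < d \<Longrightarrow> (q i \<longlongrightarrow> c i) (cnhds d a)"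
    and f: "eventually (\<lambda>z. f z = f a + (\<Sum>i<d. q i z * (z i - a i))) (cnhds d a)"
    by (auto simp: has_cgrad_def)
  show "\<forall>\<epsilon>>0. eventually (\<lambda>z. cmod (f z - f a - (\<Sum>i<d. c i * (z i - a i)))
      \<le> \<epsilon> * cnorm d (\<lambda>i. z i - a i)) (cnhds d a)"
  proof (intro allI impI)
    fix \<epsilon> :: real assume \<epsilon>: "\<epsilon> > 0"
    have "eventually (\<lambda>z. \<forall>i\<in>{..<d}. cmod (q i z - c i) < \<epsilon>) (cnhds d a)"
      using q \<epsilon> by (subst eventually_ball_finite_distrib) (auto simp: tendsto_iff dist_norm)
    then show "eventually (\<lambda>z. cmod (f z - f a - (\<Sum>i<d. c i * (z i - a i)))
      \<le> \<epsilon> * cnorm d (\<lambda>i. z i - a i)) (cnhds d a)"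
      using f
    proof eventually_elim
      case (elim z)
      have "f z - f a - (\<Sum>i<d. c i * (z i - a i)) = (\<Sum>i<d. (q i z - c i) * (z i - a i))"
        using elim(2) by (simp add: algebra_simps sum_subtractf sum.distrib)
      also have "cmod \<dots> \<le> (\<Sum>i<d. \<epsilon> * cmod (z i - a i))"
        by (rule sum_norm_le) (use elim(1) in \<open>auto simp: norm_mult intro!: mult_right_mono intro: less_imp_le\<close>)
      finally show ?case by (simp add: cnorm_def sum_distrib_left)
    qed
  qed
next
  assume R: "\<forall>\<epsilon>>0. eventually (\<lambda>z. cmod (f z - f a - (\<Sum>i<d. c i * (z i - a i)))
      \<le> \<epsilon> * cnorm d (\<lambda>i. z i - a i)) (cnhds d a)"
  define N where "N z = cnorm d (\<lambda>i. z i - a i)" for z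
  define r where "r z = f z - f a - (\<Sum>i<d. c i * (z i - a i))" for z
  \<comment> \<open>The remainder \<open>r z\<close> is shared among the coordinates in the
    proportion \<open>cmod (z i - a i) / N z\<close>. These weights add up to 1, and each share
    divided by \<open>z i - a i\<close> has modulus \<open>cmod (r z) / N z\<close>, which tends to
    0.\<close>
  define q where "q i z = c i + (if z i = a i then 0 else
    r z * complex_of_real (cmod (z i - a i) / N z) / (z i - a i))" for i z
  have N0: "N z = 0 \<longleftrightarrow> (\<forall>i<d. z i = a i)" for z
    by (auto simp: N_def cnorm_def sum_nonneg_eq_0_iff)
  have key: "f z = f a + (\<Sum>i<d. q i z * (z i - a i))" if "z \<in> cspace d" for z
  proof (cases "N z = 0")
    case True
    have "z = a"
    proof
      fix i show "z i = a i"
        using True that a N0[of z] by (cases "i < d") (auto simp: cspace_def)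
    qed
    then show ?thesis by simp
  next
    case False
    have "(\<Sum>i<d. q i z * (z i - a i))
        = (\<Sum>i<d. c i * (z i - a i) + r z * complex_of_real (cmod (z i - a i) / N z))"
      by (intro sum.cong) (auto simp: q_def distrib_right)
    also have "\<dots> = (\<Sum>i<d. c i * (z i - a i)) + r z * complex_of_real (\<Sum>i<d. cmod (z i - a i) / N z)"
      by (simp add: sum.distrib sum_distrib_left)
    also have "(\<Sum>i<d. cmod (z i - a i) / N z) = 1"
      using False by (simp add: sum_divide_distrib[symmetric] N_def cnorm_def)
    finally show ?thesis by (simp add: r_def)
  qed
  have "(q i \<longlongrightarrow> c i) (cnhds d a)" if i: "i < d" for i
    unfolding tendsto_iff
  proof (intro allI impI)
    fix \<epsilon> :: real assume \<epsilon>: "\<epsilon> > 0"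
    then have "eventually (\<lambda>z. cmod (r z) \<le> \<epsilon> / 2 * N z) (cnhds d a)"
      using R unfolding r_def N_def by (meson half_gt_zero)
    then show "eventually (\<lambda>z. dist (q i z) (c i) < \<epsilon>) (cnhds d a)"
    proof eventually_elim
      case (elim z)
      show ?case
      proof (cases "z i = a i")
        case False
        then have "N z \<noteq> 0" using N0 i by auto
        then have N: "N z > 0" unfolding N_def by (simp add: less_le)
        have "dist (q i z) (c i) = cmod (r z) / N z"
          using False N by (simp add: q_def dist_norm norm_mult norm_divide)
        also have "\<dots> \<le> \<epsilon> / 2" using elim N by (simp add: field_simps)
        finally show ?thesis using \<epsilon> by simp
      qed (use \<epsilon> in \<open>simp add: q_def\<close>)
    qed
  qed
  moreover have "eventually (\<lambda>z. f z = f a + (\<Sum>i<d. q i z * (z i - a i))) (cnhds d a)"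
    using eventually_cspace_cnhds by eventually_elim (rule key)
  ultimately show "has_cgrad d f a c" unfolding has_cgrad_def by blast
qed

text \<open>An open \<open>S\<close> is a neighbourhood, within \<open>cspace d\<close>, of each of
  its points, so restricting the test points to \<open>S\<close> does not change the condition near
  \<open>a\<close>. From here on holomorphy is handled pointwise.\<close>

lemma holo_iff_cdiff:
  assumes "copen d S"
  shows "holo d S f \<longleftrightarrow> (\<forall>a\<in>S. cdiff d f a)"
proof -
  have "(\<forall>\<epsilon>>0. \<exists>\<delta>>0. \<forall>z\<in>S. cnorm d (\<lambda>i. z i - a i) < \<delta> \<longrightarrow> P \<epsilon> z)
      \<longleftrightarrow> (\<forall>\<epsilon>>0. eventually (P \<epsilon>) (cnhds d a))" if "a \<in> S" for a and P :: "real \<Rightarrow> _ \<Rightarrow> bool"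
  proof -
    have a: "a \<in> cspace d" using assms that copen_subset by blast
    have S: "eventually (\<lambda>z. z \<in> S) (cnhds d a)" by (rule copen_eventually[OF assms that])
    have "(\<exists>\<delta>>0. \<forall>z\<in>S. cnorm d (\<lambda>i. z i - a i) < \<delta> \<longrightarrow> P \<epsilon> z) \<longleftrightarrow> eventually (P \<epsilon>) (cnhds d a)" for \<epsilon>
    proof
      assume "\<exists>\<delta>>0. \<forall>z\<in>S. cnorm d (\<lambda>i. z i - a i) < \<delta> \<longrightarrow> P \<epsilon> z"
      then have "eventually (\<lambda>z. z \<in> S \<longrightarrow> P \<epsilon> z) (cnhds d a)"
        by (subst eventually_cnhds[OF a]) blast
      then show "eventually (P \<epsilon>) (cnhds d a)" using S by eventually_elim blast
    next
      assume "eventually (P \<epsilon>) (cnhds d a)"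
      then show "\<exists>\<delta>>0. \<forall>z\<in>S. cnorm d (\<lambda>i. z i - a i) < \<delta> \<longrightarrow> P \<epsilon> z"
        using copen_subset[OF assms] by (subst (asm) eventually_cnhds[OF a]) blast
    qed
    then show ?thesis by simp
  qed
  note * = this
  have "has_cgrad d f a c \<longleftrightarrow> (\<forall>\<epsilon>>0. \<exists>\<delta>>0. \<forall>z\<in>S. cnorm d (\<lambda>i. z i - a i) < \<delta> \<longrightarrow>
      cmod (f z - f a - (\<Sum>i<d. c i * (z i - a i))) \<le> \<epsilon> * cnorm d (\<lambda>i. z i - a i))"
    if "a \<in> S" for a c
    unfolding *[OF that] by (rule has_cgrad_iff_frechet) (use assms that copen_subset in blast)
  from this[symmetric, unfolded cnorm_def] show ?thesis
    unfolding holo_def cdiff_def by (intro ball_cong refl iff_exI)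
qed

section \<open>Differentiation rules for complex gradients\<close>

lemma has_cgrad_const: "has_cgrad d (\<lambda>_. k) a (\<lambda>_. 0)"
  unfolding has_cgrad_def by (intro exI[of _ "\<lambda>_ _. 0"]) auto

lemma has_cgrad_coord: "j < d \<Longrightarrow> has_cgrad d (\<lambda>z. z j) a (\<lambda>i. if i = j then 1 else 0)"
  unfolding has_cgrad_def
  by (intro exI[of _ "\<lambda>i _. if i = j then 1 else 0"])
    (simp add: if_distrib[of "\<lambda>x. x * _"] sum.delta cong: if_cong)

lemma has_cgrad_tendsto:
  assumes "has_cgrad d f a c"
  shows "(f \<longlongrightarrow> f a) (cnhds d a)"
proof -
  obtain q where q: "\<And>i. i < d \<Longrightarrow> (q i \<longlongrightarrow> c i) (cnhds d a)"
    and f: "eventually (\<lambda>z. f z = f a + (\<Sum>i<d. q i z * (z i - a i))) (cnhds d a)"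
    using assms by (auto simp: has_cgrad_def)
  have "((\<lambda>z. f a + (\<Sum>i<d. q i z * (z i - a i))) \<longlongrightarrow> f a + (\<Sum>i<d. c i * (a i - a i))) (cnhds d a)"
    by (intro tendsto_intros tendsto_coord_cnhds q) auto
  then show ?thesis using f by (simp add: tendsto_cong)
qed

lemma has_cgrad_cong:
  assumes "a \<in> cspace d" "eventually (\<lambda>z. f z = g z) (cnhds d a)" "has_cgrad d f a c"
  shows "has_cgrad d g a c"
proof -
  have fg: "f a = g a" by (rule eventually_cnhds_self[OF assms(1,2)])
  obtain q where q: "\<forall>i<d. (q i \<longlongrightarrow> c i) (cnhds d a)"
    and f: "eventually (\<lambda>z. f z = f a + (\<Sum>i<d. q i z * (z i - a i))) (cnhds d a)"
    using assms by (auto simp: has_cgrad_def)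
  have "eventually (\<lambda>z. g z = g a + (\<Sum>i<d. q i z * (z i - a i))) (cnhds d a)"
    using f assms(2) by eventually_elim (simp add: fg)
  with q show ?thesis unfolding has_cgrad_def by blast
qed

lemma has_cgrad_add:
  assumes "has_cgrad d f a c" "has_cgrad d g a e"
  shows "has_cgrad d (\<lambda>z. f z + g z) a (\<lambda>i. c i + e i)"
proof -
  obtain p q where p: "\<And>i. i < d \<Longrightarrow> (p i \<longlongrightarrow> c i) (cnhds d a)"
    and q: "\<And>i. i < d \<Longrightarrow> (q i \<longlongrightarrow> e i) (cnhds d a)"
    and fg: "eventually (\<lambda>z. f z = f a + (\<Sum>i<d. p i z * (z i - a i))) (cnhds d a)"
      "eventually (\<lambda>z. g z = g a + (\<Sum>i<d. q i z * (z i - a i))) (cnhds d a)"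
    using assms by (auto simp: has_cgrad_def)
  have "eventually (\<lambda>z. f z + g z = f a + g a + (\<Sum>i<d. (p i z + q i z) * (z i - a i))) (cnhds d a)"
    using fg by eventually_elim (simp add: distrib_right sum.distrib)
  with p q show ?thesis
    unfolding has_cgrad_def
    by (intro exI[of _ "\<lambda>i z. p i z + q i z"]) (auto intro: tendsto_add)
qed

text \<open>The slopes of the product are \<open>f z * q i z + p i z * g a\<close>: evaluating
  \<open>f\<close> at \<open>z\<close> and \<open>g\<close> at \<open>a\<close> avoids a quadratic
  term, at the price of using the continuity of \<open>f\<close> at \<open>a\<close>.\<close>

lemma has_cgrad_mult:
  assumes "has_cgrad d f a c" "has_cgrad d g a e"
  shows "has_cgrad d (\<lambda>z. f z * g z) a (\<lambda>i. f a * e i + c i * g a)"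
proof -
  obtain p q where p: "\<And>i. i < d \<Longrightarrow> (p i \<longlongrightarrow> c i) (cnhds d a)"
    and q: "\<And>i. i < d \<Longrightarrow> (q i \<longlongrightarrow> e i) (cnhds d a)"
    and fg: "eventually (\<lambda>z. f z = f a + (\<Sum>i<d. p i z * (z i - a i))) (cnhds d a)"
      "eventually (\<lambda>z. g z = g a + (\<Sum>i<d. q i z * (z i - a i))) (cnhds d a)"
    using assms by (auto simp: has_cgrad_def)
  have "eventually (\<lambda>z. f z * g z = f a * g a +
      (\<Sum>i<d. (f z * q i z + p i z * g a) * (z i - a i))) (cnhds d a)"
    using fg
  proof eventually_elim
    case (elim z)
    have "f z * g z = f a * g a + (f z * (g z - g a) + (f z - f a) * g a)"
      by (simp add: algebra_simps)
    also have "f z * (g z - g a) + (f z - f a) * g a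
        = f z * (\<Sum>i<d. q i z * (z i - a i)) + (\<Sum>i<d. p i z * (z i - a i)) * g a"
      by (subst elim(2), subst (2) elim(1)) (simp only: add_diff_cancel_left')
    also have "\<dots> = (\<Sum>i<d. (f z * q i z + p i z * g a) * (z i - a i))"
      by (simp add: algebra_simps sum.distrib sum_distrib_left sum_distrib_right sum_subtractf)
    finally show ?case .
  qed
  moreover have "\<And>i. i < d \<Longrightarrow> ((\<lambda>z. f z * q i z + p i z * g a) \<longlongrightarrow> f a * e i + c i * g a) (cnhds d a)"
    by (intro tendsto_intros p q has_cgrad_tendsto[OF assms(1)])
  ultimately show ?thesis
    unfolding has_cgrad_def by (intro exI[of _ "\<lambda>i z. f z * q i z + p i z * g a"]) auto
qed

text \<open>Substituting the slopes of \<open>u\<close> into those of \<open>f\<close> gives the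
  slopes \<open>\<Sum>j<e. q j (u z) * p j i z\<close> of the composite. Their limit needs
  \<open>u z\<close> to tend to \<open>u a\<close> inside \<open>cspace e\<close>, where
  \<open>mem\<close> makes the coordinates from \<open>e\<close> on constant.\<close>

lemma has_cgrad_compose:
  assumes f: "has_cgrad e f (u a) c" and u: "\<And>j. j < e \<Longrightarrow> has_cgrad d (\<lambda>z. u z j) a (k j)"
    and mem: "eventually (\<lambda>z. u z \<in> cspace e) (cnhds d a)" and a: "a \<in> cspace d"
  shows "has_cgrad d (\<lambda>z. f (u z)) a (\<lambda>i. \<Sum>j<e. c j * k j i)"
proof -
  have ua: "u a \<in> cspace e" by (rule eventually_cnhds_self[OF a mem])
  have "((\<lambda>z. u z j) \<longlongrightarrow> u a j) (cnhds d a)" for j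
  proof (cases "j < e")
    case False
    have "eventually (\<lambda>z. u z j = u a j) (cnhds d a)"
      using mem by eventually_elim (use ua False in \<open>auto simp: cspace_def\<close>)
    then show ?thesis by (rule tendsto_eventually)
  qed (auto intro: has_cgrad_tendsto u)
  then have lim: "filterlim u (cnhds e (u a)) (cnhds d a)"
    using mem by (simp add: filterlim_cnhds_iff)
  obtain q where q: "\<And>j. j < e \<Longrightarrow> (q j \<longlongrightarrow> c j) (cnhds e (u a))"
    and fq: "eventually (\<lambda>w. f w = f (u a) + (\<Sum>j<e. q j w * (w j - u a j))) (cnhds e (u a))"
    using f by (auto simp: has_cgrad_def)
  have "\<exists>p. \<forall>j<e. (\<forall>i<d. (p j i \<longlongrightarrow> k j i) (cnhds d a)) \<and>
    eventually (\<lambda>z. u z j = u a j + (\<Sum>i<d. p j i z * (z i - a i))) (cnhds d a)"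
    using u unfolding has_cgrad_def by (subst choice_iff'[symmetric]) blast
  then obtain p where p: "\<And>j i. j < e \<Longrightarrow> i < d \<Longrightarrow> (p j i \<longlongrightarrow> k j i) (cnhds d a)"
    and up: "\<And>j. j < e \<Longrightarrow> eventually (\<lambda>z. u z j = u a j + (\<Sum>i<d. p j i z * (z i - a i))) (cnhds d a)"
    by blast
  have "eventually (\<lambda>z. \<forall>j\<in>{..<e}. u z j = u a j + (\<Sum>i<d. p j i z * (z i - a i))) (cnhds d a)"
    by (subst eventually_ball_finite_distrib) (auto intro: up)
  moreover have "eventually (\<lambda>z. f (u z) = f (u a) + (\<Sum>j<e. q j (u z) * (u z j - u a j))) (cnhds d a)"
    using eventually_compose_filterlim[OF fq lim] .
  ultimately have "eventually (\<lambda>z. f (u z) = f (u a) +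
      (\<Sum>i<d. (\<Sum>j<e. q j (u z) * p j i z) * (z i - a i))) (cnhds d a)"
  proof eventually_elim
    case (elim z)
    have "(\<Sum>j<e. q j (u z) * (u z j - u a j))
        = (\<Sum>j<e. q j (u z) * (\<Sum>i<d. p j i z * (z i - a i)))"
      by (intro sum.cong) (use elim(1) in auto)
    also have "\<dots> = (\<Sum>j<e. \<Sum>i<d. q j (u z) * p j i z * (z i - a i))"
      by (simp add: sum_distrib_left mult.assoc)
    also have "\<dots> = (\<Sum>i<d. (\<Sum>j<e. q j (u z) * p j i z) * (z i - a i))"
      by (subst sum.swap) (simp add: sum_distrib_right)
    finally show ?case using elim(2) by simp
  qed
  moreover have "((\<lambda>z. \<Sum>j<e. q j (u z) * p j i z) \<longlongrightarrow> (\<Sum>j<e. c j * k j i)) (cnhds d a)"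
    if "i < d" for i
    by (intro tendsto_intros p that filterlim_compose[OF q lim]) auto
  ultimately show ?thesis
    unfolding has_cgrad_def by (intro exI[of _ "\<lambda>i z. \<Sum>j<e. q j (u z) * p j i z"]) auto
qed

lemma fun_upd_cspace: "i < d \<Longrightarrow> a \<in> cspace d \<Longrightarrow> a(i := w) \<in> cspace d"
  by (auto simp: cspace_def)

lemma filterlim_fun_upd:
  assumes "a \<in> cspace d" "i < d"
  shows "filterlim (\<lambda>w. a(i := w)) (cnhds d a) (nhds (a i))"
  unfolding filterlim_cnhds_iff
proof (intro conjI allI)
  fix j show "((\<lambda>w. (a(i := w)) j) \<longlongrightarrow> a j) (nhds (a i))"
    by (cases "j = i") (auto simp: filterlim_ident)
qed (use assms in \<open>auto simp: fun_upd_cspace\<close>)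

text \<open>On a coordinate line every summand but the \<open>i\<close>-th vanishes, so the
  difference quotient is exactly the slope \<open>q i\<close>. Hence the first \<open>d\<close>
  components of a gradient are the partial derivatives.\<close>

lemma has_cgrad_partial:
  assumes f: "has_cgrad d f a c" and a: "a \<in> cspace d" and i: "i < d"
  shows "((\<lambda>w. f (a(i := w))) has_field_derivative c i) (at (a i))"
proof -
  obtain q where q: "\<And>j. j < d \<Longrightarrow> (q j \<longlongrightarrow> c j) (cnhds d a)"
    and fq: "eventually (\<lambda>z. f z = f a + (\<Sum>j<d. q j z * (z j - a j))) (cnhds d a)"
    using f by (auto simp: has_cgrad_def)
  have lim: "filterlim (\<lambda>w. a(i := w)) (cnhds d a) (nhds (a i))"
    by (rule filterlim_fun_upd[OF a i])
  have "eventually (\<lambda>w. f (a(i := w)) = f a + (\<Sum>j<d. q j (a(i := w)) * ((a(i := w)) j - a j))) (nhds (a i))"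
    by (rule eventually_compose_filterlim[OF fq lim])
  then have "eventually (\<lambda>w. (f (a(i := w)) - f a) / (w - a i) = q i (a(i := w))) (at (a i))"
    unfolding eventually_at_filter
  proof eventually_elim
    case (elim w)
    have "(\<Sum>j<d. q j (a(i := w)) * ((a(i := w)) j - a j)) = (\<Sum>j<d. if j = i then q i (a(i := w)) * (w - a i) else 0)"
      by (intro sum.cong) auto
    also have "\<dots> = q i (a(i := w)) * (w - a i)" using i by simp
    finally show ?case using elim by auto
  qed
  moreover have "((\<lambda>w. q i (a(i := w))) \<longlongrightarrow> c i) (at (a i))"
    by (rule filterlim_compose[OF q[OF i]]) (rule filterlim_mono[OF lim order_refl at_within_le_nhds])
  ultimately show ?thesis
    by (simp add: has_field_derivative_iff tendsto_cong)
qed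

lemma has_cgrad_deriv:
  "has_cgrad d f a c \<Longrightarrow> a \<in> cspace d \<Longrightarrow> i < d \<Longrightarrow> deriv (\<lambda>w. f (a(i := w))) (a i) = c i"
  by (rule DERIV_imp_deriv, rule has_cgrad_partial)

lemma cdiff_const: "cdiff d (\<lambda>_. k) a"
  using has_cgrad_const cdiff_def by blast

lemma cdiff_coord: "j < d \<Longrightarrow> cdiff d (\<lambda>z. z j) a"
  using has_cgrad_coord cdiff_def by blast

lemma cdiff_add: "cdiff d f a \<Longrightarrow> cdiff d g a \<Longrightarrow> cdiff d (\<lambda>z. f z + g z) a"
  unfolding cdiff_def using has_cgrad_add by blast

lemma cdiff_mult: "cdiff d f a \<Longrightarrow> cdiff d g a \<Longrightarrow> cdiff d (\<lambda>z. f z * g z) a"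
  unfolding cdiff_def using has_cgrad_mult by blast

lemma cdiff_sum: "(\<And>i. i \<in> I \<Longrightarrow> cdiff d (f i) a) \<Longrightarrow> cdiff d (\<lambda>z. \<Sum>i\<in>I. f i z) a"
  by (induction I rule: infinite_finite_induct) (auto intro: cdiff_const cdiff_add)

lemma cdiff_cong:
  "a \<in> cspace d \<Longrightarrow> eventually (\<lambda>z. f z = g z) (cnhds d a) \<Longrightarrow> cdiff d f a \<Longrightarrow> cdiff d g a"
  unfolding cdiff_def using has_cgrad_cong by blast

lemma cdiff_tendsto: "cdiff d f a \<Longrightarrow> (f \<longlongrightarrow> f a) (cnhds d a)"
  unfolding cdiff_def using has_cgrad_tendsto by blast

lemma cdiff_compose:
  assumes "cdiff e f (u a)" "\<And>j. j < e \<Longrightarrow> cdiff d (\<lambda>z. u z j) a"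
    "eventually (\<lambda>z. u z \<in> cspace e) (cnhds d a)" "a \<in> cspace d"
  shows "cdiff d (\<lambda>z. f (u z)) a"
proof -
  obtain c where "has_cgrad e f (u a) c" using assms(1) cdiff_def by blast
  moreover have "\<forall>j. \<exists>k. j < e \<longrightarrow> has_cgrad d (\<lambda>z. u z j) a k" using assms(2) cdiff_def by blast
  then obtain k where "\<And>j. j < e \<Longrightarrow> has_cgrad d (\<lambda>z. u z j) a (k j)" by metis
  ultimately have "has_cgrad d (\<lambda>z. f (u z)) a (\<lambda>i. \<Sum>j<e. c j * k j i)"
    by (rule has_cgrad_compose) (rule assms | assumption)+
  then show ?thesis unfolding cdiff_def by blast
qed

text \<open>Taylor's theorem at 0, evaluated at 1. Cauchy's inequality on discs of radius
  \<open>T / 2\<close> bounds the second derivative on the half disc by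
  \<open>2 * K / (T / 2)\<^sup>2 = 8 * K / T\<^sup>2\<close>, and \<open>2 < T\<close> puts 1 into
  that half disc.\<close>

lemma taylor_first_order_bound:
  assumes g: "g holomorphic_on ball 0 T" and K: "\<And>t. t \<in> ball 0 T \<Longrightarrow> cmod (g t) \<le> K"
    and T: "2 < T"
  shows "cmod (g 1 - g 0 - deriv g 0) \<le> 8 * K / T\<^sup>2"
proof -
  have sub: "cball x (T / 2) \<subseteq> ball 0 T" if "x \<in> ball 0 (T / 2)" for x :: complex
  proof
    fix y assume "y \<in> cball x (T / 2)"
    moreover have "cmod y \<le> cmod (y - x) + cmod x" by (metis diff_add_cancel norm_triangle_ineq)
    ultimately show "y \<in> ball 0 T" using that by (simp add: dist_norm norm_minus_commute)
  qed
  have B: "cmod ((deriv ^^ 2) g x) \<le> 8 * K / T\<^sup>2" if "x \<in> ball 0 (T / 2)" for x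
  proof -
    have "cmod ((deriv ^^ 2) g x) \<le> fact 2 * K / (T / 2) ^ 2"
    proof (rule Cauchy_inequality)
      show "g holomorphic_on ball x (T / 2)"
        using sub[OF that] ball_subset_cball by (blast intro: holomorphic_on_subset[OF g])
      show "continuous_on (cball x (T / 2)) g"
        using sub[OF that] by (blast intro: holomorphic_on_imp_continuous_on holomorphic_on_subset[OF g])
      fix y assume "cmod (x - y) = T / 2"
      then show "cmod (g y) \<le> K" using sub[OF that] by (intro K) (auto simp: dist_norm)
    qed (use T in auto)
    then show ?thesis by (simp add: field_simps)
  qed
  have "cmod ((deriv ^^ 0) g 1 - (\<Sum>i\<le>1. (deriv ^^ i) g 0 * (1 - 0) ^ i / fact i))
      \<le> 8 * K / T\<^sup>2 * cmod (1 - 0) ^ Suc 1 / fact 1"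
  proof (rule complex_Taylor[where S = "ball 0 (T / 2)"])
    fix i :: nat and x :: complex assume "x \<in> ball 0 (T / 2)"
    then have x: "x \<in> ball 0 T" using T by simp
    have "(deriv ^^ i) g holomorphic_on ball 0 T"
      by (rule holomorphic_higher_deriv[OF g open_ball])
    then show "((deriv ^^ i) g has_field_derivative (deriv ^^ Suc i) g x) (at x within ball 0 (T / 2))"
      using x by (simp add: holomorphic_derivI has_field_derivative_at_within)
  next
    fix x :: complex assume "x \<in> ball 0 (T / 2)"
    then show "cmod ((deriv ^^ Suc 1) g x) \<le> 8 * K / T\<^sup>2" using B by (simp add: numeral_2_eq_2)
  qed (use T in auto)
  then show ?thesis by (simp add: diff_diff_eq)
qed

lemma line_cspace: "z \<in> cspace d \<Longrightarrow> h \<in> cspace d \<Longrightarrow> (\<lambda>j. z j + t * h j) \<in> cspace d"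
  by (auto simp: cspace_def)

text \<open>The line is regarded as a map from \<open>cspace 1\<close>, with the parameter as
  coordinate 0, so that the chain rule for \<open>has_cgrad\<close> applies. The zeros in the
  gradient are those that the sum and product rules produce.\<close>

lemma has_cgrad_line:
  assumes f: "has_cgrad d f (\<lambda>j. z j + t * h j) c" and z: "z \<in> cspace d" and h: "h \<in> cspace d"
  shows "((\<lambda>s. f (\<lambda>j. z j + s * h j)) has_field_derivative (\<Sum>j<d. c j * h j)) (at t)"
proof -
  define a :: "nat \<Rightarrow> complex" where "a = (\<lambda>_. 0)(0 := t)"
  define u where "u w = (\<lambda>j. z j + w 0 * h j)" for w :: "nat \<Rightarrow> complex"
  have a: "a \<in> cspace 1" by (auto simp: a_def cspace_def)
  have "has_cgrad 1 (\<lambda>w. f (u w)) a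
    (\<lambda>i. \<Sum>j<d. c j * (0 + (a 0 * 0 + (if i = 0 then 1 else 0) * h j)))"
  proof (rule has_cgrad_compose[where f = f and u = u and c = c and
        k = "\<lambda>j i. 0 + (a 0 * 0 + (if i = 0 then 1 else 0) * h j)"])
    show "has_cgrad d f (u a) c" using f by (simp add: u_def a_def)
    show "has_cgrad 1 (\<lambda>z. u z j) a (\<lambda>i. 0 + (a 0 * 0 + (if i = 0 then 1 else 0) * h j))" for j
      unfolding u_def by (intro has_cgrad_add has_cgrad_mult has_cgrad_const has_cgrad_coord) simp
  qed (use a z h in \<open>auto simp: u_def line_cspace\<close>)
  from has_cgrad_partial[OF this a, of 0] show ?thesis by (simp add: u_def a_def)
qed

lemma cnorm_scale: "cnorm d (\<lambda>j. t * h j) = cmod t * cnorm d h"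
  by (simp add: cnorm_def norm_mult sum_distrib_left)

lemma cnorm_eq_0: "h \<in> cspace d \<Longrightarrow> cnorm d h = 0 \<longleftrightarrow> h = (\<lambda>_. 0)"
  by (force simp: cnorm_def sum_nonneg_eq_0_iff cspace_def fun_eq_iff not_less[symmetric])

text \<open>Restricted to the complex line through \<open>z\<close> in direction \<open>h\<close>,
  the function is holomorphic and bounded by \<open>K\<close> on the disc of radius
  \<open>T = R / cnorm d h\<close>. Cauchy's inequality on half of this disc bounds the first
  derivative by \<open>2 * K / T\<close>. The second bound is the one-variable Taylor estimate, for
  which \<open>cnorm d h < R / 2\<close> says \<open>2 < T\<close>.\<close>

lemma cdiff_taylor_bounds:
  assumes z: "z \<in> cspace d" and h: "h \<in> cspace d" and R: "R > 0"
    and D: "\<And>w. w \<in> cspace d \<Longrightarrow> cnorm d (\<lambda>j. w j - z j) < R \<Longrightarrow> cdiff d f w"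
    and K: "\<And>w. w \<in> cspace d \<Longrightarrow> cnorm d (\<lambda>j. w j - z j) < R \<Longrightarrow> cmod (f w) \<le> K"
    and c: "has_cgrad d f z c"
  shows "cmod (\<Sum>j<d. c j * h j) \<le> 2 * K / R * cnorm d h" (is ?A)
    and "cnorm d h < R / 2 \<Longrightarrow> cmod (f (\<lambda>j. z j + h j) - f z - (\<Sum>j<d. c j * h j))
      \<le> 8 * K / R\<^sup>2 * (cnorm d h)\<^sup>2" (is "_ \<Longrightarrow> ?B")
proof -
  show ?A "cnorm d h < R / 2 \<Longrightarrow> ?B"
  proof (atomize (full), cases "cnorm d h = 0")
    case True
    then have "h = (\<lambda>_. 0)" using h cnorm_eq_0 by blast
    with True show "?A \<and> (cnorm d h < R / 2 \<longrightarrow> ?B)" by simp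
  next
    case False
    then have N: "cnorm d h > 0" by (simp add: less_le)
    define T where "T = R / cnorm d h"
    have T: "T > 0" using N R by (simp add: T_def)
    define g where "g t = f (\<lambda>j. z j + t * h j)" for t
    have near: "cnorm d (\<lambda>j. (z j + t * h j) - z j) < R" if "t \<in> ball 0 T" for t
      using that N by (simp add: cnorm_scale T_def field_simps)
    have hol: "g holomorphic_on ball 0 T"
    proof (rule holomorphic_onI)
      fix t :: complex assume "t \<in> ball 0 T"
      then obtain k where "has_cgrad d f (\<lambda>j. z j + t * h j) k"
        using D[OF line_cspace[OF z h] near] cdiff_def by blast
      from has_cgrad_line[OF this z h] show "g field_differentiable at t within ball 0 T"
        unfolding g_def[abs_def] field_differentiable_def by (blast intro: has_field_derivative_at_within)
    qed
    have bound: "cmod (g t) \<le> K" if "t \<in> ball 0 T" for t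
      unfolding g_def by (rule K[OF line_cspace[OF z h] near[OF that]])
    have "((\<lambda>s. f (\<lambda>j. z j + s * h j)) has_field_derivative (\<Sum>j<d. c j * h j)) (at 0)"
      by (rule has_cgrad_line) (use c z h in auto)
    then have dg: "deriv g 0 = (\<Sum>j<d. c j * h j)"
      unfolding g_def[abs_def] by (rule DERIV_imp_deriv)
    have "cmod ((deriv ^^ 1) g 0) \<le> fact 1 * K / (T / 2) ^ 1"
    proof (rule Cauchy_inequality)
      have sub: "cball 0 (T / 2) \<subseteq> ball (0::complex) T" using T by auto
      show "g holomorphic_on ball 0 (T / 2)"
        using sub ball_subset_cball by (blast intro: holomorphic_on_subset[OF hol])
      show "continuous_on (cball 0 (T / 2)) g"
        using sub by (blast intro: holomorphic_on_imp_continuous_on holomorphic_on_subset[OF hol])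
    qed (use T bound in auto)
    then have A: ?A by (simp add: dg T_def field_simps)
    moreover have ?B if "cnorm d h < R / 2"
    proof -
      have "2 < T" using that N by (simp add: T_def field_simps)
      from taylor_first_order_bound[OF hol bound this, unfolded dg]
      show ?thesis by (simp add: g_def T_def power_divide)
    qed
    ultimately show "?A \<and> (cnorm d h < R / 2 \<longrightarrow> ?B)" by blast
  qed
qed

lemma cnorm_triangle: "cnorm d (\<lambda>j. z j - a j) \<le> cnorm d (\<lambda>j. z j - b j) + cnorm d (\<lambda>j. b j - a j)"
proof -
  have "cmod (z j - a j) \<le> cmod (z j - b j) + cmod (b j - a j)" for j
    using norm_triangle_ineq[of "z j - b j" "b j - a j"] by simp
  then show ?thesis unfolding cnorm_def sum.distrib[symmetric] by (intro sum_mono)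
qed

text \<open>The Taylor remainders of all \<open>F m\<close> at \<open>a\<close> share the constant
  \<open>8 * K / R\<^sup>2\<close>, so once the gradients converge the quadratic bound passes to the
  limit and makes \<open>q\<close> differentiable. The gradients converge because the first-order
  bound, applied to \<open>F m - F n\<close>, makes them Cauchy.\<close>

lemma cdiff_uniform_limit:
  fixes F :: "nat \<Rightarrow> (nat \<Rightarrow> complex) \<Rightarrow> complex"
  assumes a: "a \<in> cspace d" and R: "R > 0"
    and D: "\<And>m z. z \<in> cspace d \<Longrightarrow> cnorm d (\<lambda>j. z j - a j) < R \<Longrightarrow> cdiff d (F m) z"
    and K: "\<And>m z. z \<in> cspace d \<Longrightarrow> cnorm d (\<lambda>j. z j - a j) < R \<Longrightarrow> cmod (F m z) \<le> K"
    and lim: "\<And>m z. z \<in> cspace d \<Longrightarrow> cnorm d (\<lambda>j. z j - a j) < R \<Longrightarrow> cmod (F m z - q z) \<le> \<epsilon> m"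
    and \<epsilon>: "\<epsilon> \<longlonglongrightarrow> 0"
  shows "cdiff d q a"
proof -
  have conv: "(\<lambda>m. F m z) \<longlonglongrightarrow> q z" if "z \<in> cspace d" "cnorm d (\<lambda>j. z j - a j) < R" for z
    by (rule LIM_zero_cancel, rule tendsto_norm_zero_cancel, rule Lim_null_comparison[OF _ \<epsilon>])
      (use lim[OF that] in simp)
  have "\<exists>c. \<forall>m. has_cgrad d (F m) a (c m)"
    using D[OF a] R unfolding cdiff_def by (subst choice_iff[symmetric]) (simp add: cnorm_def)
  then obtain c where c: "\<And>m. has_cgrad d (F m) a (c m)" by blast
  have "\<exists>l. (\<lambda>m. c m i) \<longlonglongrightarrow> l" if i: "i < d" for i
  proof -
    \<comment> \<open>Testing the gradients on the unit vector \<open>e\<close> isolates their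
      \<open>i\<close>-th component.\<close>
    define e :: "nat \<Rightarrow> complex" where "e = (\<lambda>j. if j = i then 1 else 0)"
    have e: "e \<in> cspace d" using i by (auto simp: e_def cspace_def)
    have "cmod (c m i - c n i) \<le> 2 / R * (\<epsilon> m + \<epsilon> n)" for m n
    proof -
      have N1: "cnorm d e = 1" using i by (simp add: cnorm_def e_def if_distrib cong: if_cong)
      have "has_cgrad d (\<lambda>z. F m z + (-1) * F n z) a (\<lambda>j. c m j + ((-1) * c n j + 0 * F n a))"
        by (intro has_cgrad_add has_cgrad_mult has_cgrad_const c)
      then have "has_cgrad d (\<lambda>z. F m z - F n z) a (\<lambda>j. c m j - c n j)" by simp
      then have "cmod (\<Sum>j<d. (c m j - c n j) * e j) \<le> 2 * (\<epsilon> m + \<epsilon> n) / R * cnorm d e"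
      proof (rule cdiff_taylor_bounds(1)[OF a e R, rotated 2])
        fix w assume w: "w \<in> cspace d" "cnorm d (\<lambda>j. w j - a j) < R"
        have "cdiff d (\<lambda>z. F m z + (-1) * F n z) w"
          by (intro cdiff_add cdiff_mult cdiff_const D w)
        then show "cdiff d (\<lambda>z. F m z - F n z) w" by simp
        have "cmod (F m w - F n w) \<le> cmod (F m w - q w) + cmod (F n w - q w)"
          by (metis norm_minus_commute norm_triangle_sub norm_diff_triangle_le order_refl)
        then show "cmod (F m w - F n w) \<le> \<epsilon> m + \<epsilon> n" using lim[OF w, of m] lim[OF w, of n] by simp
      qed
      also have "(\<Sum>j<d. (c m j - c n j) * e j) = c m i - c n i"
        using i by (simp add: e_def if_distrib cong: if_cong)
      finally show ?thesis using N1 by simp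
    qed
    note bound = this
    have "Cauchy (\<lambda>m. c m i)"
    proof (rule metric_CauchyI)
      fix r :: real assume r: "r > 0"
      then have "\<forall>\<^sub>F m in sequentially. \<epsilon> m < r * R / 4"
        using \<epsilon> R by (intro order_tendstoD(2)[of \<epsilon> 0]) auto
      then obtain M where M: "\<And>m. m \<ge> M \<Longrightarrow> \<epsilon> m < r * R / 4"
        unfolding eventually_sequentially by blast
      show "\<exists>M. \<forall>m\<ge>M. \<forall>n\<ge>M. dist (c m i) (c n i) < r"
      proof (intro exI allI impI)
        fix m n assume "m \<ge> M" "n \<ge> M"
        then have "\<epsilon> m + \<epsilon> n < r * R / 2" using M[of m] M[of n] by simp
        then have "2 / R * (\<epsilon> m + \<epsilon> n) < r" using R by (simp add: field_simps)
        then show "dist (c m i) (c n i) < r" using bound[of m n] by (simp add: dist_norm)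
      qed
    qed
    then show ?thesis using Cauchy_convergent convergent_def by blast
  qed
  then have "\<exists>l. \<forall>i<d. (\<lambda>m. c m i) \<longlonglongrightarrow> l i" by metis
  then obtain l where l: "\<And>i. i < d \<Longrightarrow> (\<lambda>m. c m i) \<longlonglongrightarrow> l i" by blast
  define C where "C = 8 * K / R\<^sup>2"
  have K0: "K \<ge> 0" using order_trans[OF norm_ge_zero K[OF a, of 0]] R by (simp add: cnorm_def)
  then have C: "C \<ge> 0" by (simp add: C_def)
  have est: "cmod (q z - q a - (\<Sum>i<d. l i * (z i - a i))) \<le> C * (cnorm d (\<lambda>i. z i - a i))\<^sup>2"
    if z: "z \<in> cspace d" "cnorm d (\<lambda>i. z i - a i) < R / 2" for z
  proof (rule tendsto_upperbound)
    show "(\<lambda>m. cmod (F m z - F m a - (\<Sum>i<d. c m i * (z i - a i)))) \<longlonglongrightarrow>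
        cmod (q z - q a - (\<Sum>i<d. l i * (z i - a i)))"
      using z R a by (intro tendsto_intros conv l) (auto simp: cnorm_def)
    show "\<forall>\<^sub>F m in sequentially. cmod (F m z - F m a - (\<Sum>i<d. c m i * (z i - a i)))
        \<le> C * (cnorm d (\<lambda>i. z i - a i))\<^sup>2"
    proof (rule always_eventually, rule allI)
      fix m
      have "(\<lambda>j. z j - a j) \<in> cspace d" using z a by (auto simp: cspace_def)
      from cdiff_taylor_bounds(2)[OF a this R D K c] z(2)
      show "cmod (F m z - F m a - (\<Sum>i<d. c m i * (z i - a i))) \<le> C * (cnorm d (\<lambda>i. z i - a i))\<^sup>2"
        by (simp add: C_def)
    qed
  qed simp
  have "has_cgrad d q a l"
    unfolding has_cgrad_iff_frechet[OF a]
  proof (intro allI impI)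
    fix \<eta> :: real assume \<eta>: "\<eta> > 0"
    \<comment> \<open>Dividing by \<open>C + 1\<close> keeps \<open>\<delta>\<close> positive also
      when \<open>C = 0\<close>.\<close>
    define \<delta> where "\<delta> = min (R / 2) (\<eta> / (C + 1))"
    have "\<delta> > 0" using \<eta> R C by (simp add: \<delta>_def)
    moreover have "cmod (q z - q a - (\<Sum>i<d. l i * (z i - a i))) \<le> \<eta> * cnorm d (\<lambda>i. z i - a i)"
      if z: "z \<in> cspace d" "cnorm d (\<lambda>i. z i - a i) < \<delta>" for z
    proof -
      have "C * cnorm d (\<lambda>i. z i - a i) \<le> (C + 1) * (\<eta> / (C + 1))"
        by (rule mult_mono) (use z C in \<open>auto simp: \<delta>_def\<close>)
      also have "\<dots> = \<eta>" using C by simp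
      finally have "C * cnorm d (\<lambda>i. z i - a i) * cnorm d (\<lambda>i. z i - a i) \<le> \<eta> * cnorm d (\<lambda>i. z i - a i)"
        by (rule mult_right_mono) simp
      with est[of z] z show ?thesis by (simp add: \<delta>_def power2_eq_square mult.assoc)
    qed
    ultimately show "eventually (\<lambda>z. cmod (q z - q a - (\<Sum>i<d. l i * (z i - a i)))
        \<le> \<eta> * cnorm d (\<lambda>i. z i - a i)) (cnhds d a)"
      unfolding eventually_cnhds[OF a] by blast
  qed
  then show ?thesis unfolding cdiff_def by blast
qed

text \<open>The difference quotients in the \<open>i\<close>-th direction converge locally uniformly, by the Cauchy
  estimates on complex lines.\<close>

lemma cdiff_partial_deriv:
  assumes a: "a \<in> cspace d" and i: "i < d" and D: "eventually (cdiff d f) (cnhds d a)"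
  shows "cdiff d (\<lambda>z. deriv (\<lambda>w. f (z(i := w))) (z i)) a"
proof -
  define q where "q z = deriv (\<lambda>w. f (z(i := w))) (z i)" for z
  define e :: "nat \<Rightarrow> complex" where "e = (\<lambda>j. if j = i then 1 else 0)"
  have e: "e \<in> cspace d" using i by (auto simp: e_def cspace_def)
  have N1: "cnorm d e = 1" using i by (simp add: cnorm_def e_def if_distrib cong: if_cong)
  define K where "K = cmod (f a) + 1"
  have "cdiff d f a" by (rule eventually_cnhds_self[OF a D])
  then have "\<forall>\<^sub>F z in cnhds d a. dist (f z) (f a) < 1"
    using cdiff_tendsto tendstoD zero_less_one by blast
  with D have "\<forall>\<^sub>F z in cnhds d a. cdiff d f z \<and> cmod (f z) \<le> K"
  proof eventually_elim
    case (elim z)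
    have "cmod (f z) \<le> cmod (f a) + cmod (f z - f a)" by (rule norm_triangle_sub)
    with elim show ?case by (simp add: K_def dist_norm)
  qed
  then obtain R where R: "R > 0" and near: "\<And>z. z \<in> cspace d \<Longrightarrow> cnorm d (\<lambda>i. z i - a i) < R \<Longrightarrow>
      cdiff d f z \<and> cmod (f z) \<le> K"
    unfolding eventually_cnhds[OF a] by blast
  \<comment> \<open>Halving \<open>R\<close> leaves room for a full ball of radius \<open>S\<close>
    around every point of the ball of radius \<open>S\<close> about \<open>a\<close>, as the Taylor
    bounds require.\<close>
  define S where "S = R / 2"
  have S: "S > 0" using R by (simp add: S_def)
  have near2: "cdiff d f w" "cmod (f w) \<le> K"
    if "z \<in> cspace d" "cnorm d (\<lambda>i. z i - a i) < S" "w \<in> cspace d" "cnorm d (\<lambda>i. w i - z i) < S" for z w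
    using near[of w] cnorm_triangle[of d w a z] that by (auto simp: S_def)
  \<comment> \<open>The offset \<open>m0\<close> makes every step size \<open>\<tau> m\<close>
    smaller than \<open>S / 2\<close>, since \<open>cdiff_uniform_limit\<close> wants its bounds for
    all \<open>m\<close> and not only eventually.\<close>
  obtain m0 :: nat where m0: "m0 > 0" "1 / real m0 < S / 2"
    using reals_Archimedean[of "S / 2"] S by (auto simp: inverse_eq_divide simp flip: of_nat_Suc)
  define \<tau> where "\<tau> m = 1 / real (m + m0)" for m
  have \<tau>: "\<tau> m > 0" "\<tau> m < S / 2" "\<tau> m \<le> 1" for m
  proof -
    have "\<tau> m \<le> 1 / real m0" unfolding \<tau>_def using m0 by (intro divide_left_mono) auto
    with m0 show "\<tau> m < S / 2" by simp
  qed (use m0 in \<open>auto simp: \<tau>_def\<close>)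
  define F where "F m z = (f (\<lambda>j. z j + \<tau> m * e j) - f z) * of_real (1 / \<tau> m)" for m z
  have main: "cmod (F m z - q z) \<le> 8 * K / S\<^sup>2 * \<tau> m \<and> cmod (q z) \<le> 2 * K / S \<and> cdiff d (F m) z"
    if z: "z \<in> cspace d" "cnorm d (\<lambda>i. z i - a i) < S" for z m
  proof -
    note nz = near2[OF z]
    obtain c where c: "has_cgrad d f z c"
      using nz(1)[OF z(1)] S cdiff_def by (auto simp: cnorm_def)
    have q: "q z = c i" unfolding q_def by (rule has_cgrad_deriv[OF c z(1) i])
    have ce: "(\<Sum>j<d. c j * (t * e j)) = c i * t" for t
    proof -
      have "(\<Sum>j<d. c j * (t * e j)) = (\<Sum>j<d. if j = i then c i * t else 0)"
        by (intro sum.cong) (auto simp: e_def)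
      then show ?thesis using i by simp
    qed
    have te: "(\<lambda>j. complex_of_real (\<tau> m) * e j) \<in> cspace d" using e by (auto simp: cspace_def)
    have Nt: "cnorm d (\<lambda>j. complex_of_real (\<tau> m) * e j) = \<tau> m"
      using \<tau>(1)[of m] by (simp add: cnorm_scale N1)
    define D where "D = f (\<lambda>j. z j + \<tau> m * e j) - f z - c i * \<tau> m"
    have D: "cmod D \<le> 8 * K / S\<^sup>2 * (\<tau> m)\<^sup>2"
      using cdiff_taylor_bounds(2)[OF z(1) te S nz c] \<tau>(2)[of m] by (simp add: Nt ce D_def)
    have "F m z - q z = D * of_real (1 / \<tau> m)"
      using \<tau>(1)[of m] by (simp add: F_def q D_def field_simps)
    then have "cmod (F m z - q z) = cmod D * (1 / \<tau> m)"
      using \<tau>(1)[of m] by (simp add: norm_divide)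
    also have "\<dots> \<le> 8 * K / S\<^sup>2 * (\<tau> m)\<^sup>2 * (1 / \<tau> m)"
      by (rule mult_right_mono[OF D]) (use \<tau>(1)[of m] in simp)
    finally have "cmod (F m z - q z) \<le> 8 * K / S\<^sup>2 * (\<tau> m)\<^sup>2 * (1 / \<tau> m)" .
    then have 1: "cmod (F m z - q z) \<le> 8 * K / S\<^sup>2 * \<tau> m"
      using \<tau>(1)[of m] by (simp add: power2_eq_square)
    have "cmod (\<Sum>j<d. c j * (1 * e j)) \<le> 2 * K / S * cnorm d e"
      using cdiff_taylor_bounds(1)[OF z(1) e S nz c] by simp
    then have 2: "cmod (q z) \<le> 2 * K / S" unfolding ce by (simp add: q N1)
    have "cdiff d (\<lambda>z. f (\<lambda>j. z j + \<tau> m * e j)) z"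
    proof (rule cdiff_compose[where e = d and f = f and u = "\<lambda>z j. z j + \<tau> m * e j"])
      show "cdiff d f (\<lambda>j. z j + \<tau> m * e j)"
        by (rule nz(1)) (use z e Nt \<tau>(2)[of m] S in \<open>auto simp: line_cspace\<close>)
      show "\<forall>\<^sub>F z in cnhds d z. (\<lambda>j. z j + complex_of_real (\<tau> m) * e j) \<in> cspace d"
        using eventually_cspace_cnhds by eventually_elim (rule line_cspace[OF _ e])
    qed (auto intro!: cdiff_add cdiff_coord cdiff_const z)
    then have "cdiff d (\<lambda>z. (f (\<lambda>j. z j + \<tau> m * e j) + (-1) * f z) * of_real (1 / \<tau> m)) z"
      by (intro cdiff_mult cdiff_add cdiff_const nz(1)[OF z(1)]) (use S in \<open>auto simp: cnorm_def\<close>)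
    with 1 2 show ?thesis by (simp add: F_def[abs_def])
  qed
  have "cdiff d q a"
  proof (rule cdiff_uniform_limit[OF a S])
    show "(\<lambda>m. 8 * K / S\<^sup>2 * \<tau> m) \<longlonglongrightarrow> 0"
      unfolding \<tau>_def by (intro tendsto_mult_right_zero LIMSEQ_ignore_initial_segment lim_1_over_n)
    fix m z assume z: "z \<in> cspace d" "cnorm d (\<lambda>j. z j - a j) < S"
    note main[OF z, of m]
    moreover have "cmod (F m z) \<le> cmod (q z) + cmod (F m z - q z)" by (rule norm_triangle_sub)
    moreover have "8 * K / S\<^sup>2 * \<tau> m \<le> 8 * K / S\<^sup>2 * 1"
      by (rule mult_left_mono) (use \<tau> K_def in auto)
    ultimately show "cmod (F m z) \<le> 2 * K / S + 8 * K / S\<^sup>2" by simp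
    show "cdiff d (F m) z" "cmod (F m z - q z) \<le> 8 * K / S\<^sup>2 * \<tau> m" using main[OF z] by auto
  qed
  then show ?thesis unfolding q_def .
qed

section \<open>Holomorphic atlases\<close>

text \<open>Separation plays no role below, and dropping it avoids checking it for total spaces.\<close>

definition holo_atlas :: "'a cmfd \<Rightarrow> bool"
  where "holo_atlas X \<longleftrightarrow>
    (\<Union>(W, d, \<phi>)\<in>charts X. W) = pts X \<and>
    (\<forall>(W, d, \<phi>)\<in>charts X. inj_on \<phi> W \<and> \<phi> ` W \<subseteq> cspace d) \<and>
    (\<forall>(W, d, \<phi>)\<in>charts X. \<forall>(W', d', \<phi>')\<in>charts X.
       copen d (\<phi> ` (W \<inter> W')) \<and>
       (\<forall>i<d'. holo d (\<phi> ` (W \<inter> W')) (\<lambda>z. \<phi>' (inv_into W \<phi> z) i)))"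

lemma complex_manifold_holo_atlas: "complex_manifold X \<Longrightarrow> holo_atlas X"
  by (simp add: complex_manifold_def holo_atlas_def)

lemma chart_exists:
  assumes "holo_atlas X" "x \<in> pts X"
  obtains W d \<phi> where "(W, d, \<phi>) \<in> charts X" "x \<in> W"
proof -
  have "x \<in> (\<Union>(W, d, \<phi>)\<in>charts X. W)" using assms by (simp add: holo_atlas_def)
  then show thesis using that by blast
qed

context
  fixes X :: "'a cmfd" and W d \<phi>
  assumes X: "holo_atlas X" and C: "(W, d, \<phi>) \<in> charts X"
begin

lemma chart_inj: "inj_on \<phi> W"
  using X C by (auto simp: holo_atlas_def)

lemma chart_cspace: "x \<in> W \<Longrightarrow> \<phi> x \<in> cspace d"
  using X C by (fastforce simp: holo_atlas_def)

lemma chart_pts: "x \<in> W \<Longrightarrow> x \<in> pts X"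
  using X C unfolding holo_atlas_def by blast

lemma chart_inv: "x \<in> W \<Longrightarrow> inv_into W \<phi> (\<phi> x) = x"
  by (rule inv_into_f_f[OF chart_inj])

lemma chart_overlap:
  assumes C': "(W', d', \<phi>') \<in> charts X"
  shows "copen d (\<phi> ` (W \<inter> W')) \<and> (\<forall>i<d'. holo d (\<phi> ` (W \<inter> W')) (\<lambda>z. \<phi>' (inv_into W \<phi> z) i))"
proof -
  have "\<forall>(W, d, \<phi>)\<in>charts X. \<forall>(W', d', \<phi>')\<in>charts X. copen d (\<phi> ` (W \<inter> W')) \<and>
       (\<forall>i<d'. holo d (\<phi> ` (W \<inter> W')) (\<lambda>z. \<phi>' (inv_into W \<phi> z) i))"
    using X unfolding holo_atlas_def by (elim conjE)
  from bspec[OF bspec[OF this C, unfolded prod.case] C', unfolded prod.case] show ?thesis .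
qed

lemma chart_overlap_copen: "(W', d', \<phi>') \<in> charts X \<Longrightarrow> copen d (\<phi> ` (W \<inter> W'))"
  using chart_overlap by blast

lemma chart_copen: "copen d (\<phi> ` W)"
  using chart_overlap_copen[OF C] by simp

lemma eventually_chart:
  assumes "x \<in> W"
  shows "eventually (\<lambda>z. z \<in> \<phi> ` W) (cnhds d (\<phi> x))"
  using copen_eventually[OF chart_copen] assms by blast

lemma chart_transition_cdiff:
  assumes C': "(W', d', \<phi>') \<in> charts X" and "x \<in> W" "x \<in> W'" "i < d'"
  shows "cdiff d (\<lambda>z. \<phi>' (inv_into W \<phi> z) i) (\<phi> x)"
proof -
  have "holo d (\<phi> ` (W \<inter> W')) (\<lambda>z. \<phi>' (inv_into W \<phi> z) i)"
    using chart_overlap[OF C'] assms(4) by simp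
  then show ?thesis
    using assms by (simp add: holo_iff_cdiff[OF chart_overlap_copen[OF C']])
qed

end

lemma filterlim_cnhds_cdiff:
  assumes "\<And>i. i < e \<Longrightarrow> cdiff d (\<lambda>z. u z i) a" "eventually (\<lambda>z. u z \<in> cspace e) (cnhds d a)"
    "a \<in> cspace d"
  shows "filterlim u (cnhds e (u a)) (cnhds d a)"
  unfolding filterlim_cnhds_iff
proof (intro conjI allI)
  fix i
  have ua: "u a \<in> cspace e" by (rule eventually_cnhds_self[OF assms(3,2)])
  show "((\<lambda>z. u z i) \<longlongrightarrow> u a i) (cnhds d a)"
  proof (cases "i < e")
    case True then show ?thesis by (intro cdiff_tendsto assms)
  next
    case False
    have "eventually (\<lambda>z. u z i = u a i) (cnhds d a)"
      using assms(2) by eventually_elim (use ua False in \<open>auto simp: cspace_def\<close>)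
    then show ?thesis by (rule tendsto_eventually)
  qed
qed (rule assms(2))

lemma chart_transition_filterlim:
  assumes X: "holo_atlas X" and C: "(W, d, \<phi>) \<in> charts X" "(W', d', \<phi>') \<in> charts X"
    and x: "x \<in> W" "x \<in> W'"
  shows "filterlim (\<lambda>z. \<phi>' (inv_into W \<phi> z)) (cnhds d' (\<phi>' x)) (cnhds d (\<phi> x))"
proof -
  have "eventually (\<lambda>z. z \<in> \<phi> ` (W \<inter> W')) (cnhds d (\<phi> x))"
    by (rule copen_eventually[OF chart_overlap_copen[OF X C]]) (use x in blast)
  then have "eventually (\<lambda>z. \<phi>' (inv_into W \<phi> z) \<in> cspace d') (cnhds d (\<phi> x))"
    by eventually_elim (auto simp: chart_inv[OF X C(1)] chart_cspace[OF X C(2)])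
  from filterlim_cnhds_cdiff[OF chart_transition_cdiff[OF X C x] this chart_cspace[OF X C(1) x(1)]]
  show ?thesis by (simp add: chart_inv[OF X C(1) x(1)])
qed

section \<open>The topology of an atlas and its neighbourhood filters\<close>

lemma copen_Int: "copen d S \<Longrightarrow> copen d T \<Longrightarrow> copen d (S \<inter> T)"
  by (simp add: copen_def openin_Int)

lemma copen_Union: "(\<And>S. S \<in> K \<Longrightarrow> copen d S) \<Longrightarrow> copen d (\<Union>K)"
  by (simp add: copen_def openin_Union)

text \<open>\<open>mtop\<close> applies \<open>topology\<close> to a predicate, so that predicate
  must first be shown to be a topology. Closure under intersections uses that charts are
  injective.\<close>

lemma openin_mtop:
  assumes X: "holo_atlas X"
  shows "openin (mtop X) S \<longleftrightarrow> S \<subseteq> pts X \<and> (\<forall>(W, d, \<phi>)\<in>charts X. copen d (\<phi> ` (S \<inter> W)))"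
proof -
  have "istopology (\<lambda>S. S \<subseteq> pts X \<and> (\<forall>(W, d, \<phi>)\<in>charts X. copen d (\<phi> ` (S \<inter> W))))"
    unfolding istopology_def
  proof (intro conjI allI impI)
    fix S T
    assume S: "S \<subseteq> pts X \<and> (\<forall>(W, d, \<phi>)\<in>charts X. copen d (\<phi> ` (S \<inter> W)))"
      and T: "T \<subseteq> pts X \<and> (\<forall>(W, d, \<phi>)\<in>charts X. copen d (\<phi> ` (T \<inter> W)))"
    show "S \<inter> T \<subseteq> pts X" using S by blast
    show "\<forall>(W, d, \<phi>)\<in>charts X. copen d (\<phi> ` (S \<inter> T \<inter> W))"
    proof clarify
      fix W d \<phi> assume C: "(W, d, \<phi>) \<in> charts X"
      have "\<phi> ` (S \<inter> T \<inter> W) = \<phi> ` (S \<inter> W) \<inter> \<phi> ` (T \<inter> W)"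
        using chart_inj[OF X C] by (auto simp: inj_on_def)
      then show "copen d (\<phi> ` (S \<inter> T \<inter> W))" using S T C by (auto intro!: copen_Int)
    qed
  next
    fix K assume K: "\<forall>S\<in>K. S \<subseteq> pts X \<and> (\<forall>(W, d, \<phi>)\<in>charts X. copen d (\<phi> ` (S \<inter> W)))"
    show "\<Union>K \<subseteq> pts X" using K by blast
    show "\<forall>(W, d, \<phi>)\<in>charts X. copen d (\<phi> ` (\<Union>K \<inter> W))"
    proof clarify
      fix W d \<phi> assume C: "(W, d, \<phi>) \<in> charts X"
      have "\<phi> ` (\<Union>K \<inter> W) = \<Union>((\<lambda>S. \<phi> ` (S \<inter> W)) ` K)" by auto
      also have "copen d \<dots>"
      proof (rule copen_Union)
        fix T assume "T \<in> (\<lambda>S. \<phi> ` (S \<inter> W)) ` K"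
        then obtain S where "S \<in> K" and T: "T = \<phi> ` (S \<inter> W)" by (rule imageE)
        with K have "\<forall>(W, d, \<phi>)\<in>charts X. copen d (\<phi> ` (S \<inter> W))" by simp
        from bspec[OF this C] T show "copen d T" by simp
      qed
      finally show "copen d (\<phi> ` (\<Union>K \<inter> W))" .
    qed
  qed
  then show ?thesis by (simp add: mtop_def topology_inverse')
qed

lemma openin_chart: "holo_atlas X \<Longrightarrow> (W, d, \<phi>) \<in> charts X \<Longrightarrow> openin (mtop X) W"
  unfolding openin_mtop
  using chart_pts[of X W d \<phi>] chart_overlap_copen[of X _ _ _ W d \<phi>]
  by (auto simp: Int_commute)

lemma topspace_mtop: "holo_atlas X \<Longrightarrow> topspace (mtop X) = pts X"
proof (rule antisym)
  assume X: "holo_atlas X"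
  then show "topspace (mtop X) \<subseteq> pts X"
    using openin_mtop[OF X, of "topspace (mtop X)"] by simp
  show "pts X \<subseteq> topspace (mtop X)"
    using chart_exists[OF X] openin_chart[OF X] openin_subset by (metis subsetD subsetI)
qed

abbreviation mnhds :: "'a cmfd \<Rightarrow> 'a \<Rightarrow> 'a filter"
  where "mnhds X \<equiv> nhdsin (mtop X)"

lemma eventually_mnhds:
  "holo_atlas X \<Longrightarrow> x \<in> pts X \<Longrightarrow>
    eventually P (mnhds X x) \<longleftrightarrow> (\<exists>S. openin (mtop X) S \<and> x \<in> S \<and> (\<forall>y\<in>S. P y))"
  by (simp add: eventually_nhdsin topspace_mtop)

lemma eventually_mnhdsE:
  assumes "holo_atlas X" "x \<in> pts X" "eventually P (mnhds X x)"
  obtains S where "openin (mtop X) S" "x \<in> S" "\<And>y. y \<in> S \<Longrightarrow> P y"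
proof -
  from assms(3) have "\<exists>S. openin (mtop X) S \<and> x \<in> S \<and> (\<forall>y\<in>S. P y)"
    by (simp only: eventually_mnhds[OF assms(1,2)])
  then show thesis using that by blast
qed

lemma eventually_mnhds_open:
  "openin (mtop X) S \<Longrightarrow> x \<in> S \<Longrightarrow> eventually (\<lambda>y. y \<in> S) (mnhds X x)"
  unfolding eventually_nhdsin by blast

lemma eventually_mnhds_pts: "holo_atlas X \<Longrightarrow> eventually (\<lambda>y. y \<in> pts X) (mnhds X x)"
  unfolding eventually_nhdsin by (metis openin_topspace topspace_mtop)

lemma eventually_mnhds_self: "holo_atlas X \<Longrightarrow> x \<in> pts X \<Longrightarrow> eventually P (mnhds X x) \<Longrightarrow> P x"
  by (auto simp: eventually_mnhds)

lemma eventually_eventually_mnhds: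
  "eventually P (mnhds X x) \<Longrightarrow> eventually (\<lambda>y. eventually P (mnhds X y)) (mnhds X x)"
  unfolding eventually_nhdsin by blast

lemma openin_mtop_iff_eventually:
  assumes X: "holo_atlas X"
  shows "openin (mtop X) S \<longleftrightarrow> S \<subseteq> pts X \<and> (\<forall>x\<in>S. eventually (\<lambda>y. y \<in> S) (mnhds X x))"
proof
  assume "openin (mtop X) S"
  then show "S \<subseteq> pts X \<and> (\<forall>x\<in>S. eventually (\<lambda>y. y \<in> S) (mnhds X x))"
    using eventually_mnhds_open openin_subset topspace_mtop[OF X] by metis
next
  assume S: "S \<subseteq> pts X \<and> (\<forall>x\<in>S. eventually (\<lambda>y. y \<in> S) (mnhds X x))"
  show "openin (mtop X) S"
  proof (subst openin_subopen, rule ballI)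
    fix x assume x: "x \<in> S"
    with S have "x \<in> pts X" "eventually (\<lambda>y. y \<in> S) (mnhds X x)" by auto
    then show "\<exists>T. openin (mtop X) T \<and> x \<in> T \<and> T \<subseteq> S"
      unfolding eventually_mnhds[OF X \<open>x \<in> pts X\<close>] by (auto simp: subset_iff)
  qed
qed

text \<open>Openness in \<open>mtop\<close> is tested in all charts, but continuity of the
  transition maps carries a neighbourhood seen in one chart around \<open>x\<close> to all the
  others.\<close>

lemma eventually_mnhds_chart:
  assumes X: "holo_atlas X" and C: "(W, d, \<phi>) \<in> charts X" and x: "x \<in> W"
  shows "eventually P (mnhds X x) \<longleftrightarrow> eventually (\<lambda>z. P (inv_into W \<phi> z)) (cnhds d (\<phi> x))"
proof
  assume "eventually P (mnhds X x)"
  then obtain S where S: "openin (mtop X) S" "x \<in> S" "\<And>y. y \<in> S \<Longrightarrow> P y"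
    by (rule eventually_mnhdsE[OF X chart_pts[OF X C x]]) blast
  have "copen d (\<phi> ` (S \<inter> W))" using S(1) C by (auto simp: openin_mtop[OF X])
  from copen_eventually[OF this, of "\<phi> x"]
  have "eventually (\<lambda>z. z \<in> \<phi> ` (S \<inter> W)) (cnhds d (\<phi> x))" using S x by blast
  then show "eventually (\<lambda>z. P (inv_into W \<phi> z)) (cnhds d (\<phi> x))"
    by eventually_elim (auto simp: chart_inv[OF X C] S)
next
  assume P: "eventually (\<lambda>z. P (inv_into W \<phi> z)) (cnhds d (\<phi> x))"
  \<comment> \<open>\<open>T\<close> collects the points near which, and not only at which, the
    condition holds; this makes it open by \<open>eventually_eventually_cnhds\<close>.\<close>
  define T where "T = {z. z \<in> \<phi> ` W \<and> eventually (\<lambda>z. P (inv_into W \<phi> z)) (cnhds d z)}"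
  define S where "S = {y \<in> W. \<phi> y \<in> T}"
  have T: "eventually (\<lambda>z. z \<in> T) (cnhds d a)" if "a \<in> T" for a
  proof -
    have "eventually (\<lambda>z. z \<in> \<phi> ` W) (cnhds d a)"
      by (rule copen_eventually[OF chart_copen[OF X C]]) (use that in \<open>simp add: T_def\<close>)
    moreover have "eventually (\<lambda>b. eventually (\<lambda>z. P (inv_into W \<phi> z)) (cnhds d b)) (cnhds d a)"
      by (rule eventually_eventually_cnhds) (use that in \<open>simp add: T_def\<close>)
    ultimately show ?thesis unfolding T_def by eventually_elim simp
  qed
  have "openin (mtop X) S"
    unfolding openin_mtop[OF X]
  proof (intro conjI ballI, goal_cases)
    case 1 then show ?case using chart_pts[OF X C] by (auto simp: S_def)
  next
    case (2 c)
    obtain W' d' \<phi>' where c: "c = (W', d', \<phi>')" by (cases c) auto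
    with 2 have C': "(W', d', \<phi>') \<in> charts X" by simp
    have "copen d' (\<phi>' ` (S \<inter> W'))"
      unfolding copen_iff
    proof (intro conjI ballI)
      show "\<phi>' ` (S \<inter> W') \<subseteq> cspace d'" using chart_cspace[OF X C'] by blast
      fix a assume "a \<in> \<phi>' ` (S \<inter> W')"
      then obtain y where y: "y \<in> W" "y \<in> W'" "\<phi> y \<in> T" "a = \<phi>' y" by (auto simp: S_def)
      have "eventually (\<lambda>z. z \<in> \<phi>' ` (W' \<inter> W)) (cnhds d' a)"
        using copen_eventually[OF chart_overlap_copen[OF X C' C]] y by blast
      moreover have "eventually (\<lambda>z. \<phi> (inv_into W' \<phi>' z) \<in> T) (cnhds d' a)"
        unfolding y(4)
        by (rule eventually_compose_filterlim[OF T[OF y(3)] chart_transition_filterlim[OF X C' C y(2,1)]])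
      ultimately show "eventually (\<lambda>z. z \<in> \<phi>' ` (S \<inter> W')) (cnhds d' a)"
        by eventually_elim (auto simp: S_def chart_inv[OF X C'])
    qed
    with c show ?case by simp
  qed
  moreover have "x \<in> S" using x P by (simp add: S_def T_def)
  moreover have "P y" if "y \<in> S" for y
  proof -
    from that have "y \<in> W" "eventually (\<lambda>z. P (inv_into W \<phi> z)) (cnhds d (\<phi> y))"
      by (auto simp: S_def T_def)
    with eventually_cnhds_self[OF chart_cspace[OF X C]] chart_inv[OF X C] show ?thesis by metis
  qed
  ultimately show "eventually P (mnhds X x)"
    unfolding eventually_nhdsin by blast
qed

section \<open>Differentiable functions and holomorphic maps at a point\<close>

definition mdiff :: "'a cmfd \<Rightarrow> 'a \<Rightarrow> ('a \<Rightarrow> complex) \<Rightarrow> bool"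
  where "mdiff X x h \<longleftrightarrow>
    (\<forall>(W, d, \<phi>)\<in>charts X. x \<in> W \<longrightarrow> cdiff d (\<lambda>z. h (inv_into W \<phi> z)) (\<phi> x))"

text \<open>Other charts are reached by composing with the transition map, whose coordinates are
  differentiable. The composite agrees with \<open>h\<close> in the new chart only near the point,
  where the two chart domains overlap.\<close>

lemma mdiff_chart:
  assumes X: "holo_atlas X" and C: "(W, d, \<phi>) \<in> charts X" and x: "x \<in> W"
  shows "mdiff X x h \<longleftrightarrow> cdiff d (\<lambda>z. h (inv_into W \<phi> z)) (\<phi> x)"
proof
  assume h: "cdiff d (\<lambda>z. h (inv_into W \<phi> z)) (\<phi> x)"
  show "mdiff X x h"
    unfolding mdiff_def
  proof (clarify)
    fix W' d' \<phi>' assume C': "(W', d', \<phi>') \<in> charts X" and x': "x \<in> W'"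
    have ev: "eventually (\<lambda>z. z \<in> \<phi>' ` (W' \<inter> W)) (cnhds d' (\<phi>' x))"
      by (rule copen_eventually[OF chart_overlap_copen[OF X C' C]]) (use x x' in blast)
    have "cdiff d' (\<lambda>z. h (inv_into W \<phi> (\<phi> (inv_into W' \<phi>' z)))) (\<phi>' x)"
    proof (rule cdiff_compose[where e = d and f = "\<lambda>z. h (inv_into W \<phi> z)"
          and u = "\<lambda>z. \<phi> (inv_into W' \<phi>' z)"])
      show "cdiff d (\<lambda>z. h (inv_into W \<phi> z)) (\<phi> (inv_into W' \<phi>' (\<phi>' x)))"
        using h by (simp add: chart_inv[OF X C' x'])
      show "\<forall>\<^sub>F z in cnhds d' (\<phi>' x). \<phi> (inv_into W' \<phi>' z) \<in> cspace d"
        using ev by eventually_elim (auto simp: chart_inv[OF X C'] chart_cspace[OF X C])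
    qed (use chart_transition_cdiff[OF X C' C x' x] chart_cspace[OF X C' x'] in auto)
    then show "cdiff d' (\<lambda>z. h (inv_into W' \<phi>' z)) (\<phi>' x)"
    proof (rule cdiff_cong[OF chart_cspace[OF X C' x'], rotated])
      show "\<forall>\<^sub>F z in cnhds d' (\<phi>' x).
          h (inv_into W \<phi> (\<phi> (inv_into W' \<phi>' z))) = h (inv_into W' \<phi>' z)"
        using ev by eventually_elim (auto simp: chart_inv[OF X C'] chart_inv[OF X C])
    qed
  qed
qed (use C x in \<open>auto simp: mdiff_def\<close>)

lemma mholo_iff_mdiff:
  assumes X: "holo_atlas X" and S: "openin (mtop X) S"
  shows "mholo X S h \<longleftrightarrow> (\<forall>x\<in>S. mdiff X x h)"
proof -
  have "holo d (\<phi> ` (S \<inter> W)) (\<lambda>z. h (inv_into W \<phi> z))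
      \<longleftrightarrow> (\<forall>x\<in>S \<inter> W. cdiff d (\<lambda>z. h (inv_into W \<phi> z)) (\<phi> x))"
    if C: "(W, d, \<phi>) \<in> charts X" for W d \<phi>
  proof -
    have "copen d (\<phi> ` (S \<inter> W))" using S C by (auto simp: openin_mtop[OF X])
    then show ?thesis by (simp add: holo_iff_cdiff)
  qed
  then show ?thesis unfolding mholo_def mdiff_def by fast
qed

lemma mdiff_cong:
  assumes X: "holo_atlas X" and ev: "eventually (\<lambda>y. h y = k y) (mnhds X x)" and h: "mdiff X x h"
  shows "mdiff X x k"
  unfolding mdiff_def
proof clarify
  fix W d \<phi> assume C: "(W, d, \<phi>) \<in> charts X" and x: "x \<in> W"
  show "cdiff d (\<lambda>z. k (inv_into W \<phi> z)) (\<phi> x)"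
    by (rule cdiff_cong[OF chart_cspace[OF X C x]])
      (use ev h in \<open>simp_all add: eventually_mnhds_chart[OF X C x] mdiff_chart[OF X C x]\<close>)
qed

lemma mdiff_const: "mdiff X x (\<lambda>_. k)"
  by (auto simp: mdiff_def intro: cdiff_const)

lemma mdiff_add: "mdiff X x h \<Longrightarrow> mdiff X x k \<Longrightarrow> mdiff X x (\<lambda>y. h y + k y)"
  by (auto simp: mdiff_def intro!: cdiff_add)

lemma mdiff_mult: "mdiff X x h \<Longrightarrow> mdiff X x k \<Longrightarrow> mdiff X x (\<lambda>y. h y * k y)"
  by (auto simp: mdiff_def intro!: cdiff_mult)

lemma mdiff_sum: "(\<And>i. i \<in> I \<Longrightarrow> mdiff X x (h i)) \<Longrightarrow> mdiff X x (\<lambda>y. \<Sum>i\<in>I. h i y)"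
  by (induction I rule: infinite_finite_induct) (auto intro: mdiff_const mdiff_add)

lemma mdiff_compose:
  assumes X: "holo_atlas X" and x: "x \<in> pts X"
    and f: "cdiff e f (u x)" and u: "\<And>j. j < e \<Longrightarrow> mdiff X x (\<lambda>y. u y j)"
    and ev: "eventually (\<lambda>y. u y \<in> cspace e) (mnhds X x)"
  shows "mdiff X x (\<lambda>y. f (u y))"
proof -
  obtain W d \<phi> where C: "(W, d, \<phi>) \<in> charts X" "x \<in> W" by (rule chart_exists[OF X x])
  have "cdiff d (\<lambda>z. f (u (inv_into W \<phi> z))) (\<phi> x)"
    by (rule cdiff_compose[where f = f and u = "\<lambda>z. u (inv_into W \<phi> z)" and e = e])
      (use f u ev C chart_inv[OF X C] chart_cspace[OF X C] in
        \<open>auto simp: mdiff_chart[OF X C] eventually_mnhds_chart[OF X C]\<close>)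
  then show ?thesis by (simp add: mdiff_chart[OF X C])
qed

lemma mdiff_chart_coord:
  assumes X: "holo_atlas X" and C: "(W, d, \<phi>) \<in> charts X" and x: "x \<in> W" and i: "i < d"
  shows "mdiff X x (\<lambda>y. \<phi> y i)"
  using chart_transition_cdiff[OF X C C x x i] by (simp add: mdiff_chart[OF X C x])

lemma mdiff_filterlim:
  assumes X: "holo_atlas X" and x: "x \<in> pts X"
    and u: "\<And>j. j < e \<Longrightarrow> mdiff X x (\<lambda>y. u y j)"
    and ev: "eventually (\<lambda>y. u y \<in> cspace e) (mnhds X x)"
  shows "filterlim u (cnhds e (u x)) (mnhds X x)"
proof -
  obtain W d \<phi> where C: "(W, d, \<phi>) \<in> charts X" "x \<in> W" by (rule chart_exists[OF X x])
  have "filterlim (\<lambda>z. u (inv_into W \<phi> z)) (cnhds e (u (inv_into W \<phi> (\<phi> x)))) (cnhds d (\<phi> x))"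
    by (rule filterlim_cnhds_cdiff)
      (use u ev chart_cspace[OF X C] in
        \<open>auto simp: mdiff_chart[OF X C] eventually_mnhds_chart[OF X C]\<close>)
  then show ?thesis
    by (simp add: filterlim_iff eventually_mnhds_chart[OF X C] chart_inv[OF X C])
qed

text \<open>Only one chart around \<open>f x\<close> is asked for, in contrast to
  \<open>holo_map\<close>. Staying in \<open>W\<close> near \<open>x\<close> is part of the
  condition because \<open>\<phi>\<close> is arbitrary outside \<open>W\<close>; together with
  differentiability it yields continuity.\<close>

definition holo_at :: "'a cmfd \<Rightarrow> 'b cmfd \<Rightarrow> ('a \<Rightarrow> 'b) \<Rightarrow> 'a \<Rightarrow> bool"
  where "holo_at X Y f x \<longleftrightarrow> (\<exists>(W, d, \<phi>)\<in>charts Y. f x \<in> W \<and>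
    eventually (\<lambda>y. f y \<in> W) (mnhds X x) \<and> (\<forall>i<d. mdiff X x (\<lambda>y. \<phi> (f y) i)))"

lemma holo_atI:
  "(W, d, \<phi>) \<in> charts Y \<Longrightarrow> f x \<in> W \<Longrightarrow> eventually (\<lambda>y. f y \<in> W) (mnhds X x) \<Longrightarrow>
    (\<And>i. i < d \<Longrightarrow> mdiff X x (\<lambda>y. \<phi> (f y) i)) \<Longrightarrow> holo_at X Y f x"
  unfolding holo_at_def by blast

context
  fixes X :: "'a cmfd" and Y :: "'b cmfd" and f x
  assumes X: "holo_atlas X" and Y: "holo_atlas Y" and x: "x \<in> pts X" and f: "holo_at X Y f x"
begin

lemma holo_at_filterlim_chart:
  assumes W: "(W, d, \<phi>) \<in> charts Y" "eventually (\<lambda>y. f y \<in> W) (mnhds X x)"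
    "\<And>i. i < d \<Longrightarrow> mdiff X x (\<lambda>y. \<phi> (f y) i)"
  shows "filterlim (\<lambda>y. \<phi> (f y)) (cnhds d (\<phi> (f x))) (mnhds X x)"
  by (rule mdiff_filterlim[OF X x W(3)])
    (use W(2) chart_cspace[OF Y W(1)] in \<open>auto elim: eventually_mono\<close>)

lemma holo_at_filterlim: "filterlim f (mnhds Y (f x)) (mnhds X x)"
proof -
  obtain W d \<phi> where W: "(W, d, \<phi>) \<in> charts Y" "f x \<in> W" "eventually (\<lambda>y. f y \<in> W) (mnhds X x)"
    "\<And>i. i < d \<Longrightarrow> mdiff X x (\<lambda>y. \<phi> (f y) i)"
    using f by (auto simp: holo_at_def)
  have "eventually (\<lambda>y. P (f y)) (mnhds X x)" if P: "eventually P (mnhds Y (f x))" for P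
  proof -
    have "eventually (\<lambda>z. P (inv_into W \<phi> z)) (cnhds d (\<phi> (f x)))"
      using P by (simp add: eventually_mnhds_chart[OF Y W(1,2)])
    then have "eventually (\<lambda>y. P (inv_into W \<phi> (\<phi> (f y)))) (mnhds X x)"
      by (rule eventually_compose_filterlim[OF _ holo_at_filterlim_chart[OF W(1,3,4)]])
    with W(3) show ?thesis by eventually_elim (simp add: chart_inv[OF Y W(1)])
  qed
  then show ?thesis by (simp add: filterlim_iff)
qed

lemma holo_at_mdiff: "mdiff Y (f x) h \<Longrightarrow> mdiff X x (\<lambda>y. h (f y))"
proof -
  assume h: "mdiff Y (f x) h"
  obtain W d \<phi> where W: "(W, d, \<phi>) \<in> charts Y" "f x \<in> W" "eventually (\<lambda>y. f y \<in> W) (mnhds X x)"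
    "\<And>i. i < d \<Longrightarrow> mdiff X x (\<lambda>y. \<phi> (f y) i)"
    using f by (auto simp: holo_at_def)
  have "mdiff X x (\<lambda>y. h (inv_into W \<phi> (\<phi> (f y))))"
    by (rule mdiff_compose[OF X x, where f = "\<lambda>z. h (inv_into W \<phi> z)" and u = "\<lambda>y. \<phi> (f y)" and e = d])
      (use h W chart_cspace[OF Y W(1)] in \<open>auto simp: mdiff_chart[OF Y W(1,2)] elim: eventually_mono\<close>)
  then show ?thesis
    by (rule mdiff_cong[OF X, rotated]) (use W(3) in \<open>eventually_elim, simp add: chart_inv[OF Y W(1)]\<close>)
qed

lemma holo_at_pts: "f x \<in> pts Y"
  using f chart_pts[OF Y] by (auto simp: holo_at_def)

end

lemma holo_at_cong:
  assumes X: "holo_atlas X" and x: "x \<in> pts X" and ev: "eventually (\<lambda>y. f y = g y) (mnhds X x)"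
    and f: "holo_at X Y f x"
  shows "holo_at X Y g x"
proof -
  obtain W d \<phi> where W: "(W, d, \<phi>) \<in> charts Y" "f x \<in> W" "eventually (\<lambda>y. f y \<in> W) (mnhds X x)"
    "\<And>i. i < d \<Longrightarrow> mdiff X x (\<lambda>y. \<phi> (f y) i)"
    using f by (auto simp: holo_at_def)
  have "f x = g x" by (rule eventually_mnhds_self[OF X x ev])
  moreover have "eventually (\<lambda>y. g y \<in> W) (mnhds X x)"
    using ev W(3) by eventually_elim simp
  moreover have "mdiff X x (\<lambda>y. \<phi> (g y) i)" if "i < d" for i
    by (rule mdiff_cong[OF X _ W(4)[OF that]]) (use ev in \<open>eventually_elim, simp\<close>)
  ultimately show ?thesis using W by (intro holo_atI[OF W(1)]) auto
qed

text \<open>Trades continuity and preimages of charts for a condition at each point, for which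
  composition, pairing and local modification are easy. Forwards, a chart around \<open>f x\<close>
  is chosen; backwards, continuity comes from \<open>holo_at_filterlim\<close>.\<close>

lemma holo_map_iff:
  assumes X: "holo_atlas X" and Y: "holo_atlas Y"
  shows "holo_map X Y f \<longleftrightarrow> (\<forall>x\<in>pts X. holo_at X Y f x)"
proof
  assume f: "holo_map X Y f"
  show "\<forall>x\<in>pts X. holo_at X Y f x"
  proof
    fix x assume x: "x \<in> pts X"
    then have "f x \<in> pts Y" using f by (auto simp: holo_map_def)
    then obtain W d \<phi> where C: "(W, d, \<phi>) \<in> charts Y" "f x \<in> W" by (rule chart_exists[OF Y])
    have "openin (mtop X) {y \<in> topspace (mtop X). f y \<in> W}"
      by (rule openin_continuous_map_preimage) (use f openin_chart[OF Y C(1)] in \<open>auto simp: holo_map_def\<close>)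
    also have "{y \<in> topspace (mtop X). f y \<in> W} = pts X \<inter> f -` W" by (auto simp: topspace_mtop[OF X])
    finally have op: "openin (mtop X) (pts X \<inter> f -` W)" .
    have "eventually (\<lambda>y. y \<in> pts X \<inter> f -` W) (mnhds X x)"
      by (rule eventually_mnhds_open[OF op]) (use x C in auto)
    then have ev: "eventually (\<lambda>y. f y \<in> W) (mnhds X x)" by eventually_elim simp
    have "mdiff X x (\<lambda>y. \<phi> (f y) i)" if "i < d" for i
    proof -
      have "mholo X (pts X \<inter> f -` W) (\<lambda>y. \<phi> (f y) i)" using f C that by (fastforce simp: holo_map_def)
      then show ?thesis using x C by (simp add: mholo_iff_mdiff[OF X op])
    qed
    with C ev show "holo_at X Y f x" by (intro holo_atI[OF C(1)])
  qed
next
  assume f: "\<forall>x\<in>pts X. holo_at X Y f x"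
  have op: "openin (mtop X) (pts X \<inter> f -` S)" if S: "openin (mtop Y) S" for S
    unfolding openin_mtop_iff_eventually[OF X]
  proof (intro conjI ballI)
    fix x assume x: "x \<in> pts X \<inter> f -` S"
    have "eventually (\<lambda>y. f y \<in> S) (mnhds X x)"
      by (rule eventually_compose_filterlim[OF eventually_mnhds_open[OF S] holo_at_filterlim[OF X Y]])
        (use x f in auto)
    with eventually_mnhds_pts[OF X] show "eventually (\<lambda>y. y \<in> pts X \<inter> f -` S) (mnhds X x)"
      by eventually_elim simp
  qed auto
  show "holo_map X Y f"
    unfolding holo_map_def
  proof (intro conjI)
    show fXY: "f \<in> pts X \<rightarrow> pts Y" using holo_at_pts[OF X Y] f by blast
    have "{x \<in> pts X. f x \<in> S} = pts X \<inter> f -` S" for S by blast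
    then show "continuous_map (mtop X) (mtop Y) f"
      using fXY op by (simp add: continuous_map_def topspace_mtop X Y)
    show "\<forall>(W, d, \<phi>)\<in>charts Y. \<forall>i<d. mholo X (pts X \<inter> f -` W) (\<lambda>x. \<phi> (f x) i)"
    proof clarify
      fix W d \<phi> i assume C: "(W, d, \<phi>) \<in> charts Y" and i: "i < d"
      show "mholo X (pts X \<inter> f -` W) (\<lambda>x. \<phi> (f x) i)"
        unfolding mholo_iff_mdiff[OF X op[OF openin_chart[OF Y C]]]
        using f holo_at_mdiff[OF X Y _ _ mdiff_chart_coord[OF Y C _ i]] by blast
    qed
  qed
qed

lemma holo_map_pts: "holo_map X Y f \<Longrightarrow> x \<in> pts X \<Longrightarrow> f x \<in> pts Y"
  by (auto simp: holo_map_def)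

lemma holo_map_at: "holo_atlas X \<Longrightarrow> holo_atlas Y \<Longrightarrow> holo_map X Y f \<Longrightarrow> x \<in> pts X \<Longrightarrow> holo_at X Y f x"
  by (simp add: holo_map_iff)

lemma holo_map_mdiff:
  "holo_atlas X \<Longrightarrow> holo_atlas Y \<Longrightarrow> holo_map X Y f \<Longrightarrow> x \<in> pts X \<Longrightarrow> mdiff Y (f x) h
    \<Longrightarrow> mdiff X x (\<lambda>y. h (f y))"
  using holo_at_mdiff holo_map_at by metis

lemma holo_map_filterlim:
  "holo_atlas X \<Longrightarrow> holo_atlas Y \<Longrightarrow> holo_map X Y f \<Longrightarrow> x \<in> pts X
    \<Longrightarrow> filterlim f (mnhds Y (f x)) (mnhds X x)"
  using holo_at_filterlim holo_map_at by metis

lemma holo_map_openin: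
  "holo_atlas X \<Longrightarrow> holo_map X Y f \<Longrightarrow> openin (mtop Y) S \<Longrightarrow> openin (mtop X) (pts X \<inter> f -` S)"
  using openin_continuous_map_preimage[of "mtop X" "mtop Y" f S]
  by (simp add: holo_map_def topspace_mtop Int_def vimage_def)

lemma holo_at_compose:
  assumes X: "holo_atlas X" and Y: "holo_atlas Y" and x: "x \<in> pts X"
    and f: "holo_at X Y f x" and g: "holo_at Y Z g (f x)"
  shows "holo_at X Z (\<lambda>y. g (f y)) x"
proof -
  obtain W d \<phi> where W: "(W, d, \<phi>) \<in> charts Z" "g (f x) \<in> W"
    "eventually (\<lambda>y. g y \<in> W) (mnhds Y (f x))" "\<And>i. i < d \<Longrightarrow> mdiff Y (f x) (\<lambda>y. \<phi> (g y) i)"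
    using g by (auto simp: holo_at_def)
  have "eventually (\<lambda>y. g (f y) \<in> W) (mnhds X x)"
    by (rule eventually_compose_filterlim[OF W(3) holo_at_filterlim[OF X Y x f]])
  moreover have "mdiff X x (\<lambda>y. \<phi> (g (f y)) i)" if "i < d" for i
    by (rule holo_at_mdiff[OF X Y x f W(4)[OF that]])
  ultimately show ?thesis unfolding holo_at_def using W(1,2) by (intro bexI[OF _ W(1)]) simp
qed

lemma holo_map_compose:
  "holo_atlas X \<Longrightarrow> holo_atlas Y \<Longrightarrow> holo_atlas Z \<Longrightarrow> holo_map X Y f \<Longrightarrow> holo_map Y Z g
    \<Longrightarrow> holo_map X Z (\<lambda>x. g (f x))"
  by (simp add: holo_map_iff holo_at_compose holo_at_pts)

lemma holo_map_cong:
  assumes X: "holo_atlas X" "holo_atlas Y" and fg: "\<And>x. x \<in> pts X \<Longrightarrow> f x = g x" and f: "holo_map X Y f"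
  shows "holo_map X Y g"
  unfolding holo_map_iff[OF X]
proof
  fix x assume x: "x \<in> pts X"
  show "holo_at X Y g x"
    by (rule holo_at_cong[OF X(1) x _ holo_map_at[OF X f x]])
      (use eventually_mnhds_pts[OF X(1)] in \<open>eventually_elim, simp add: fg\<close>)
qed

lemma holo_map_id:
  assumes X: "holo_atlas X"
  shows "holo_map X X (\<lambda>x. x)"
  unfolding holo_map_iff[OF X X]
proof
  fix x assume "x \<in> pts X"
  then obtain W d \<phi> where C: "(W, d, \<phi>) \<in> charts X" "x \<in> W" by (rule chart_exists[OF X])
  show "holo_at X X (\<lambda>x. x) x"
    by (rule holo_atI[OF C(1)])
      (auto intro: C(2) mdiff_chart_coord[OF X C] eventually_mnhds_open[OF openin_chart[OF X C(1)] C(2)])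
qed

lemma holo_map_const:
  assumes "holo_atlas X" "holo_atlas Y" "c \<in> pts Y"
  shows "holo_map X Y (\<lambda>_. c)"
  unfolding holo_map_iff[OF assms(1,2)]
proof
  fix x assume "x \<in> pts X"
  obtain W d \<phi> where C: "(W, d, \<phi>) \<in> charts Y" "c \<in> W" by (rule chart_exists[OF assms(2,3)])
  show "holo_at X Y (\<lambda>_. c) x" by (rule holo_atI[OF C(1)]) (use C in \<open>auto intro: mdiff_const\<close>)
qed

lemma holo_atlasI:
  assumes cover: "(\<Union>(W, d, \<phi>)\<in>charts X. W) = pts X"
    and inj: "\<And>W d \<phi>. (W, d, \<phi>) \<in> charts X \<Longrightarrow> inj_on \<phi> W"
    and sub: "\<And>W d \<phi> x. (W, d, \<phi>) \<in> charts X \<Longrightarrow> x \<in> W \<Longrightarrow> \<phi> x \<in> cspace d"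
    and op: "\<And>W d \<phi> W' d' \<phi>' x. (W, d, \<phi>) \<in> charts X \<Longrightarrow> (W', d', \<phi>') \<in> charts X \<Longrightarrow> x \<in> W \<Longrightarrow>
      x \<in> W' \<Longrightarrow> eventually (\<lambda>z. z \<in> \<phi> ` (W \<inter> W')) (cnhds d (\<phi> x))"
    and trans: "\<And>W d \<phi> W' d' \<phi>' x i. (W, d, \<phi>) \<in> charts X \<Longrightarrow> (W', d', \<phi>') \<in> charts X \<Longrightarrow> x \<in> W \<Longrightarrow>
      x \<in> W' \<Longrightarrow> i < d' \<Longrightarrow> cdiff d (\<lambda>z. \<phi>' (inv_into W \<phi> z) i) (\<phi> x)"
  shows "holo_atlas X"
proof -
  have "copen d (\<phi> ` (W \<inter> W'))" if "(W, d, \<phi>) \<in> charts X" "(W', d', \<phi>') \<in> charts X" for W d \<phi> W' d' \<phi>'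
    unfolding copen_iff using sub op that by blast
  moreover from this have "holo d (\<phi> ` (W \<inter> W')) (\<lambda>z. \<phi>' (inv_into W \<phi> z) i)"
    if "(W, d, \<phi>) \<in> charts X" "(W', d', \<phi>') \<in> charts X" "i < d'" for W d \<phi> W' d' \<phi>' i
    using trans that by (auto simp: holo_iff_cdiff)
  ultimately have "\<forall>(W, d, \<phi>)\<in>charts X. \<forall>(W', d', \<phi>')\<in>charts X. copen d (\<phi> ` (W \<inter> W')) \<and>
       (\<forall>i<d'. holo d (\<phi> ` (W \<inter> W')) (\<lambda>z. \<phi>' (inv_into W \<phi> z) i))"
    by clarify simp
  moreover have "\<forall>(W, d, \<phi>)\<in>charts X. inj_on \<phi> W \<and> \<phi> ` W \<subseteq> cspace d"
    using inj sub by fast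
  ultimately show ?thesis
    unfolding holo_atlas_def using cover by (intro conjI)
qed

section \<open>Products and powers\<close>

text \<open>\<open>fstc\<close> and \<open>sndc\<close> undo \<open>cat\<close>. The first must be
  cut off at \<open>d\<close> to land in \<open>cspace d\<close>, whereas the second shifts the
  indices and inherits its zeros.\<close>

definition fstc :: "nat \<Rightarrow> (nat \<Rightarrow> complex) \<Rightarrow> nat \<Rightarrow> complex"
  where "fstc d z = (\<lambda>i. if i < d then z i else 0)"

definition sndc :: "nat \<Rightarrow> (nat \<Rightarrow> complex) \<Rightarrow> nat \<Rightarrow> complex"
  where "sndc d z = (\<lambda>i. z (i + d))"

lemma cat_cspace: "z \<in> cspace d \<Longrightarrow> w \<in> cspace e \<Longrightarrow> cat d z w \<in> cspace (d + e)"
  by (auto simp: cspace_def cat_def)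

lemma fstc_cspace [simp]: "fstc d z \<in> cspace d"
  by (auto simp: cspace_def fstc_def)

lemma sndc_cspace: "z \<in> cspace (d + e) \<Longrightarrow> sndc d z \<in> cspace e"
  by (auto simp: cspace_def sndc_def)

lemma fstc_cat: "z \<in> cspace d \<Longrightarrow> fstc d (cat d z w) = z"
  by (auto simp: cspace_def fstc_def cat_def fun_eq_iff)

lemma sndc_cat [simp]: "sndc d (cat d z w) = w"
  by (auto simp: sndc_def cat_def)

lemma cat_fstc_sndc [simp]: "cat d (fstc d z) (sndc d z) = z"
  by (auto simp: fstc_def sndc_def cat_def)

lemma cdiff_fstc: "i < d \<Longrightarrow> cdiff (d + e) (\<lambda>z. fstc d z i) a"
  using cdiff_coord[of i "d + e" a] by (simp add: fstc_def)

lemma cdiff_sndc: "i < e \<Longrightarrow> cdiff (d + e) (\<lambda>z. sndc d z i) a"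
  using cdiff_coord[of "i + d" "d + e" a] by (simp add: sndc_def)

lemma filterlim_fstc: "a \<in> cspace (d + e) \<Longrightarrow> filterlim (fstc d) (cnhds d (fstc d a)) (cnhds (d + e) a)"
  by (rule filterlim_cnhds_cdiff) (auto intro: cdiff_fstc)

lemma filterlim_sndc: "a \<in> cspace (d + e) \<Longrightarrow> filterlim (sndc d) (cnhds e (sndc d a)) (cnhds (d + e) a)"
  by (rule filterlim_cnhds_cdiff)
    (use eventually_cspace_cnhds[of "d + e" a] in \<open>auto intro: cdiff_sndc elim!: eventually_mono sndc_cspace\<close>)

lemma cdiff_compose_fstc:
  "cdiff d f (fstc d a) \<Longrightarrow> a \<in> cspace (d + e) \<Longrightarrow> cdiff (d + e) (\<lambda>z. f (fstc d z)) a"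
  by (rule cdiff_compose[where e = d and u = "fstc d" and f = f]) (auto intro: cdiff_fstc)

lemma cdiff_compose_sndc:
  "cdiff e f (sndc d a) \<Longrightarrow> a \<in> cspace (d + e) \<Longrightarrow> cdiff (d + e) (\<lambda>z. f (sndc d z)) a"
  by (rule cdiff_compose[where e = e and u = "sndc d" and f = f])
    (use eventually_cspace_cnhds[of "d + e" a] in \<open>auto intro: cdiff_sndc elim!: eventually_mono sndc_cspace\<close>)

lemma pts_prod [simp]: "pts (prod_mfd X Y) = pts X \<times> pts Y"
  by (simp add: prod_mfd_def)

lemma charts_prodI:
  "(W, d, \<phi>) \<in> charts X \<Longrightarrow> (W', d', \<phi>') \<in> charts Y \<Longrightarrow>
    (W \<times> W', d + d', \<lambda>(x, y). cat d (\<phi> x) (\<phi>' y)) \<in> charts (prod_mfd X Y)"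
  unfolding prod_mfd_def by simp blast

lemma charts_prodE:
  assumes "(S, k, \<Psi>) \<in> charts (prod_mfd X Y)"
  obtains W d \<phi> W' d' \<phi>' where "(W, d, \<phi>) \<in> charts X" "(W', d', \<phi>') \<in> charts Y"
    "S = W \<times> W'" "k = d + d'" "\<Psi> = (\<lambda>(x, y). cat d (\<phi> x) (\<phi>' y))"
  using assms unfolding prod_mfd_def by auto

context
  fixes X :: "'a cmfd" and Y :: "'b cmfd"
  assumes X: "holo_atlas X" and Y: "holo_atlas Y"
begin

lemma holo_atlas_prod: "holo_atlas (prod_mfd X Y)"
proof (rule holo_atlasI)
  show "(\<Union>(S, k, \<Psi>)\<in>charts (prod_mfd X Y). S) = pts (prod_mfd X Y)"
  proof (intro subset_antisym subsetI)
    fix p assume "p \<in> (\<Union>(S, k, \<Psi>)\<in>charts (prod_mfd X Y). S)"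
    then obtain S k \<Psi> where "(S, k, \<Psi>) \<in> charts (prod_mfd X Y)" "p \<in> S" by auto
    then show "p \<in> pts (prod_mfd X Y)"
      by (elim charts_prodE) (use chart_pts[OF X] chart_pts[OF Y] in auto)
  next
    fix p assume p: "p \<in> pts (prod_mfd X Y)"
    obtain W d \<phi> where C: "(W, d, \<phi>) \<in> charts X" "fst p \<in> W"
      by (rule chart_exists[OF X, of "fst p"]) (use p in auto)
    obtain W' d' \<phi>' where C': "(W', d', \<phi>') \<in> charts Y" "snd p \<in> W'"
      by (rule chart_exists[OF Y, of "snd p"]) (use p in auto)
    have "p \<in> W \<times> W'" using C C' by (simp add: mem_Times_iff)
    with charts_prodI[OF C(1) C'(1)] show "p \<in> (\<Union>(S, k, \<Psi>)\<in>charts (prod_mfd X Y). S)" by blast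
  qed
next
  fix S k \<Psi> assume "(S, k, \<Psi>) \<in> charts (prod_mfd X Y)"
  then obtain W d \<phi> W' d' \<phi>' where C: "(W, d, \<phi>) \<in> charts X" "(W', d', \<phi>') \<in> charts Y"
    and S: "S = W \<times> W'" "k = d + d'" "\<Psi> = (\<lambda>(x, y). cat d (\<phi> x) (\<phi>' y))"
    by (rule charts_prodE)
  have fs: "fstc d (\<Psi> p) = \<phi> (fst p)" "sndc d (\<Psi> p) = \<phi>' (snd p)" if "p \<in> S" for p
    using that by (auto simp: S fstc_cat chart_cspace[OF X C(1)])
  have inv: "fst p = inv_into W \<phi> (fstc d (\<Psi> p))" "snd p = inv_into W' \<phi>' (sndc d (\<Psi> p))" if "p \<in> S" for p
    using that fs[OF that] by (auto simp: S chart_inv[OF X C(1)] chart_inv[OF Y C(2)])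
  show inj: "inj_on \<Psi> S"
    by (rule inj_onI) (metis inv prod_eqI)
  show cs: "\<Psi> p \<in> cspace k" if "p \<in> S" for p
    using that by (auto simp: S cat_cspace chart_cspace[OF X C(1)] chart_cspace[OF Y C(2)])
  fix S2 k2 \<Psi>2 p assume "(S2, k2, \<Psi>2) \<in> charts (prod_mfd X Y)" and p: "p \<in> S" "p \<in> S2"
  then obtain W2 d2 \<phi>2 W2' d2' \<phi>2' where C2: "(W2, d2, \<phi>2) \<in> charts X" "(W2', d2', \<phi>2') \<in> charts Y"
    and S2: "S2 = W2 \<times> W2'" "k2 = d2 + d2'" "\<Psi>2 = (\<lambda>(x, y). cat d2 (\<phi>2 x) (\<phi>2' y))"
    by (elim charts_prodE)
  have kp: "\<Psi> p \<in> cspace (d + d')" using cs[OF p(1)] S(2) by simp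
  have p1: "fst p \<in> W" "fst p \<in> W2" and p2: "snd p \<in> W'" "snd p \<in> W2'" using p S S2 by auto
  have "eventually (\<lambda>z. z \<in> \<phi> ` (W \<inter> W2)) (cnhds d (fstc d (\<Psi> p)))"
    unfolding fs(1)[OF p(1)]
    by (rule copen_eventually[OF chart_overlap_copen[OF X C(1) C2(1)]]) (use p1 in blast)
  then have e1: "eventually (\<lambda>z. fstc d z \<in> \<phi> ` (W \<inter> W2)) (cnhds k (\<Psi> p))"
    unfolding S(2) by (rule eventually_compose_filterlim[OF _ filterlim_fstc[OF kp]])
  have "eventually (\<lambda>z. z \<in> \<phi>' ` (W' \<inter> W2')) (cnhds d' (sndc d (\<Psi> p)))"
    unfolding fs(2)[OF p(1)]
    by (rule copen_eventually[OF chart_overlap_copen[OF Y C(2) C2(2)]]) (use p2 in blast)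
  then have e2: "eventually (\<lambda>z. sndc d z \<in> \<phi>' ` (W' \<inter> W2')) (cnhds k (\<Psi> p))"
    unfolding S(2) by (rule eventually_compose_filterlim[OF _ filterlim_sndc[OF kp]])
  from e1 e2 show ev: "eventually (\<lambda>z. z \<in> \<Psi> ` (S \<inter> S2)) (cnhds k (\<Psi> p))"
  proof eventually_elim
    case (elim z)
    then obtain x y where "x \<in> W \<inter> W2" "y \<in> W' \<inter> W2'" "fstc d z = \<phi> x" "sndc d z = \<phi>' y" by auto
    then have "(x, y) \<in> S \<inter> S2" "\<Psi> (x, y) = z"
      using cat_fstc_sndc[of d z] by (auto simp: S S2)
    then show ?case by blast
  qed
  fix i assume i: "i < k2"
  \<comment> \<open>The inverse of a product chart splits into the two inverses only on its image,
    which is why this is used under the eventuality \<open>ev\<close>.\<close>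
  have invS: "inv_into S \<Psi> z = (inv_into W \<phi> (fstc d z), inv_into W' \<phi>' (sndc d z))"
    if "z \<in> \<Psi> ` (S \<inter> S2)" for z
  proof -
    obtain q where q: "q \<in> S" "z = \<Psi> q" using \<open>z \<in> \<Psi> ` (S \<inter> S2)\<close> by blast
    then have "inv_into S \<Psi> z = q" using inj by simp
    then show ?thesis using inv[OF q(1)] q(2) by (simp add: prod_eq_iff)
  qed
  show "cdiff k (\<lambda>z. \<Psi>2 (inv_into S \<Psi> z) i) (\<Psi> p)"
  proof (cases "i < d2")
    case True
    have "cdiff d (\<lambda>z. \<phi>2 (inv_into W \<phi> z) i) (fstc d (\<Psi> p))"
      unfolding fs(1)[OF p(1)] by (rule chart_transition_cdiff[OF X C(1) C2(1) p1 True])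
    then have c: "cdiff k (\<lambda>z. \<phi>2 (inv_into W \<phi> (fstc d z)) i) (\<Psi> p)"
      unfolding S(2) by (rule cdiff_compose_fstc[OF _ kp])
    show ?thesis
      by (rule cdiff_cong[OF cs[OF p(1)] _ c], use ev in eventually_elim)
        (simp add: invS S2 cat_def True)
  next
    case False
    then have i': "i - d2 < d2'" using i S2 by simp
    have "cdiff d' (\<lambda>z. \<phi>2' (inv_into W' \<phi>' z) (i - d2)) (sndc d (\<Psi> p))"
      unfolding fs(2)[OF p(1)] by (rule chart_transition_cdiff[OF Y C(2) C2(2) p2 i'])
    then have c: "cdiff k (\<lambda>z. \<phi>2' (inv_into W' \<phi>' (sndc d z)) (i - d2)) (\<Psi> p)"
      unfolding S(2) by (rule cdiff_compose_sndc[OF _ kp])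
    show ?thesis
      by (rule cdiff_cong[OF cs[OF p(1)] _ c], use ev in eventually_elim)
        (simp add: invS S2 cat_def False)
  qed
qed

lemma holo_map_fst: "holo_map (prod_mfd X Y) X fst"
  unfolding holo_map_iff[OF holo_atlas_prod X]
proof
  fix p assume p: "p \<in> pts (prod_mfd X Y)"
  obtain W d \<phi> where C: "(W, d, \<phi>) \<in> charts X" "fst p \<in> W"
    by (rule chart_exists[OF X, of "fst p"]) (use p in auto)
  obtain W' d' \<phi>' where C': "(W', d', \<phi>') \<in> charts Y" "snd p \<in> W'"
    by (rule chart_exists[OF Y, of "snd p"]) (use p in auto)
  note CP = charts_prodI[OF C(1) C'(1)]
  have pW: "p \<in> W \<times> W'" using C C' by (simp add: mem_Times_iff)
  have ev: "eventually (\<lambda>q. q \<in> W \<times> W') (mnhds (prod_mfd X Y) p)"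
    by (rule eventually_mnhds_open[OF openin_chart[OF holo_atlas_prod CP] pW])
  show "holo_at (prod_mfd X Y) X fst p"
  proof (rule holo_atI[OF C(1)])
    show "fst p \<in> W" by (rule C(2))
    show "\<forall>\<^sub>F q in mnhds (prod_mfd X Y) p. fst q \<in> W" using ev by eventually_elim auto
    fix i assume i: "i < d"
    have "mdiff (prod_mfd X Y) p (\<lambda>q. (case q of (x, y) \<Rightarrow> cat d (\<phi> x) (\<phi>' y)) i)"
      by (rule mdiff_chart_coord[OF holo_atlas_prod CP pW]) (use i in simp)
    then show "mdiff (prod_mfd X Y) p (\<lambda>q. \<phi> (fst q) i)"
      by (simp add: case_prod_unfold cat_def i)
  qed
qed

lemma holo_map_snd: "holo_map (prod_mfd X Y) Y snd"
  unfolding holo_map_iff[OF holo_atlas_prod Y]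
proof
  fix p assume p: "p \<in> pts (prod_mfd X Y)"
  obtain W d \<phi> where C: "(W, d, \<phi>) \<in> charts X" "fst p \<in> W"
    by (rule chart_exists[OF X, of "fst p"]) (use p in auto)
  obtain W' d' \<phi>' where C': "(W', d', \<phi>') \<in> charts Y" "snd p \<in> W'"
    by (rule chart_exists[OF Y, of "snd p"]) (use p in auto)
  note CP = charts_prodI[OF C(1) C'(1)]
  have pW: "p \<in> W \<times> W'" using C C' by (simp add: mem_Times_iff)
  have ev: "eventually (\<lambda>q. q \<in> W \<times> W') (mnhds (prod_mfd X Y) p)"
    by (rule eventually_mnhds_open[OF openin_chart[OF holo_atlas_prod CP] pW])
  show "holo_at (prod_mfd X Y) Y snd p"
  proof (rule holo_atI[OF C'(1)])
    show "snd p \<in> W'" by (rule C'(2))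
    show "\<forall>\<^sub>F q in mnhds (prod_mfd X Y) p. snd q \<in> W'" using ev by eventually_elim auto
    fix i assume i: "i < d'"
    have "mdiff (prod_mfd X Y) p (\<lambda>q. (case q of (x, y) \<Rightarrow> cat d (\<phi> x) (\<phi>' y)) (d + i))"
      by (rule mdiff_chart_coord[OF holo_atlas_prod CP pW]) (use i in simp)
    then show "mdiff (prod_mfd X Y) p (\<lambda>q. \<phi>' (snd q) i)"
      by (simp add: case_prod_unfold cat_def)
  qed
qed

lemma holo_map_Pair:
  assumes Z: "holo_atlas Z" and f: "holo_map Z X f" and g: "holo_map Z Y g"
  shows "holo_map Z (prod_mfd X Y) (\<lambda>z. (f z, g z))"
  unfolding holo_map_iff[OF Z holo_atlas_prod]
proof
  fix z assume z: "z \<in> pts Z"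
  obtain W d \<phi> where C: "(W, d, \<phi>) \<in> charts X" "f z \<in> W" "eventually (\<lambda>y. f y \<in> W) (mnhds Z z)"
    "\<And>i. i < d \<Longrightarrow> mdiff Z z (\<lambda>y. \<phi> (f y) i)"
    using holo_map_at[OF Z X f z] by (auto simp: holo_at_def)
  obtain W' d' \<phi>' where C': "(W', d', \<phi>') \<in> charts Y" "g z \<in> W'" "eventually (\<lambda>y. g y \<in> W') (mnhds Z z)"
    "\<And>i. i < d' \<Longrightarrow> mdiff Z z (\<lambda>y. \<phi>' (g y) i)"
    using holo_map_at[OF Z Y g z] by (auto simp: holo_at_def)
  show "holo_at Z (prod_mfd X Y) (\<lambda>z. (f z, g z)) z"
  proof (rule holo_atI[OF charts_prodI[OF C(1) C'(1)]])
    show "\<forall>\<^sub>F y in mnhds Z z. (f y, g y) \<in> W \<times> W'" using C(3) C'(3) by eventually_elim simp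
    show "mdiff Z z (\<lambda>y. (case (f y, g y) of (x, y) \<Rightarrow> cat d (\<phi> x) (\<phi>' y)) i)" if "i < d + d'" for i
      using that C(4)[of i] C'(4)[of "i - d"] by (cases "i < d") (auto simp: cat_def)
  qed (use C C' in simp)
qed

end

text \<open>Lets the power manifolds, whose points are lists, inherit their structure from products:
  a bijection that matches the charts carries the atlas over, because in coordinates it is the
  identity.\<close>

lemma holo_atlas_transport:
  assumes X: "holo_atlas X" and b: "bij_betw b (pts X) (pts Z)"
    and 1: "\<And>S d \<Psi>. (S, d, \<Psi>) \<in> charts Z \<Longrightarrow>
      \<exists>W \<phi>. (W, d, \<phi>) \<in> charts X \<and> S = b ` W \<and> (\<forall>x\<in>W. \<Psi> (b x) = \<phi> x)"
    and 2: "\<And>W d \<phi>. (W, d, \<phi>) \<in> charts X \<Longrightarrow>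
      \<exists>S \<Psi>. (S, d, \<Psi>) \<in> charts Z \<and> S = b ` W \<and> (\<forall>x\<in>W. \<Psi> (b x) = \<phi> x)"
  shows "holo_atlas Z" "holo_map X Z b" "holo_map Z X (inv_into (pts X) b)"
proof -
  have inv: "inv_into (pts X) b (b x) = x" if "x \<in> pts X" for x
    using b that by (auto simp: bij_betw_def)
  have eqZ: "inv_into S \<Psi> z = b (inv_into W \<phi> z)"
    if "(W, d, \<phi>) \<in> charts X" "S = b ` W" "\<forall>x\<in>W. \<Psi> (b x) = \<phi> x" "inj_on \<Psi> S" "z \<in> \<phi> ` W"
    for S \<Psi> W d \<phi> z
  proof -
    from that(5) obtain x where x: "x \<in> W" "z = \<phi> x" by blast
    have "inv_into S \<Psi> (\<Psi> (b x)) = b x" using that x by (intro inv_into_f_f) auto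
    then show ?thesis using x that chart_inv[OF X that(1) x(1)] by simp
  qed
  have inj: "inj_on \<Psi> S" if "(S, d, \<Psi>) \<in> charts Z" for S d \<Psi>
  proof -
    from 1[OF that] obtain W \<phi> where C: "(W, d, \<phi>) \<in> charts X" "S = b ` W" "\<forall>x\<in>W. \<Psi> (b x) = \<phi> x" by blast
    then show ?thesis using chart_inj[OF X C(1)] by (auto simp: inj_on_def)
  qed
  have overlap: "b ` W \<inter> b ` W' = b ` (W \<inter> W')"
    if "(W, d, \<phi>) \<in> charts X" "(W', d', \<phi>') \<in> charts X" for W d \<phi> W' d' \<phi>'
    using b chart_pts[OF X that(1)] chart_pts[OF X that(2)]
    by (intro inj_on_image_Int[of b "pts X", symmetric]) (auto simp: bij_betw_def)
  show Z: "holo_atlas Z"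
  proof (rule holo_atlasI)
    show "(\<Union>(S, k, \<Psi>)\<in>charts Z. S) = pts Z"
    proof (intro subset_antisym subsetI)
      fix p assume "p \<in> (\<Union>(S, k, \<Psi>)\<in>charts Z. S)"
      then obtain S k \<Psi> where S: "(S, k, \<Psi>) \<in> charts Z" "p \<in> S" by auto
      from 1[OF S(1)] obtain W \<phi> where W: "(W, k, \<phi>) \<in> charts X" "S = b ` W" by blast
      from S(2) obtain x where "x \<in> W" "p = b x" unfolding W(2) by (rule imageE)
      with chart_pts[OF X W(1)] show "p \<in> pts Z" using bij_betw_apply[OF b] by simp
    next
      fix p assume "p \<in> pts Z"
      then obtain x where x: "x \<in> pts X" "p = b x"
        unfolding bij_betw_imp_surj_on[OF b, symmetric] by (rule imageE)
      obtain W d \<phi> where W: "(W, d, \<phi>) \<in> charts X" "x \<in> W" by (rule chart_exists[OF X x(1)])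
      from 2[OF W(1)] obtain S \<Psi> where S: "(S, d, \<Psi>) \<in> charts Z" "S = b ` W" by blast
      show "p \<in> (\<Union>(S, k, \<Psi>)\<in>charts Z. S)" by (rule UN_I[OF S(1)]) (simp add: S(2) x W)
    qed
  next
    fix S d \<Psi> assume CZ: "(S, d, \<Psi>) \<in> charts Z"
    from 1[OF CZ] obtain W \<phi> where C: "(W, d, \<phi>) \<in> charts X" "S = b ` W" "\<forall>x\<in>W. \<Psi> (b x) = \<phi> x"
      by blast
    show "inj_on \<Psi> S" by (rule inj[OF CZ])
    show "\<Psi> p \<in> cspace d" if "p \<in> S" for p using that C chart_cspace[OF X C(1)] by auto
    fix S' d' \<Psi>' p assume CZ': "(S', d', \<Psi>') \<in> charts Z" and p: "p \<in> S" "p \<in> S'"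
    from 1[OF CZ'] obtain W' \<phi>' where C': "(W', d', \<phi>') \<in> charts X" "S' = b ` W'"
      "\<forall>x\<in>W'. \<Psi>' (b x) = \<phi>' x" by blast
    have SS: "S \<inter> S' = b ` (W \<inter> W')" unfolding C(2) C'(2) by (rule overlap[OF C(1) C'(1)])
    with p obtain x where x: "x \<in> W" "x \<in> W'" "p = b x" by blast
    have "\<Psi> ` (S \<inter> S') = \<phi> ` (W \<inter> W')" unfolding SS image_image using C(3) by simp
    moreover have px: "\<Psi> p = \<phi> x" using C(3) x by simp
    ultimately show ev: "eventually (\<lambda>z. z \<in> \<Psi> ` (S \<inter> S')) (cnhds d (\<Psi> p))"
      using copen_eventually[OF chart_overlap_copen[OF X C(1) C'(1)], of "\<phi> x"] x by auto
    fix i assume "i < d'"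
    have ev': "eventually (\<lambda>z. z \<in> \<phi> ` (W \<inter> W')) (cnhds d (\<phi> x))"
      by (rule copen_eventually[OF chart_overlap_copen[OF X C(1) C'(1)]]) (use x in blast)
    show "cdiff d (\<lambda>z. \<Psi>' (inv_into S \<Psi> z) i) (\<Psi> p)"
      unfolding px
    proof (rule cdiff_cong[OF _ _ chart_transition_cdiff[OF X C(1) C'(1) x(1,2) \<open>i < d'\<close>]])
      show "eventually (\<lambda>z. \<phi>' (inv_into W \<phi> z) i = \<Psi>' (inv_into S \<Psi> z) i) (cnhds d (\<phi> x))"
        using ev'
      proof eventually_elim
        case (elim z)
        then obtain y where y: "y \<in> W" "y \<in> W'" "z = \<phi> y" by blast
        have "inv_into S \<Psi> z = b (inv_into W \<phi> z)" by (rule eqZ[OF C inj[OF CZ]]) (use y in blast)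
        then show ?case using y C' chart_inv[OF X C(1) y(1)] by simp
      qed
    qed (rule chart_cspace[OF X C(1) x(1)])
  qed
  show "holo_map X Z b"
    unfolding holo_map_iff[OF X Z]
  proof
    fix x assume "x \<in> pts X"
    then obtain W d \<phi> where C: "(W, d, \<phi>) \<in> charts X" "x \<in> W" by (rule chart_exists[OF X])
    from 2[OF C(1)] obtain S \<Psi> where S: "(S, d, \<Psi>) \<in> charts Z" "S = b ` W" "\<forall>x\<in>W. \<Psi> (b x) = \<phi> x"
      by blast
    have ev: "eventually (\<lambda>y. y \<in> W) (mnhds X x)"
      by (rule eventually_mnhds_open[OF openin_chart[OF X C(1)] C(2)])
    show "holo_at X Z b x"
    proof (rule holo_atI[OF S(1)])
      show "\<forall>\<^sub>F y in mnhds X x. b y \<in> S" using ev by eventually_elim (simp add: S)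
      show "mdiff X x (\<lambda>y. \<Psi> (b y) i)" if "i < d" for i
        by (rule mdiff_cong[OF X _ mdiff_chart_coord[OF X C that]], use ev in eventually_elim) (simp add: S)
    qed (use C S in simp)
  qed
  show "holo_map Z X (inv_into (pts X) b)"
    unfolding holo_map_iff[OF Z X]
  proof
    fix p assume "p \<in> pts Z"
    then obtain S d \<Psi> where S: "(S, d, \<Psi>) \<in> charts Z" "p \<in> S" by (rule chart_exists[OF Z])
    from 1[OF S(1)] obtain W \<phi> where C: "(W, d, \<phi>) \<in> charts X" "S = b ` W" "\<forall>x\<in>W. \<Psi> (b x) = \<phi> x"
      by blast
    have ev: "eventually (\<lambda>y. y \<in> S) (mnhds Z p)"
      by (rule eventually_mnhds_open[OF openin_chart[OF Z S(1)] S(2)])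
    have invS: "inv_into (pts X) b y \<in> W \<and> \<phi> (inv_into (pts X) b y) = \<Psi> y" if "y \<in> S" for y
      using that C inv chart_pts[OF X C(1)] by auto
    show "holo_at Z X (inv_into (pts X) b) p"
    proof (rule holo_atI[OF C(1)])
      show "\<forall>\<^sub>F y in mnhds Z p. inv_into (pts X) b y \<in> W" using ev by eventually_elim (simp add: invS)
      show "mdiff Z p (\<lambda>y. \<phi> (inv_into (pts X) b y) i)" if "i < d" for i
        by (rule mdiff_cong[OF Z _ mdiff_chart_coord[OF Z S that]], use ev in eventually_elim) (simp add: invS)
    qed (use invS S in blast)
  qed
qed

lemma pts_power: "pts (power_mfd X l) = {xs. length xs = l \<and> set xs \<subseteq> pts X}"
proof (induction l)
  case (Suc l)
  show ?case by (auto simp: Suc length_Suc_conv)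
qed auto

lemma holo_atlas_power_0: "holo_atlas (power_mfd X 0)"
  by (rule holo_atlasI) (auto simp: cspace_def intro!: eventually_mono[OF eventually_cspace_cnhds[of 0]])

lemma holo_map_power_0: "holo_atlas X \<Longrightarrow> holo_map X (power_mfd Y 0) (\<lambda>_. [])"
  by (rule holo_map_const[OF _ holo_atlas_power_0]) auto

lemma charts_power_SucI:
  "(W, d, \<phi>) \<in> charts X \<Longrightarrow> (W', d', \<phi>') \<in> charts (power_mfd X l) \<Longrightarrow>
    ({x # xs |x xs. x \<in> W \<and> xs \<in> W'}, d + d', \<lambda>ys. cat d (\<phi> (hd ys)) (\<phi>' (tl ys)))
      \<in> charts (power_mfd X (Suc l))"
  unfolding power_mfd.simps cmfd.simps by blast

text \<open>Consing matches the charts of the product of \<open>X\<close> and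
  \<open>power_mfd X l\<close> with those of \<open>power_mfd X (Suc l)\<close>, so
  \<open>holo_atlas_transport\<close> applies; the inverse is \<open>hd\<close> and
  \<open>tl\<close> on the nonempty lists.\<close>

lemma power_mfd_Suc_aux:
  assumes X: "holo_atlas X" and P: "holo_atlas (power_mfd X l)"
  shows "holo_atlas (power_mfd X (Suc l))"
    and "holo_map (prod_mfd X (power_mfd X l)) (power_mfd X (Suc l)) (\<lambda>(x, xs). x # xs)"
    and "holo_map (power_mfd X (Suc l)) (prod_mfd X (power_mfd X l)) (\<lambda>ys. (hd ys, tl ys))"
proof -
  let ?X = "prod_mfd X (power_mfd X l)" and ?Z = "power_mfd X (Suc l)" and ?b = "\<lambda>(x, xs). x # xs"
  have b: "bij_betw ?b (pts ?X) (pts ?Z)"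
    by (auto simp: bij_betw_def inj_on_def image_iff)
  have cons: "{x # xs |x xs. x \<in> W \<and> xs \<in> W'} = ?b ` (W \<times> W')" for W :: "'a set" and W'
    by auto
  note t = holo_atlas_transport[OF holo_atlas_prod[OF X P] b]
  have 1: "\<exists>W \<phi>. (W, k, \<phi>) \<in> charts ?X \<and> S = ?b ` W \<and> (\<forall>x\<in>W. \<Psi> (?b x) = \<phi> x)"
    if "(S, k, \<Psi>) \<in> charts ?Z" for S k \<Psi>
  proof -
    from that obtain W d \<phi> W' d' \<phi>' where C: "(W, d, \<phi>) \<in> charts X" "(W', d', \<phi>') \<in> charts (power_mfd X l)"
      and S: "S = ?b ` (W \<times> W')" "k = d + d'" "\<Psi> = (\<lambda>ys. cat d (\<phi> (hd ys)) (\<phi>' (tl ys)))"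
      by (auto simp: cons)
    show ?thesis
      by (rule exI[of _ "W \<times> W'"], rule exI[of _ "\<lambda>(x, y). cat d (\<phi> x) (\<phi>' y)"])
        (use charts_prodI[OF C] S in auto)
  qed
  have 2: "\<exists>S \<Psi>. (S, k, \<Psi>) \<in> charts ?Z \<and> S = ?b ` W \<and> (\<forall>x\<in>W. \<Psi> (?b x) = \<phi> x)"
    if "(W, k, \<phi>) \<in> charts ?X" for W k \<phi>
    using that
  proof (rule charts_prodE)
    fix W1 d \<phi>1 W' d' \<phi>'
    assume C: "(W1, d, \<phi>1) \<in> charts X" "(W', d', \<phi>') \<in> charts (power_mfd X l)"
      and S: "W = W1 \<times> W'" "k = d + d'" "\<phi> = (\<lambda>(x, y). cat d (\<phi>1 x) (\<phi>' y))"
    have "(?b ` W, k, \<lambda>ys. cat d (\<phi>1 (hd ys)) (\<phi>' (tl ys))) \<in> charts ?Z"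
      unfolding S cons[symmetric] by (rule charts_power_SucI[OF C])
    then show ?thesis using S by (intro exI[of _ "?b ` W"] exI[of _ "\<lambda>ys. cat d (\<phi>1 (hd ys)) (\<phi>' (tl ys))"]) auto
  qed
  show Z: "holo_atlas ?Z" and "holo_map ?X ?Z ?b" by (rule t; (rule 1 2, assumption))+
  have inv: "holo_map ?Z ?X (inv_into (pts ?X) ?b)" by (rule t; (rule 1 2, assumption))
  show "holo_map ?Z ?X (\<lambda>ys. (hd ys, tl ys))"
  proof (rule holo_map_cong[OF Z holo_atlas_prod[OF X P] _ inv])
    fix ys assume "ys \<in> pts ?Z"
    then obtain x xs where ys: "ys = ?b (x, xs)" "(x, xs) \<in> pts ?X" by auto
    have "inv_into (pts ?X) ?b (?b (x, xs)) = (x, xs)"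
      by (rule inv_into_f_f[OF bij_betw_imp_inj_on[OF b] ys(2)])
    with ys(1) show "inv_into (pts ?X) ?b ys = (hd ys, tl ys)" by simp
  qed
qed

lemma holo_atlas_power: "holo_atlas X \<Longrightarrow> holo_atlas (power_mfd X l)"
  by (induction l) (simp_all only: holo_atlas_power_0 power_mfd_Suc_aux)

lemma holo_map_Cons:
  assumes "holo_atlas X" "holo_atlas Z" "holo_map Z X f" "holo_map Z (power_mfd X l) g"
  shows "holo_map Z (power_mfd X (Suc l)) (\<lambda>z. f z # g z)"
  using holo_map_compose[OF assms(2) holo_atlas_prod holo_atlas_power
      holo_map_Pair[OF assms(1) holo_atlas_power assms(2,3,4)] power_mfd_Suc_aux(2)]
  by (simp add: assms holo_atlas_power del: power_mfd.simps)

lemma holo_map_hd: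
  assumes X: "holo_atlas X"
  shows "holo_map (power_mfd X (Suc l)) X hd"
proof -
  note P = holo_atlas_power[OF X]
  from holo_map_compose[OF P holo_atlas_prod[OF X P] X power_mfd_Suc_aux(3)[OF X P] holo_map_fst[OF X P]]
  show ?thesis by (simp del: power_mfd.simps)
qed

lemma holo_map_tl:
  assumes X: "holo_atlas X"
  shows "holo_map (power_mfd X (Suc l)) (power_mfd X l) tl"
proof -
  note P = holo_atlas_power[OF X]
  from holo_map_compose[OF P holo_atlas_prod[OF X P] P power_mfd_Suc_aux(3)[OF X P] holo_map_snd[OF X P]]
  show ?thesis by (simp del: power_mfd.simps)
qed

text \<open>Peeling off the first entry shifts the range, so the induction on \<open>k\<close> needs
  the lower bound \<open>m\<close> arbitrary.\<close>

lemma holo_map_map_upt: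
  assumes X: "holo_atlas X" "holo_atlas Z" and f: "\<And>i. i < m + k \<Longrightarrow> holo_map Z X (\<lambda>z. f i z)"
  shows "holo_map Z (power_mfd X k) (\<lambda>z. map (\<lambda>i. f i z) [m..<m + k])"
  using f
proof (induction k arbitrary: m)
  case 0
  then show ?case using holo_map_power_0[OF X(2)] by simp
next
  case (Suc k)
  have "holo_map Z (power_mfd X k) (\<lambda>z. map (\<lambda>i. f i z) [Suc m..<Suc m + k])"
    by (rule Suc.IH) (use Suc.prems in simp)
  from holo_map_Cons[OF X Suc.prems[of m] this]
  show ?case by (simp add: upt_conv_Cons del: upt_Suc power_mfd.simps)
qed

section \<open>The simplicial manifold of an action\<close>

locale lie_action =
  fixes M :: "'m cmfd" and G :: "'g monoid" and N :: "'g cmfd" and \<rho> :: "'m \<Rightarrow> 'g \<Rightarrow> 'm"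
  assumes M: "complex_manifold M" and lie: "complex_lie_group G N"
    and act: "holo_right_action M G N \<rho>"
begin

sublocale group G
  using lie by (simp add: complex_lie_group_def)

lemma atlas_M: "holo_atlas M"
  by (rule complex_manifold_holo_atlas[OF M])

lemma atlas_N: "holo_atlas N"
  using lie by (simp add: complex_lie_group_def complex_manifold_holo_atlas)

lemma pts_N: "pts N = carrier G"
  using lie by (simp add: complex_lie_group_def)

lemma act_one: "x \<in> pts M \<Longrightarrow> \<rho> x \<one>\<^bsub>G\<^esub> = x"
  using act by (simp add: holo_right_action_def)

lemma act_mult: "x \<in> pts M \<Longrightarrow> g \<in> carrier G \<Longrightarrow> h \<in> carrier G \<Longrightarrow> \<rho> (\<rho> x g) h = \<rho> x (g \<otimes>\<^bsub>G\<^esub> h)"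
  using act by (simp add: holo_right_action_def)

lemma holo_act: "holo_map (prod_mfd M N) M (\<lambda>(x, g). \<rho> x g)"
  using act by (simp add: holo_right_action_def)

lemma act_closed: "x \<in> pts M \<Longrightarrow> g \<in> carrier G \<Longrightarrow> \<rho> x g \<in> pts M"
  using holo_map_pts[OF holo_act, of "(x, g)"] by (simp add: pts_N)

lemma holo_map_mult:
  assumes "holo_atlas Z" "holo_map Z N f" "holo_map Z N g"
  shows "holo_map Z N (\<lambda>z. f z \<otimes>\<^bsub>G\<^esub> g z)"
proof -
  have m: "holo_map (prod_mfd N N) N (\<lambda>(g, h). g \<otimes>\<^bsub>G\<^esub> h)"
    using lie by (simp add: complex_lie_group_def)
  from holo_map_compose[OF assms(1) holo_atlas_prod[OF atlas_N atlas_N] atlas_N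
      holo_map_Pair[OF atlas_N atlas_N assms] m]
  show ?thesis by simp
qed

lemma holo_map_inv: "holo_atlas Z \<Longrightarrow> holo_map Z N f \<Longrightarrow> holo_map Z N (\<lambda>z. inv\<^bsub>G\<^esub> (f z))"
  by (rule holo_map_compose[OF _ atlas_N atlas_N]) (use lie in \<open>auto simp: complex_lie_group_def\<close>)

lemma holo_map_act:
  assumes "holo_atlas Z" "holo_map Z M f" "holo_map Z N g"
  shows "holo_map Z M (\<lambda>z. \<rho> (f z) (g z))"
  using holo_map_compose[OF assms(1) holo_atlas_prod[OF atlas_M atlas_N] atlas_M
      holo_map_Pair[OF atlas_M atlas_N assms] holo_act]
  by simp

abbreviation lev :: "nat \<Rightarrow> ('m \<times> 'g list) cmfd"
  where "lev \<equiv> quot_level M N"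

lemma atlas_level: "holo_atlas (lev l)"
  unfolding quot_level_def by (intro holo_atlas_prod atlas_M holo_atlas_power atlas_N)

lemma pts_level: "p \<in> pts (lev l) \<longleftrightarrow> fst p \<in> pts M \<and> length (snd p) = l \<and> set (snd p) \<subseteq> carrier G"
  by (auto simp: quot_level_def pts_power pts_N mem_Times_iff)

text \<open>For the list \<open>g1, ..., gl\<close> this is the product of the entries with index
  from \<open>i + 1\<close> to \<open>j\<close>, the group element carried by the edge from vertex
  \<open>i\<close> to vertex \<open>j\<close>; it is the unit for \<open>j \<le> i\<close>.\<close>

definition seg :: "nat \<Rightarrow> nat \<Rightarrow> 'g list \<Rightarrow> 'g"
  where "seg i j gs = list_mult G (take (j - i) (drop i gs))"

lemma list_mult_closed [simp]: "set gs \<subseteq> carrier G \<Longrightarrow> list_mult G gs \<in> carrier G"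
  by (induction gs) (auto simp: list_mult_def)

lemma list_mult_append:
  "set gs \<subseteq> carrier G \<Longrightarrow> set hs \<subseteq> carrier G \<Longrightarrow> list_mult G (gs @ hs) = list_mult G gs \<otimes>\<^bsub>G\<^esub> list_mult G hs"
proof (induction gs)
  case (Cons g gs)
  then show ?case using list_mult_closed[of gs] list_mult_closed[of hs]
    by (simp add: list_mult_def m_assoc)
qed (use list_mult_closed[of hs] in \<open>simp add: list_mult_def\<close>)

lemma set_take_drop: "set gs \<subseteq> carrier G \<Longrightarrow> set (take i (drop j gs)) \<subseteq> carrier G"
  by (meson set_drop_subset set_take_subset subset_trans)

lemma seg_closed [simp]: "set gs \<subseteq> carrier G \<Longrightarrow> seg i j gs \<in> carrier G"
  by (simp add: seg_def set_take_drop)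

lemma seg_self [simp]: "seg i i gs = \<one>\<^bsub>G\<^esub>"
  by (simp add: seg_def list_mult_def)

lemma seg_append:
  assumes "set gs \<subseteq> carrier G" "i \<le> j" "j \<le> k"
  shows "seg i j gs \<otimes>\<^bsub>G\<^esub> seg j k gs = seg i k gs"
proof -
  have "take (k - i) (drop i gs) = take (j - i) (drop i gs) @ take (k - j) (drop j gs)"
    using assms take_add[of "j - i" "k - j" "drop i gs"] by simp
  then show ?thesis by (simp add: seg_def list_mult_append set_take_drop assms)
qed

lemma seg_Suc: "i < length gs \<Longrightarrow> set gs \<subseteq> carrier G \<Longrightarrow> seg i (Suc i) gs = gs ! i"
  by (simp add: seg_def list_mult_def take_Suc hd_drop_conv_nth subset_iff)

text \<open>The structure map \<open>M \<times> G\<^sup>l \<rightarrow> M\<close> of the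
  \<open>j\<close>-th vertex \<open>[0] \<rightarrow> [l]\<close>, with
  \<open>M \<times> G\<^sup>0\<close> already identified with \<open>M\<close>.\<close>

definition vmap :: "nat \<Rightarrow> 'm \<times> 'g list \<Rightarrow> 'm"
  where "vmap j = (\<lambda>(x, gs). \<rho> x (seg 0 j gs))"

lemma quot_map_eq:
  "quot_map G \<rho> k \<theta> (x, gs) = (vmap (\<theta> 0) (x, gs), map (\<lambda>j. seg (\<theta> j) (\<theta> (Suc j)) gs) [0..<k])"
  by (simp add: quot_map_def vmap_def seg_def)

lemma vmap_act:
  assumes "(x, gs) \<in> pts (lev l)" "i \<le> j"
  shows "\<rho> (vmap i (x, gs)) (seg i j gs) = vmap j (x, gs)"
  using assms by (auto simp: vmap_def pts_level act_mult seg_append)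

lemma vmap_closed: "p \<in> pts (lev l) \<Longrightarrow> vmap j p \<in> pts M"
  by (auto simp: vmap_def pts_level act_closed split: prod.split)

lemma vmap_0: "p \<in> pts (lev l) \<Longrightarrow> vmap 0 p = fst p"
  by (auto simp: vmap_def pts_level act_one split: prod.split)

lemma omaps_le: "\<theta> \<in> omaps k m \<Longrightarrow> i \<le> j \<Longrightarrow> j \<le> k \<Longrightarrow> \<theta> i \<le> \<theta> j"
  by (auto simp: omaps_def mono_on_def)

lemma omaps_bound: "\<theta> \<in> omaps k m \<Longrightarrow> i \<le> k \<Longrightarrow> \<theta> i \<le> m"
  by (auto simp: omaps_def)

text \<open>The entries of the image list are the segments between consecutive values of \<theta>,
  so their product telescopes; monotonicity of \<theta> makes neighbouring segments adjoin.\<close>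

lemma seg_quot_map:
  assumes \<theta>: "\<theta> \<in> omaps k m" and gs: "set gs \<subseteq> carrier G" and ij: "i \<le> j" "j \<le> k"
  shows "seg i j (map (\<lambda>j. seg (\<theta> j) (\<theta> (Suc j)) gs) [0..<k]) = seg (\<theta> i) (\<theta> j) gs"
  using ij
proof (induction j rule: dec_induct)
  case (step j)
  let ?hs = "map (\<lambda>j. seg (\<theta> j) (\<theta> (Suc j)) gs) [0..<k]"
  have hs: "set ?hs \<subseteq> carrier G" using gs by auto
  have "seg i (Suc j) ?hs = seg i j ?hs \<otimes>\<^bsub>G\<^esub> seg j (Suc j) ?hs"
    by (rule seg_append[symmetric]) (use hs step in auto)
  also have "seg j (Suc j) ?hs = ?hs ! j" by (rule seg_Suc) (use hs step in auto)
  also have "seg i j ?hs \<otimes>\<^bsub>G\<^esub> ?hs ! j = seg (\<theta> i) (\<theta> j) gs \<otimes>\<^bsub>G\<^esub> seg (\<theta> j) (\<theta> (Suc j)) gs"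
    using step by simp
  also have "\<dots> = seg (\<theta> i) (\<theta> (Suc j)) gs"
    by (rule seg_append[OF gs]) (use omaps_le[OF \<theta>] step in auto)
  finally show ?case .
qed simp

lemma quot_map_pts: "p \<in> pts (lev m) \<Longrightarrow> quot_map G \<rho> k \<theta> p \<in> pts (lev k)"
  by (cases p) (auto simp: quot_map_eq pts_level intro: vmap_closed)

text \<open>Functoriality of the structure maps on vertices. Together with
  \<open>seg_quot_map\<close> it stands in for a general composition law of structure maps.\<close>

lemma vmap_quot_map:
  assumes \<theta>: "\<theta> \<in> omaps k m" and p: "p \<in> pts (lev m)" and j: "j \<le> k"
  shows "vmap j (quot_map G \<rho> k \<theta> p) = vmap (\<theta> j) p"
proof -
  obtain x gs where pe: "p = (x, gs)" by (cases p)
  have gs: "set gs \<subseteq> carrier G" using p by (simp add: pe pts_level)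
  have "vmap j (quot_map G \<rho> k \<theta> p) = \<rho> (vmap (\<theta> 0) (x, gs)) (seg (\<theta> 0) (\<theta> j) gs)"
    using seg_quot_map[OF \<theta> gs, of 0 j] j by (simp add: pe quot_map_eq vmap_def del: upt_Suc)
  also have "\<dots> = vmap (\<theta> j) (x, gs)"
    by (rule vmap_act[of _ _ m]) (use p pe omaps_le[OF \<theta>, of 0 j] j in auto)
  finally show ?thesis by (simp add: pe)
qed

text \<open>Induction on the length of the list: only a segment that starts at 0 and ends later
  involves the head, every other one is a segment of the tail. Truncated subtraction is harmless
  there, since both sides are the unit when \<open>j = 0\<close>.\<close>

lemma holo_map_seg: "holo_map (power_mfd N l) N (seg i j)"
proof (induction l arbitrary: i j)
  case 0
  show ?case
    by (rule holo_map_cong[OF _ _ _ holo_map_const[OF _ _ one_closed[folded pts_N]]])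
      (auto intro: holo_atlas_power_0 atlas_N simp: seg_def list_mult_def simp del: power_mfd.simps simp: pts_power)
next
  case (Suc l)
  note A = holo_atlas_power[OF atlas_N]
  have tl: "holo_map (power_mfd N (Suc l)) N (\<lambda>gs. seg i j (tl gs))" for i j
    by (rule holo_map_compose[OF A A atlas_N holo_map_tl[OF atlas_N] Suc.IH])
  show ?case
  proof (cases "i = 0 \<and> j \<noteq> 0")
    case True
    then obtain j' where j: "i = 0" "j = Suc j'" by (auto simp: gr0_conv_Suc)
    have "seg 0 (Suc j') gs = hd gs \<otimes>\<^bsub>G\<^esub> seg 0 j' (tl gs)" if "gs \<in> pts (power_mfd N (Suc l))" for gs
      using that by (cases gs) (auto simp: seg_def list_mult_def pts_power simp del: power_mfd.simps)
    then show ?thesis unfolding j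
      by (intro holo_map_cong[OF A atlas_N _ holo_map_mult[OF A holo_map_hd[OF atlas_N] tl]]) simp
  next
    case False
    then have "seg i j gs = seg (i - 1) (j - 1) (tl gs)" for gs
      by (cases i; cases gs) (auto simp: seg_def list_mult_def)
    then have "seg i j = (\<lambda>gs. seg (i - 1) (j - 1) (tl gs))" by blast
    then show ?thesis using tl by simp
  qed
qed

lemma holo_level_fst: "holo_map (lev l) M fst"
  unfolding quot_level_def by (rule holo_map_fst[OF atlas_M holo_atlas_power[OF atlas_N]])

lemma holo_level_seg: "holo_map (lev l) N (\<lambda>p. seg i j (snd p))"
  by (rule holo_map_compose[OF atlas_level holo_atlas_power[OF atlas_N] atlas_N _ holo_map_seg])
    (unfold quot_level_def, rule holo_map_snd[OF atlas_M holo_atlas_power[OF atlas_N]])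

lemma holo_vmap: "holo_map (lev l) M (vmap j)"
  using holo_map_act[OF atlas_level holo_level_fst holo_level_seg]
  by (simp add: vmap_def case_prod_unfold)

lemma holo_map_level:
  assumes "holo_atlas Z" "holo_map Z M f" "holo_map Z (power_mfd N l) g"
  shows "holo_map Z (lev l) (\<lambda>z. (f z, g z))"
  unfolding quot_level_def by (rule holo_map_Pair[OF atlas_M holo_atlas_power[OF atlas_N] assms])

lemma holo_quot_map: "holo_map (lev m) (lev k) (quot_map G \<rho> k \<theta>)"
proof -
  have "holo_map (lev m) (power_mfd N k) (\<lambda>p. map (\<lambda>j. seg (\<theta> j) (\<theta> (Suc j)) (snd p)) [0..<0 + k])"
    by (rule holo_map_map_upt[OF atlas_N atlas_level holo_level_seg])
  from holo_map_level[OF atlas_level holo_vmap this, of "\<theta> 0"]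
  moreover have "quot_map G \<rho> k \<theta> = (\<lambda>z. (vmap (\<theta> 0) z, map (\<lambda>j. seg (\<theta> j) (\<theta> (Suc j)) (snd z)) [0..<0 + k]))"
    by (auto simp: fun_eq_iff quot_map_eq simp del: upt_Suc)
  ultimately show ?thesis by simp
qed

lemma base_incl_pts: "x \<in> pts M \<Longrightarrow> base_incl x \<in> pts (lev 0)"
  by (simp add: base_incl_def pts_level)

lemma holo_base_incl: "holo_map M (lev 0) base_incl"
  unfolding base_incl_def[abs_def]
  by (rule holo_map_level[OF atlas_M holo_map_id[OF atlas_M] holo_map_power_0[OF atlas_M]])

end

section \<open>Local trivialisations\<close>

definition cunit :: "nat \<Rightarrow> nat \<Rightarrow> complex"
  where "cunit b = (\<lambda>i. if i = b then 1 else 0)"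

lemma cunit_cspace: "b < r \<Longrightarrow> cunit b \<in> cspace r"
  by (auto simp: cunit_def cspace_def)

definition fibre_iso :: "(complex, 'e) module \<Rightarrow> nat \<Rightarrow> ('e \<Rightarrow> nat \<Rightarrow> complex) \<Rightarrow> bool"
  where "fibre_iso A r \<psi> \<longleftrightarrow> bij_betw \<psi> (carrier A) (cspace r) \<and>
    (\<forall>a\<in>carrier A. \<forall>b\<in>carrier A. \<psi> (a \<oplus>\<^bsub>A\<^esub> b) = (\<lambda>i. \<psi> a i + \<psi> b i)) \<and>
    (\<forall>c. \<forall>a\<in>carrier A. \<psi> (c \<odot>\<^bsub>A\<^esub> a) = (\<lambda>i. c * \<psi> a i))"

lemma local_triv_iff:
  "local_triv U F (V, r, \<psi>) \<longleftrightarrow> openin (mtop U) V \<and> (\<forall>x\<in>V. fibre_iso (F x) r (\<psi> x))"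
  by (simp add: local_triv_def fibre_iso_def)

context
  fixes A :: "(complex, 'e) module"
  assumes A: "module complex_ring A"
begin

lemma module_add_closed: "a \<in> carrier A \<Longrightarrow> b \<in> carrier A \<Longrightarrow> a \<oplus>\<^bsub>A\<^esub> b \<in> carrier A"
  using A by (simp add: module_def abelian_group_def abelian_monoid.a_closed)

lemma module_smult_closed: "a \<in> carrier A \<Longrightarrow> c \<odot>\<^bsub>A\<^esub> a \<in> carrier A"
  using module.smult_closed[OF A, of c a] by (simp add: complex_ring_def)

context
  fixes r \<psi>
  assumes \<psi>: "fibre_iso A r \<psi>"
begin

lemma fibre_iso_add: "a \<in> carrier A \<Longrightarrow> b \<in> carrier A \<Longrightarrow> \<psi> (a \<oplus>\<^bsub>A\<^esub> b) = (\<lambda>i. \<psi> a i + \<psi> b i)"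
  and fibre_iso_smult: "a \<in> carrier A \<Longrightarrow> \<psi> (c \<odot>\<^bsub>A\<^esub> a) = (\<lambda>i. c * \<psi> a i)"
  and fibre_iso_cspace: "a \<in> carrier A \<Longrightarrow> \<psi> a \<in> cspace r"
  and fibre_iso_eqI: "a \<in> carrier A \<Longrightarrow> b \<in> carrier A \<Longrightarrow> \<psi> a = \<psi> b \<Longrightarrow> a = b"
  using \<psi> by (auto simp: fibre_iso_def bij_betw_def inj_on_def)

lemma fibre_iso_eqI': 
  assumes "a \<in> carrier A" "b \<in> carrier A" "\<And>i. i < r \<Longrightarrow> \<psi> a i = \<psi> b i"
  shows "a = b"
proof (rule fibre_iso_eqI[OF assms(1,2)], rule ext)
  fix i show "\<psi> a i = \<psi> b i"
    using fibre_iso_cspace[OF assms(1)] fibre_iso_cspace[OF assms(2)] assms(3)[of i]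
    by (cases "i < r") (auto simp: cspace_def)
qed

lemma fibre_iso_inv:
  assumes "z \<in> cspace r"
  shows "inv_into (carrier A) \<psi> z \<in> carrier A" "\<psi> (inv_into (carrier A) \<psi> z) = z"
  using assms \<psi> inv_into_into[of z \<psi> "carrier A"] f_inv_into_f[of z \<psi> "carrier A"]
  by (auto simp: fibre_iso_def bij_betw_def)

lemma fibre_iso_inv_left: "a \<in> carrier A \<Longrightarrow> inv_into (carrier A) \<psi> (\<psi> a) = a"
  using \<psi> by (simp add: fibre_iso_def bij_betw_def)

text \<open>Sums in the abstract module are avoided by adding one coordinate at a time:
  \<open>p k\<close> keeps the first \<open>k\<close> coordinates of \<open>e\<close>, and
  \<open>p (Suc k)\<close> differs from it by a multiple of the preimage of
  \<open>cunit k\<close>.\<close>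

lemma fibre_iso_expand:
  fixes L :: "'e \<Rightarrow> complex"
  assumes add: "\<And>a b. a \<in> carrier A \<Longrightarrow> b \<in> carrier A \<Longrightarrow> L (a \<oplus>\<^bsub>A\<^esub> b) = L a + L b"
    and smult: "\<And>c a. a \<in> carrier A \<Longrightarrow> L (c \<odot>\<^bsub>A\<^esub> a) = c * L a"
    and e: "e \<in> carrier A"
  shows "L e = (\<Sum>b<r. \<psi> e b * L (inv_into (carrier A) \<psi> (cunit b)))"
proof -
  define p where "p k = inv_into (carrier A) \<psi> (\<lambda>i. if i < k then \<psi> e i else 0)" for k
  have p: "p k \<in> carrier A" "\<psi> (p k) = (\<lambda>i. if i < k then \<psi> e i else 0)" for k
    unfolding p_def by (rule fibre_iso_inv; use fibre_iso_cspace[OF e] in \<open>auto simp: cspace_def\<close>)+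
  have "k \<le> r \<Longrightarrow> L (p k) = (\<Sum>b<k. \<psi> e b * L (inv_into (carrier A) \<psi> (cunit b)))" for k
  proof (induction k)
    case 0
    have "p 0 = 0 \<odot>\<^bsub>A\<^esub> e"
      by (rule fibre_iso_eqI) (simp_all add: p e module_smult_closed fibre_iso_smult)
    then show ?case by (simp add: smult e)
  next
    case (Suc k)
    define u where "u = inv_into (carrier A) \<psi> (cunit k)"
    have u: "u \<in> carrier A" "\<psi> u = cunit k"
      using Suc.prems fibre_iso_inv[OF cunit_cspace, of k] by (simp_all add: u_def)
    have "p (Suc k) = p k \<oplus>\<^bsub>A\<^esub> (\<psi> e k \<odot>\<^bsub>A\<^esub> u)"
      by (rule fibre_iso_eqI)
        (auto simp: p u module_smult_closed module_add_closed fibre_iso_smult fibre_iso_add cunit_def fun_eq_iff less_Suc_eq)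
    then show ?case using Suc by (simp add: add smult p u module_smult_closed u_def[symmetric])
  qed
  moreover have "p r = e"
    by (rule fibre_iso_eqI') (simp_all add: p e)
  ultimately show ?thesis using order_refl by metis
qed

end

end

text \<open>The transition matrix, made canonical so that it is a function on the whole overlap.\<close>

definition tmat ::
    "('u \<Rightarrow> (complex, 'e) module) \<Rightarrow> ('u \<Rightarrow> 'e \<Rightarrow> nat \<Rightarrow> complex) \<Rightarrow> ('u \<Rightarrow> 'e \<Rightarrow> nat \<Rightarrow> complex)
      \<Rightarrow> nat \<Rightarrow> nat \<Rightarrow> 'u \<Rightarrow> complex"
  where "tmat F \<psi> \<psi>' a b x = \<psi>' x (inv_into (carrier (F x)) (\<psi> x) (cunit b)) a"

definition trans_at ::
    "'u cmfd \<Rightarrow> ('u \<Rightarrow> (complex, 'e) module) \<Rightarrow> 'u set \<times> nat \<times> ('u \<Rightarrow> 'e \<Rightarrow> nat \<Rightarrow> complex)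
      \<Rightarrow> 'u set \<times> nat \<times> ('u \<Rightarrow> 'e \<Rightarrow> nat \<Rightarrow> complex) \<Rightarrow> 'u \<Rightarrow> bool"
  where "trans_at U F = (\<lambda>(V, r, \<psi>) (V', r', \<psi>') x.
    \<forall>a<r'. \<forall>b<r. mdiff U x (tmat F \<psi> \<psi>' a b))"

lemma tmat_expand:
  assumes "module complex_ring (F x)" "fibre_iso (F x) r (\<psi> x)" "fibre_iso (F x) r' (\<psi>' x)" "e \<in> carrier (F x)"
  shows "\<psi>' x e a = (\<Sum>b<r. tmat F \<psi> \<psi>' a b x * \<psi> x e b)"
  using fibre_iso_expand[OF assms(1,2), of "\<lambda>e. \<psi>' x e a" e] assms(4)
  by (simp add: tmat_def fibre_iso_add[OF assms(1,3)] fibre_iso_smult[OF assms(1,3)] mult.commute)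

lemma tmat_compose:
  assumes "module complex_ring (F x)" "fibre_iso (F x) r (\<psi> x)" "fibre_iso (F x) r' (\<psi>' x)"
    "fibre_iso (F x) r'' (\<psi>'' x)" "b < r"
  shows "tmat F \<psi> \<psi>'' a b x = (\<Sum>c<r'. tmat F \<psi>' \<psi>'' a c x * tmat F \<psi> \<psi>' c b x)"
  unfolding tmat_def[of F \<psi>]
  by (rule tmat_expand[of F x r' \<psi>' r'' \<psi>'', OF assms(1,3,4)])
    (rule fibre_iso_inv(1)[OF assms(1,2) cunit_cspace[OF assms(5)]])

context
  fixes U :: "'u cmfd" and F :: "'u \<Rightarrow> (complex, 'e) module"
  assumes U: "holo_atlas U" and F: "\<forall>x\<in>pts U. module complex_ring (F x)"
begin

lemma local_triv_pts: "local_triv U F (V, r, \<psi>) \<Longrightarrow> x \<in> V \<Longrightarrow> x \<in> pts U"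
  using openin_subset[of "mtop U" V] by (auto simp: local_triv_iff topspace_mtop[OF U])

lemma local_triv_fibre_iso: "local_triv U F (V, r, \<psi>) \<Longrightarrow> x \<in> V \<Longrightarrow> fibre_iso (F x) r (\<psi> x)"
  by (simp add: local_triv_iff)

lemma local_triv_module: "local_triv U F (V, r, \<psi>) \<Longrightarrow> x \<in> V \<Longrightarrow> module complex_ring (F x)"
  using local_triv_pts F by blast

lemma eventually_triv: "local_triv U F (V, r, \<psi>) \<Longrightarrow> x \<in> V \<Longrightarrow> eventually (\<lambda>y. y \<in> V) (mnhds U x)"
  by (rule eventually_mnhds_open) (auto simp: local_triv_iff)

text \<open>The definition asks for some holomorphic matrix on the overlap. Evaluation on the frame
  shows that it must be \<open>tmat\<close> there, so the condition can be checked point by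
  point.\<close>

lemma holo_transition_iff:
  assumes t: "local_triv U F (V, r, \<psi>)" "local_triv U F (V', r', \<psi>')"
  shows "holo_transition U F (V, r, \<psi>) (V', r', \<psi>') \<longleftrightarrow>
    (\<forall>x\<in>V \<inter> V'. trans_at U F (V, r, \<psi>) (V', r', \<psi>') x)"
proof -
  have op: "openin (mtop U) (V \<inter> V')" using t by (simp add: local_triv_iff openin_Int)
  show ?thesis
  proof
    assume "holo_transition U F (V, r, \<psi>) (V', r', \<psi>')"
    then obtain g where g: "\<And>a b. a < r' \<Longrightarrow> b < r \<Longrightarrow> mholo U (V \<inter> V') (g a b)"
      and eq: "\<And>x e a. x \<in> V \<inter> V' \<Longrightarrow> e \<in> carrier (F x) \<Longrightarrow> a < r' \<Longrightarrow>
        \<psi>' x e a = (\<Sum>b<r. g a b x * \<psi> x e b)"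
      unfolding holo_transition_def by fast
    have tg: "tmat F \<psi> \<psi>' a b x = g a b x" if x: "x \<in> V \<inter> V'" and ab: "a < r'" "b < r" for a b x
    proof -
      note m = local_triv_module[OF t(1), of x] and i = local_triv_fibre_iso[OF t(1), of x]
      have "tmat F \<psi> \<psi>' a b x = (\<Sum>c<r. g a c x * cunit b c)"
        using eq[OF x fibre_iso_inv(1)[OF m i cunit_cspace[OF ab(2)]] ab(1)]
          fibre_iso_inv(2)[OF m i cunit_cspace[OF ab(2)]] x by (simp add: tmat_def)
      also have "\<dots> = (\<Sum>c<r. if c = b then g a c x else 0)" by (rule sum.cong) (auto simp: cunit_def)
      finally show ?thesis using ab by simp
    qed
    show "\<forall>x\<in>V \<inter> V'. trans_at U F (V, r, \<psi>) (V', r', \<psi>') x"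
      unfolding trans_at_def prod.case
    proof (intro ballI allI impI)
      fix x a b assume x: "x \<in> V \<inter> V'" and ab: "a < r'" "b < r"
      show "mdiff U x (tmat F \<psi> \<psi>' a b)"
      proof (rule mdiff_cong[OF U])
        show "mdiff U x (g a b)" using g[OF ab] x by (simp add: mholo_iff_mdiff[OF U op])
        show "\<forall>\<^sub>F y in mnhds U x. g a b y = tmat F \<psi> \<psi>' a b y"
          using eventually_mnhds_open[OF op x] by eventually_elim (simp add: tg ab)
      qed
    qed
  next
    assume tr: "\<forall>x\<in>V \<inter> V'. trans_at U F (V, r, \<psi>) (V', r', \<psi>') x"
    show "holo_transition U F (V, r, \<psi>) (V', r', \<psi>')"
      unfolding holo_transition_def prod.case
    proof (rule exI[of _ "tmat F \<psi> \<psi>'"], intro conjI allI impI ballI)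
      fix a b assume "a < r'" "b < r"
      then show "mholo U (V \<inter> V') (tmat F \<psi> \<psi>' a b)"
        using tr by (simp add: mholo_iff_mdiff[OF U op] trans_at_def)
    next
      fix x e a assume "x \<in> V \<inter> V'" "e \<in> carrier (F x)"
      then show "\<psi>' x e a = (\<Sum>b<r. tmat F \<psi> \<psi>' a b x * \<psi> x e b)"
        using local_triv_module[OF t(1)] local_triv_fibre_iso[OF t(1)] local_triv_fibre_iso[OF t(2)]
        by (intro tmat_expand[of F x r \<psi> r' \<psi>']) auto
    qed
  qed
qed

lemma holo_compatible_iff:
  assumes t: "local_triv U F (V, r, \<psi>)" "local_triv U F (V', r', \<psi>')"
  shows "holo_compatible U F (V, r, \<psi>) (V', r', \<psi>') \<longleftrightarrow>
    (\<forall>x\<in>V \<inter> V'. trans_at U F (V, r, \<psi>) (V', r', \<psi>') x \<and> trans_at U F (V', r', \<psi>') (V, r, \<psi>) x)"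
  unfolding holo_compatible_def holo_transition_iff[OF t] holo_transition_iff[OF t(2,1)] by blast

text \<open>Transition matrices multiply near \<open>x\<close>, and the entries of the product are
  sums of products of holomorphic functions. The point has to lie in all three domains for
  \<open>tmat_compose\<close> to hold around it.\<close>

lemma trans_at_compose:
  assumes t: "local_triv U F (V, r, \<psi>)" "local_triv U F (V', r', \<psi>')" "local_triv U F (V'', r'', \<psi>'')"
    and x: "x \<in> V" "x \<in> V'" "x \<in> V''"
    and "trans_at U F (V, r, \<psi>) (V', r', \<psi>') x" "trans_at U F (V', r', \<psi>') (V'', r'', \<psi>'') x"
  shows "trans_at U F (V, r, \<psi>) (V'', r'', \<psi>'') x"
  unfolding trans_at_def prod.case
proof (intro allI impI)
  fix a b assume ab: "a < r''" "b < r"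
  have "mdiff U x (\<lambda>y. \<Sum>c<r'. tmat F \<psi>' \<psi>'' a c y * tmat F \<psi> \<psi>' c b y)"
    using assms(7,8) ab by (intro mdiff_sum mdiff_mult) (auto simp: trans_at_def)
  then show "mdiff U x (tmat F \<psi> \<psi>'' a b)"
  proof (rule mdiff_cong[OF U, rotated])
    show "\<forall>\<^sub>F y in mnhds U x. (\<Sum>c<r'. tmat F \<psi>' \<psi>'' a c y * tmat F \<psi> \<psi>' c b y) = tmat F \<psi> \<psi>'' a b y"
      using eventually_triv[OF t(1) x(1)] eventually_triv[OF t(2) x(2)] eventually_triv[OF t(3) x(3)]
      by eventually_elim
        (rule sym, rule tmat_compose[of F _ r \<psi> r' \<psi>' r'' \<psi>''],
          simp_all add: local_triv_module[OF t(1)] local_triv_fibre_iso[OF t(1)]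
          local_triv_fibre_iso[OF t(2)] local_triv_fibre_iso[OF t(3)] ab(2))
  qed
qed

end

lemma holo_bundle_module: "holo_bundle U E \<Longrightarrow> x \<in> pts U \<Longrightarrow> module complex_ring (fibre E x)"
  by (simp add: holo_bundle_def)

lemma holo_bundle_modules: "holo_bundle U E \<Longrightarrow> \<forall>x\<in>pts U. module complex_ring (fibre E x)"
  by (simp add: holo_bundle_def)

lemma holo_bundle_local_triv: "holo_bundle U E \<Longrightarrow> t \<in> trivs E \<Longrightarrow> local_triv U (fibre E) t"
  by (simp add: holo_bundle_def)

lemma holo_bundle_compatible:
  "holo_bundle U E \<Longrightarrow> t \<in> trivs E \<Longrightarrow> t' \<in> trivs E \<Longrightarrow> holo_compatible U (fibre E) t t'"
  by (simp add: holo_bundle_def)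

lemma holo_bundle_triv_exists:
  assumes "holo_bundle U E" "x \<in> pts U"
  obtains V r \<psi> where "(V, r, \<psi>) \<in> trivs E" "x \<in> V"
proof -
  have "x \<in> (\<Union>(V, r, \<psi>)\<in>trivs E. V)" using assms by (simp add: holo_bundle_def)
  then show thesis using that by blast
qed

lemma holo_bundle_trivI:
  assumes "holo_bundle U E" "local_triv U (fibre E) t" "\<And>t'. t' \<in> trivs E \<Longrightarrow> holo_compatible U (fibre E) t t'"
  shows "t \<in> trivs E"
proof -
  have "\<forall>t. local_triv U (fibre E) t \<and> (\<forall>t'\<in>trivs E. holo_compatible U (fibre E) t t') \<longrightarrow> t \<in> trivs E"
    using assms(1) unfolding holo_bundle_def by (elim conjE)
  with assms(2,3) show ?thesis by blast
qed

context
  fixes U :: "'u cmfd" and E :: "('u, 'e) vbundle"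
  assumes U: "holo_atlas U" and E: "holo_bundle U E"
begin

lemma triv_pts: "(V, r, \<psi>) \<in> trivs E \<Longrightarrow> x \<in> V \<Longrightarrow> x \<in> pts U"
  by (rule local_triv_pts[OF U holo_bundle_modules[OF E] holo_bundle_local_triv[OF E]])

lemma triv_fibre_iso: "(V, r, \<psi>) \<in> trivs E \<Longrightarrow> x \<in> V \<Longrightarrow> fibre_iso (fibre E x) r (\<psi> x)"
  using holo_bundle_local_triv[OF E] by (fastforce simp: local_triv_iff)

lemma triv_module: "(V, r, \<psi>) \<in> trivs E \<Longrightarrow> x \<in> V \<Longrightarrow> module complex_ring (fibre E x)"
  using triv_pts holo_bundle_module[OF E] by blast

lemma triv_open: "(V, r, \<psi>) \<in> trivs E \<Longrightarrow> openin (mtop U) V"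
  using holo_bundle_local_triv[OF E] by (fastforce simp: local_triv_iff)

lemma triv_eventually: "(V, r, \<psi>) \<in> trivs E \<Longrightarrow> x \<in> V \<Longrightarrow> eventually (\<lambda>y. y \<in> V) (mnhds U x)"
  by (rule eventually_mnhds_open[OF triv_open])

lemma triv_trans_at:
  assumes "(V, r, \<psi>) \<in> trivs E" "(V', r', \<psi>') \<in> trivs E" "x \<in> V" "x \<in> V'"
  shows "trans_at U (fibre E) (V, r, \<psi>) (V', r', \<psi>') x"
  using holo_bundle_compatible[OF E assms(1,2)] assms(3,4)
    holo_compatible_iff[OF U holo_bundle_modules[OF E] holo_bundle_local_triv[OF E assms(1)]
      holo_bundle_local_triv[OF E assms(2)]]
  by simp

lemma triv_tmat_mdiff:
  assumes "(V, r, \<psi>) \<in> trivs E" "(V', r', \<psi>') \<in> trivs E" "x \<in> V" "x \<in> V'" "a < r'" "b < r"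
  shows "mdiff U x (tmat (fibre E) \<psi> \<psi>' a b)"
  using triv_trans_at[OF assms(1-4)] assms(5,6) by (simp add: trans_at_def)

lemma triv_expand:
  assumes "(V, r, \<psi>) \<in> trivs E" "(V', r', \<psi>') \<in> trivs E" "x \<in> V" "x \<in> V'" "e \<in> carrier (fibre E x)"
  shows "\<psi>' x e a = (\<Sum>b<r. tmat (fibre E) \<psi> \<psi>' a b x * \<psi> x e b)"
  by (rule tmat_expand[of _ _ r \<psi> r' \<psi>'])
    (simp_all add: assms triv_module[OF assms(1,3)] triv_fibre_iso[OF assms(1,3)] triv_fibre_iso[OF assms(2,4)])

section \<open>Total spaces\<close>

lemma pts_total: "p \<in> pts (total_space U E) \<longleftrightarrow> fst p \<in> pts U \<and> snd p \<in> carrier (fibre E (fst p))"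
  by (cases p) (auto simp: total_space_def)

lemma charts_totalI:
  "(W, d, \<phi>) \<in> charts U \<Longrightarrow> (V, r, \<psi>) \<in> trivs E \<Longrightarrow>
    (SIGMA x:W \<inter> V. carrier (fibre E x), d + r, \<lambda>(x, e). cat d (\<phi> x) (\<psi> x e)) \<in> charts (total_space U E)"
  unfolding total_space_def by simp blast

lemma charts_totalE:
  assumes "(S, k, \<Psi>) \<in> charts (total_space U E)"
  obtains W d \<phi> V r \<psi> where "(W, d, \<phi>) \<in> charts U" "(V, r, \<psi>) \<in> trivs E"
    "S = (SIGMA x:W \<inter> V. carrier (fibre E x))" "k = d + r" "\<Psi> = (\<lambda>(x, e). cat d (\<phi> x) (\<psi> x e))"
  using assms unfolding total_space_def by auto

text \<open>A change of charts is the base transition on the first coordinates; on the others it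
  applies the matrix \<open>tmat\<close> at the base point to the fibre coordinates, hence is a sum
  of products of differentiable functions.\<close>

lemma holo_atlas_total: "holo_atlas (total_space U E)"
proof (rule holo_atlasI)
  show "(\<Union>(S, k, \<Psi>)\<in>charts (total_space U E). S) = pts (total_space U E)"
  proof (intro subset_antisym subsetI)
    fix p assume "p \<in> (\<Union>(S, k, \<Psi>)\<in>charts (total_space U E). S)"
    then obtain S k \<Psi> where S: "(S, k, \<Psi>) \<in> charts (total_space U E)" "p \<in> S" by auto
    from S(1) obtain W d \<phi> V r \<psi> where "(W, d, \<phi>) \<in> charts U" "S = (SIGMA x:W \<inter> V. carrier (fibre E x))"
      by (rule charts_totalE)
    then show "p \<in> pts (total_space U E)"
      using S(2) chart_pts[OF U] by (auto simp: pts_total)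
  next
    fix p assume p: "p \<in> pts (total_space U E)"
    obtain W d \<phi> where C: "(W, d, \<phi>) \<in> charts U" "fst p \<in> W"
      by (rule chart_exists[OF U, of "fst p"]) (use p in \<open>auto simp: pts_total\<close>)
    obtain V r \<psi> where C': "(V, r, \<psi>) \<in> trivs E" "fst p \<in> V"
      by (rule holo_bundle_triv_exists[OF E, of "fst p"]) (use p in \<open>auto simp: pts_total\<close>)
    have "p \<in> (SIGMA x:W \<inter> V. carrier (fibre E x))"
      using C C' p by (cases p) (auto simp: pts_total)
    then show "p \<in> (\<Union>(S, k, \<Psi>)\<in>charts (total_space U E). S)"
      by (intro UN_I[OF charts_totalI[OF C(1) C'(1)]]) simp
  qed
next
  fix S k \<Psi> assume "(S, k, \<Psi>) \<in> charts (total_space U E)"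
  then obtain W d \<phi> V r \<psi> where C: "(W, d, \<phi>) \<in> charts U" "(V, r, \<psi>) \<in> trivs E"
    and S: "S = (SIGMA x:W \<inter> V. carrier (fibre E x))" "k = d + r" "\<Psi> = (\<lambda>(x, e). cat d (\<phi> x) (\<psi> x e))"
    by (rule charts_totalE)
  have S_mem: "p \<in> S \<longleftrightarrow> fst p \<in> W \<and> fst p \<in> V \<and> snd p \<in> carrier (fibre E (fst p))" for p
    by (cases p) (auto simp: S)
  have fs: "fstc d (\<Psi> p) = \<phi> (fst p)" "sndc d (\<Psi> p) = \<psi> (fst p) (snd p)" if "p \<in> S" for p
    using that S_mem[of p] by (simp_all add: S(3) fstc_cat chart_cspace[OF U C(1)] case_prod_unfold)
  have inv: "fst p = inv_into W \<phi> (fstc d (\<Psi> p))"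
    "snd p = inv_into (carrier (fibre E (fst p))) (\<psi> (fst p)) (sndc d (\<Psi> p))" if "p \<in> S" for p
    using that S_mem[of p] fs[OF that]
    by (simp_all add: chart_inv[OF U C(1)] fibre_iso_inv_left[OF triv_module[OF C(2)] triv_fibre_iso[OF C(2)]])
  show inj: "inj_on \<Psi> S"
    by (rule inj_onI) (metis inv prod_eqI)
  show cs: "\<Psi> p \<in> cspace k" if "p \<in> S" for p
    using that S_mem[of p]
    by (simp add: S(2,3) case_prod_unfold cat_cspace chart_cspace[OF U C(1)]
        fibre_iso_cspace[OF triv_module[OF C(2)] triv_fibre_iso[OF C(2)]])
  fix S2 k2 \<Psi>2 p assume "(S2, k2, \<Psi>2) \<in> charts (total_space U E)" and p: "p \<in> S" "p \<in> S2"
  then obtain W2 d2 \<phi>2 V2 r2 \<psi>2 where C2: "(W2, d2, \<phi>2) \<in> charts U" "(V2, r2, \<psi>2) \<in> trivs E"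
    and S2: "S2 = (SIGMA x:W2 \<inter> V2. carrier (fibre E x))" "k2 = d2 + r2" "\<Psi>2 = (\<lambda>(x, e). cat d2 (\<phi>2 x) (\<psi>2 x e))"
    by (elim charts_totalE)
  have S2_mem: "p \<in> S2 \<longleftrightarrow> fst p \<in> W2 \<and> fst p \<in> V2 \<and> snd p \<in> carrier (fibre E (fst p))" for p
    by (cases p) (auto simp: S2)
  have kp: "\<Psi> p \<in> cspace (d + r)" using cs[OF p(1)] S(2) by simp
  have p1: "fst p \<in> W" "fst p \<in> V" and p2: "fst p \<in> W2" "fst p \<in> V2"
    using p S_mem S2_mem by blast+
  \<comment> \<open>For the openness of overlaps, a model point near \<open>\<Psi> p\<close> must
    come from both charts: its first part yields a base point \<open>y\<close> in all four domains,
    and inverting \<open>\<psi> y\<close> on its second part yields the fibre element.\<close>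
  have "eventually (\<lambda>y. y \<in> W \<and> y \<in> V \<and> y \<in> W2 \<and> y \<in> V2) (mnhds U (fst p))"
    by (intro eventually_conj eventually_mnhds_open openin_chart[OF U C(1)] openin_chart[OF U C2(1)]
        triv_open[OF C(2)] triv_open[OF C2(2)] p1 p2)
  then have "eventually (\<lambda>z. inv_into W \<phi> z \<in> W \<and> inv_into W \<phi> z \<in> V \<and> inv_into W \<phi> z \<in> W2 \<and>
      inv_into W \<phi> z \<in> V2) (cnhds d (fstc d (\<Psi> p)))"
    unfolding fs(1)[OF p(1)] by (simp add: eventually_mnhds_chart[OF U C(1) p1(1)])
  moreover have "eventually (\<lambda>z. z \<in> \<phi> ` W) (cnhds d (fstc d (\<Psi> p)))"
    unfolding fs(1)[OF p(1)] by (rule eventually_chart[OF U C(1) p1(1)])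
  ultimately have "eventually (\<lambda>z. \<exists>y. z = \<phi> y \<and> y \<in> W \<and> y \<in> V \<and> y \<in> W2 \<and> y \<in> V2) (cnhds d (fstc d (\<Psi> p)))"
    by eventually_elim (auto simp: chart_inv[OF U C(1)])
  then have "eventually (\<lambda>z. \<exists>y. fstc d z = \<phi> y \<and> y \<in> W \<and> y \<in> V \<and> y \<in> W2 \<and> y \<in> V2) (cnhds k (\<Psi> p))"
    unfolding S(2) by (rule eventually_compose_filterlim[OF _ filterlim_fstc[OF kp]])
  moreover have "eventually (\<lambda>z. z \<in> cspace (d + r)) (cnhds k (\<Psi> p))"
    unfolding S(2) by (rule eventually_cspace_cnhds)
  ultimately show ev: "eventually (\<lambda>z. z \<in> \<Psi> ` (S \<inter> S2)) (cnhds k (\<Psi> p))"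
  proof eventually_elim
    case (elim z)
    then obtain y where y: "fstc d z = \<phi> y" "y \<in> W" "y \<in> V" "y \<in> W2" "y \<in> V2" by blast
    define e where "e = inv_into (carrier (fibre E y)) (\<psi> y) (sndc d z)"
    have e: "e \<in> carrier (fibre E y)" "\<psi> y e = sndc d z"
      unfolding e_def by (rule fibre_iso_inv[OF triv_module[OF C(2) y(3)] triv_fibre_iso[OF C(2) y(3)]];
        rule sndc_cspace[OF elim(2)])+
    have "(y, e) \<in> S \<inter> S2" using y e S_mem S2_mem by auto
    moreover have "\<Psi> (y, e) = z" using e y cat_fstc_sndc[of d z] by (simp add: S)
    ultimately show ?case by (rule image_eqI[rotated, OF _ sym])
  qed
  fix i assume i: "i < k2"
  have invS: "\<exists>y e. z = \<Psi> (y, e) \<and> (y, e) \<in> S \<and> (y, e) \<in> S2 \<and> inv_into S \<Psi> z = (y, e) \<and>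
      inv_into W \<phi> (fstc d z) = y \<and> \<psi> y e = sndc d z"
    if "z \<in> \<Psi> ` (S \<inter> S2)" for z
  proof -
    obtain q where q: "q \<in> S" "q \<in> S2" "z = \<Psi> q" using \<open>z \<in> \<Psi> ` (S \<inter> S2)\<close> by blast
    then have "inv_into S \<Psi> z = q" using inj by simp
    then show ?thesis using inv(1)[OF q(1), symmetric] fs(2)[OF q(1)] q
      by (intro exI[of _ "fst q"] exI[of _ "snd q"]) simp
  qed
  show "cdiff k (\<lambda>z. \<Psi>2 (inv_into S \<Psi> z) i) (\<Psi> p)"
  proof (cases "i < d2")
    case True
    have "cdiff d (\<lambda>z. \<phi>2 (inv_into W \<phi> z) i) (fstc d (\<Psi> p))"
      unfolding fs(1)[OF p(1)] by (rule chart_transition_cdiff[OF U C(1) C2(1) p1(1) p2(1) True])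
    then have c: "cdiff k (\<lambda>z. \<phi>2 (inv_into W \<phi> (fstc d z)) i) (\<Psi> p)"
      unfolding S(2) by (rule cdiff_compose_fstc[OF _ kp])
    show ?thesis
    proof (rule cdiff_cong[OF cs[OF p(1)] _ c], use ev in eventually_elim)
      case (elim z)
      from invS[OF this] True show ?case by (auto simp: S2(3) cat_def)
    qed
  next
    case False
    define a where "a = i - d2"
    have a: "a < r2" using i S2 False by (simp add: a_def)
    have "cdiff d (\<lambda>z. tmat (fibre E) \<psi> \<psi>2 a b (inv_into W \<phi> z)) (fstc d (\<Psi> p))" if "b < r" for b
      using triv_tmat_mdiff[OF C(2) C2(2) p1(2) p2(2) a that]
      unfolding fs(1)[OF p(1)] mdiff_chart[OF U C(1) p1(1)] .
    from cdiff_compose_fstc[OF this kp]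
    have c: "cdiff k (\<lambda>z. \<Sum>b<r. tmat (fibre E) \<psi> \<psi>2 a b (inv_into W \<phi> (fstc d z)) * sndc d z b) (\<Psi> p)"
      unfolding S(2) by (intro cdiff_sum cdiff_mult cdiff_sndc) auto
    show ?thesis
    proof (rule cdiff_cong[OF cs[OF p(1)] _ c], use ev in eventually_elim)
      case (elim z)
      from invS[OF this] obtain y e where y: "(y, e) \<in> S" "(y, e) \<in> S2" "inv_into S \<Psi> z = (y, e)"
        "inv_into W \<phi> (fstc d z) = y" "\<psi> y e = sndc d z" by blast
      have "\<psi>2 y e a = (\<Sum>b<r. tmat (fibre E) \<psi> \<psi>2 a b y * \<psi> y e b)"
        by (rule triv_expand[OF C(2) C2(2)]) (use y S_mem S2_mem in auto)
      then show ?case using y False by (simp add: S2(3) cat_def a_def)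
    qed
  qed
qed

lemma holo_total_fst: "holo_map (total_space U E) U fst"
  unfolding holo_map_iff[OF holo_atlas_total U]
proof
  fix p assume p: "p \<in> pts (total_space U E)"
  obtain W d \<phi> where C: "(W, d, \<phi>) \<in> charts U" "fst p \<in> W"
    by (rule chart_exists[OF U, of "fst p"]) (use p in \<open>auto simp: pts_total\<close>)
  obtain V r \<psi> where C': "(V, r, \<psi>) \<in> trivs E" "fst p \<in> V"
    by (rule holo_bundle_triv_exists[OF E, of "fst p"]) (use p in \<open>auto simp: pts_total\<close>)
  note CP = charts_totalI[OF C(1) C'(1)]
  have pW: "p \<in> (SIGMA x:W \<inter> V. carrier (fibre E x))"
    using C C' p by (cases p) (auto simp: pts_total)
  show "holo_at (total_space U E) U fst p"
  proof (rule holo_atI[OF C(1)])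
    show "fst p \<in> W" by (rule C(2))
    show "\<forall>\<^sub>F q in mnhds (total_space U E) p. fst q \<in> W"
      using eventually_mnhds_open[OF openin_chart[OF holo_atlas_total CP] pW] by eventually_elim auto
    fix i assume i: "i < d"
    have "mdiff (total_space U E) p (\<lambda>q. (case q of (x, e) \<Rightarrow> cat d (\<phi> x) (\<psi> x e)) i)"
      by (rule mdiff_chart_coord[OF holo_atlas_total CP pW]) (use i in simp)
    then show "mdiff (total_space U E) p (\<lambda>q. \<phi> (fst q) i)"
      by (simp add: case_prod_unfold cat_def i)
  qed
qed

lemma mdiff_total_coord:
  assumes C': "(V, r, \<psi>) \<in> trivs E" "fst p \<in> V" and p: "p \<in> pts (total_space U E)" and i: "i < r"
  shows "mdiff (total_space U E) p (\<lambda>q. \<psi> (fst q) (snd q) i)"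
proof -
  obtain W d \<phi> where C: "(W, d, \<phi>) \<in> charts U" "fst p \<in> W"
    by (rule chart_exists[OF U, of "fst p"]) (use p in \<open>auto simp: pts_total\<close>)
  note CP = charts_totalI[OF C(1) C'(1)]
  have pW: "p \<in> (SIGMA x:W \<inter> V. carrier (fibre E x))"
    using C C' p by (cases p) (auto simp: pts_total)
  have "mdiff (total_space U E) p (\<lambda>q. (case q of (x, e) \<Rightarrow> cat d (\<phi> x) (\<psi> x e)) (d + i))"
    by (rule mdiff_chart_coord[OF holo_atlas_total CP pW]) (use i in simp)
  then show ?thesis by (simp add: case_prod_unfold cat_def)
qed

text \<open>The base coordinates are covered by the assumption on \<open>fst\<close>, so only the
  fibre coordinates in one trivialisation around each image point remain. Continuity of the base map
  keeps nearby points in that trivialisation.\<close>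

lemma holo_map_totalI:
  assumes Z: "holo_atlas Z" and f: "holo_map Z U (\<lambda>z. fst (f z))"
    and pts: "\<And>z. z \<in> pts Z \<Longrightarrow> f z \<in> pts (total_space U E)"
    and coord: "\<And>z. z \<in> pts Z \<Longrightarrow> \<exists>V r \<psi>. (V, r, \<psi>) \<in> trivs E \<and> fst (f z) \<in> V \<and>
      (\<forall>i<r. mdiff Z z (\<lambda>y. \<psi> (fst (f y)) (snd (f y)) i))"
  shows "holo_map Z (total_space U E) f"
  unfolding holo_map_iff[OF Z holo_atlas_total]
proof
  fix z assume z: "z \<in> pts Z"
  obtain V r \<psi> where C': "(V, r, \<psi>) \<in> trivs E" "fst (f z) \<in> V"
    and co: "\<And>i. i < r \<Longrightarrow> mdiff Z z (\<lambda>y. \<psi> (fst (f y)) (snd (f y)) i)"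
    using coord[OF z] by blast
  obtain W d \<phi> where C: "(W, d, \<phi>) \<in> charts U" "fst (f z) \<in> W"
    by (rule chart_exists[OF U, of "fst (f z)"]) (use pts[OF z] in \<open>auto simp: pts_total\<close>)
  have mem: "q \<in> (SIGMA x:W \<inter> V. carrier (fibre E x)) \<longleftrightarrow>
      fst q \<in> W \<and> fst q \<in> V \<and> snd q \<in> carrier (fibre E (fst q))" for q
    by (cases q) auto
  have lim: "filterlim (\<lambda>y. fst (f y)) (mnhds U (fst (f z))) (mnhds Z z)"
    by (rule holo_map_filterlim[OF Z U f z])
  show "holo_at Z (total_space U E) f z"
  proof (rule holo_atI[OF charts_totalI[OF C(1) C'(1)]])
    show "f z \<in> (SIGMA x:W \<inter> V. carrier (fibre E x))"
      using C C' pts[OF z] by (simp add: mem pts_total)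
    have "\<forall>\<^sub>F y in mnhds Z z. fst (f y) \<in> W"
      by (rule eventually_compose_filterlim[OF eventually_mnhds_open[OF openin_chart[OF U C(1)] C(2)] lim])
    moreover have "\<forall>\<^sub>F y in mnhds Z z. fst (f y) \<in> V"
      by (rule eventually_compose_filterlim[OF triv_eventually[OF C'] lim])
    ultimately show "\<forall>\<^sub>F y in mnhds Z z. f y \<in> (SIGMA x:W \<inter> V. carrier (fibre E x))"
      using eventually_mnhds_pts[OF Z] by eventually_elim (use pts in \<open>auto simp: mem pts_total\<close>)
    fix i assume i: "i < d + r"
    show "mdiff Z z (\<lambda>y. (case f y of (x, e) \<Rightarrow> cat d (\<phi> x) (\<psi> x e)) i)"
    proof (cases "i < d")
      case True
      have "mdiff Z z (\<lambda>y. \<phi> (fst (f y)) i)"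
        by (rule holo_map_mdiff[OF Z U f z mdiff_chart_coord[OF U C True]])
      then show ?thesis using True by (simp add: cat_def case_prod_unfold)
    next
      case False
      then show ?thesis using co[of "i - d"] i by (simp add: cat_def case_prod_unfold)
    qed
  qed
qed

lemma holo_map_total_coord:
  assumes "holo_atlas Z" "holo_map Z (total_space U E) f" "z \<in> pts Z" "(V, r, \<psi>) \<in> trivs E" "fst (f z) \<in> V" "i < r"
  shows "mdiff Z z (\<lambda>y. \<psi> (fst (f y)) (snd (f y)) i)"
  by (rule holo_map_mdiff[OF assms(1) holo_atlas_total assms(2,3), of "\<lambda>q. \<psi> (fst q) (snd q) i"])
    (rule mdiff_total_coord[OF assms(4,5) holo_map_pts[OF assms(2,3)] assms(6)])

end

section \<open>Pullbacks of bundles\<close>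

lemma fibre_pull [simp]: "v \<in> pts V \<Longrightarrow> fibre (pull_bundle V U f E) v = fibre E (f v)"
  by (simp add: pull_bundle_def Let_def)

lemma fibre_pull_restrict: "fibre (pull_bundle V U f E) = (\<lambda>v\<in>pts V. fibre E (f v))"
  by (simp add: pull_bundle_def Let_def)

lemma trivs_pull_iff:
  "t \<in> trivs (pull_bundle V U f E) \<longleftrightarrow> local_triv V (fibre (pull_bundle V U f E)) t \<and>
    (\<forall>(W, r, \<psi>)\<in>trivs E. holo_compatible V (fibre (pull_bundle V U f E)) t (pts V \<inter> f -` W, r, \<lambda>v. \<psi> (f v)))"
  by (simp add: pull_bundle_def Let_def)

lemma holo_compatible_sym: "holo_compatible U F t t' \<longleftrightarrow> holo_compatible U F t' t"
  by (auto simp: holo_compatible_def)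

context
  fixes V :: "'v cmfd" and U :: "'u cmfd" and f :: "'v \<Rightarrow> 'u" and E :: "('u, 'e) vbundle"
  assumes V: "holo_atlas V" and U: "holo_atlas U" and f: "holo_map V U f" and E: "holo_bundle U E"
begin

lemma module_pull: "v \<in> pts V \<Longrightarrow> module complex_ring (fibre (pull_bundle V U f E) v)"
  using holo_bundle_module[OF E holo_map_pts[OF f]] by simp

lemma modules_pull: "\<forall>v\<in>pts V. module complex_ring (fibre (pull_bundle V U f E) v)"
  using module_pull by blast

lemma local_triv_pull:
  assumes "(W, r, \<psi>) \<in> trivs E"
  shows "local_triv V (fibre (pull_bundle V U f E)) (pts V \<inter> f -` W, r, \<lambda>v. \<psi> (f v))"
  using holo_map_openin[OF V f triv_open[OF U E assms]] triv_fibre_iso[OF U E assms]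
  by (simp add: local_triv_iff)

lemma trans_at_pull:
  assumes t: "(W, r, \<psi>) \<in> trivs E" "(W', r', \<psi>') \<in> trivs E" and x: "x \<in> pts V" "f x \<in> W" "f x \<in> W'"
  shows "trans_at V (fibre (pull_bundle V U f E)) (S, r, \<lambda>v. \<psi> (f v)) (S', r', \<lambda>v. \<psi>' (f v)) x"
  unfolding trans_at_def prod.case
proof (intro allI impI)
  fix a b assume ab: "a < r'" "b < r"
  have "mdiff V x (\<lambda>v. tmat (fibre E) \<psi> \<psi>' a b (f v))"
    by (rule holo_map_mdiff[OF V U f x(1) triv_tmat_mdiff[OF U E t x(2,3) ab]])
  then show "mdiff V x (tmat (fibre (pull_bundle V U f E)) (\<lambda>v. \<psi> (f v)) (\<lambda>v. \<psi>' (f v)) a b)"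
    by (rule mdiff_cong[OF V, rotated], use eventually_mnhds_pts[OF V] in eventually_elim)
      (simp add: tmat_def)
qed

lemma triv_pull:
  assumes t: "(W, r, \<psi>) \<in> trivs E"
  shows "(pts V \<inter> f -` W, r, \<lambda>v. \<psi> (f v)) \<in> trivs (pull_bundle V U f E)"
  unfolding trivs_pull_iff
proof (intro conjI local_triv_pull[OF t], clarify)
  fix W' r' \<psi>' assume t': "(W', r', \<psi>') \<in> trivs E"
  show "holo_compatible V (fibre (pull_bundle V U f E)) (pts V \<inter> f -` W, r, \<lambda>v. \<psi> (f v))
      (pts V \<inter> f -` W', r', \<lambda>v. \<psi>' (f v))"
    unfolding holo_compatible_iff[OF V modules_pull local_triv_pull[OF t] local_triv_pull[OF t']]
    using trans_at_pull[OF t t'] trans_at_pull[OF t' t] by blast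
qed

lemma trivs_pull_local_triv:
  "t \<in> trivs (pull_bundle V U f E) \<Longrightarrow> local_triv V (fibre (pull_bundle V U f E)) t"
  by (simp add: trivs_pull_iff)

lemma trivs_pull_trans_at:
  assumes t: "(S, k, \<xi>) \<in> trivs (pull_bundle V U f E)" and t': "(W, r, \<psi>) \<in> trivs E"
    and x: "x \<in> S" "f x \<in> W"
  shows "trans_at V (fibre (pull_bundle V U f E)) (S, k, \<xi>) (pts V \<inter> f -` W, r, \<lambda>v. \<psi> (f v)) x"
    and "trans_at V (fibre (pull_bundle V U f E)) (pts V \<inter> f -` W, r, \<lambda>v. \<psi> (f v)) (S, k, \<xi>) x"
proof -
  have "x \<in> pts V" by (rule local_triv_pts[OF V modules_pull trivs_pull_local_triv[OF t] x(1)])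
  moreover have "holo_compatible V (fibre (pull_bundle V U f E)) (S, k, \<xi>)
      (pts V \<inter> f -` W, r, \<lambda>v. \<psi> (f v))"
    using t t' unfolding trivs_pull_iff by fast
  ultimately show "trans_at V (fibre (pull_bundle V U f E)) (S, k, \<xi>) (pts V \<inter> f -` W, r, \<lambda>v. \<psi> (f v)) x"
    "trans_at V (fibre (pull_bundle V U f E)) (pts V \<inter> f -` W, r, \<lambda>v. \<psi> (f v)) (S, k, \<xi>) x"
    using x holo_compatible_iff[OF V modules_pull trivs_pull_local_triv[OF t] local_triv_pull[OF t']]
    by simp_all
qed

text \<open>Trivialisations of a pullback are by definition only compared with the pulled back ones.
  Around each point two of them can be compared through a pulled back one, and compatibility is a
  pointwise condition.\<close>

lemma holo_compatible_pull_sufficient: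
  assumes s: "local_triv V (fibre (pull_bundle V U f E)) s"
    and t: "t \<in> trivs (pull_bundle V U f E)"
    and c: "\<And>W r \<psi>. (W, r, \<psi>) \<in> trivs E \<Longrightarrow>
      holo_compatible V (fibre (pull_bundle V U f E)) s (pts V \<inter> f -` W, r, \<lambda>v. \<psi> (f v))"
  shows "holo_compatible V (fibre (pull_bundle V U f E)) s t"
proof -
  obtain S k \<xi> where se: "s = (S, k, \<xi>)" by (cases s) auto
  obtain T l \<zeta> where te: "t = (T, l, \<zeta>)" by (cases t) auto
  note s = s[unfolded se] and t = t[unfolded te]
  note t_lt = trivs_pull_local_triv[OF t]
  show ?thesis
    unfolding se te holo_compatible_iff[OF V modules_pull s t_lt]
  proof (intro ballI)
    fix x assume x: "x \<in> S \<inter> T"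
    have xV: "x \<in> pts V" by (rule local_triv_pts[OF V modules_pull t_lt]) (use x in auto)
    obtain W r \<psi> where W: "(W, r, \<psi>) \<in> trivs E" "f x \<in> W"
      by (rule holo_bundle_triv_exists[OF E holo_map_pts[OF f xV]])
    let ?t = "(pts V \<inter> f -` W, r, \<lambda>v. \<psi> (f v))"
    note p_lt = local_triv_pull[OF W(1)]
    have 1: "trans_at V (fibre (pull_bundle V U f E)) (S, k, \<xi>) ?t x \<and>
        trans_at V (fibre (pull_bundle V U f E)) ?t (S, k, \<xi>) x"
      using c[OF W(1)] x xV W(2) unfolding se holo_compatible_iff[OF V modules_pull s p_lt] by simp
    have x': "x \<in> S" "x \<in> T" "x \<in> pts V \<inter> f -` W" using x xV W(2) by auto
    note 2 = trivs_pull_trans_at[OF t W(1) x'(2) W(2)]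
    show "trans_at V (fibre (pull_bundle V U f E)) (S, k, \<xi>) (T, l, \<zeta>) x \<and>
        trans_at V (fibre (pull_bundle V U f E)) (T, l, \<zeta>) (S, k, \<xi>) x"
      using trans_at_compose[OF V modules_pull s p_lt t_lt x'(1,3,2)]
        trans_at_compose[OF V modules_pull t_lt p_lt s x'(2,3,1)] 1 2 by blast
  qed
qed

lemma holo_bundle_pull: "holo_bundle V (pull_bundle V U f E)"
  unfolding holo_bundle_def
proof (intro conjI ballI allI impI)
  show "fibre (pull_bundle V U f E) \<in> extensional (pts V)" by (simp add: fibre_pull_restrict)
  show "module complex_ring (fibre (pull_bundle V U f E) x)" if "x \<in> pts V" for x by (rule module_pull[OF that])
  show "(\<Union>(V, r, \<psi>)\<in>trivs (pull_bundle V U f E). V) = pts V"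
  proof (intro subset_antisym subsetI)
    fix x assume "x \<in> (\<Union>(V, r, \<psi>)\<in>trivs (pull_bundle V U f E). V)"
    then obtain S k \<xi> where S: "(S, k, \<xi>) \<in> trivs (pull_bundle V U f E)" "x \<in> S" by auto
    show "x \<in> pts V" by (rule local_triv_pts[OF V modules_pull trivs_pull_local_triv[OF S(1)] S(2)])
  next
    fix x assume x: "x \<in> pts V"
    obtain W r \<psi> where W: "(W, r, \<psi>) \<in> trivs E" "f x \<in> W"
      by (rule holo_bundle_triv_exists[OF E holo_map_pts[OF f x]])
    show "x \<in> (\<Union>(V, r, \<psi>)\<in>trivs (pull_bundle V U f E). V)"
      by (rule UN_I[OF triv_pull[OF W(1)]]) (use x W in simp)
  qed
  show lt: "local_triv V (fibre (pull_bundle V U f E)) t" if "t \<in> trivs (pull_bundle V U f E)" for t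
    by (rule trivs_pull_local_triv[OF that])
  show "holo_compatible V (fibre (pull_bundle V U f E)) t t'"
    if "t \<in> trivs (pull_bundle V U f E)" "t' \<in> trivs (pull_bundle V U f E)" for t t'
    by (rule holo_compatible_pull_sufficient[OF lt[OF that(1)] that(2)])
      (use that(1) in \<open>unfold trivs_pull_iff, fast\<close>)
  show "t \<in> trivs (pull_bundle V U f E)"
    if "local_triv V (fibre (pull_bundle V U f E)) t \<and>
      (\<forall>t'\<in>trivs (pull_bundle V U f E). holo_compatible V (fibre (pull_bundle V U f E)) t t')" for t
    unfolding trivs_pull_iff using that triv_pull by fast
qed

lemma holo_map_pull_total:
  "holo_map (total_space V (pull_bundle V U f E)) (total_space U E) (\<lambda>(v, e). (f v, e))"
proof (rule holo_map_totalI[OF U E])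
  note P = holo_bundle_pull
  show A: "holo_atlas (total_space V (pull_bundle V U f E))" by (rule holo_atlas_total[OF V P])
  have "holo_map (total_space V (pull_bundle V U f E)) U (\<lambda>z. f (fst z))"
    by (rule holo_map_compose[OF A V U holo_total_fst[OF V P] f])
  then show "holo_map (total_space V (pull_bundle V U f E)) U (\<lambda>z. fst (case z of (v, e) \<Rightarrow> (f v, e)))"
    by (simp add: case_prod_unfold)
  fix z assume z: "z \<in> pts (total_space V (pull_bundle V U f E))"
  then have zV: "fst z \<in> pts V" by (simp add: pts_total[OF V P])
  show "(case z of (v, e) \<Rightarrow> (f v, e)) \<in> pts (total_space U E)"
    using z zV holo_map_pts[OF f zV] by (simp add: pts_total[OF V P] pts_total[OF U E] case_prod_unfold)
  obtain W r \<psi> where W: "(W, r, \<psi>) \<in> trivs E" "f (fst z) \<in> W"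
    by (rule holo_bundle_triv_exists[OF E holo_map_pts[OF f zV]])
  have "mdiff (total_space V (pull_bundle V U f E)) z (\<lambda>q. \<psi> (f (fst q)) (snd q) i)" if "i < r" for i
    using mdiff_total_coord[OF V P triv_pull[OF W(1)] _ z that] zV W(2) by simp
  then show "\<exists>V' r \<psi>. (V', r, \<psi>) \<in> trivs E \<and> fst (case z of (v, e) \<Rightarrow> (f v, e)) \<in> V' \<and>
     (\<forall>i<r. mdiff (total_space V (pull_bundle V U f E)) z
       (\<lambda>y. \<psi> (fst (case y of (v, e) \<Rightarrow> (f v, e))) (snd (case y of (v, e) \<Rightarrow> (f v, e))) i))"
    using W by (intro exI[of _ W] exI[of _ r] exI[of _ \<psi>]) (simp add: case_prod_unfold)
qed

text \<open>In a pulled back trivialisation the fibre coordinates of \<open>H\<close> are those of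
  its image over \<open>U\<close>, so the second assumption already says that they are
  holomorphic.\<close>

lemma holo_map_into_pull:
  assumes Z: "holo_atlas Z" and 1: "holo_map Z V (\<lambda>z. fst (H z))"
    and 2: "holo_map Z (total_space U E) (\<lambda>z. (f (fst (H z)), snd (H z)))"
  shows "holo_map Z (total_space V (pull_bundle V U f E)) H"
proof (rule holo_map_totalI[OF V holo_bundle_pull Z 1])
  fix z assume z: "z \<in> pts Z"
  have zV: "fst (H z) \<in> pts V" by (rule holo_map_pts[OF 1 z])
  show "H z \<in> pts (total_space V (pull_bundle V U f E))"
    using holo_map_pts[OF 2 z] zV by (simp add: pts_total[OF V holo_bundle_pull] pts_total[OF U E])
  obtain W r \<psi> where W: "(W, r, \<psi>) \<in> trivs E" "f (fst (H z)) \<in> W"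
    by (rule holo_bundle_triv_exists[OF E holo_map_pts[OF f zV]])
  show "\<exists>V' r \<psi>. (V', r, \<psi>) \<in> trivs (pull_bundle V U f E) \<and> fst (H z) \<in> V' \<and>
      (\<forall>i<r. mdiff Z z (\<lambda>y. \<psi> (fst (H y)) (snd (H y)) i))"
    using triv_pull[OF W(1)] W(2) zV holo_map_total_coord[OF U E Z 2 z W(1)]
    by (intro exI[of _ "pts V \<inter> f -` W"] exI[of _ r] exI[of _ "\<lambda>v. \<psi> (f v)"]) simp
qed

end

lemma vbundle_eqI: "fibre E = fibre E' \<Longrightarrow> trivs E = trivs E' \<Longrightarrow> (E :: ('u, 'e) vbundle) = E'"
  by (rule vbundle.equality) auto

text \<open>Fibres agree because both are read off at \<open>f (g z)\<close>. For trivialisations,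
  those pulled back twice are those pulled back along the composite; compatibility with these is
  implied by membership on the left and, by \<open>holo_compatible_pull_sufficient\<close>, forces
  membership there.\<close>

lemma pull_bundle_compose:
  assumes Z: "holo_atlas Z" and V: "holo_atlas V" and U: "holo_atlas U"
    and g: "holo_map Z V g" and f: "holo_map V U f" and E: "holo_bundle U E"
  shows "pull_bundle Z V g (pull_bundle V U f E) = pull_bundle Z U (\<lambda>z. f (g z)) E"
proof (rule vbundle_eqI)
  let ?L = "pull_bundle Z V g (pull_bundle V U f E)" and ?R = "pull_bundle Z U (\<lambda>z. f (g z)) E"
  show F: "fibre ?L = fibre ?R"
    using holo_map_pts[OF g] by (auto simp: fibre_pull_restrict fun_eq_iff)
  note P = holo_bundle_pull[OF V U f E]
  have eq: "pts Z \<inter> g -` (pts V \<inter> f -` W) = pts Z \<inter> (\<lambda>z. f (g z)) -` W" for W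
    using holo_map_pts[OF g] by auto
  show "trivs ?L = trivs ?R"
  proof (intro subset_antisym subsetI)
    fix t assume t: "t \<in> trivs ?L"
    have "holo_compatible Z (fibre ?L) t (pts Z \<inter> (\<lambda>z. f (g z)) -` W, r, \<lambda>z. \<psi> (f (g z)))"
      if "(W, r, \<psi>) \<in> trivs E" for W r \<psi>
      using t triv_pull[OF V U f E that] eq unfolding trivs_pull_iff[of t Z V] by fastforce
    then show "t \<in> trivs ?R"
      using t unfolding trivs_pull_iff[of t Z U] F[symmetric] by (auto simp: trivs_pull_iff[of t Z V])
  next
    fix t assume t: "t \<in> trivs ?R"
    then have lt: "local_triv Z (fibre ?L) t" unfolding F by (simp add: trivs_pull_iff)
    show "t \<in> trivs ?L"
      unfolding trivs_pull_iff[of t Z V]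
    proof (intro conjI lt, clarify)
      fix W r \<psi> assume W: "(W, r, \<psi>) \<in> trivs (pull_bundle V U f E)"
      have gf: "holo_map Z U (\<lambda>z. f (g z))" by (rule holo_map_compose[OF Z V U g f])
      have "holo_compatible Z (fibre ?R) (pts Z \<inter> g -` W, r, \<lambda>v. \<psi> (g v)) t"
      proof (rule holo_compatible_pull_sufficient[OF Z U gf E _ t])
        show "local_triv Z (fibre ?R) (pts Z \<inter> g -` W, r, \<lambda>v. \<psi> (g v))"
          unfolding F[symmetric] by (rule local_triv_pull[OF Z V g P W])
        fix W' r' \<psi>' assume W': "(W', r', \<psi>') \<in> trivs E"
        have "holo_compatible Z (fibre ?L) (pts Z \<inter> g -` W, r, \<lambda>v. \<psi> (g v))
            (pts Z \<inter> g -` (pts V \<inter> f -` W'), r', \<lambda>v. \<psi>' (f (g v)))"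
          using triv_pull[OF Z V g P W] triv_pull[OF V U f E W'] unfolding trivs_pull_iff[of _ Z V] by fast
        then show "holo_compatible Z (fibre ?R) (pts Z \<inter> g -` W, r, \<lambda>v. \<psi> (g v))
            (pts Z \<inter> (\<lambda>z. f (g z)) -` W', r', \<lambda>v. \<psi>' (f (g v)))"
          unfolding F eq .
      qed
      then show "holo_compatible Z (fibre ?L) t (pts Z \<inter> g -` W, r, \<lambda>v. \<psi> (g v))"
        unfolding F by (subst holo_compatible_sym)
    qed
  qed
qed

lemma holo_transition_cong:
  assumes "\<And>x. x \<in> V \<inter> V' \<Longrightarrow> \<psi> x = \<xi> x" "\<And>x. x \<in> V \<inter> V' \<Longrightarrow> \<psi>' x = \<xi>' x"
  shows "holo_transition U F (V, r, \<psi>) (V', r', \<psi>') \<longleftrightarrow> holo_transition U F (V, r, \<xi>) (V', r', \<xi>')"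
  unfolding holo_transition_def using assms by simp

text \<open>Maps built in different ways agree only on the points of the manifold, so equality of
  functions would be too much to ask. Compatibility inspects overlaps inside \<open>pts V\<close>
  only.\<close>

lemma pull_bundle_cong:
  fixes V :: "'v cmfd" and U :: "'u cmfd" and E :: "('u, 'e) vbundle"
  assumes "\<And>v. v \<in> pts V \<Longrightarrow> f v = g v"
  shows "pull_bundle V U f E = pull_bundle V U g E"
proof (rule vbundle_eqI)
  show F: "fibre (pull_bundle V U f E) = fibre (pull_bundle V U g E)"
    by (auto simp: fibre_pull_restrict assms)
  have eq: "pts V \<inter> f -` W = pts V \<inter> g -` W" for W using assms by auto
  have "holo_compatible V F t (pts V \<inter> f -` W, r, \<lambda>v. \<psi> (f v)) \<longleftrightarrow>
      holo_compatible V F t (pts V \<inter> g -` W, r, \<lambda>v. \<psi> (g v))"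
    for F :: "'v \<Rightarrow> (complex, 'e) module" and t W r \<psi>
  proof -
    obtain S k \<xi> where t: "t = (S, k, \<xi>)" by (cases t) auto
    show ?thesis
      unfolding t holo_compatible_def eq
      by (intro arg_cong2[of _ _ _ _ "(\<and>)"] holo_transition_cong) (auto simp: assms)
  qed
  note c = this
  have "t \<in> trivs (pull_bundle V U f E) \<longleftrightarrow> t \<in> trivs (pull_bundle V U g E)" for t
    unfolding trivs_pull_iff F
    by (intro conj_cong refl ball_cong) (rename_tac p, case_tac p, simp only: prod.case, rule c)
  then show "trivs (pull_bundle V U f E) = trivs (pull_bundle V U g E)" by blast
qed

text \<open>Strict unitality comes from two clauses of \<open>holo_bundle\<close>:
  \<open>fibre E\<close> is extensional and \<open>trivs E\<close> is maximal.\<close>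

lemma pull_bundle_id:
  assumes U: "holo_atlas U" and E: "holo_bundle U E"
  shows "pull_bundle U U (\<lambda>x. x) E = E"
proof (rule vbundle_eqI)
  have "fibre E \<in> extensional (pts U)" using E by (simp add: holo_bundle_def)
  then show F: "fibre (pull_bundle U U (\<lambda>x. x) E) = fibre E"
    by (simp add: fibre_pull_restrict extensional_restrict)
  have eq: "pts U \<inter> (\<lambda>x. x) -` W = W" if "(W, r, \<psi>) \<in> trivs E" for W r \<psi>
    using triv_pts[OF U E that] by auto
  show "trivs (pull_bundle U U (\<lambda>x. x) E) = trivs E"
  proof (intro subset_antisym subsetI)
    fix t assume t: "t \<in> trivs (pull_bundle U U (\<lambda>x. x) E)"
    show "t \<in> trivs E"
    proof (rule holo_bundle_trivI[OF E])
      show "local_triv U (fibre E) t" using t by (simp add: trivs_pull_iff F)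
      fix t' assume "t' \<in> trivs E"
      then show "holo_compatible U (fibre E) t t'"
        using t eq unfolding trivs_pull_iff F by (cases t') fastforce
    qed
  next
    fix t assume t: "t \<in> trivs E"
    show "t \<in> trivs (pull_bundle U U (\<lambda>x. x) E)"
      unfolding trivs_pull_iff F
    proof (intro conjI holo_bundle_local_triv[OF E t], clarify)
      fix W r \<psi> assume W: "(W, r, \<psi>) \<in> trivs E"
      show "holo_compatible U (fibre E) t (pts U \<inter> (\<lambda>x. x) -` W, r, \<psi>)"
        unfolding eq[OF W] by (rule holo_bundle_compatible[OF E t W])
    qed
  qed
qed

section \<open>Isomorphisms of bundles\<close>

lemma clinear_compose: "clinear A B f \<Longrightarrow> clinear B C g \<Longrightarrow> clinear A C (\<lambda>a. g (f a))"
  by (auto simp: clinear_def Pi_iff)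

lemma clinear_cong:
  assumes "module complex_ring A" "\<And>a. a \<in> carrier A \<Longrightarrow> f a = g a" "clinear A B f"
  shows "clinear A B g"
  using assms(2,3) module_add_closed[OF assms(1)] module_smult_closed[OF assms(1)]
  by (auto simp: clinear_def Pi_iff)

lemma bundle_isosI:
  assumes "\<alpha> \<in> extensional (pts U)" "\<And>x. x \<in> pts U \<Longrightarrow> \<alpha> x \<in> extensional (carrier (fibre E x))"
    "\<And>x. x \<in> pts U \<Longrightarrow> clinear (fibre E x) (fibre E' x) (\<alpha> x)"
    "\<And>x. x \<in> pts U \<Longrightarrow> bij_betw (\<alpha> x) (carrier (fibre E x)) (carrier (fibre E' x))"
    "holo_map (total_space U E) (total_space U E') (\<lambda>(x, e). (x, \<alpha> x e))"
    "holo_map (total_space U E') (total_space U E)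
      (\<lambda>(x, e). (x, inv_into (carrier (fibre E x)) (\<alpha> x) e))"
  shows "\<alpha> \<in> bundle_isos U E E'"
  using assms by (simp add: bundle_isos_def)

lemma bundle_isosD:
  assumes "\<alpha> \<in> bundle_isos U E E'"
  shows "\<alpha> \<in> extensional (pts U)"
    "x \<in> pts U \<Longrightarrow> \<alpha> x \<in> extensional (carrier (fibre E x))"
    "x \<in> pts U \<Longrightarrow> clinear (fibre E x) (fibre E' x) (\<alpha> x)"
    "x \<in> pts U \<Longrightarrow> bij_betw (\<alpha> x) (carrier (fibre E x)) (carrier (fibre E' x))"
    "x \<in> pts U \<Longrightarrow> e \<in> carrier (fibre E x) \<Longrightarrow> \<alpha> x e \<in> carrier (fibre E' x)"
    "holo_map (total_space U E) (total_space U E') (\<lambda>(x, e). (x, \<alpha> x e))"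
    "holo_map (total_space U E') (total_space U E)
      (\<lambda>(x, e). (x, inv_into (carrier (fibre E x)) (\<alpha> x) e))"
  using assms by (auto simp: bundle_isos_def bij_betw_def)

lemma bundle_isos_id:
  assumes U: "holo_atlas U" and E: "holo_bundle U E"
  shows "(\<lambda>x\<in>pts U. \<lambda>e\<in>carrier (fibre E x). e) \<in> bundle_isos U E E"
proof (rule bundle_isosI)
  let ?\<alpha> = "\<lambda>x\<in>pts U. \<lambda>e\<in>carrier (fibre E x). e"
  note A = holo_atlas_total[OF U E]
  fix x assume x: "x \<in> pts U"
  show "clinear (fibre E x) (fibre E x) (?\<alpha> x)"
    by (rule clinear_cong[OF holo_bundle_module[OF E x], of "\<lambda>e. e"]) (use x in \<open>auto simp: clinear_def\<close>)
  show "bij_betw (?\<alpha> x) (carrier (fibre E x)) (carrier (fibre E x))"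
    using x by (auto simp: bij_betw_def inj_on_def)
next
  let ?\<alpha> = "\<lambda>x\<in>pts U. \<lambda>e\<in>carrier (fibre E x). e"
  note A = holo_atlas_total[OF U E]
  show "holo_map (total_space U E) (total_space U E) (\<lambda>(x, e). (x, ?\<alpha> x e))"
    by (rule holo_map_cong[OF A A _ holo_map_id[OF A]]) (auto simp: pts_total[OF U E])
  have "inv_into (carrier (fibre E x)) (?\<alpha> x) e = e" if "x \<in> pts U" "e \<in> carrier (fibre E x)" for x e
    using inv_into_f_f[of "?\<alpha> x" "carrier (fibre E x)" e] that by (simp add: inj_on_def)
  then show "holo_map (total_space U E) (total_space U E)
      (\<lambda>(x, e). (x, inv_into (carrier (fibre E x)) (?\<alpha> x) e))"
    by (intro holo_map_cong[OF A A _ holo_map_id[OF A]]) (auto simp: pts_total[OF U E])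
qed auto

lemma bundle_isos_comp:
  assumes U: "holo_atlas U" and E: "holo_bundle U E" "holo_bundle U E'" "holo_bundle U E''"
    and \<alpha>: "\<alpha> \<in> bundle_isos U E E'" and \<beta>: "\<beta> \<in> bundle_isos U E' E''"
  shows "(\<lambda>x\<in>pts U. compose (carrier (fibre E x)) (\<beta> x) (\<alpha> x)) \<in> bundle_isos U E E''"
proof (rule bundle_isosI)
  let ?\<gamma> = "\<lambda>x\<in>pts U. compose (carrier (fibre E x)) (\<beta> x) (\<alpha> x)"
  note A = holo_atlas_total[OF U E(1)] holo_atlas_total[OF U E(2)] holo_atlas_total[OF U E(3)]
  show "clinear (fibre E x) (fibre E'' x) (?\<gamma> x)" if x: "x \<in> pts U" for x
    by (rule clinear_cong[OF holo_bundle_module[OF E(1) x] _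
          clinear_compose[OF bundle_isosD(3)[OF \<alpha> x] bundle_isosD(3)[OF \<beta> x]]])
      (simp add: x compose_def)
  show bij: "bij_betw (?\<gamma> x) (carrier (fibre E x)) (carrier (fibre E'' x))" if x: "x \<in> pts U" for x
    using bij_betw_compose[OF bundle_isosD(4)[OF \<alpha> x] bundle_isosD(4)[OF \<beta> x]] x by simp
  have "holo_map (total_space U E) (total_space U E'')
      (\<lambda>p. case (case p of (x, e) \<Rightarrow> (x, \<alpha> x e)) of (x, e) \<Rightarrow> (x, \<beta> x e))"
    by (rule holo_map_compose[OF A bundle_isosD(6)[OF \<alpha>] bundle_isosD(6)[OF \<beta>]])
  then show "holo_map (total_space U E) (total_space U E'') (\<lambda>(x, e). (x, ?\<gamma> x e))"
    by (rule holo_map_cong[OF A(1,3), rotated]) (auto simp: pts_total[OF U E(1)] compose_def)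
  have "holo_map (total_space U E'') (total_space U E)
      (\<lambda>p. case (case p of (x, e) \<Rightarrow> (x, inv_into (carrier (fibre E' x)) (\<beta> x) e))
        of (x, e) \<Rightarrow> (x, inv_into (carrier (fibre E x)) (\<alpha> x) e))"
    by (rule holo_map_compose[OF A(3,2,1) bundle_isosD(7)[OF \<beta>] bundle_isosD(7)[OF \<alpha>]])
  then show "holo_map (total_space U E'') (total_space U E)
      (\<lambda>(x, e). (x, inv_into (carrier (fibre E x)) (?\<gamma> x) e))"
  proof (rule holo_map_cong[OF A(3,1), rotated])
    fix p assume p: "p \<in> pts (total_space U E'')"
    obtain x e where pe: "p = (x, e)" by (cases p)
    have x: "x \<in> pts U" and e: "e \<in> carrier (fibre E'' x)" using p by (simp_all add: pe pts_total[OF U E(3)])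
    define e' where "e' = inv_into (carrier (fibre E' x)) (\<beta> x) e"
    define e0 where "e0 = inv_into (carrier (fibre E x)) (\<alpha> x) e'"
    have e': "e' \<in> carrier (fibre E' x)" "\<beta> x e' = e"
      using bundle_isosD(4)[OF \<beta> x] e inv_into_into f_inv_into_f unfolding e'_def bij_betw_def by metis+
    have e0: "e0 \<in> carrier (fibre E x)" "\<alpha> x e0 = e'"
      using bundle_isosD(4)[OF \<alpha> x] e'(1) inv_into_into f_inv_into_f unfolding e0_def bij_betw_def by metis+
    have "inv_into (carrier (fibre E x)) (?\<gamma> x) (?\<gamma> x e0) = e0"
      by (rule inv_into_f_f[OF bij_betw_imp_inj_on[OF bij[OF x]] e0(1)])
    moreover have "?\<gamma> x e0 = e" using x e0 e' by (simp add: compose_def)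
    ultimately have "inv_into (carrier (fibre E x)) (?\<gamma> x) e = e0" by simp
    then show "(case case p of (x, e) \<Rightarrow> (x, inv_into (carrier (fibre E' x)) (\<beta> x) e) of
          (x, e) \<Rightarrow> (x, inv_into (carrier (fibre E x)) (\<alpha> x) e)) =
         (case p of (x, e) \<Rightarrow> (x, inv_into (carrier (fibre E x)) (?\<gamma> x) e))"
      by (simp add: pe e0_def e'_def)
  qed
qed (simp_all add: compose_def)

text \<open>Both the map and its inverse land in a pullback, so by \<open>holo_map_into_pull\<close>
  it suffices to follow them by the projection to the total space over \<open>U\<close>, where they
  are composites with the given isomorphism or its inverse.\<close>

lemma pull_iso_bundle_isos:
  assumes V: "holo_atlas V" and U: "holo_atlas U" and f: "holo_map V U f"
    and E: "holo_bundle U E" "holo_bundle U E'" and \<alpha>: "\<alpha> \<in> bundle_isos U E E'"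
  shows "pull_iso V f \<alpha> \<in> bundle_isos V (pull_bundle V U f E) (pull_bundle V U f E')"
proof (rule bundle_isosI)
  note P = holo_bundle_pull[OF V U f E(1)] holo_bundle_pull[OF V U f E(2)]
  note A = holo_atlas_total[OF V P(1)] holo_atlas_total[OF V P(2)]
    holo_atlas_total[OF U E(1)] holo_atlas_total[OF U E(2)]
  have "holo_map (total_space V (pull_bundle V U f E)) (total_space U E')
      (\<lambda>p. case (case p of (v, e) \<Rightarrow> (f v, e)) of (x, e) \<Rightarrow> (x, \<alpha> x e))"
    by (rule holo_map_compose[OF A(1,3,4) holo_map_pull_total[OF V U f E(1)] bundle_isosD(6)[OF \<alpha>]])
  then have 1: "holo_map (total_space V (pull_bundle V U f E)) (total_space U E') (\<lambda>p. (f (fst p), \<alpha> (f (fst p)) (snd p)))"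
    by (simp add: case_prod_unfold)
  have "holo_map (total_space V (pull_bundle V U f E)) (total_space V (pull_bundle V U f E'))
      (\<lambda>p. (fst p, \<alpha> (f (fst p)) (snd p)))"
    by (rule holo_map_into_pull[OF V U f E(2) A(1)]) (simp_all add: holo_total_fst[OF V P(1)] 1)
  then show "holo_map (total_space V (pull_bundle V U f E)) (total_space V (pull_bundle V U f E'))
      (\<lambda>(v, e). (v, pull_iso V f \<alpha> v e))"
    by (rule holo_map_cong[OF A(1,2), rotated]) (auto simp: pts_total[OF V P(1)] pull_iso_def)
  have "holo_map (total_space V (pull_bundle V U f E')) (total_space U E)
      (\<lambda>p. case (case p of (v, e) \<Rightarrow> (f v, e)) of (x, e) \<Rightarrow> (x, inv_into (carrier (fibre E x)) (\<alpha> x) e))"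
    by (rule holo_map_compose[OF A(2,4,3) holo_map_pull_total[OF V U f E(2)] bundle_isosD(7)[OF \<alpha>]])
  then have 2: "holo_map (total_space V (pull_bundle V U f E')) (total_space U E)
      (\<lambda>p. (f (fst p), inv_into (carrier (fibre E (f (fst p)))) (\<alpha> (f (fst p))) (snd p)))"
    by (simp add: case_prod_unfold)
  have "holo_map (total_space V (pull_bundle V U f E')) (total_space V (pull_bundle V U f E))
      (\<lambda>p. (fst p, inv_into (carrier (fibre E (f (fst p)))) (\<alpha> (f (fst p))) (snd p)))"
    by (rule holo_map_into_pull[OF V U f E(1) A(2)]) (simp_all add: holo_total_fst[OF V P(2)] 2)
  then show "holo_map (total_space V (pull_bundle V U f E')) (total_space V (pull_bundle V U f E))
      (\<lambda>(v, e). (v, inv_into (carrier (fibre (pull_bundle V U f E) v)) (pull_iso V f \<alpha> v) e))"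
    by (rule holo_map_cong[OF A(2,1), rotated]) (auto simp: pts_total[OF V P(2)] pull_iso_def)
qed (use holo_map_pts[OF f] bundle_isosD[OF \<alpha>] in \<open>auto simp: pull_iso_def\<close>)

section \<open>Germs and tangent vectors\<close>

context
  fixes U :: "'u cmfd"
  assumes U: "holo_atlas U"
begin

lemma germ_fun_iff:
  assumes x: "x \<in> pts U"
  shows "h \<in> germ_fun U x \<longleftrightarrow> eventually (\<lambda>y. mdiff U y h) (mnhds U x)"
proof -
  have "(\<exists>V. openin (mtop U) V \<and> x \<in> V \<and> mholo U V h) \<longleftrightarrow>
      (\<exists>V. openin (mtop U) V \<and> x \<in> V \<and> (\<forall>y\<in>V. mdiff U y h))"
    using mholo_iff_mdiff[OF U] by blast
  then show ?thesis by (simp add: germ_fun_def eventually_mnhds[OF U x])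
qed

lemma germ_fun_mdiff: "x \<in> pts U \<Longrightarrow> h \<in> germ_fun U x \<Longrightarrow> mdiff U x h"
  unfolding germ_fun_iff by (rule eventually_mnhds_self[OF U])

lemma germ_eq_iff: "x \<in> pts U \<Longrightarrow> germ_eq U x h k \<longleftrightarrow> eventually (\<lambda>y. h y = k y) (mnhds U x)"
  by (simp add: germ_eq_def eventually_mnhds[OF U])

lemma eventually_mdiff_cong:
  assumes h: "eventually (\<lambda>y. mdiff U y h) (mnhds U x)" and ev: "eventually (\<lambda>y. h y = k y) (mnhds U x)"
  shows "eventually (\<lambda>y. mdiff U y k) (mnhds U x)"
  using h eventually_eventually_mnhds[OF ev] by eventually_elim (rule mdiff_cong[OF U])

lemma germ_fun_cong:
  assumes x: "x \<in> pts U" and h: "h \<in> germ_fun U x" and ev: "eventually (\<lambda>y. h y = k y) (mnhds U x)"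
  shows "k \<in> germ_fun U x"
  using eventually_mdiff_cong[OF _ ev] h by (simp add: germ_fun_iff[OF x])

lemma germ_fun_const: "x \<in> pts U \<Longrightarrow> (\<lambda>_. c) \<in> germ_fun U x"
  by (simp add: germ_fun_iff mdiff_const)

lemma germ_fun_add:
  "x \<in> pts U \<Longrightarrow> h \<in> germ_fun U x \<Longrightarrow> k \<in> germ_fun U x \<Longrightarrow> (\<lambda>y. h y + k y) \<in> germ_fun U x"
  unfolding germ_fun_iff by (erule (1) eventually_elim2) (rule mdiff_add)

lemma germ_fun_mult:
  "x \<in> pts U \<Longrightarrow> h \<in> germ_fun U x \<Longrightarrow> k \<in> germ_fun U x \<Longrightarrow> (\<lambda>y. h y * k y) \<in> germ_fun U x"
  unfolding germ_fun_iff by (erule (1) eventually_elim2) (rule mdiff_mult)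

lemma germ_fun_sum:
  assumes x: "x \<in> pts U" and h: "\<And>i. i \<in> I \<Longrightarrow> h i \<in> germ_fun U x"
  shows "(\<lambda>y. \<Sum>i\<in>I. h i y) \<in> germ_fun U x"
  using h
proof (induction I rule: infinite_finite_induct)
  case (insert i I)
  then have "(\<lambda>y. h i y + (\<Sum>i\<in>I. h i y)) \<in> germ_fun U x"
    by (intro germ_fun_add[OF x]) auto
  then show ?case using insert.hyps by simp
qed (simp_all add: germ_fun_const[OF x])

lemma tangent_spaceI:
  assumes x: "x \<in> pts U" and "v \<in> extensional (germ_fun U x)"
    and "\<And>h k. h \<in> germ_fun U x \<Longrightarrow> k \<in> germ_fun U x \<Longrightarrow> eventually (\<lambda>y. h y = k y) (mnhds U x) \<Longrightarrow> v h = v k"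
    and "\<And>h k. h \<in> germ_fun U x \<Longrightarrow> k \<in> germ_fun U x \<Longrightarrow> v (\<lambda>y. h y + k y) = v h + v k"
    and "\<And>h k. h \<in> germ_fun U x \<Longrightarrow> k \<in> germ_fun U x \<Longrightarrow> v (\<lambda>y. h y * k y) = v h * k x + h x * v k"
    and "\<And>c h. h \<in> germ_fun U x \<Longrightarrow> v (\<lambda>y. c * h y) = c * v h"
  shows "v \<in> tangent_space U x"
  unfolding tangent_space_def germ_eq_iff[OF x]
  by (intro CollectI conjI ballI allI impI; rule assms; assumption)

context
  fixes x v
  assumes x: "x \<in> pts U" and v: "v \<in> tangent_space U x"
begin

lemma tangent_cong:
  assumes h: "h \<in> germ_fun U x" and ev: "eventually (\<lambda>y. h y = k y) (mnhds U x)"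
  shows "v h = v k"
proof -
  have "\<forall>h\<in>germ_fun U x. \<forall>k\<in>germ_fun U x. (germ_eq U x h k \<longrightarrow> v h = v k) \<and>
       v (\<lambda>y. h y + k y) = v h + v k \<and> v (\<lambda>y. h y * k y) = v h * k x + h x * v k"
    using v unfolding tangent_space_def by blast
  from bspec[OF bspec[OF this h] germ_fun_cong[OF x h ev]] show ?thesis
    using ev by (simp only: germ_eq_iff[OF x])
qed

lemma tangent_extensional: "v \<in> extensional (germ_fun U x)"
  and tangent_add: "h \<in> germ_fun U x \<Longrightarrow> k \<in> germ_fun U x \<Longrightarrow> v (\<lambda>y. h y + k y) = v h + v k"
  and tangent_mult: "h \<in> germ_fun U x \<Longrightarrow> k \<in> germ_fun U x \<Longrightarrow> v (\<lambda>y. h y * k y) = v h * k x + h x * v k"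
  and tangent_scale: "h \<in> germ_fun U x \<Longrightarrow> v (\<lambda>y. c * h y) = c * v h"
  using v by (simp_all add: tangent_space_def)

lemma tangent_zero: "v (\<lambda>_. 0) = 0"
  using tangent_scale[OF germ_fun_const[OF x], of 0 0] by simp

lemma tangent_sum:
  "finite I \<Longrightarrow> (\<And>i. i \<in> I \<Longrightarrow> h i \<in> germ_fun U x) \<Longrightarrow> v (\<lambda>y. \<Sum>i\<in>I. h i y) = (\<Sum>i\<in>I. v (h i))"
  by (induction I rule: finite_induct) (simp_all add: tangent_zero tangent_add germ_fun_sum[OF x])

end

text \<open>Coordinate vectors are defined by \<open>deriv\<close>. Reading them off an explicit
  gradient lets the tangent space axioms follow from the rules for \<open>has_cgrad\<close>.\<close>

lemma coord_vector_eq: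
  assumes C: "(W, d, \<phi>) \<in> charts U" and x: "x \<in> W" and i: "i < d" and h: "h \<in> germ_fun U x"
    and c: "has_cgrad d (\<lambda>z. h (inv_into W \<phi> z)) (\<phi> x) c"
  shows "coord_vector U (W, d, \<phi>) i x h = c i"
  using has_cgrad_deriv[OF c chart_cspace[OF U C x] i] h by (simp add: coord_vector_def)

lemma germ_fun_has_cgrad:
  assumes C: "(W, d, \<phi>) \<in> charts U" and x: "x \<in> W" and h: "h \<in> germ_fun U x"
  obtains c where "has_cgrad d (\<lambda>z. h (inv_into W \<phi> z)) (\<phi> x) c"
  using germ_fun_mdiff[OF chart_pts[OF U C x] h] unfolding mdiff_chart[OF U C x] cdiff_def by blast

lemma coord_vector_tangent:
  assumes C: "(W, d, \<phi>) \<in> charts U" and x: "x \<in> W" and i: "i < d"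
  shows "coord_vector U (W, d, \<phi>) i x \<in> tangent_space U x"
proof (rule tangent_spaceI)
  note eq = coord_vector_eq[OF C x i] and xp = chart_pts[OF U C x]
  show "x \<in> pts U" by (rule xp)
  show "coord_vector U (W, d, \<phi>) i x \<in> extensional (germ_fun U x)" by (simp add: coord_vector_def)
  fix h assume h: "h \<in> germ_fun U x"
  obtain c where c: "has_cgrad d (\<lambda>z. h (inv_into W \<phi> z)) (\<phi> x) c" by (rule germ_fun_has_cgrad[OF C x h])
  {
    fix k assume k: "k \<in> germ_fun U x" and ev: "eventually (\<lambda>y. h y = k y) (mnhds U x)"
    have "has_cgrad d (\<lambda>z. k (inv_into W \<phi> z)) (\<phi> x) c"
      by (rule has_cgrad_cong[OF chart_cspace[OF U C x] _ c]) (use ev in \<open>simp add: eventually_mnhds_chart[OF U C x]\<close>)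
    then show "coord_vector U (W, d, \<phi>) i x h = coord_vector U (W, d, \<phi>) i x k"
      by (simp add: eq[OF h c] eq[OF k])
  next
    fix k assume k: "k \<in> germ_fun U x"
    obtain e where e: "has_cgrad d (\<lambda>z. k (inv_into W \<phi> z)) (\<phi> x) e" by (rule germ_fun_has_cgrad[OF C x k])
    show "coord_vector U (W, d, \<phi>) i x (\<lambda>y. h y + k y)
        = coord_vector U (W, d, \<phi>) i x h + coord_vector U (W, d, \<phi>) i x k"
      by (simp add: eq[OF h c] eq[OF k e] eq[OF germ_fun_add[OF xp h k] has_cgrad_add[OF c e]])
    show "coord_vector U (W, d, \<phi>) i x (\<lambda>y. h y * k y)
        = coord_vector U (W, d, \<phi>) i x h * k x + h x * coord_vector U (W, d, \<phi>) i x k"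
      by (simp add: eq[OF h c] eq[OF k e] eq[OF germ_fun_mult[OF xp h k] has_cgrad_mult[OF c e]]
          chart_inv[OF U C x])
  next
    fix b
    show "coord_vector U (W, d, \<phi>) i x (\<lambda>y. b * h y) = b * coord_vector U (W, d, \<phi>) i x h"
      by (simp add: eq[OF h c] eq[OF germ_fun_mult[OF xp germ_fun_const[OF xp] h] has_cgrad_mult[OF has_cgrad_const c]])
  }
qed

text \<open>Rests on \<open>cdiff_partial_deriv\<close> in the chart: here a derivative has to be
  differentiated again.\<close>

lemma mdiff_coord_vector:
  assumes C: "(W, d, \<phi>) \<in> charts U" and x: "x \<in> W" and i: "i < d" and h: "h \<in> germ_fun U x"
  shows "mdiff U x (\<lambda>y. coord_vector U (W, d, \<phi>) i y h)"
proof -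
  note xp = chart_pts[OF U C x]
  have ev: "eventually (\<lambda>z. z \<in> \<phi> ` W) (cnhds d (\<phi> x))" by (rule eventually_chart[OF U C x])
  have h': "eventually (\<lambda>y. mdiff U y h) (mnhds U x)" using h by (simp add: germ_fun_iff[OF xp])
  then have "eventually (\<lambda>z. mdiff U (inv_into W \<phi> z) h) (cnhds d (\<phi> x))"
    by (simp add: eventually_mnhds_chart[OF U C x])
  with ev have "eventually (cdiff d (\<lambda>z. h (inv_into W \<phi> z))) (cnhds d (\<phi> x))"
  proof eventually_elim
    case (elim z)
    then obtain y where y: "y \<in> W" "z = \<phi> y" by blast
    with elim(2) show ?case by (simp add: chart_inv[OF U C] mdiff_chart[OF U C])
  qed
  then have "cdiff d (\<lambda>z. deriv (\<lambda>w. h (inv_into W \<phi> (z(i := w)))) (z i)) (\<phi> x)"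
    by (rule cdiff_partial_deriv[OF chart_cspace[OF U C x] i])
  then have "cdiff d (\<lambda>z. coord_vector U (W, d, \<phi>) i (inv_into W \<phi> z) h) (\<phi> x)"
  proof (rule cdiff_cong[OF chart_cspace[OF U C x], rotated])
    \<comment> \<open>\<open>coord_vector\<close> returns a default value unless \<open>h\<close> is
      a germ at the base point, so \<open>h\<close> must be a holomorphic germ at every nearby
      point; hence the nested eventuality.\<close>
    have "eventually (\<lambda>y. eventually (\<lambda>y. mdiff U y h) (mnhds U y)) (mnhds U x)"
      by (rule eventually_eventually_mnhds[OF h'])
    then have "eventually (\<lambda>z. eventually (\<lambda>y. mdiff U y h) (mnhds U (inv_into W \<phi> z))) (cnhds d (\<phi> x))"
      by (simp add: eventually_mnhds_chart[OF U C x])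
    with ev show "\<forall>\<^sub>F z in cnhds d (\<phi> x). deriv (\<lambda>w. h (inv_into W \<phi> (z(i := w)))) (z i)
        = coord_vector U (W, d, \<phi>) i (inv_into W \<phi> z) h"
    proof eventually_elim
      case (elim z)
      then obtain y where y: "y \<in> W" "z = \<phi> y" by blast
      with elim(2) have "h \<in> germ_fun U y" by (simp add: chart_inv[OF U C] germ_fun_iff[OF chart_pts[OF U C]])
      then show ?case using y by (simp add: coord_vector_def chart_inv[OF U C])
    qed
  qed
  then show ?thesis by (simp add: mdiff_chart[OF U C x])
qed

end

lemma germ_fun_compose:
  assumes V: "holo_atlas V" and U: "holo_atlas U" and f: "holo_map V U f" and x: "x \<in> pts V"
    and h: "h \<in> germ_fun U (f x)"
  shows "(\<lambda>y. h (f y)) \<in> germ_fun V x"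
proof -
  have "eventually (\<lambda>u. mdiff U u h) (mnhds U (f x))"
    using h by (simp add: germ_fun_iff[OF U holo_map_pts[OF f x]])
  from eventually_compose_filterlim[OF this holo_map_filterlim[OF V U f x]] eventually_mnhds_pts[OF V]
  have "eventually (\<lambda>y. mdiff V y (\<lambda>y. h (f y))) (mnhds V x)"
    by eventually_elim (rule holo_map_mdiff[OF V U f])
  then show ?thesis by (simp add: germ_fun_iff[OF V x])
qed

lemma push_tangent_eq: "h \<in> germ_fun U (f x) \<Longrightarrow> push_tangent U f x v h = v (\<lambda>y. h (f y))"
  by (simp add: push_tangent_def)

lemma push_tangent_tangent:
  assumes V: "holo_atlas V" and U: "holo_atlas U" and f: "holo_map V U f" and x: "x \<in> pts V"
    and v: "v \<in> tangent_space V x"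
  shows "push_tangent U f x v \<in> tangent_space U (f x)"
proof (rule tangent_spaceI[OF U])
  note fx = holo_map_pts[OF f x] and gc = germ_fun_compose[OF V U f x]
  show "f x \<in> pts U" by (rule fx)
  show "push_tangent U f x v \<in> extensional (germ_fun U (f x))" by (simp add: push_tangent_def)
  fix h assume h: "h \<in> germ_fun U (f x)"
  {
    fix k assume k: "k \<in> germ_fun U (f x)" and ev: "eventually (\<lambda>y. h y = k y) (mnhds U (f x))"
    show "push_tangent U f x v h = push_tangent U f x v k"
      unfolding push_tangent_eq[of _ U f x, OF h] push_tangent_eq[of _ U f x, OF k]
      by (rule tangent_cong[OF V x v gc[OF h]])
        (rule eventually_compose_filterlim[OF ev holo_map_filterlim[OF V U f x]])
  next
    fix k assume k: "k \<in> germ_fun U (f x)"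
    show "push_tangent U f x v (\<lambda>y. h y + k y) = push_tangent U f x v h + push_tangent U f x v k"
      by (simp add: push_tangent_eq h k germ_fun_add[OF U fx] tangent_add[OF V x v] gc)
    show "push_tangent U f x v (\<lambda>y. h y * k y) = push_tangent U f x v h * k (f x) + h (f x) * push_tangent U f x v k"
      by (simp add: push_tangent_eq h k germ_fun_mult[OF U fx] tangent_mult[OF V x v] gc)
  next
    fix c
    show "push_tangent U f x v (\<lambda>y. c * h y) = c * push_tangent U f x v h"
      by (simp add: push_tangent_eq h germ_fun_mult[OF U fx germ_fun_const[OF U fx]] tangent_scale[OF V x v] gc)
  }
qed

text \<open>The chain rule, tested on germs: both sides are computed from the gradients of
  \<open>h\<close> and of the coordinates of \<open>f\<close> in charts. The restriction to germs on
  the right is there because tangent vectors are extensional.\<close>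

lemma push_coord_vector:
  assumes V: "holo_atlas V" and U: "holo_atlas U" and f: "holo_map V U f"
    and C: "(W, d, \<phi>) \<in> charts V" and x: "x \<in> W" and i: "i < d"
    and C': "(W', d', \<phi>') \<in> charts U" and fx: "f x \<in> W'"
  shows "push_tangent U f x (coord_vector V (W, d, \<phi>) i x) =
    (\<lambda>h\<in>germ_fun U (f x). \<Sum>l<d'. coord_vector V (W, d, \<phi>) i x (\<lambda>y. \<phi>' (f y) l) *
        coord_vector U (W', d', \<phi>') l (f x) h)"
proof (rule extensionalityI[of _ "germ_fun U (f x)"])
  fix h assume h: "h \<in> germ_fun U (f x)"
  note xp = chart_pts[OF V C x]
  obtain c where c: "has_cgrad d' (\<lambda>z. h (inv_into W' \<phi>' z)) (\<phi>' (f x)) c"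
    by (rule germ_fun_has_cgrad[OF U C' fx h])
  have g: "(\<lambda>y. \<phi>' (f y) l) \<in> germ_fun V x" if l: "l < d'" for l
  proof (rule germ_fun_compose[OF V U f xp, where h = "\<lambda>u. \<phi>' u l"])
    show "(\<lambda>u. \<phi>' u l) \<in> germ_fun U (f x)"
      unfolding germ_fun_iff[OF U chart_pts[OF U C' fx]]
      using eventually_mnhds_open[OF openin_chart[OF U C'] fx]
      by eventually_elim (rule mdiff_chart_coord[OF U C' _ l])
  qed
  have "\<exists>k. \<forall>l<d'. has_cgrad d (\<lambda>z. \<phi>' (f (inv_into W \<phi> z)) l) (\<phi> x) (k l)"
    by (subst choice_iff'[symmetric]) (use germ_fun_has_cgrad[OF V C x g] in metis)
  then obtain k where k: "\<And>l. l < d' \<Longrightarrow> has_cgrad d (\<lambda>z. \<phi>' (f (inv_into W \<phi> z)) l) (\<phi> x) (k l)" by blast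
  have near: "eventually (\<lambda>z. f (inv_into W \<phi> z) \<in> W') (cnhds d (\<phi> x))"
    using eventually_compose_filterlim[OF eventually_mnhds_open[OF openin_chart[OF U C'] fx]
        holo_map_filterlim[OF V U f xp]]
    by (simp add: eventually_mnhds_chart[OF V C x])
  have "has_cgrad d (\<lambda>z. h (inv_into W' \<phi>' (\<phi>' (f (inv_into W \<phi> z))))) (\<phi> x) (\<lambda>i. \<Sum>l<d'. c l * k l i)"
    by (rule has_cgrad_compose[where f = "\<lambda>z. h (inv_into W' \<phi>' z)" and u = "\<lambda>z. \<phi>' (f (inv_into W \<phi> z))"])
      (use c k near chart_cspace[OF U C'] chart_cspace[OF V C x] in
        \<open>auto simp: chart_inv[OF V C x] elim: eventually_mono\<close>)
  then have hf: "has_cgrad d (\<lambda>z. h (f (inv_into W \<phi> z))) (\<phi> x) (\<lambda>i. \<Sum>l<d'. c l * k l i)"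
    by (rule has_cgrad_cong[OF chart_cspace[OF V C x], rotated])
      (use near in \<open>eventually_elim, simp add: chart_inv[OF U C']\<close>)
  have "push_tangent U f x (coord_vector V (W, d, \<phi>) i x) h = (\<Sum>l<d'. c l * k l i)"
    unfolding push_tangent_eq[of _ U f x, OF h]
    by (rule coord_vector_eq[OF V C x i germ_fun_compose[OF V U f xp h] hf])
  also have "\<dots> = (\<Sum>l<d'. coord_vector V (W, d, \<phi>) i x (\<lambda>y. \<phi>' (f y) l) *
        coord_vector U (W', d', \<phi>') l (f x) h)"
    by (rule sum.cong) (simp_all add: coord_vector_eq[OF V C x i g k] coord_vector_eq[OF U C' fx _ h c])
  finally show "push_tangent U f x (coord_vector V (W, d, \<phi>) i x) h =
      (\<lambda>h\<in>germ_fun U (f x). \<Sum>l<d'. coord_vector V (W, d, \<phi>) i x (\<lambda>y. \<phi>' (f y) l) *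
        coord_vector U (W', d', \<phi>') l (f x) h) h"
    using h by simp
qed (simp_all add: push_tangent_def)

section \<open>Sections\<close>

definition sec_at :: "'u cmfd \<Rightarrow> ('u, 'e) vbundle \<Rightarrow> 'u \<Rightarrow> ('u \<Rightarrow> 'e) \<Rightarrow> bool"
  where "sec_at U E x s \<longleftrightarrow> s x \<in> carrier (fibre E x) \<and>
    (\<forall>(W, r, \<psi>)\<in>trivs E. x \<in> W \<longrightarrow> (\<forall>i<r. mdiff U x (\<lambda>y. \<psi> y (s y) i)))"

definition tframe :: "('u, 'e) vbundle \<Rightarrow> ('u \<Rightarrow> 'e \<Rightarrow> nat \<Rightarrow> complex) \<Rightarrow> nat \<Rightarrow> 'u \<Rightarrow> 'e"
  where "tframe E \<psi> b y = inv_into (carrier (fibre E y)) (\<psi> y) (cunit b)"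

context
  fixes U :: "'u cmfd" and E :: "('u, 'e) vbundle"
  assumes U: "holo_atlas U" and E: "holo_bundle U E"
begin

lemma holo_section_iff: "holo_section U E V s \<longleftrightarrow> openin (mtop U) V \<and> (\<forall>x\<in>V. sec_at U E x s)"
proof -
  have "mholo U (V \<inter> W) (\<lambda>x. \<psi> x (s x) i) \<longleftrightarrow> (\<forall>x\<in>V \<inter> W. mdiff U x (\<lambda>x. \<psi> x (s x) i))"
    if "openin (mtop U) V" "(W, r, \<psi>) \<in> trivs E" for W r \<psi> i
    by (rule mholo_iff_mdiff[OF U openin_Int[OF that(1) triv_open[OF U E that(2)]]])
  then show ?thesis unfolding holo_section_def sec_at_def by fast
qed

lemma germ_section_iff:
  assumes "x \<in> pts U"
  shows "s \<in> germ_section U E x \<longleftrightarrow> eventually (\<lambda>y. sec_at U E y s) (mnhds U x)"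
  unfolding germ_section_def holo_section_iff eventually_mnhds[OF U assms] by blast

text \<open>Near \<open>x\<close> the coordinates in another trivialisation are the holomorphic
  matrix \<open>tmat\<close> applied to the given ones, so a single trivialisation is
  enough.\<close>

lemma sec_at_triv:
  assumes t: "(W, r, \<psi>) \<in> trivs E" "x \<in> W" and s: "eventually (\<lambda>y. s y \<in> carrier (fibre E y)) (mnhds U x)"
    and c: "\<And>i. i < r \<Longrightarrow> mdiff U x (\<lambda>y. \<psi> y (s y) i)"
  shows "sec_at U E x s"
  unfolding sec_at_def
proof (intro conjI, goal_cases)
  case 1
  show ?case by (rule eventually_mnhds_self[OF U triv_pts[OF U E t] s])
next
  case 2
  show ?case
  proof clarify
    fix W' r' \<psi>' i assume t': "(W', r', \<psi>') \<in> trivs E" "x \<in> W'" and i: "i < r'"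
    have "mdiff U x (\<lambda>y. \<Sum>b<r. tmat (fibre E) \<psi> \<psi>' i b y * \<psi> y (s y) b)"
      by (intro mdiff_sum mdiff_mult c triv_tmat_mdiff[OF U E t(1) t'(1) t(2) t'(2) i]) auto
    then show "mdiff U x (\<lambda>y. \<psi>' y (s y) i)"
      by (rule mdiff_cong[OF U, rotated], use s triv_eventually[OF U E t] triv_eventually[OF U E t'] in eventually_elim)
        (rule triv_expand[OF U E t(1) t'(1), symmetric])
  qed
qed

lemma sec_at_coord: "sec_at U E x s \<Longrightarrow> (W, r, \<psi>) \<in> trivs E \<Longrightarrow> x \<in> W \<Longrightarrow> i < r \<Longrightarrow> mdiff U x (\<lambda>y. \<psi> y (s y) i)"
  unfolding sec_at_def by fast

lemma sec_at_carrier: "sec_at U E x s \<Longrightarrow> s x \<in> carrier (fibre E x)"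
  by (simp add: sec_at_def)

lemma germ_section_eventually_carrier:
  "x \<in> pts U \<Longrightarrow> s \<in> germ_section U E x \<Longrightarrow> eventually (\<lambda>y. s y \<in> carrier (fibre E y)) (mnhds U x)"
  unfolding germ_section_iff by (erule eventually_mono) (rule sec_at_carrier)

lemma germ_section_carrier: "x \<in> pts U \<Longrightarrow> s \<in> germ_section U E x \<Longrightarrow> s x \<in> carrier (fibre E x)"
  using eventually_mnhds_self[OF U _ germ_section_eventually_carrier] .

lemma germ_section_coord:
  assumes x: "x \<in> pts U" and s: "s \<in> germ_section U E x" and t: "(W, r, \<psi>) \<in> trivs E" "x \<in> W" and i: "i < r"
  shows "(\<lambda>y. \<psi> y (s y) i) \<in> germ_fun U x"
  using s unfolding germ_section_iff[OF x] germ_fun_iff[OF U x]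
  by (rule eventually_elim2[OF _ triv_eventually[OF U E t]]) (rule sec_at_coord[OF _ t(1) _ i])

lemma germ_section_trivI:
  assumes t: "(W, r, \<psi>) \<in> trivs E" "x \<in> W" and s: "eventually (\<lambda>y. s y \<in> carrier (fibre E y)) (mnhds U x)"
    and c: "\<And>i. i < r \<Longrightarrow> (\<lambda>y. \<psi> y (s y) i) \<in> germ_fun U x"
  shows "s \<in> germ_section U E x"
proof -
  note x = triv_pts[OF U E t]
  have "eventually (\<lambda>y. \<forall>i\<in>{..<r}. mdiff U y (\<lambda>y. \<psi> y (s y) i)) (mnhds U x)"
    using c by (subst eventually_ball_finite_distrib) (auto simp: germ_fun_iff[OF U x])
  with triv_eventually[OF U E t] eventually_eventually_mnhds[OF s]
  have "eventually (\<lambda>y. sec_at U E y s) (mnhds U x)"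
    by eventually_elim (rule sec_at_triv[OF t(1)], auto)
  then show ?thesis by (simp add: germ_section_iff[OF x])
qed

lemma tframe_carrier: "(W, r, \<psi>) \<in> trivs E \<Longrightarrow> y \<in> W \<Longrightarrow> b < r \<Longrightarrow> tframe E \<psi> b y \<in> carrier (fibre E y)"
  and tframe_coord: "(W, r, \<psi>) \<in> trivs E \<Longrightarrow> y \<in> W \<Longrightarrow> b < r \<Longrightarrow> \<psi> y (tframe E \<psi> b y) = cunit b"
  unfolding tframe_def
  by (rule fibre_iso_inv[OF triv_module[OF U E] triv_fibre_iso[OF U E] cunit_cspace], assumption+)+

lemma tframe_sec_at:
  assumes t: "(W, r, \<psi>) \<in> trivs E" "x \<in> W" and b: "b < r"
  shows "sec_at U E x (tframe E \<psi> b)"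
proof (rule sec_at_triv[OF t])
  note ev = triv_eventually[OF U E t]
  show "\<forall>\<^sub>F y in mnhds U x. tframe E \<psi> b y \<in> carrier (fibre E y)"
    using ev by eventually_elim (rule tframe_carrier[OF t(1) _ b])
  show "mdiff U x (\<lambda>y. \<psi> y (tframe E \<psi> b y) i)" for i
    by (rule mdiff_cong[OF U _ mdiff_const[of U x "cunit b i"]], use ev in eventually_elim)
      (simp add: tframe_coord[OF t(1) _ b])
qed

lemma tframe_section: "(W, r, \<psi>) \<in> trivs E \<Longrightarrow> b < r \<Longrightarrow> holo_section U E W (tframe E \<psi> b)"
  unfolding holo_section_iff using triv_open[OF U E] tframe_sec_at by blast

lemma tframe_germ_section:
  "(W, r, \<psi>) \<in> trivs E \<Longrightarrow> x \<in> W \<Longrightarrow> b < r \<Longrightarrow> tframe E \<psi> b \<in> germ_section U E x"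
  unfolding germ_section_def using tframe_section by blast

lemma germ_section_add:
  assumes x: "x \<in> pts U" and s: "s \<in> germ_section U E x" "s' \<in> germ_section U E x"
  shows "(\<lambda>y. s y \<oplus>\<^bsub>fibre E y\<^esub> s' y) \<in> germ_section U E x"
proof -
  obtain W r \<psi> where t: "(W, r, \<psi>) \<in> trivs E" "x \<in> W" by (rule holo_bundle_triv_exists[OF E x])
  note ev = triv_eventually[OF U E t] germ_section_eventually_carrier[OF x s(1)]
    germ_section_eventually_carrier[OF x s(2)]
  show ?thesis
  proof (rule germ_section_trivI[OF t])
    show "\<forall>\<^sub>F y in mnhds U x. s y \<oplus>\<^bsub>fibre E y\<^esub> s' y \<in> carrier (fibre E y)"
      using ev by eventually_elim (rule module_add_closed[OF triv_module[OF U E t(1)]])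
    fix i assume i: "i < r"
    show "(\<lambda>y. \<psi> y (s y \<oplus>\<^bsub>fibre E y\<^esub> s' y) i) \<in> germ_fun U x"
      by (rule germ_fun_cong[OF U x germ_fun_add[OF U x germ_section_coord[OF x s(1) t i] germ_section_coord[OF x s(2) t i]]],
          use ev in eventually_elim) (simp add: fibre_iso_add[OF triv_module[OF U E t(1)] triv_fibre_iso[OF U E t(1)]])
  qed
qed

lemma germ_section_smult:
  assumes x: "x \<in> pts U" and s: "s \<in> germ_section U E x" and h: "h \<in> germ_fun U x"
  shows "(\<lambda>y. h y \<odot>\<^bsub>fibre E y\<^esub> s y) \<in> germ_section U E x"
proof -
  obtain W r \<psi> where t: "(W, r, \<psi>) \<in> trivs E" "x \<in> W" by (rule holo_bundle_triv_exists[OF E x])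
  note ev = triv_eventually[OF U E t] germ_section_eventually_carrier[OF x s]
  show ?thesis
  proof (rule germ_section_trivI[OF t])
    show "\<forall>\<^sub>F y in mnhds U x. h y \<odot>\<^bsub>fibre E y\<^esub> s y \<in> carrier (fibre E y)"
      using ev by eventually_elim (rule module_smult_closed[OF triv_module[OF U E t(1)]])
    fix i assume i: "i < r"
    show "(\<lambda>y. \<psi> y (h y \<odot>\<^bsub>fibre E y\<^esub> s y) i) \<in> germ_fun U x"
      by (rule germ_fun_cong[OF U x germ_fun_mult[OF U x h germ_section_coord[OF x s t i]]],
          use ev in eventually_elim) (simp add: fibre_iso_smult[OF triv_module[OF U E t(1)] triv_fibre_iso[OF U E t(1)]])
  qed
qed

lemma germ_section_cong:
  assumes x: "x \<in> pts U" and s: "s \<in> germ_section U E x" and ev: "eventually (\<lambda>y. s y = s' y) (mnhds U x)"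
  shows "s' \<in> germ_section U E x"
proof -
  obtain W r \<psi> where t: "(W, r, \<psi>) \<in> trivs E" "x \<in> W" by (rule holo_bundle_triv_exists[OF E x])
  show ?thesis
  proof (rule germ_section_trivI[OF t])
    show "\<forall>\<^sub>F y in mnhds U x. s' y \<in> carrier (fibre E y)"
      using germ_section_eventually_carrier[OF x s] ev by eventually_elim simp
    show "(\<lambda>y. \<psi> y (s' y) i) \<in> germ_fun U x" if "i < r" for i
      by (rule germ_fun_cong[OF U x germ_section_coord[OF x s t that]], use ev in eventually_elim) simp
  qed
qed

end

context
  fixes U :: "'u cmfd" and x
  assumes U: "holo_atlas U" and x: "x \<in> pts U"
begin

lemma tangent_space_add:
  assumes v: "v \<in> tangent_space U x" and w: "w \<in> tangent_space U x"
  shows "(\<lambda>h\<in>germ_fun U x. v h + w h) \<in> tangent_space U x"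
  by (rule tangent_spaceI[OF U x])
    (simp_all add: germ_fun_add[OF U x] germ_fun_mult[OF U x] germ_fun_mult[OF U x germ_fun_const[OF U x]]
      tangent_add[OF U x v] tangent_add[OF U x w] tangent_mult[OF U x v] tangent_mult[OF U x w]
      tangent_scale[OF U x v] tangent_scale[OF U x w] tangent_cong[OF U x v] tangent_cong[OF U x w] algebra_simps)

lemma tangent_space_scale:
  assumes v: "v \<in> tangent_space U x"
  shows "(\<lambda>h\<in>germ_fun U x. c * v h) \<in> tangent_space U x"
  by (rule tangent_spaceI[OF U x])
    (simp_all add: germ_fun_add[OF U x] germ_fun_mult[OF U x] germ_fun_mult[OF U x germ_fun_const[OF U x]]
      tangent_add[OF U x v] tangent_mult[OF U x v] tangent_scale[OF U x v] tangent_cong[OF U x v] algebra_simps)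

lemma tangent_space_zero: "(\<lambda>h\<in>germ_fun U x. 0) \<in> tangent_space U x"
  by (rule tangent_spaceI[OF U x])
    (simp_all add: germ_fun_add[OF U x] germ_fun_mult[OF U x] germ_fun_mult[OF U x germ_fun_const[OF U x]])

end

section \<open>Connections\<close>

context
  fixes U :: "'u cmfd" and E :: "('u, 'e) vbundle" and D
  assumes U: "holo_atlas U" and E: "holo_bundle U E" and D: "holo_connection U E D"
begin

lemma conn_extensional: "D \<in> extensional (pts U)"
  using D by (simp add: holo_connection_def)

lemma conn_holo:
  assumes s: "holo_section U E V s" and C: "(W, d, \<phi>) \<in> charts U" and i: "i < d"
  shows "holo_section U E (V \<inter> W) (\<lambda>x. D x (coord_vector U (W, d, \<phi>) i x) s)"
proof -
  have "\<forall>V s. holo_section U E V s \<longrightarrow> (\<forall>(W, d, \<phi>)\<in>charts U. \<forall>i<d.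
      holo_section U E (V \<inter> W) (\<lambda>x. D x (coord_vector U (W, d, \<phi>) i x) s))"
    using D unfolding holo_connection_def by (elim conjE)
  from bspec[OF mp[OF spec[OF spec[OF this]] s] C, unfolded prod.case] i show ?thesis by blast
qed

context
  fixes x
  assumes x: "x \<in> pts U"
begin

lemma conn_extensional_tangent: "D x \<in> extensional (tangent_space U x)"
  using D x by (simp add: holo_connection_def)

lemma conn_funcset: "v \<in> tangent_space U x \<Longrightarrow> D x v \<in> germ_section U E x \<rightarrow>\<^sub>E carrier (fibre E x)"
  using D x by (simp add: holo_connection_def)

lemma conn_closed: "v \<in> tangent_space U x \<Longrightarrow> s \<in> germ_section U E x \<Longrightarrow> D x v s \<in> carrier (fibre E x)"
  using conn_funcset by blast

lemma conn_cong:
  assumes v: "v \<in> tangent_space U x" and s: "s \<in> germ_section U E x" and ev: "eventually (\<lambda>y. s y = s' y) (mnhds U x)"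
  shows "D x v s = D x v s'"
proof -
  note s' = germ_section_cong[OF U E x s ev]
  have "germ_eq U x s s' \<longrightarrow> D x v s = D x v s'"
    by (rule D[unfolded holo_connection_def, THEN conjunct2, THEN conjunct1, THEN bspec, OF x, THEN conjunct2,
          THEN conjunct1, THEN bspec, OF v, THEN conjunct2, THEN conjunct1, THEN bspec, OF s, THEN bspec, OF s',
          THEN conjunct1])
  then show ?thesis using ev by (simp only: germ_eq_iff[OF U x])
qed

lemma conn_add:
  "v \<in> tangent_space U x \<Longrightarrow> s \<in> germ_section U E x \<Longrightarrow> s' \<in> germ_section U E x \<Longrightarrow>
    D x v (\<lambda>y. s y \<oplus>\<^bsub>fibre E y\<^esub> s' y) = D x v s \<oplus>\<^bsub>fibre E x\<^esub> D x v s'"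
  using D x by (simp add: holo_connection_def)

lemma conn_leibniz:
  "v \<in> tangent_space U x \<Longrightarrow> s \<in> germ_section U E x \<Longrightarrow> h \<in> germ_fun U x \<Longrightarrow>
    D x v (\<lambda>y. h y \<odot>\<^bsub>fibre E y\<^esub> s y)
      = v h \<odot>\<^bsub>fibre E x\<^esub> s x \<oplus>\<^bsub>fibre E x\<^esub> h x \<odot>\<^bsub>fibre E x\<^esub> D x v s"
  using D x by (simp add: holo_connection_def)

lemma conn_tangent_add:
  "v \<in> tangent_space U x \<Longrightarrow> w \<in> tangent_space U x \<Longrightarrow> s \<in> germ_section U E x \<Longrightarrow>
    D x (\<lambda>h\<in>germ_fun U x. v h + w h) s = D x v s \<oplus>\<^bsub>fibre E x\<^esub> D x w s"
  using D x by (simp add: holo_connection_def)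

lemma conn_tangent_scale:
  "v \<in> tangent_space U x \<Longrightarrow> s \<in> germ_section U E x \<Longrightarrow>
    D x (\<lambda>h\<in>germ_fun U x. c * v h) s = c \<odot>\<^bsub>fibre E x\<^esub> D x v s"
  using D x by (simp add: holo_connection_def)

text \<open>Prepares the connection for the finite sums of coordinate vectors produced by
  \<open>push_coord_vector\<close>. The axioms speak of restricted functions, so each partial sum is
  first shown to be a tangent vector of this form.\<close>

lemma conn_tangent_sum:
  assumes t: "(V, r, \<psi>) \<in> trivs E" "x \<in> V" and s: "s \<in> germ_section U E x"
    and w: "\<And>l. l < (n::nat) \<Longrightarrow> w l \<in> tangent_space U x"
  shows "(\<lambda>h\<in>germ_fun U x. \<Sum>l<n. c l * w l h) \<in> tangent_space U x \<and>
    \<psi> x (D x (\<lambda>h\<in>germ_fun U x. \<Sum>l<n. c l * w l h) s) j = (\<Sum>l<n. c l * \<psi> x (D x (w l) s) j)"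
  using w
proof (induction n)
  case 0
  note m = triv_module[OF U E t] and i = triv_fibre_iso[OF U E t]
  \<comment> \<open>The zero vector equals 0 times itself, so the axiom on scalar multiples makes
    its derivative vanish.\<close>
  define Z where "Z = (\<lambda>h\<in>germ_fun U x. 0 :: complex)"
  have Z: "Z \<in> tangent_space U x" unfolding Z_def by (rule tangent_space_zero[OF U x])
  have ZZ: "(\<lambda>h\<in>germ_fun U x. 0 * Z h) = Z" unfolding Z_def by (rule restrict_ext) simp
  have eq: "D x Z s = 0 \<odot>\<^bsub>fibre E x\<^esub> D x Z s"
    using conn_tangent_scale[OF Z s, of 0] unfolding ZZ .
  have "\<psi> x (D x Z s) j = \<psi> x (0 \<odot>\<^bsub>fibre E x\<^esub> D x Z s) j"
    by (rule arg_cong[OF eq])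
  also have "\<dots> = 0" by (simp add: fibre_iso_smult[OF m i conn_closed[OF Z s]])
  finally have D0: "\<psi> x (D x Z s) j = 0" .
  have Zeq: "(\<lambda>h\<in>germ_fun U x. \<Sum>l<0. c l * w l h) = Z" unfolding Z_def by (rule restrict_ext) simp
  show ?case unfolding Zeq using Z D0 by (simp del: restrict_apply)
next
  case (Suc n)
  note m = triv_module[OF U E t] and i = triv_fibre_iso[OF U E t]
  define S where "S = (\<lambda>h\<in>germ_fun U x. \<Sum>l<n. c l * w l h)"
  define T where "T = (\<lambda>h\<in>germ_fun U x. c n * w n h)"
  have IH: "S \<in> tangent_space U x \<and> \<psi> x (D x S s) j = (\<Sum>l<n. c l * \<psi> x (D x (w l) s) j)"
    unfolding S_def by (rule Suc.IH) (use Suc.prems in simp)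
  then have S: "S \<in> tangent_space U x" by blast
  have wn: "w n \<in> tangent_space U x" using Suc.prems by simp
  have T: "T \<in> tangent_space U x" unfolding T_def by (rule tangent_space_scale[OF U x wn])
  have eq: "(\<lambda>h\<in>germ_fun U x. \<Sum>l<Suc n. c l * w l h) = (\<lambda>h\<in>germ_fun U x. S h + T h)"
    unfolding S_def T_def by (rule restrict_ext) simp
  have "D x T s = c n \<odot>\<^bsub>fibre E x\<^esub> D x (w n) s"
    unfolding T_def by (rule conn_tangent_scale[OF wn s])
  then have "\<psi> x (D x (\<lambda>h\<in>germ_fun U x. S h + T h) s) j
      = \<psi> x (D x S s) j + c n * \<psi> x (D x (w n) s) j"
    unfolding conn_tangent_add[OF S T s]
    by (simp add: fibre_iso_add[OF m i] fibre_iso_smult[OF m i] conn_closed[OF S s] conn_closed[OF wn s]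
        module_smult_closed[OF m])
  then show ?case
    unfolding eq using tangent_space_add[OF U x S T] IH by (simp del: restrict_apply)
qed

text \<open>Expands \<open>s\<close> in the frame and applies additivity and the Leibniz rule. As in
  \<open>fibre_iso_expand\<close>, sums in the fibres are avoided by including one coordinate at a
  time; the derivative term appears in the induction once the index \<open>j\<close> has been
  included.\<close>

lemma conn_local:
  assumes v: "v \<in> tangent_space U x" and t: "(V, r, \<psi>) \<in> trivs E" "x \<in> V"
    and s: "s \<in> germ_section U E x" and j: "j < r"
  shows "\<psi> x (D x v s) j = v (\<lambda>y. \<psi> y (s y) j) + (\<Sum>b<r. \<psi> x (s x) b * \<psi> x (D x v (tframe E \<psi> b)) j)"
proof -
  note m = triv_module[OF U E t(1)] and i = triv_fibre_iso[OF U E t(1)]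
  note ev = triv_eventually[OF U E t]
  define p where "p k y = inv_into (carrier (fibre E y)) (\<psi> y) (\<lambda>i. if i < k then \<psi> y (s y) i else 0)" for k y
  have p: "p k y \<in> carrier (fibre E y)" "\<psi> y (p k y) = (\<lambda>i. if i < k then \<psi> y (s y) i else 0)"
    if "y \<in> V" "k \<le> r" for k y
    unfolding p_def by (rule fibre_iso_inv[OF m i]; use that in \<open>auto simp: cspace_def\<close>)+
  have ps: "p k \<in> germ_section U E x" if k: "k \<le> r" for k
  proof (rule germ_section_trivI[OF U E t])
    show "\<forall>\<^sub>F y in mnhds U x. p k y \<in> carrier (fibre E y)" using ev by eventually_elim (rule p(1)[OF _ k])
    fix i assume "i < r"
    show "(\<lambda>y. \<psi> y (p k y) i) \<in> germ_fun U x"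
    proof (cases "i < k")
      case True
      show ?thesis
        by (rule germ_fun_cong[OF U x germ_section_coord[OF U E x s t \<open>i < r\<close>]], use ev in eventually_elim)
          (simp add: p k True)
    next
      case False
      show ?thesis
        by (rule germ_fun_cong[OF U x germ_fun_const[OF U x, of 0]], use ev in eventually_elim)
          (simp add: p k False)
    qed
  qed
  have main: "k \<le> r \<Longrightarrow> \<psi> x (D x v (p k)) j = (if j < k then v (\<lambda>y. \<psi> y (s y) j) else 0)
      + (\<Sum>b<k. \<psi> x (s x) b * \<psi> x (D x v (tframe E \<psi> b)) j)" for k
  proof (induction k)
    case 0
    \<comment> \<open>The section \<open>p 0\<close> vanishes near \<open>x\<close>, hence equals 0
      times itself as a germ, and the Leibniz rule then shows that its derivative is 0.\<close>
    have "D x v (p 0) = D x v (\<lambda>y. 0 \<odot>\<^bsub>fibre E y\<^esub> p 0 y)"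
    proof (rule conn_cong[OF v ps[OF le0]], use ev in eventually_elim)
      case (elim y)
      show ?case
        by (rule fibre_iso_eqI[OF m[OF elim] i[OF elim]])
          (simp_all add: p[OF elim] module_smult_closed[OF m[OF elim]] fibre_iso_smult[OF m[OF elim] i[OF elim]])
    qed
    also have "\<dots> = v (\<lambda>_. 0) \<odot>\<^bsub>fibre E x\<^esub> p 0 x \<oplus>\<^bsub>fibre E x\<^esub> 0 \<odot>\<^bsub>fibre E x\<^esub> D x v (p 0)"
      by (rule conn_leibniz[OF v ps[OF le0] germ_fun_const[OF U x]])
    finally have eq: "D x v (p 0) = v (\<lambda>_. 0) \<odot>\<^bsub>fibre E x\<^esub> p 0 x \<oplus>\<^bsub>fibre E x\<^esub> 0 \<odot>\<^bsub>fibre E x\<^esub> D x v (p 0)" .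
    have "\<psi> x (D x v (p 0)) j = 0"
      by (subst eq) (simp add: fibre_iso_add[OF m[OF t(2)] i[OF t(2)]] fibre_iso_smult[OF m[OF t(2)] i[OF t(2)]]
          module_smult_closed[OF m[OF t(2)]] p[OF t(2)] conn_closed[OF v ps[OF le0]])
    then show ?case by simp
  next
    case (Suc k)
    then have k: "k < r" "k \<le> r" by auto
    let ?h = "\<lambda>y. \<psi> y (s y) k"
    have h: "?h \<in> germ_fun U x" by (rule germ_section_coord[OF U E x s t k(1)])
    have e: "tframe E \<psi> k \<in> germ_section U E x" by (rule tframe_germ_section[OF U E t k(1)])
    note es = germ_section_smult[OF U E x e h]
    have "D x v (p (Suc k)) = D x v (\<lambda>y. p k y \<oplus>\<^bsub>fibre E y\<^esub> (?h y \<odot>\<^bsub>fibre E y\<^esub> tframe E \<psi> k y))"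
    proof (rule conn_cong[OF v ps[OF Suc.prems]], use ev in eventually_elim)
      case (elim y)
      show ?case
        by (rule fibre_iso_eqI[OF m[OF elim] i[OF elim]])
          (auto simp: p[OF elim] k Suc.prems module_smult_closed[OF m[OF elim]] module_add_closed[OF m[OF elim]]
            fibre_iso_smult[OF m[OF elim] i[OF elim]] fibre_iso_add[OF m[OF elim] i[OF elim]]
            tframe_carrier[OF U E t(1) elim] tframe_coord[OF U E t(1) elim] cunit_def fun_eq_iff less_Suc_eq)
    qed
    also have "\<dots> = D x v (p k) \<oplus>\<^bsub>fibre E x\<^esub> D x v (\<lambda>y. ?h y \<odot>\<^bsub>fibre E y\<^esub> tframe E \<psi> k y)"
      by (rule conn_add[OF v ps[OF k(2)] es])
    also have "D x v (\<lambda>y. ?h y \<odot>\<^bsub>fibre E y\<^esub> tframe E \<psi> k y)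
        = v ?h \<odot>\<^bsub>fibre E x\<^esub> tframe E \<psi> k x \<oplus>\<^bsub>fibre E x\<^esub> ?h x \<odot>\<^bsub>fibre E x\<^esub> D x v (tframe E \<psi> k)"
      by (rule conn_leibniz[OF v e h])
    finally have "\<psi> x (D x v (p (Suc k))) j = \<psi> x (D x v (p k)) j
        + (v ?h * cunit k j + ?h x * \<psi> x (D x v (tframe E \<psi> k)) j)"
      by (simp add: fibre_iso_add[OF m[OF t(2)] i[OF t(2)]] fibre_iso_smult[OF m[OF t(2)] i[OF t(2)]]
          module_smult_closed[OF m[OF t(2)]] module_add_closed[OF m[OF t(2)]] conn_closed[OF v ps[OF k(2)]]
          conn_closed[OF v e] tframe_carrier[OF U E t k(1)] tframe_coord[OF U E t k(1)])
    then show ?case using Suc.IH[OF k(2)] by (auto simp: cunit_def less_Suc_eq)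
  qed
  have "D x v (p r) = D x v s"
  proof (rule conn_cong[OF v ps[OF order_refl]],
      use ev germ_section_eventually_carrier[OF U E x s] in eventually_elim)
    case (elim y)
    show ?case
      by (rule fibre_iso_eqI'[OF m[OF elim(1)] i[OF elim(1)]]) (simp_all add: p[OF elim(1)] elim)
  qed
  then show ?thesis using main[OF order_refl] j by simp
qed

end

end

section \<open>Pullbacks of connections\<close>

text \<open>The components that \<open>conn_local\<close> forces on a pulled back connection, its
  values on the pulled back frame being taken from \<open>D\<close> on the frame of
  \<open>E\<close>.\<close>

definition pconn_coord ::
    "'v cmfd \<Rightarrow> 'u cmfd \<Rightarrow> ('v \<Rightarrow> 'u) \<Rightarrow> ('u, 'e) vbundle \<Rightarrow> ('u, 'e) connection
      \<Rightarrow> nat \<Rightarrow> ('u \<Rightarrow> 'e \<Rightarrow> nat \<Rightarrow> complex) \<Rightarrow> 'v \<Rightarrow> 'v tangent \<Rightarrow> ('v \<Rightarrow> 'e) \<Rightarrow> nat \<Rightarrow> complex"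
  where "pconn_coord V U f E D r \<psi> x v s j = v (\<lambda>y. \<psi> (f y) (s y) j) +
    (\<Sum>b<r. \<psi> (f x) (s x) b * \<psi> (f x) (D (f x) (push_tangent U f x v) (tframe E \<psi> b)) j)"

text \<open>Described through all trivialisations at once, so that no choice enters;
  \<open>pconn_coord_change\<close> shows that their demands agree.\<close>

definition pconn ::
    "'v cmfd \<Rightarrow> 'u cmfd \<Rightarrow> ('v \<Rightarrow> 'u) \<Rightarrow> ('u, 'e) vbundle \<Rightarrow> ('u, 'e) connection
      \<Rightarrow> ('v, 'e) connection"
  where "pconn V U f E D = (\<lambda>x\<in>pts V. \<lambda>v\<in>tangent_space V x. \<lambda>s\<in>germ_section V (pull_bundle V U f E) x.
    THE e. e \<in> carrier (fibre E (f x)) \<and> (\<forall>(W, r, \<psi>)\<in>trivs E. f x \<in> W \<longrightarrow>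
      (\<forall>j<r. \<psi> (f x) e j = pconn_coord V U f E D r \<psi> x v s j)))"

context
  fixes V :: "'v cmfd" and U :: "'u cmfd" and f :: "'v \<Rightarrow> 'u" and E :: "('u, 'e) vbundle" and D P
  assumes V: "holo_atlas V" and U: "holo_atlas U" and f: "holo_map V U f" and E: "holo_bundle U E"
    and D: "holo_connection U E D"
  defines "P \<equiv> pull_bundle V U f E"
begin

lemma P: "holo_bundle V P"
  unfolding P_def by (rule holo_bundle_pull[OF V U f E])

lemma P_fibre: "x \<in> pts V \<Longrightarrow> fibre P x = fibre E (f x)"
  by (simp add: P_def)

lemma P_triv: "(W, r, \<psi>) \<in> trivs E \<Longrightarrow> (pts V \<inter> f -` W, r, \<lambda>v. \<psi> (f v)) \<in> trivs P"
  unfolding P_def by (rule triv_pull[OF V U f E])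

lemma eventually_preimage:
  "(W, r, \<psi>) \<in> trivs E \<Longrightarrow> x \<in> pts V \<Longrightarrow> f x \<in> W \<Longrightarrow> eventually (\<lambda>y. y \<in> pts V \<inter> f -` W) (mnhds V x)"
  by (rule triv_eventually[OF V P P_triv]) auto

lemma germ_section_pull:
  assumes x: "x \<in> pts V" and s: "s \<in> germ_section U E (f x)"
  shows "(\<lambda>y. s (f y)) \<in> germ_section V P x"
proof -
  obtain W r \<psi> where t: "(W, r, \<psi>) \<in> trivs E" "f x \<in> W"
    by (rule holo_bundle_triv_exists[OF E holo_map_pts[OF f x]])
  show ?thesis
  proof (rule germ_section_trivI[OF V P P_triv[OF t(1)]])
    show "x \<in> pts V \<inter> f -` W" using x t by simp
    have "\<forall>\<^sub>F y in mnhds V x. s (f y) \<in> carrier (fibre E (f y))"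
      by (rule eventually_compose_filterlim[OF germ_section_eventually_carrier[OF U E holo_map_pts[OF f x] s]
            holo_map_filterlim[OF V U f x]])
    with eventually_mnhds_pts[OF V] show "\<forall>\<^sub>F y in mnhds V x. s (f y) \<in> carrier (fibre P y)"
      by eventually_elim (simp add: P_fibre)
    show "(\<lambda>y. \<psi> (f y) (s (f y)) i) \<in> germ_fun V x" if "i < r" for i
      using germ_fun_compose[OF V U f x germ_section_coord[OF U E holo_map_pts[OF f x] s t that]] .
  qed
qed

context
  fixes x v
  assumes x: "x \<in> pts V" and v: "v \<in> tangent_space V x"
begin

text \<open>The transformation law of connection matrices. Changing the frame produces the
  derivative of the transition matrix, and the same term arises from the product rule for the
  coordinates of \<open>s\<close>.\<close>

lemma pconn_coord_change:
  assumes s: "s \<in> germ_section V P x" and t: "(W, r, \<psi>) \<in> trivs E" "f x \<in> W"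
    and t': "(W', r', \<psi>') \<in> trivs E" "f x \<in> W'" and a: "a < r'"
  shows "pconn_coord V U f E D r' \<psi>' x v s a
    = (\<Sum>j<r. tmat (fibre E) \<psi> \<psi>' a j (f x) * pconn_coord V U f E D r \<psi> x v s j)"
proof -
  note fx = holo_map_pts[OF f x] and v' = push_tangent_tangent[OF V U f x v]
  let ?g = "\<lambda>a b. tmat (fibre E) \<psi> \<psi>' a b"
  let ?\<Gamma> = "\<lambda>b. D (f x) (push_tangent U f x v) (tframe E \<psi> b)"
  let ?\<Gamma>' = "\<lambda>c. D (f x) (push_tangent U f x v) (tframe E \<psi>' c)"
  have g: "?g a b \<in> germ_fun U (f x)" if "b < r" "a < r'" for a b
    unfolding germ_fun_iff[OF U fx]
    using triv_eventually[OF U E t] triv_eventually[OF U E t']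
    by eventually_elim (rule triv_tmat_mdiff[OF U E t(1) t'(1) _ _ that(2,1)])
  have gf: "(\<lambda>y. ?g a b (f y)) \<in> germ_fun V x" if "b < r" for b
    by (rule germ_fun_compose[OF V U f x g[OF that a]])
  have sb: "(\<lambda>y. \<psi> (f y) (s y) b) \<in> germ_fun V x" if "b < r" for b
    using germ_section_coord[OF V P x s P_triv[OF t(1)] _ that] x t(2) by simp
  have sc: "s x \<in> carrier (fibre E (f x))" using germ_section_carrier[OF V P x s] by (simp add: P_fibre x)
  have 1: "v (\<lambda>y. \<psi>' (f y) (s y) a) = (\<Sum>b<r. v (\<lambda>y. ?g a b (f y)) * \<psi> (f x) (s x) b
      + ?g a b (f x) * v (\<lambda>y. \<psi> (f y) (s y) b))"
  proof -
    have "v (\<lambda>y. \<psi>' (f y) (s y) a) = v (\<lambda>y. \<Sum>b<r. ?g a b (f y) * \<psi> (f y) (s y) b)"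
    proof (rule tangent_cong[OF V x v, symmetric])
      show "(\<lambda>y. \<Sum>b<r. ?g a b (f y) * \<psi> (f y) (s y) b) \<in> germ_fun V x"
        by (intro germ_fun_sum[OF V x] germ_fun_mult[OF V x] gf sb) auto
      show "\<forall>\<^sub>F y in mnhds V x. (\<Sum>b<r. ?g a b (f y) * \<psi> (f y) (s y) b) = \<psi>' (f y) (s y) a"
        using eventually_preimage[OF t(1) x t(2)] eventually_preimage[OF t'(1) x t'(2)]
          germ_section_eventually_carrier[OF V P x s]
        by eventually_elim (rule triv_expand[OF U E t(1) t'(1), symmetric], auto simp: P_fibre)
    qed
    also have "\<dots> = (\<Sum>b<r. v (\<lambda>y. ?g a b (f y) * \<psi> (f y) (s y) b))"
      by (rule tangent_sum[OF V x v]) (auto intro!: germ_fun_mult[OF V x] gf sb)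
    also have "\<dots> = (\<Sum>b<r. v (\<lambda>y. ?g a b (f y)) * \<psi> (f x) (s x) b
      + ?g a b (f x) * v (\<lambda>y. \<psi> (f y) (s y) b))"
      by (rule sum.cong) (auto simp: tangent_mult[OF V x v gf sb])
    finally show ?thesis .
  qed
  \<comment> \<open>\<open>conn_local\<close> in the second trivialisation, applied to the frame of
    the first, whose coordinates there are the transition matrix.\<close>
  have 2: "\<psi>' (f x) (?\<Gamma> b) a = v (\<lambda>y. ?g a b (f y)) + (\<Sum>c<r'. ?g c b (f x) * \<psi>' (f x) (?\<Gamma>' c) a)" if b: "b < r" for b
  proof -
    have "\<psi>' (f x) (?\<Gamma> b) a = push_tangent U f x v (\<lambda>u. \<psi>' u (tframe E \<psi> b u) a)
        + (\<Sum>c<r'. \<psi>' (f x) (tframe E \<psi> b (f x)) c * \<psi>' (f x) (?\<Gamma>' c) a)"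
      by (rule conn_local[OF U E D fx v' t' tframe_germ_section[OF U E t b] a])
    also have "(\<lambda>u. \<psi>' u (tframe E \<psi> b u) a) = ?g a b" by (simp add: tmat_def tframe_def fun_eq_iff)
    also have "push_tangent U f x v (?g a b) = v (\<lambda>y. ?g a b (f y))"
      by (rule push_tangent_eq[of _ U f x, OF g[OF b a]])
    also have "(\<Sum>c<r'. \<psi>' (f x) (tframe E \<psi> b (f x)) c * \<psi>' (f x) (?\<Gamma>' c) a)
        = (\<Sum>c<r'. ?g c b (f x) * \<psi>' (f x) (?\<Gamma>' c) a)"
      by (simp only: tmat_def tframe_def[of E \<psi> b "f x"])
    finally show ?thesis .
  qed
  \<comment> \<open>The same vector expressed through its coordinates in the first trivialisation;
    equating this with 2 gives the transformation law.\<close>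
  have 3: "\<psi>' (f x) (?\<Gamma> b) a = (\<Sum>j<r. ?g a j (f x) * \<psi> (f x) (?\<Gamma> b) j)" if b: "b < r" for b
    by (rule triv_expand[OF U E t(1) t'(1) t(2) t'(2)])
      (rule conn_closed[OF U E D fx v' tframe_germ_section[OF U E t b]])
  have "(\<Sum>j<r. ?g a j (f x) * pconn_coord V U f E D r \<psi> x v s j)
      = (\<Sum>j<r. ?g a j (f x) * v (\<lambda>y. \<psi> (f y) (s y) j))
        + (\<Sum>j<r. \<Sum>b<r. ?g a j (f x) * (\<psi> (f x) (s x) b * \<psi> (f x) (?\<Gamma> b) j))"
    by (simp add: pconn_coord_def distrib_left sum.distrib sum_distrib_left)
  also have "(\<Sum>j<r. \<Sum>b<r. ?g a j (f x) * (\<psi> (f x) (s x) b * \<psi> (f x) (?\<Gamma> b) j))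
      = (\<Sum>b<r. \<psi> (f x) (s x) b * (\<Sum>j<r. ?g a j (f x) * \<psi> (f x) (?\<Gamma> b) j))"
    by (subst sum.swap) (simp add: sum_distrib_left mult.left_commute)
  also have "\<dots> = (\<Sum>b<r. \<psi> (f x) (s x) b * (v (\<lambda>y. ?g a b (f y)) + (\<Sum>c<r'. ?g c b (f x) * \<psi>' (f x) (?\<Gamma>' c) a)))"
    by (rule sum.cong) (simp_all add: 2[symmetric] 3[symmetric])
  also have "\<dots> = (\<Sum>b<r. v (\<lambda>y. ?g a b (f y)) * \<psi> (f x) (s x) b)
      + (\<Sum>c<r'. (\<Sum>b<r. ?g c b (f x) * \<psi> (f x) (s x) b) * \<psi>' (f x) (?\<Gamma>' c) a)"
  proof -
    have "(\<Sum>b<r. \<psi> (f x) (s x) b * (\<Sum>c<r'. ?g c b (f x) * \<psi>' (f x) (?\<Gamma>' c) a))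
        = (\<Sum>c<r'. (\<Sum>b<r. ?g c b (f x) * \<psi> (f x) (s x) b) * \<psi>' (f x) (?\<Gamma>' c) a)"
      unfolding sum_distrib_left sum_distrib_right by (subst sum.swap) (simp add: mult_ac)
    then show ?thesis by (simp add: distrib_left sum.distrib mult.commute)
  qed
  also have "(\<Sum>c<r'. (\<Sum>b<r. ?g c b (f x) * \<psi> (f x) (s x) b) * \<psi>' (f x) (?\<Gamma>' c) a)
      = (\<Sum>c<r'. \<psi>' (f x) (s x) c * \<psi>' (f x) (?\<Gamma>' c) a)"
    by (rule sum.cong) (simp_all add: triv_expand[OF U E t(1) t'(1) t(2) t'(2) sc])
  finally show ?thesis by (simp add: pconn_coord_def 1 sum.distrib)
qed

text \<open>By \<open>pconn_coord_change\<close> an element with the right components in one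
  trivialisation has them in every other, so it satisfies the description; its components in one
  trivialisation also determine it.\<close>

lemma pconn_eqI:
  assumes s: "s \<in> germ_section V P x" and t: "(W, r, \<psi>) \<in> trivs E" "f x \<in> W"
    and e: "e \<in> carrier (fibre E (f x))" "\<And>j. j < r \<Longrightarrow> \<psi> (f x) e j = pconn_coord V U f E D r \<psi> x v s j"
  shows "pconn V U f E D x v s = e"
proof -
  note m = triv_module[OF U E t] and i = triv_fibre_iso[OF U E t]
  have "\<psi>' (f x) e a = pconn_coord V U f E D r' \<psi>' x v s a"
    if t': "(W', r', \<psi>') \<in> trivs E" "f x \<in> W'" and a: "a < r'" for W' r' \<psi>' a
    unfolding pconn_coord_change[OF s t t' a] triv_expand[OF U E t(1) t'(1) t(2) t'(2) e(1)]
    by (rule sum.cong) (simp_all add: e(2))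
  then have ex: "e \<in> carrier (fibre E (f x)) \<and> (\<forall>(W, r, \<psi>)\<in>trivs E. f x \<in> W \<longrightarrow>
      (\<forall>j<r. \<psi> (f x) e j = pconn_coord V U f E D r \<psi> x v s j))"
    using e(1) by blast
  have "(THE e. e \<in> carrier (fibre E (f x)) \<and> (\<forall>(W, r, \<psi>)\<in>trivs E. f x \<in> W \<longrightarrow>
      (\<forall>j<r. \<psi> (f x) e j = pconn_coord V U f E D r \<psi> x v s j))) = e"
  proof (rule the_equality, rule ex)
    fix e' assume e': "e' \<in> carrier (fibre E (f x)) \<and> (\<forall>(W, r, \<psi>)\<in>trivs E. f x \<in> W \<longrightarrow>
      (\<forall>j<r. \<psi> (f x) e' j = pconn_coord V U f E D r \<psi> x v s j))"
    then have "\<forall>j<r. \<psi> (f x) e' j = pconn_coord V U f E D r \<psi> x v s j" using t by fast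
    then show "e' = e" using e' e by (intro fibre_iso_eqI'[OF m i]) auto
  qed
  then show ?thesis using x v s by (simp add: pconn_def P_def)
qed

lemma pconn_props:
  assumes s: "s \<in> germ_section V P x" and t: "(W, r, \<psi>) \<in> trivs E" "f x \<in> W"
  shows "pconn V U f E D x v s \<in> carrier (fibre E (f x))"
    and "j < r \<Longrightarrow> \<psi> (f x) (pconn V U f E D x v s) j = pconn_coord V U f E D r \<psi> x v s j"
proof -
  note m = triv_module[OF U E t] and i = triv_fibre_iso[OF U E t]
  define z where "z = (\<lambda>j. if j < r then pconn_coord V U f E D r \<psi> x v s j else 0)"
  have z: "z \<in> cspace r" by (simp add: z_def cspace_def)
  note w = fibre_iso_inv[OF m i z]
  have eq: "pconn V U f E D x v s = inv_into (carrier (fibre E (f x))) (\<psi> (f x)) z"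
    by (rule pconn_eqI[OF s t w(1)]) (simp only: w(2), simp add: z_def)
  show "pconn V U f E D x v s \<in> carrier (fibre E (f x))" unfolding eq by (rule w(1))
  show "j < r \<Longrightarrow> \<psi> (f x) (pconn V U f E D x v s) j = pconn_coord V U f E D r \<psi> x v s j"
    unfolding eq w(2) by (simp add: z_def)
qed

lemma pconn_pull_section:
  assumes s: "s \<in> germ_section U E (f x)"
  shows "pconn V U f E D x v (\<lambda>y. s (f y)) = D (f x) (push_tangent U f x v) s"
proof -
  note fx = holo_map_pts[OF f x] and v' = push_tangent_tangent[OF V U f x v]
  obtain W r \<psi> where t: "(W, r, \<psi>) \<in> trivs E" "f x \<in> W" by (rule holo_bundle_triv_exists[OF E fx])
  show ?thesis
  proof (rule pconn_eqI[OF germ_section_pull[OF x s] t conn_closed[OF U E D fx v' s]])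
    fix j assume j: "j < r"
    show "\<psi> (f x) (D (f x) (push_tangent U f x v) s) j = pconn_coord V U f E D r \<psi> x v (\<lambda>y. s (f y)) j"
      using conn_local[OF U E D fx v' t s j] push_tangent_eq[of _ U f x v, OF germ_section_coord[OF U E fx s t j]]
      by (simp add: pconn_coord_def)
  qed
qed

lemma conn_pull_unique:
  assumes D': "holo_connection V P D'"
    and char: "\<And>s. s \<in> germ_section U E (f x) \<Longrightarrow> D' x v (\<lambda>y. s (f y)) = D (f x) (push_tangent U f x v) s"
    and s: "s \<in> germ_section V P x"
  shows "D' x v s = pconn V U f E D x v s"
proof -
  obtain W r \<psi> where t: "(W, r, \<psi>) \<in> trivs E" "f x \<in> W"
    by (rule holo_bundle_triv_exists[OF E holo_map_pts[OF f x]])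
  have xW: "x \<in> pts V \<inter> f -` W" using x t by simp
  show ?thesis
  proof (rule pconn_eqI[OF s t, symmetric])
    show "D' x v s \<in> carrier (fibre E (f x))" using conn_closed[OF V P D' x v s] by (simp add: P_fibre x)
    fix j assume j: "j < r"
    \<comment> \<open>The frame of the pulled back trivialisation is the pulled back frame, but only
      as a germ, since outside \<open>pts V\<close> the fibres of \<open>P\<close> are default
      values.\<close>
    have "D' x v (tframe P (\<lambda>v. \<psi> (f v)) b) = D (f x) (push_tangent U f x v) (tframe E \<psi> b)" if b: "b < r" for b
    proof -
      have "D' x v (tframe P (\<lambda>v. \<psi> (f v)) b) = D' x v (\<lambda>y. tframe E \<psi> b (f y))"
        by (rule conn_cong[OF V P D' x v tframe_germ_section[OF V P P_triv[OF t(1)] xW b]],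
            use eventually_mnhds_pts[OF V] in eventually_elim) (simp add: tframe_def P_fibre)
      then show ?thesis by (simp add: char tframe_germ_section[OF U E t b])
    qed
    then show "\<psi> (f x) (D' x v s) j = pconn_coord V U f E D r \<psi> x v s j"
      using conn_local[OF V P D' x v P_triv[OF t(1)] xW s j] by (simp add: pconn_coord_def)
  qed
qed

end

text \<open>Each algebraic axiom is tested on components in a trivialisation around
  \<open>f x\<close>, where \<open>pconn\<close> is given by its formula, and comes down to the
  derivation rules of \<open>v\<close> or to linearity of \<open>D\<close> in the direction.\<close>

lemma holo_connection_pconn: "holo_connection V P (pconn V U f E D)"
  unfolding holo_connection_def
proof (intro conjI ballI allI impI)
  let ?D = "pconn V U f E D"
  show "?D \<in> extensional (pts V)" by (simp add: pconn_def)
  fix x assume x: "x \<in> pts V"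
  show "?D x \<in> extensional (tangent_space V x)" using x by (simp add: pconn_def)
  obtain W r \<psi> where t: "(W, r, \<psi>) \<in> trivs E" "f x \<in> W"
    by (rule holo_bundle_triv_exists[OF E holo_map_pts[OF f x]])
  note m = triv_module[OF U E t] and i = triv_fibre_iso[OF U E t]
  note m' = triv_module[OF U E t(1)] and i' = triv_fibre_iso[OF U E t(1)]
  note fx = holo_map_pts[OF f x] and ev = eventually_preimage[OF t(1) x t(2)]
  have xW: "x \<in> pts V \<inter> f -` W" using x t by simp
  note gc = germ_section_coord[OF V P x _ P_triv[OF t(1)] xW]
  note eqI = fibre_iso_eqI'[OF m i]
  note fa = fibre_iso_add[OF m i] and fs = fibre_iso_smult[OF m i]
  note sc = germ_section_carrier[OF V P x, unfolded P_fibre[OF x]]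
  fix v assume v: "v \<in> tangent_space V x"
  note cl = pconn_props(1)[OF x v _ t] and co = pconn_props(2)[OF x v _ t]
  show "?D x v \<in> germ_section V P x \<rightarrow>\<^sub>E carrier (fibre P x)"
    using x v cl by (auto simp: pconn_def P_fibre P_def[symmetric])
  {
    fix s s' assume s: "s \<in> germ_section V P x" and s': "s' \<in> germ_section V P x"
    show "?D x v s = ?D x v s'" if "germ_eq V x s s'"
    proof (rule eqI[OF cl[OF s] cl[OF s']])
      have ss: "\<forall>\<^sub>F y in mnhds V x. s y = s' y" using that by (simp add: germ_eq_iff[OF V x])
      have "s x = s' x" by (rule eventually_mnhds_self[OF V x ss])
      moreover have "v (\<lambda>y. \<psi> (f y) (s y) j) = v (\<lambda>y. \<psi> (f y) (s' y) j)" if "j < r" for j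
        by (rule tangent_cong[OF V x v gc[OF s that]], use ss in eventually_elim) simp
      ultimately show "\<psi> (f x) (?D x v s) j = \<psi> (f x) (?D x v s') j" if "j < r" for j
        using that by (simp add: co s s' pconn_coord_def)
    qed
    show "?D x v (\<lambda>y. s y \<oplus>\<^bsub>fibre P y\<^esub> s' y) = ?D x v s \<oplus>\<^bsub>fibre P x\<^esub> ?D x v s'"
      unfolding P_fibre[OF x]
    proof (rule eqI[OF cl module_add_closed[OF m cl cl]])
      show ss: "(\<lambda>y. s y \<oplus>\<^bsub>fibre P y\<^esub> s' y) \<in> germ_section V P x" by (rule germ_section_add[OF V P x s s'])
      fix j assume j: "j < r"
      have "v (\<lambda>y. \<psi> (f y) (s y \<oplus>\<^bsub>fibre P y\<^esub> s' y) j) = v (\<lambda>y. \<psi> (f y) (s y) j + \<psi> (f y) (s' y) j)"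
        by (rule tangent_cong[OF V x v gc[OF ss j]],
            use ev germ_section_eventually_carrier[OF V P x s] germ_section_eventually_carrier[OF V P x s'] in eventually_elim)
          (simp add: P_fibre fibre_iso_add[OF m' i'])
      also have "\<dots> = v (\<lambda>y. \<psi> (f y) (s y) j) + v (\<lambda>y. \<psi> (f y) (s' y) j)"
        by (rule tangent_add[OF V x v gc[OF s j] gc[OF s' j]])
      finally show "\<psi> (f x) (?D x v (\<lambda>y. s y \<oplus>\<^bsub>fibre P y\<^esub> s' y)) j = \<psi> (f x) (?D x v s \<oplus>\<^bsub>fibre E (f x)\<^esub> ?D x v s') j"
        using j by (simp add: co ss s s' fa cl pconn_coord_def P_fibre x sc distrib_right sum.distrib)
    qed (rule s s')+
  }
  {
    fix s h assume s: "s \<in> germ_section V P x" and h: "h \<in> germ_fun V x"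
    show "?D x v (\<lambda>y. h y \<odot>\<^bsub>fibre P y\<^esub> s y)
               = v h \<odot>\<^bsub>fibre P x\<^esub> s x \<oplus>\<^bsub>fibre P x\<^esub> h x \<odot>\<^bsub>fibre P x\<^esub> ?D x v s"
      unfolding P_fibre[OF x]
    proof (rule eqI[OF cl module_add_closed[OF m module_smult_closed[OF m sc] module_smult_closed[OF m cl]]])
      show ss: "(\<lambda>y. h y \<odot>\<^bsub>fibre P y\<^esub> s y) \<in> germ_section V P x" by (rule germ_section_smult[OF V P x s h])
      fix j assume j: "j < r"
      have "v (\<lambda>y. \<psi> (f y) (h y \<odot>\<^bsub>fibre P y\<^esub> s y) j) = v (\<lambda>y. h y * \<psi> (f y) (s y) j)"
        by (rule tangent_cong[OF V x v gc[OF ss j]],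
            use ev germ_section_eventually_carrier[OF V P x s] in eventually_elim)
          (simp add: P_fibre fibre_iso_smult[OF m' i'])
      also have "\<dots> = v h * \<psi> (f x) (s x) j + h x * v (\<lambda>y. \<psi> (f y) (s y) j)"
        by (rule tangent_mult[OF V x v h gc[OF s j]])
      finally show "\<psi> (f x) (?D x v (\<lambda>y. h y \<odot>\<^bsub>fibre P y\<^esub> s y)) j
          = \<psi> (f x) (v h \<odot>\<^bsub>fibre E (f x)\<^esub> s x \<oplus>\<^bsub>fibre E (f x)\<^esub> h x \<odot>\<^bsub>fibre E (f x)\<^esub> ?D x v s) j"
        using j by (simp add: co ss s fa fs cl pconn_coord_def P_fibre x sc module_smult_closed[OF m]
            distrib_left sum_distrib_left mult.assoc)
    qed (rule s)+
  }
next
  let ?D = "pconn V U f E D"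
  fix x s v assume x: "x \<in> pts V" and s: "s \<in> germ_section V P x" and v: "v \<in> tangent_space V x"
  obtain W r \<psi> where t: "(W, r, \<psi>) \<in> trivs E" "f x \<in> W"
    by (rule holo_bundle_triv_exists[OF E holo_map_pts[OF f x]])
  have xW: "x \<in> pts V \<inter> f -` W" using x t by simp
  note m = triv_module[OF U E t] and i = triv_fibre_iso[OF U E t]
  note fx = holo_map_pts[OF f x]
  note gc = germ_section_coord[OF V P x s P_triv[OF t(1)] xW]
  note cl = pconn_props(1)[OF x _ s t] and co = pconn_props(2)[OF x _ s t]
  note v' = push_tangent_tangent[OF V U f x v]
  note fr = tframe_germ_section[OF U E t]
  {
    fix w assume w: "w \<in> tangent_space V x"
    note w' = push_tangent_tangent[OF V U f x w]
    note vw = tangent_space_add[OF V x v w]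
    have p: "push_tangent U f x (\<lambda>h\<in>germ_fun V x. v h + w h)
        = (\<lambda>h\<in>germ_fun U (f x). push_tangent U f x v h + push_tangent U f x w h)"
      unfolding push_tangent_def by (rule restrict_ext) (simp add: germ_fun_compose[OF V U f x])
    show "?D x (\<lambda>h\<in>germ_fun V x. v h + w h) s = ?D x v s \<oplus>\<^bsub>fibre P x\<^esub> ?D x w s"
      unfolding P_fibre[OF x]
    proof (rule fibre_iso_eqI'[OF m i cl[OF vw] module_add_closed[OF m cl[OF v] cl[OF w]]])
      fix j assume j: "j < r"
      have "\<psi> (f x) (D (f x) (push_tangent U f x (\<lambda>h\<in>germ_fun V x. v h + w h)) (tframe E \<psi> b)) j
          = \<psi> (f x) (D (f x) (push_tangent U f x v) (tframe E \<psi> b)) j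
            + \<psi> (f x) (D (f x) (push_tangent U f x w) (tframe E \<psi> b)) j" if "b < r" for b
        unfolding p conn_tangent_add[OF U E D fx v' w' fr[OF that]]
        by (simp add: fibre_iso_add[OF m i] conn_closed[OF U E D fx v' fr[OF that]] conn_closed[OF U E D fx w' fr[OF that]])
      then show "\<psi> (f x) (?D x (\<lambda>h\<in>germ_fun V x. v h + w h) s) j = \<psi> (f x) (?D x v s \<oplus>\<^bsub>fibre E (f x)\<^esub> ?D x w s) j"
        using j gc[OF j] by (simp add: co v w vw fibre_iso_add[OF m i] cl pconn_coord_def distrib_left sum.distrib)
    qed
  }
  fix c
  note cv = tangent_space_scale[OF V x v]
  have p: "push_tangent U f x (\<lambda>h\<in>germ_fun V x. c * v h)
      = (\<lambda>h\<in>germ_fun U (f x). c * push_tangent U f x v h)"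
    unfolding push_tangent_def by (rule restrict_ext) (simp add: germ_fun_compose[OF V U f x])
  show "?D x (\<lambda>h\<in>germ_fun V x. c * v h) s = c \<odot>\<^bsub>fibre P x\<^esub> ?D x v s"
    unfolding P_fibre[OF x]
  proof (rule fibre_iso_eqI'[OF m i cl[OF cv] module_smult_closed[OF m cl[OF v]]])
    fix j assume j: "j < r"
    have "\<psi> (f x) (D (f x) (push_tangent U f x (\<lambda>h\<in>germ_fun V x. c * v h)) (tframe E \<psi> b)) j
        = c * \<psi> (f x) (D (f x) (push_tangent U f x v) (tframe E \<psi> b)) j" if "b < r" for b
      unfolding p conn_tangent_scale[OF U E D fx v' fr[OF that]]
      by (simp add: fibre_iso_smult[OF m i] conn_closed[OF U E D fx v' fr[OF that]])
    then show "\<psi> (f x) (?D x (\<lambda>h\<in>germ_fun V x. c * v h) s) j = \<psi> (f x) (c \<odot>\<^bsub>fibre E (f x)\<^esub> ?D x v s) j"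
      using j gc[OF j] by (simp add: co v cv fibre_iso_smult[OF m i] cl pconn_coord_def distrib_left sum_distrib_left mult.left_commute)
  qed
next
  let ?D = "pconn V U f E D"
  fix S s c assume s: "holo_section V P S s" and c: "c \<in> charts V"
  obtain C d \<phi> where ce: "c = (C, d, \<phi>)" by (cases c) auto
  with c have C: "(C, d, \<phi>) \<in> charts V" by simp
  show "case c of (W, d, \<phi>) \<Rightarrow> \<forall>i<d. holo_section V P (S \<inter> W) (\<lambda>x. ?D x (coord_vector V (W, d, \<phi>) i x) s)"
    unfolding ce prod.case
  proof (intro allI impI)
    fix i assume i: "i < d"
    let ?dC = "coord_vector V (C, d, \<phi>) i"
    show "holo_section V P (S \<inter> C) (\<lambda>x. ?D x (?dC x) s)"
      unfolding holo_section_iff[OF V P]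
    proof (intro conjI ballI)
      have S: "openin (mtop V) S" using s by (simp add: holo_section_def)
      show "openin (mtop V) (S \<inter> C)" by (rule openin_Int[OF S openin_chart[OF V C]])
      fix x assume "x \<in> S \<inter> C"
      then have xS: "x \<in> S" and xC: "x \<in> C" by auto
      note x = chart_pts[OF V C xC]
      obtain W r \<psi> where t: "(W, r, \<psi>) \<in> trivs E" "f x \<in> W"
        by (rule holo_bundle_triv_exists[OF E holo_map_pts[OF f x]])
      have xW: "x \<in> pts V \<inter> f -` W" using x t by simp
      obtain C' d' \<phi>' where C': "(C', d', \<phi>') \<in> charts U" "f x \<in> C'"
        by (rule chart_exists[OF U holo_map_pts[OF f x]])
      have sg: "s \<in> germ_section V P y" if "y \<in> S" for y
        using s that unfolding germ_section_def by blast
      note evS = eventually_mnhds_open[OF S xS] and evC = eventually_mnhds_open[OF openin_chart[OF V C] xC]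
        and evW = eventually_preimage[OF t(1) x t(2)]
      have evC': "\<forall>\<^sub>F y in mnhds V x. f y \<in> C'"
        by (rule eventually_compose_filterlim[OF eventually_mnhds_open[OF openin_chart[OF U C'(1)] C'(2)]
              holo_map_filterlim[OF V U f x]])
      note dC = coord_vector_tangent[OF V C _ i]
      show "sec_at V P x (\<lambda>x. ?D x (?dC x) s)"
      proof (rule sec_at_triv[OF V P P_triv[OF t(1)] xW])
        show "\<forall>\<^sub>F y in mnhds V x. ?D y (?dC y) s \<in> carrier (fibre P y)"
          using evS evC evW
        proof eventually_elim
          case (elim y)
          then have "y \<in> pts V" "f y \<in> W" by auto
          with pconn_props(1)[OF this(1) dC[OF elim(2)] sg[OF elim(1)] t(1) this(2)] show ?case
            by (simp add: P_fibre)
        qed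
        fix j assume j: "j < r"
        \<comment> \<open>The component of \<open>pconn\<close> along a coordinate vector, with the
          pushed direction expanded in the coordinate vectors of \<open>U\<close>. Only derivatives
          of holomorphic functions and components of holomorphic sections of \<open>E\<close>
          remain.\<close>
        let ?R = "\<lambda>y. ?dC y (\<lambda>y. \<psi> (f y) (s y) j) + (\<Sum>b<r. \<psi> (f y) (s y) b *
          (\<Sum>l<d'. ?dC y (\<lambda>y. \<phi>' (f y) l) *
            \<psi> (f y) (D (f y) (coord_vector U (C', d', \<phi>') l (f y)) (tframe E \<psi> b)) j))"
        have "mdiff V x ?R"
        proof (intro mdiff_add mdiff_sum mdiff_mult)
          show "mdiff V x (\<lambda>y. ?dC y (\<lambda>y. \<psi> (f y) (s y) j))"
            using germ_section_coord[OF V P x sg[OF xS] P_triv[OF t(1)] xW j]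
            by (intro mdiff_coord_vector[OF V C xC i]) simp
          fix b assume "b \<in> {..<r}"
          then have b: "b < r" by simp
          show "mdiff V x (\<lambda>y. \<psi> (f y) (s y) b)"
            using germ_fun_mdiff[OF V x germ_section_coord[OF V P x sg[OF xS] P_triv[OF t(1)] xW b]] by simp
          fix l assume "l \<in> {..<d'}"
          then have l: "l < d'" by simp
          have "(\<lambda>u. \<phi>' u l) \<in> germ_fun U (f x)"
            unfolding germ_fun_iff[OF U holo_map_pts[OF f x]]
            using eventually_mnhds_open[OF openin_chart[OF U C'(1)] C'(2)]
            by eventually_elim (rule mdiff_chart_coord[OF U C'(1) _ l])
          from germ_fun_compose[OF V U f x this]
          show "mdiff V x (\<lambda>y. ?dC y (\<lambda>y. \<phi>' (f y) l))" by (rule mdiff_coord_vector[OF V C xC i])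
          have "holo_section U E (W \<inter> C') (\<lambda>u. D u (coord_vector U (C', d', \<phi>') l u) (tframe E \<psi> b))"
            by (rule conn_holo[OF U E D tframe_section[OF U E t(1) b] C'(1) l])
          then have "sec_at U E (f x) (\<lambda>u. D u (coord_vector U (C', d', \<phi>') l u) (tframe E \<psi> b))"
            using t(2) C'(2) by (simp add: holo_section_iff[OF U E])
          from holo_map_mdiff[OF V U f x sec_at_coord[OF U E this t j]]
          show "mdiff V x (\<lambda>y. \<psi> (f y) (D (f y) (coord_vector U (C', d', \<phi>') l (f y)) (tframe E \<psi> b)) j)" .
        qed
        then show "mdiff V x (\<lambda>y. \<psi> (f y) (?D y (?dC y) s) j)"
        proof (rule mdiff_cong[OF V, rotated], use evS evC evW evC' in eventually_elim)
          case (elim y)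
          then have y: "y \<in> pts V" "f y \<in> W" by auto
          note fy = holo_map_pts[OF f y(1)]
          have "\<psi> (f y) (D (f y) (push_tangent U f y (?dC y)) (tframe E \<psi> b)) j
              = (\<Sum>l<d'. ?dC y (\<lambda>y. \<phi>' (f y) l) *
                \<psi> (f y) (D (f y) (coord_vector U (C', d', \<phi>') l (f y)) (tframe E \<psi> b)) j)" if b: "b < r" for b
            unfolding push_coord_vector[OF V U f C elim(2) i C'(1) elim(4)]
            using conn_tangent_sum[OF U E D fy t(1) y(2) tframe_germ_section[OF U E t(1) y(2) b]
                coord_vector_tangent[OF U C'(1) elim(4)], of d' "\<lambda>l. l" "\<lambda>l. ?dC y (\<lambda>y. \<phi>' (f y) l)" j]
            by simp
          then show ?case
            using pconn_props(2)[OF y(1) dC[OF elim(2)] sg[OF elim(1)] t(1) y(2) j]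
            by (simp add: pconn_coord_def)
        qed
      qed
    qed
  qed
qed

text \<open>Connections are extensional in the point, the tangent vector and the germ of the
  section, so agreement on admissible arguments is equality of functions, as the definite
  description in \<open>pull_connection\<close> demands.\<close>

lemma conn_eq_pconn:
  assumes D': "holo_connection V P D'"
    and char: "\<And>x v s. x \<in> pts V \<Longrightarrow> v \<in> tangent_space V x \<Longrightarrow> s \<in> germ_section U E (f x) \<Longrightarrow>
      D' x v (\<lambda>y. s (f y)) = D (f x) (push_tangent U f x v) s"
  shows "D' = pconn V U f E D"
proof -
  note D0 = holo_connection_pconn
  show ?thesis
  proof (rule extensionalityI[OF conn_extensional[OF V P D'] conn_extensional[OF V P D0]])
    fix x assume x: "x \<in> pts V"
    show "D' x = pconn V U f E D x"
    proof (rule extensionalityI[OF conn_extensional_tangent[OF V P D' x] conn_extensional_tangent[OF V P D0 x]])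
      fix v assume v: "v \<in> tangent_space V x"
      show "D' x v = pconn V U f E D x v"
      proof (rule PiE_ext[OF conn_funcset[OF V P D' x v] conn_funcset[OF V P D0 x v]])
        fix s assume "s \<in> germ_section V P x"
        then show "D' x v s = pconn V U f E D x v s"
          by (intro conn_pull_unique[OF x v D'] char[OF x v])
      qed
    qed
  qed
qed

lemma pull_connection_eq_pconn: "pull_connection V U f E D = pconn V U f E D"
  unfolding pull_connection_def P_def[symmetric]
proof (rule the_equality)
  show "holo_connection V P (pconn V U f E D) \<and> (\<forall>x\<in>pts V. \<forall>v\<in>tangent_space V x. \<forall>s\<in>germ_section U E (f x).
      pconn V U f E D x v (\<lambda>y. s (f y)) = D (f x) (push_tangent U f x v) s)"
    using holo_connection_pconn pconn_pull_section by blast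
  fix D' assume D': "holo_connection V P D' \<and> (\<forall>x\<in>pts V. \<forall>v\<in>tangent_space V x. \<forall>s\<in>germ_section U E (f x).
      D' x v (\<lambda>y. s (f y)) = D (f x) (push_tangent U f x v) s)"
  show "D' = pconn V U f E D"
    by (rule conn_eq_pconn) (use D' in auto)
qed

lemma holo_connection_pull: "holo_connection V (pull_bundle V U f E) (pull_connection V U f E D)"
  using holo_connection_pconn by (simp add: pull_connection_eq_pconn P_def)

lemma pull_connection_pull_section:
  "x \<in> pts V \<Longrightarrow> v \<in> tangent_space V x \<Longrightarrow> s \<in> germ_section U E (f x) \<Longrightarrow>
    pull_connection V U f E D x v (\<lambda>y. s (f y)) = D (f x) (push_tangent U f x v) s"
  by (simp add: pull_connection_eq_pconn pconn_pull_section)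

lemma pull_connection_unique:
  assumes D': "holo_connection V (pull_bundle V U f E) D'"
    and char: "\<And>x v s. x \<in> pts V \<Longrightarrow> v \<in> tangent_space V x \<Longrightarrow> s \<in> germ_section U E (f x) \<Longrightarrow>
      D' x v (\<lambda>y. s (f y)) = D (f x) (push_tangent U f x v) s"
  shows "pull_connection V U f E D = D'"
  unfolding pull_connection_eq_pconn by (rule sym, rule conn_eq_pconn[OF D'[folded P_def] char])

end

lemma push_tangent_compose:
  assumes V: "holo_atlas V" and U: "holo_atlas U" and f: "holo_map V U f" and gz: "g z \<in> pts V"
  shows "push_tangent U f (g z) (push_tangent V g z v) = push_tangent U (\<lambda>z. f (g z)) z v"
  unfolding push_tangent_def by (rule restrict_ext) (simp add: germ_fun_compose[OF V U f gz])

text \<open>By uniqueness only sections pulled back from \<open>U\<close> have to be tested, and on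
  those both steps of the iterated pullback are given by their characterising property.\<close>

lemma pull_connection_compose:
  assumes Z: "holo_atlas Z" and V: "holo_atlas V" and U: "holo_atlas U"
    and g: "holo_map Z V g" and f: "holo_map V U f" and E: "holo_bundle U E" and D: "holo_connection U E D"
  shows "pull_connection Z V g (pull_bundle V U f E) (pull_connection V U f E D)
    = pull_connection Z U (\<lambda>z. f (g z)) E D"
proof (rule sym, rule pull_connection_unique[OF Z U holo_map_compose[OF Z V U g f] E D])
  note P = holo_bundle_pull[OF V U f E] and PD = holo_connection_pull[OF V U f E D]
  show "holo_connection Z (pull_bundle Z U (\<lambda>z. f (g z)) E)
      (pull_connection Z V g (pull_bundle V U f E) (pull_connection V U f E D))"
    using holo_connection_pull[OF Z V g P PD] by (simp add: pull_bundle_compose[OF Z V U g f E])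
  fix z v s assume z: "z \<in> pts Z" and v: "v \<in> tangent_space Z z" and s: "s \<in> germ_section U E (f (g z))"
  note gz = holo_map_pts[OF g z]
  show "pull_connection Z V g (pull_bundle V U f E) (pull_connection V U f E D) z v (\<lambda>y. s (f (g y)))
      = D (f (g z)) (push_tangent U (\<lambda>z. f (g z)) z v) s"
    using pull_connection_pull_section[OF Z V g P PD z v germ_section_pull[OF V U f E D gz s]]
      pull_connection_pull_section[OF V U f E D gz push_tangent_tangent[OF Z V g z v] s]
      push_tangent_compose[where g = g and z = z and v = v, OF V U f gz]
    by simp
qed

text \<open>Since \<open>f\<close> and \<open>g\<close> may differ off \<open>pts V\<close>,
  sections pulled back along them agree only as germs, and so do the functions on which the pushed
  tangent vectors are tested.\<close>

lemma pull_connection_cong: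
  assumes V: "holo_atlas V" and U: "holo_atlas U" and f: "holo_map V U f"
    and E: "holo_bundle U E" and D: "holo_connection U E D" and fg: "\<And>x. x \<in> pts V \<Longrightarrow> f x = g x"
  shows "pull_connection V U f E D = pull_connection V U g E D"
proof (rule pull_connection_unique[OF V U f E D])
  have g: "holo_map V U g" by (rule holo_map_cong[OF V U fg f])
  have PE: "pull_bundle V U g E = pull_bundle V U f E" by (rule pull_bundle_cong[symmetric, OF fg])
  note gP = holo_bundle_pull[OF V U g E] and gD = holo_connection_pull[OF V U g E D]
  show "holo_connection V (pull_bundle V U f E) (pull_connection V U g E D)" using gD by (simp add: PE)
  fix x v s assume x: "x \<in> pts V" and v: "v \<in> tangent_space V x" and s: "s \<in> germ_section U E (f x)"
  have ev: "\<forall>\<^sub>F y in mnhds V x. g y = f y" using eventually_mnhds_pts[OF V] by eventually_elim (simp add: fg)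
  have s': "s \<in> germ_section U E (g x)" using s by (simp add: fg[OF x, symmetric])
  have "pull_connection V U g E D x v (\<lambda>y. s (f y)) = pull_connection V U g E D x v (\<lambda>y. s (g y))"
    by (rule conn_cong[OF V gP gD x v, symmetric])
      (use germ_section_pull[OF V U g E D x s'] ev in \<open>auto elim: eventually_mono\<close>)
  also have "\<dots> = D (g x) (push_tangent U g x v) s"
    by (rule pull_connection_pull_section[OF V U g E D x v s'])
  also have "push_tangent U g x v = push_tangent U f x v"
    unfolding push_tangent_def fg[OF x, symmetric]
  proof (rule restrict_ext)
    fix h assume "h \<in> germ_fun U (f x)"
    then have "h \<in> germ_fun U (g x)" by (simp add: fg[OF x])
    from germ_fun_compose[OF V U g x this]
    show "v (\<lambda>y. h (g y)) = v (\<lambda>y. h (f y))"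
      by (rule tangent_cong[OF V x v]) (use ev in \<open>eventually_elim, simp\<close>)
  qed
  finally show "pull_connection V U g E D x v (\<lambda>y. s (f y)) = D (f x) (push_tangent U f x v) s"
    by (simp add: fg[OF x])
qed

lemma pull_connection_id:
  assumes U: "holo_atlas U" and E: "holo_bundle U E" and D: "holo_connection U E D"
  shows "pull_connection U U (\<lambda>x. x) E D = D"
proof (rule pull_connection_unique[OF U U holo_map_id[OF U] E D])
  show "holo_connection U (pull_bundle U U (\<lambda>x. x) E) D" using D by (simp add: pull_bundle_id[OF U E])
  fix x v s assume x: "x \<in> pts U" and v: "v \<in> tangent_space U x"
  have "push_tangent U (\<lambda>x. x) x v = v"
    unfolding push_tangent_def using tangent_extensional[OF U x v] by (simp add: extensional_restrict)
  then show "D x v s = D x (push_tangent U (\<lambda>x. x) x v) s" by simp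
qed

section \<open>Pullbacks of objects\<close>

abbreviation hvb_obs :: "'u cmfd \<Rightarrow> ('u, 'e) hvb_object set"
  where "hvb_obs U \<equiv> {(E, D). holo_bundle U E \<and> holo_connection U E D}"

lemma fst_pull_object [simp]: "fst (pull_object V U f A) = pull_bundle V U f (fst A)"
  by (simp add: pull_object_def case_prod_unfold)

lemma pull_object_obs:
  "holo_atlas V \<Longrightarrow> holo_atlas U \<Longrightarrow> holo_map V U f \<Longrightarrow> A \<in> hvb_obs U \<Longrightarrow> pull_object V U f A \<in> hvb_obs V"
  by (auto simp: pull_object_def holo_bundle_pull holo_connection_pull)

lemma pull_object_compose:
  assumes "holo_atlas Z" "holo_atlas V" "holo_atlas U" "holo_map Z V g" "holo_map V U f" "A \<in> hvb_obs U"
  shows "pull_object Z V g (pull_object V U f A) = pull_object Z U (\<lambda>z. f (g z)) A"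
  using assms by (auto simp: pull_object_def pull_bundle_compose pull_connection_compose)

lemma pull_object_cong:
  assumes "holo_atlas V" "holo_atlas U" "holo_map V U f" "A \<in> hvb_obs U" "\<And>x. x \<in> pts V \<Longrightarrow> f x = g x"
  shows "pull_object V U f A = pull_object V U g A"
  using assms(4) pull_bundle_cong[of V f g U, OF assms(5)] pull_connection_cong[OF assms(1-3) _ _ assms(5)]
  by (auto simp: pull_object_def)

lemma pull_object_id: "holo_atlas U \<Longrightarrow> A \<in> hvb_obs U \<Longrightarrow> pull_object U U (\<lambda>x. x) A = A"
  by (auto simp: pull_object_def pull_bundle_id pull_connection_id)

section \<open>The simplex category\<close>

text \<open>Degenerate edges are included, so that \<open>edge_map\<close> and the constant maps on
  \<open>[1]\<close> become special cases of one notation.\<close>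

definition edge2 :: "nat \<Rightarrow> nat \<Rightarrow> nat \<Rightarrow> nat"
  where "edge2 i j = (\<lambda>k\<in>{..1}. if k = 0 then i else j)"

definition tri :: "nat \<Rightarrow> nat \<Rightarrow> nat \<Rightarrow> nat \<Rightarrow> nat"
  where "tri i j k = (\<lambda>l\<in>{..2}. if l = 0 then i else if l = 1 then j else k)"

lemma const_map_omaps: "i \<le> m \<Longrightarrow> const_map k i \<in> omaps k m"
  by (auto simp: const_map_def omaps_def mono_on_def)

lemma edge2_omaps: "i \<le> j \<Longrightarrow> j \<le> m \<Longrightarrow> edge2 i j \<in> omaps 1 m"
  by (auto simp: edge2_def omaps_def mono_on_def)

lemma tri_omaps: "i \<le> j \<Longrightarrow> j \<le> k \<Longrightarrow> k \<le> m \<Longrightarrow> tri i j k \<in> omaps 2 m"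
  by (auto simp: tri_def omaps_def mono_on_def)

lemma edge_map_eq: "edge_map i = edge2 i (Suc i)"
  by (auto simp: edge_map_def edge2_def le_Suc_eq)

lemma const_map_edge2: "const_map 1 i = edge2 i i"
  by (auto simp: const_map_def edge2_def)

lemma omaps_compose:
  assumes "\<theta> \<in> omaps k m" "a \<in> omaps p k"
  shows "compose {..p} \<theta> a \<in> omaps p m"
proof -
  have a: "\<And>i. i \<le> p \<Longrightarrow> a i \<le> k" "\<And>i j. i \<le> j \<Longrightarrow> j \<le> p \<Longrightarrow> a i \<le> a j"
    using assms(2) by (auto simp: omaps_def mono_on_def)
  have t: "\<And>i. i \<le> k \<Longrightarrow> \<theta> i \<le> m" "\<And>i j. i \<le> j \<Longrightarrow> j \<le> k \<Longrightarrow> \<theta> i \<le> \<theta> j"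
    using assms(1) by (auto simp: omaps_def mono_on_def)
  show ?thesis unfolding omaps_def mono_on_def compose_def using a t by simp
qed

lemma compose_const: "a \<in> omaps p m \<Longrightarrow> q \<le> p \<Longrightarrow> compose {..k} a (const_map k q) = const_map k (a q)"
  by (auto simp: compose_def const_map_def)

lemma compose_edge2: "compose {..1} a (edge2 i j) = edge2 (a i) (a j)"
  by (auto simp: compose_def edge2_def)

lemma compose_omaps_apply: "i \<le> k \<Longrightarrow> compose {..k} a \<theta> i = a (\<theta> i)"
  by (simp add: compose_def)

lemma const_map_0: "const_map k i 0 = i"
  by (simp add: const_map_def)

lemma edge2_0: "edge2 i j 0 = i" and edge2_1: "edge2 i j 1 = j" and edge2_Suc_0: "edge2 i j (Suc 0) = j"
  by (simp_all add: edge2_def)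

lemma tri_simps: "tri i j k 0 = i" "tri i j k (Suc 0) = j" "tri i j k 2 = k"
  by (simp_all add: tri_def)

section \<open>Cells of the totalisation\<close>

text \<open>The composite of \<open>k\<close> consecutive maps, beginning with
  \<open>\<alpha> i\<close>. It is not restricted to carriers, which makes \<open>achain_add\<close>
  unconditional; restrictions are imposed where isomorphisms are built from it.\<close>

primrec achain :: "(nat \<Rightarrow> 'm \<Rightarrow> 'e \<Rightarrow> 'e) \<Rightarrow> nat \<Rightarrow> nat \<Rightarrow> 'm \<Rightarrow> 'e \<Rightarrow> 'e"
  where
    "achain \<alpha> i 0 = (\<lambda>x e. e)"
  | "achain \<alpha> i (Suc k) = (\<lambda>x e. \<alpha> (i + k) x (achain \<alpha> i k x e))"

lemma achain_add: "achain \<alpha> i (j + k) x e = achain \<alpha> (i + j) k x (achain \<alpha> i j x e)"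
  by (induction k) (simp_all add: add.assoc)

definition eqv_object :: "('m, 'g, 'e) eqv_data \<Rightarrow> ('m, 'e) hvb_object"
  where "eqv_object = (\<lambda>(E, \<Phi>, D). (E, D))"

definition eqv_act :: "('m, 'g, 'e) eqv_data \<Rightarrow> ('m \<times> 'e) \<times> 'g \<Rightarrow> 'm \<times> 'e"
  where "eqv_act = (\<lambda>(E, \<Phi>, D). \<Phi>)"

lemma nerve_simplicesD:
  assumes "(X, h) \<in> simplices (nerve C) p"
  shows "X \<in> extensional {..p}" "h \<in> extensional (le_pairs p)"
    "q \<le> p \<Longrightarrow> X q \<in> Ob C"
    "q \<le> q' \<Longrightarrow> q' \<le> p \<Longrightarrow> h (q, q') \<in> Hom C (X q) (X q')"
    "q \<le> p \<Longrightarrow> h (q, q) = Id C (X q)"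
    "q \<le> q' \<Longrightarrow> q' \<le> q'' \<Longrightarrow> q'' \<le> p \<Longrightarrow> h (q, q'') = Comp C (X q) (X q') (X q'') (h (q', q'')) (h (q, q'))"
proof -
  have *: "X \<in> {..p} \<rightarrow>\<^sub>E Ob C" "h \<in> extensional (le_pairs p)" "\<forall>(i, j)\<in>le_pairs p. h (i, j) \<in> Hom C (X i) (X j)"
    "\<forall>i\<le>p. h (i, i) = Id C (X i)"
    "\<forall>i j k. i \<le> j \<and> j \<le> k \<and> k \<le> p \<longrightarrow> h (i, k) = Comp C (X i) (X j) (X k) (h (j, k)) (h (i, j))"
    using assms by (simp_all add: nerve_def)
  show "X \<in> extensional {..p}" using *(1) by (simp add: PiE_def)
  show "h \<in> extensional (le_pairs p)" by (rule *(2))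
  show "q \<le> p \<Longrightarrow> X q \<in> Ob C" using *(1) by (rule PiE_mem) simp
  show "q \<le> q' \<Longrightarrow> q' \<le> p \<Longrightarrow> h (q, q') \<in> Hom C (X q) (X q')"
    using bspec[OF *(3), of "(q, q')"] by (simp add: le_pairs_def)
  show "q \<le> p \<Longrightarrow> h (q, q) = Id C (X q)" using *(4) by blast
  show "q \<le> q' \<Longrightarrow> q' \<le> q'' \<Longrightarrow> q'' \<le> p \<Longrightarrow> h (q, q'') = Comp C (X q) (X q') (X q'') (h (q', q'')) (h (q, q'))"
    using *(5) by blast
qed

lemma nerve_simplicesI:
  assumes X: "X \<in> {..p} \<rightarrow>\<^sub>E Ob C" and h: "h \<in> extensional (le_pairs p)"
    and hom: "\<And>q q'. q \<le> q' \<Longrightarrow> q' \<le> p \<Longrightarrow> h (q, q') \<in> Hom C (X q) (X q')"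
    and id: "\<And>q. q \<le> p \<Longrightarrow> h (q, q) = Id C (X q)"
    and comp: "\<And>q q' q''. q \<le> q' \<Longrightarrow> q' \<le> q'' \<Longrightarrow> q'' \<le> p \<Longrightarrow>
      h (q, q'') = Comp C (X q) (X q') (X q'') (h (q', q'')) (h (q, q'))"
  shows "(X, h) \<in> simplices (nerve C) p"
proof -
  have "\<forall>(i, j)\<in>le_pairs p. h (i, j) \<in> Hom C (X i) (X j)"
    using hom by (auto simp: le_pairs_def)
  then show ?thesis
    unfolding nerve_def sset.simps mem_Collect_eq prod.case
    using X h id comp by (intro conjI allI impI) blast+
qed

lemma sact_nerve: "sact (nerve C) k m \<theta> (X, h) = (\<lambda>i\<in>{..k}. X (\<theta> i), \<lambda>(i, j)\<in>le_pairs k. h (\<theta> i, \<theta> j))"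
  by (simp add: nerve_def)

context lie_action
begin

text \<open>The isomorphism over \<open>M \<times> G\<^sup>l\<close> that first acts by \<open>g\<^bsub>i+1\<^esub> \<cdots> g\<^sub>j\<close> and then applies
  \<open>\<alpha>\<^bsub>c+k-1\<^esub> \<circ> \<cdots> \<circ> \<alpha>\<^sub>c\<close>.\<close>

definition cell_mor ::
    "(nat \<Rightarrow> ('m, 'g, 'e) eqv_data) \<Rightarrow> (nat \<Rightarrow> 'm \<Rightarrow> 'e \<Rightarrow> 'e) \<Rightarrow> nat \<Rightarrow> nat \<Rightarrow> nat \<Rightarrow> nat \<Rightarrow> nat
      \<Rightarrow> 'm \<times> 'g list \<Rightarrow> 'e \<Rightarrow> 'e"
  where "cell_mor B \<alpha> l i j c k = (\<lambda>P\<in>pts (lev l). \<lambda>e\<in>carrier (fibre (fst (B c)) (vmap i P)).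
    achain \<alpha> c k (vmap j P) (snd (eqv_act (B c) ((vmap i P, e), seg i j (snd P)))))"

text \<open>The inverse of \<open>cell_string\<close>. The chain lengths \<open>b q' - b q\<close>
  are honest differences because \<open>b\<close> is monotone.\<close>

definition cell_of ::
    "nat \<Rightarrow> (nat \<Rightarrow> ('m, 'g, 'e) eqv_data) \<times> (nat \<Rightarrow> 'm \<Rightarrow> 'e \<Rightarrow> 'e)
      \<Rightarrow> ('m \<times> 'g list, 'e) hvb_simplex tot_cell"
  where "cell_of n = (\<lambda>(B, \<alpha>) l p. \<lambda>(a, b)\<in>omaps p l \<times> omaps p n.
    (\<lambda>q\<in>{..p}. pull_object (lev l) M (vmap (a q)) (eqv_object (B (b q))),
     \<lambda>(q, q')\<in>le_pairs p. cell_mor B \<alpha> l (a q) (a q') (b q) (b q' - b q)))"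

abbreviation cells :: "nat \<Rightarrow> ('m \<times> 'g list, 'e) hvb_simplex tot_cell set"
  where "cells n \<equiv> simplices (Tot (HVB_quot M G N \<rho> :: ('m \<times> 'g list, 'e) hvb_simplex csset)) n"

text \<open>The clauses are: values in the nerve, naturality in the degree of the simplices,
  naturality in the cosimplicial level. Later proofs access cells only in this form.\<close>

lemma cells_iff:
  fixes F :: "('m \<times> 'g list, 'e) hvb_simplex tot_cell"
  shows "F \<in> cells n \<longleftrightarrow>
    (\<forall>l p. F l p \<in> omaps p l \<times> omaps p n \<rightarrow>\<^sub>E simplices (nerve (hvb_groupoid (lev l))) p) \<and>
    (\<forall>l k m. \<forall>\<theta>\<in>omaps k m. \<forall>a\<in>omaps m l. \<forall>b\<in>omaps m n.
      F l k (compose {..k} a \<theta>, compose {..k} b \<theta>) = sact (nerve (hvb_groupoid (lev l))) k m \<theta> (F l m (a, b))) \<and>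
    (\<forall>k m. \<forall>\<theta>\<in>omaps k m. \<forall>p. \<forall>a\<in>omaps p k. \<forall>b\<in>omaps p n.
         F m p (compose {..p} \<theta> a, b) = HVB_pull (lev m) (lev k) (quot_map G \<rho> k \<theta>) p (F k p (a, b)))"
  by (auto simp: Tot_def smaps_def prod_sset_def std_simplex_def HVB_quot_def HVB_def)

lemma vmap_base_incl: "x \<in> pts M \<Longrightarrow> vmap j (base_incl x) = x"
  by (simp add: base_incl_def vmap_def seg_def list_mult_def act_one)

text \<open>\<open>base_incl\<close> is a section of every vertex map, since over
  \<open>M \<times> G\<^sup>0\<close> all segments are empty products.\<close>

lemma pull_base_incl_vmap:
  assumes A: "A \<in> hvb_obs M"
  shows "pull_object M (lev 0) base_incl (pull_object (lev 0) M (vmap j) A) = A"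
proof -
  have "pull_object M (lev 0) base_incl (pull_object (lev 0) M (vmap j) A)
      = pull_object M M (\<lambda>x. vmap j (base_incl x)) A"
    by (rule pull_object_compose[OF atlas_M atlas_level atlas_M holo_base_incl holo_vmap A])
  also have "\<dots> = pull_object M M (\<lambda>x. x) A"
    by (rule pull_object_cong[OF atlas_M atlas_M
          holo_map_compose[OF atlas_M atlas_level atlas_M holo_base_incl holo_vmap] A vmap_base_incl])
  also have "\<dots> = A" by (rule pull_object_id[OF atlas_M A])
  finally show ?thesis .
qed

lemma pull_base_incl_apply: "x \<in> pts M \<Longrightarrow> pull_iso M base_incl h x = h (x, [])"
  by (simp add: pull_iso_def base_incl_def)

section \<open>The data extracted from a cell\<close>

context
  fixes F :: "('m \<times> 'g list, 'e) hvb_simplex tot_cell" and n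
  assumes F: "F \<in> cells n"
begin

lemma cell_PiE: "F l p \<in> omaps p l \<times> omaps p n \<rightarrow>\<^sub>E simplices (nerve (hvb_groupoid (lev l))) p"
  using F unfolding cells_iff by blast

lemma cell_simplex:
  assumes "a \<in> omaps p l" "b \<in> omaps p n"
  shows "(fst (F l p (a, b)), snd (F l p (a, b))) \<in> simplices (nerve (hvb_groupoid (lev l))) p"
  using PiE_mem[OF cell_PiE, of "(a, b)" p l] assms by simp

lemma cell_sact:
  assumes "\<theta> \<in> omaps k m" "a \<in> omaps m l" "b \<in> omaps m n"
  shows "F l k (compose {..k} a \<theta>, compose {..k} b \<theta>)
    = sact (nerve (hvb_groupoid (lev l))) k m \<theta> (fst (F l m (a, b)), snd (F l m (a, b)))"
proof -
  have "\<forall>l k m. \<forall>\<theta>\<in>omaps k m. \<forall>a\<in>omaps m l. \<forall>b\<in>omaps m n.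
      F l k (compose {..k} a \<theta>, compose {..k} b \<theta>) = sact (nerve (hvb_groupoid (lev l))) k m \<theta> (F l m (a, b))"
    using F unfolding cells_iff by (elim conjE)
  then show ?thesis using assms by simp
qed

lemma cell_sact_fst:
  assumes "\<theta> \<in> omaps k m" "a \<in> omaps m l" "b \<in> omaps m n" "i \<le> k"
  shows "fst (F l k (compose {..k} a \<theta>, compose {..k} b \<theta>)) i = fst (F l m (a, b)) (\<theta> i)"
  unfolding cell_sact[OF assms(1-3)] sact_nerve using assms(4) by simp

lemma cell_sact_snd:
  assumes "\<theta> \<in> omaps k m" "a \<in> omaps m l" "b \<in> omaps m n" "i \<le> j" "j \<le> k"
  shows "snd (F l k (compose {..k} a \<theta>, compose {..k} b \<theta>)) (i, j) = snd (F l m (a, b)) (\<theta> i, \<theta> j)"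
  unfolding cell_sact[OF assms(1-3)] sact_nerve using assms(4,5) by (simp add: le_pairs_def)

lemma cell_cact:
  assumes "\<theta> \<in> omaps k m" "a \<in> omaps p k" "b \<in> omaps p n"
  shows "F m p (compose {..p} \<theta> a, b)
    = HVB_pull (lev m) (lev k) (quot_map G \<rho> k \<theta>) p (fst (F k p (a, b)), snd (F k p (a, b)))"
proof -
  have "\<forall>k m. \<forall>\<theta>\<in>omaps k m. \<forall>p. \<forall>a\<in>omaps p k. \<forall>b\<in>omaps p n.
         F m p (compose {..p} \<theta> a, b) = HVB_pull (lev m) (lev k) (quot_map G \<rho> k \<theta>) p (F k p (a, b))"
    using F unfolding cells_iff by (elim conjE)
  then show ?thesis using assms by simp
qed

lemma cell_cact_fst:
  assumes "\<theta> \<in> omaps k m" "a \<in> omaps p k" "b \<in> omaps p n" "q \<le> p"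
  shows "fst (F m p (compose {..p} \<theta> a, b)) q
    = pull_object (lev m) (lev k) (quot_map G \<rho> k \<theta>) (fst (F k p (a, b)) q)"
  unfolding cell_cact[OF assms(1-3)] HVB_pull_def nerve_map_def using assms(4) by (simp add: case_prod_unfold)

lemma cell_cact_snd:
  assumes "\<theta> \<in> omaps k m" "a \<in> omaps p k" "b \<in> omaps p n" "q \<le> q'" "q' \<le> p"
  shows "snd (F m p (compose {..p} \<theta> a, b)) (q, q')
    = pull_iso (lev m) (quot_map G \<rho> k \<theta>) (snd (F k p (a, b)) (q, q'))"
  unfolding cell_cact[OF assms(1-3)] HVB_pull_def nerve_map_def using assms(4,5) by (simp add: le_pairs_def case_prod_unfold)

lemma cell_obs:
  "a \<in> omaps p l \<Longrightarrow> b \<in> omaps p n \<Longrightarrow> q \<le> p \<Longrightarrow> fst (F l p (a, b)) q \<in> hvb_obs (lev l)"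
  using nerve_simplicesD(3)[OF cell_simplex, of a p l b q] by (simp add: hvb_groupoid_def)

lemma cell_isos:
  "a \<in> omaps p l \<Longrightarrow> b \<in> omaps p n \<Longrightarrow> q \<le> q' \<Longrightarrow> q' \<le> p \<Longrightarrow>
    snd (F l p (a, b)) (q, q') \<in> bundle_isos (lev l) (fst (fst (F l p (a, b)) q)) (fst (fst (F l p (a, b)) q'))"
  using nerve_simplicesD(4)[OF cell_simplex, of a p l b q q'] by (simp add: hvb_groupoid_def case_prod_unfold)

lemma cell_id:
  assumes "a \<in> omaps p l" "b \<in> omaps p n" "q \<le> p" "P \<in> pts (lev l)"
    "e \<in> carrier (fibre (fst (fst (F l p (a, b)) q)) P)"
  shows "snd (F l p (a, b)) (q, q) P e = e"
  using nerve_simplicesD(5)[OF cell_simplex[OF assms(1,2)] assms(3)] assms(4,5)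
  by (simp add: hvb_groupoid_def case_prod_unfold)

lemma cell_comp:
  assumes "a \<in> omaps p l" "b \<in> omaps p n" "q \<le> q'" "q' \<le> q''" "q'' \<le> p" "P \<in> pts (lev l)"
    "e \<in> carrier (fibre (fst (fst (F l p (a, b)) q)) P)"
  shows "snd (F l p (a, b)) (q, q'') P e = snd (F l p (a, b)) (q', q'') P (snd (F l p (a, b)) (q, q') P e)"
  using nerve_simplicesD(6)[OF cell_simplex[OF assms(1,2)] assms(3-5)] assms(6,7)
  by (simp add: hvb_groupoid_def case_prod_unfold compose_def)

text \<open>The ingredients of a cell: the objects over \<open>M \<times> G\<^sup>0\<close> moved to
  \<open>M\<close>, and below them in \<open>cell_act\<close> the arrows over
  \<open>M \<times> G\<close> along the edge of the first factor, in \<open>cell_arr\<close> the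
  arrows over \<open>M \<times> G\<^sup>0\<close> along edges of the second.\<close>

definition cell_ob :: "nat \<Rightarrow> ('m, 'e) hvb_object"
  where "cell_ob i = pull_object M (lev 0) base_incl (fst (F 0 0 (const_map 0 0, const_map 0 i)) 0)"

definition cell_act :: "nat \<Rightarrow> 'm \<times> 'g list \<Rightarrow> 'e \<Rightarrow> 'e"
  where "cell_act i = snd (F 1 1 (edge2 0 1, edge2 i i)) (0, 1)"

definition cell_arr :: "nat \<Rightarrow> nat \<Rightarrow> 'm \<times> 'g list \<Rightarrow> 'e \<Rightarrow> 'e"
  where "cell_arr i j = snd (F 0 1 (edge2 0 0, edge2 i j)) (0, 1)"

lemma cell_ob_obs: "i \<le> n \<Longrightarrow> cell_ob i \<in> hvb_obs M"
  unfolding cell_ob_def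
  by (rule pull_object_obs[OF atlas_M atlas_level holo_base_incl cell_obs]) (simp_all add: const_map_omaps)

lemma cell_ob_bundle: "i \<le> n \<Longrightarrow> holo_bundle M (fst (cell_ob i))"
  using cell_ob_obs[of i] by auto

text \<open>Naturality in the degree restricts to the vertex \<open>q\<close>. Naturality in the
  level then pulls back from \<open>M \<times> G\<^sup>0\<close> along the structure map of the
  constant map at \<open>a q\<close>, which is \<open>base_incl\<close> after
  \<open>vmap (a q)\<close>.\<close>

lemma cell_object:
  assumes a: "a \<in> omaps p l" and b: "b \<in> omaps p n" and q: "q \<le> p"
  shows "fst (F l p (a, b)) q = pull_object (lev l) M (vmap (a q)) (cell_ob (b q))"
proof -
  have bq: "b q \<le> n" and aq: "a q \<le> l" using omaps_bound[OF a q] omaps_bound[OF b q] by auto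
  let ?O = "fst (F 0 0 (const_map 0 0, const_map 0 (b q))) 0"
  have O: "?O \<in> hvb_obs (lev 0)" by (rule cell_obs) (simp_all add: const_map_omaps bq)
  have "fst (F l p (a, b)) q = fst (F l 0 (compose {..0} a (const_map 0 q), compose {..0} b (const_map 0 q))) 0"
    using cell_sact_fst[OF const_map_omaps[OF q] a b le0] unfolding const_map_0 by (rule sym)
  also have "\<dots> = fst (F l 0 (compose {..0} (const_map 0 (a q)) (const_map 0 0), const_map 0 (b q))) 0"
    by (simp only: compose_const[OF a q] compose_const[OF b q] compose_const[OF const_map_omaps[OF aq] le0]
        const_map_0)
  also have "\<dots> = pull_object (lev l) (lev 0) (quot_map G \<rho> 0 (const_map 0 (a q))) ?O"
    by (rule cell_cact_fst) (simp_all add: const_map_omaps aq bq)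
  also have "\<dots> = pull_object (lev l) (lev 0) (\<lambda>P. base_incl (vmap (a q) P)) ?O"
    by (rule pull_object_cong[OF atlas_level atlas_level holo_quot_map O])
      (auto simp: quot_map_eq base_incl_def const_map_0)
  also have "\<dots> = pull_object (lev l) M (vmap (a q)) (cell_ob (b q))"
    unfolding cell_ob_def by (rule pull_object_compose[symmetric, OF atlas_level atlas_M atlas_level holo_vmap holo_base_incl O])
  finally show ?thesis .
qed

lemma cell_fibre:
  "a \<in> omaps p l \<Longrightarrow> b \<in> omaps p n \<Longrightarrow> q \<le> p \<Longrightarrow> P \<in> pts (lev l) \<Longrightarrow>
    fibre (fst (fst (F l p (a, b)) q)) P = fibre (fst (cell_ob (b q))) (vmap (a q) P)"
  by (simp add: cell_object)

text \<open>A nerve simplex records all arrows of its functor, and restricting it to the edge from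
  \<open>q\<close> to \<open>q'\<close> keeps the one in question.\<close>

lemma cell_edge_snd:
  assumes a: "a \<in> omaps p l" and b: "b \<in> omaps p n" and q: "q \<le> q'" "q' \<le> p"
  shows "snd (F l p (a, b)) (q, q') = snd (F l 1 (edge2 (a q) (a q'), edge2 (b q) (b q'))) (0, 1)"
  using cell_sact_snd[OF edge2_omaps[OF q] a b zero_le_one order_refl]
  unfolding compose_edge2 edge2_0 edge2_1 by (rule sym)

text \<open>The edge from \<open>i\<close> to \<open>j\<close> is the image of the edge of
  \<open>[1]\<close> under \<open>edge2 i j\<close>, whose structure map sends \<open>P\<close> to
  its \<open>i\<close>-th vertex together with the segment from \<open>i\<close> to
  \<open>j\<close>.\<close>

lemma cell_act_pull:
  assumes ij: "i \<le> j" "j \<le> l" and c: "c \<le> n" and P: "P \<in> pts (lev l)"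
  shows "snd (F l 1 (edge2 i j, edge2 c c)) (0, 1) P = cell_act c (vmap i P, [seg i j (snd P)])"
proof -
  have id: "compose {..1} (edge2 i j) (edge2 0 1) = edge2 i j" by (simp only: compose_edge2 edge2_0 edge2_1)
  have "snd (F l 1 (edge2 i j, edge2 c c)) (0, 1)
      = pull_iso (lev l) (quot_map G \<rho> 1 (edge2 i j)) (cell_act c)"
    using cell_cact_snd[OF edge2_omaps[OF ij] edge2_omaps[of 0 1 1] edge2_omaps[of c c n], of 0 1] c
    unfolding id cell_act_def by simp
  then show ?thesis using P by (cases P) (simp add: pull_iso_def quot_map_eq edge2_0 edge2_Suc_0)
qed

lemma cell_arr_pull:
  assumes j: "j \<le> l" and c: "c \<le> c'" "c' \<le> n" and P: "P \<in> pts (lev l)"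
  shows "snd (F l 1 (edge2 j j, edge2 c c')) (0, 1) P = cell_arr c c' (vmap j P, [])"
proof -
  have id: "compose {..1} (const_map 0 j) (edge2 0 0) = edge2 j j" by (simp only: compose_edge2 const_map_0)
  have "snd (F l 1 (edge2 j j, edge2 c c')) (0, 1)
      = pull_iso (lev l) (quot_map G \<rho> 0 (const_map 0 j)) (cell_arr c c')"
    using cell_cact_snd[OF const_map_omaps[OF j] edge2_omaps[of 0 0 0] edge2_omaps[OF c], of 0 1]
    unfolding id cell_arr_def by simp
  then show ?thesis using P by (cases P) (simp add: pull_iso_def quot_map_eq const_map_0)
qed

text \<open>Functoriality on the 2-simplex \<open>(tri i j k, tri c c' c'')\<close>. Repeated
  vertices in one or both factors give associativity of the action, the factorisation of arrows and
  both halves of the commuting squares.\<close>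

lemma cell_triangle:
  assumes a: "i \<le> j" "j \<le> k" "k \<le> l" and b: "c \<le> c'" "c' \<le> c''" "c'' \<le> n" and P: "P \<in> pts (lev l)"
    and e: "e \<in> carrier (fibre (fst (cell_ob c)) (vmap i P))"
  shows "snd (F l 1 (edge2 i k, edge2 c c'')) (0, 1) P e
    = snd (F l 1 (edge2 j k, edge2 c' c'')) (0, 1) P (snd (F l 1 (edge2 i j, edge2 c c')) (0, 1) P e)"
proof -
  note t = tri_omaps[OF a] tri_omaps[OF b]
  have "snd (F l 2 (tri i j k, tri c c' c'')) (0, 2) P e
    = snd (F l 2 (tri i j k, tri c c' c'')) (1, 2) P (snd (F l 2 (tri i j k, tri c c' c'')) (0, 1) P e)"
    by (rule cell_comp[OF t _ _ _ P]) (use e in \<open>simp_all add: cell_fibre[OF t _ P] tri_simps\<close>)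
  then show ?thesis
    using cell_edge_snd[OF t, of 0 2] cell_edge_snd[OF t, of 1 2] cell_edge_snd[OF t, of 0 1]
    by (simp add: tri_simps)
qed

lemma cell_act_isos:
  assumes c: "c \<le> n"
  shows "cell_act c \<in> bundle_isos (lev 1) (pull_bundle (lev 1) M (vmap 0) (fst (cell_ob c)))
    (pull_bundle (lev 1) M (vmap 1) (fst (cell_ob c)))"
proof -
  have o: "edge2 0 1 \<in> omaps 1 1" "edge2 c c \<in> omaps 1 n" by (rule edge2_omaps; simp add: c)+
  show ?thesis
    using cell_isos[OF o, of 0 1] cell_object[OF o, of 0] cell_object[OF o, of 1]
    by (simp add: cell_act_def edge2_0 edge2_Suc_0)
qed

lemma cell_arr_isos:
  assumes c: "c \<le> c'" "c' \<le> n"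
  shows "pull_iso M base_incl (cell_arr c c') \<in> bundle_isos M (fst (cell_ob c)) (fst (cell_ob c'))"
proof -
  have o: "edge2 0 0 \<in> omaps 1 0" "edge2 c c' \<in> omaps 1 n" by (rule edge2_omaps; simp add: c)+
  have cc: "c \<le> n" using c by simp
  have "cell_arr c c' \<in> bundle_isos (lev 0) (fst (pull_object (lev 0) M (vmap 0) (cell_ob c)))
      (fst (pull_object (lev 0) M (vmap 0) (cell_ob c')))"
    using cell_isos[OF o, of 0 1] cell_object[OF o, of 0] cell_object[OF o, of 1]
    by (simp add: cell_arr_def edge2_0 edge2_Suc_0)
  then have "pull_iso M base_incl (cell_arr c c') \<in> bundle_isos M
      (pull_bundle M (lev 0) base_incl (fst (pull_object (lev 0) M (vmap 0) (cell_ob c))))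
      (pull_bundle M (lev 0) base_incl (fst (pull_object (lev 0) M (vmap 0) (cell_ob c'))))"
    by (rule pull_iso_bundle_isos[OF atlas_M atlas_level holo_base_incl, rotated 2])
      (simp_all add: holo_bundle_pull[OF atlas_level atlas_M holo_vmap cell_ob_bundle] c cc)
  then show ?thesis
    using arg_cong[OF pull_base_incl_vmap[OF cell_ob_obs[OF cc]], of fst] arg_cong[OF pull_base_incl_vmap[OF cell_ob_obs[OF c(2)]], of fst]
    by simp
qed

lemma cell_edge_id:
  assumes i: "i \<le> l" and c: "c \<le> n" and P: "P \<in> pts (lev l)"
    and e: "e \<in> carrier (fibre (fst (cell_ob c)) (vmap i P))"
  shows "snd (F l 1 (edge2 i i, edge2 c c)) (0, 1) P e = e"
proof -
  have o: "const_map 0 i \<in> omaps 0 l" "const_map 0 c \<in> omaps 0 n" using i c by (simp_all add: const_map_omaps)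
  have "snd (F l 0 (const_map 0 i, const_map 0 c)) (0, 0) P e = e"
    by (rule cell_id[OF o _ P]) (use e in \<open>simp_all add: cell_fibre[OF o _ P] const_map_0\<close>)
  then show ?thesis using cell_edge_snd[OF o, of 0 0] by (simp add: const_map_0)
qed

lemma cell_mor_eq:
  assumes a: "a \<in> omaps p l" and b: "b \<in> omaps p n" and q: "q \<le> q'" "q' \<le> p" and P: "P \<in> pts (lev l)"
    and e: "e \<in> carrier (fibre (fst (cell_ob (b q))) (vmap (a q) P))"
  shows "snd (F l p (a, b)) (q, q') P e = pull_iso M base_incl (cell_arr (b q) (b q')) (vmap (a q') P)
    (cell_act (b q) (vmap (a q) P, [seg (a q) (a q') (snd P)]) e)"
proof -
  have le: "a q \<le> a q'" "a q' \<le> l" "b q \<le> b q'" "b q' \<le> n" "b q \<le> n"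
    using omaps_le[OF a q] omaps_le[OF b q] omaps_bound[OF a q(2)] omaps_bound[OF b q(2)] by simp_all
  show ?thesis
    unfolding cell_edge_snd[OF a b q] cell_triangle[OF le(1) order_refl le(2) order_refl le(3,4) P e]
    by (simp only: cell_arr_pull[OF le(2-4) P] cell_act_pull[OF le(1,2,5) P] pull_base_incl_apply[OF vmap_closed[OF P]])
qed

text \<open>Induction along consecutive edges, the last one being split off by a triangle that is
  constant in the first factor; length 0 is a degenerate edge.\<close>

lemma cell_arr_chain:
  assumes \<alpha>: "\<And>i. i < n \<Longrightarrow> \<alpha> i = pull_iso M base_incl (cell_arr i (Suc i))"
    and x: "x \<in> pts M" and e: "e \<in> carrier (fibre (fst (cell_ob c)) x)"
  shows "c + k \<le> n \<Longrightarrow> pull_iso M base_incl (cell_arr c (c + k)) x e = achain \<alpha> c k x e"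
proof (induction k)
  case 0
  have P: "(x, []) \<in> pts (lev 0)" using base_incl_pts[OF x] by (simp add: base_incl_def)
  have "vmap 0 (x, []) = x" using vmap_0[OF P] by simp
  then show ?case
    using cell_edge_id[OF _ _ P, of 0 c e] e 0 by (simp add: pull_base_incl_apply[OF x] cell_arr_def)
next
  case (Suc k)
  have P: "(x, []) \<in> pts (lev 0)" using base_incl_pts[OF x] by (simp add: base_incl_def)
  have v: "vmap 0 (x, []) = x" using vmap_0[OF P] by simp
  have "snd (F 0 1 (edge2 0 0, edge2 c (c + Suc k))) (0, 1) (x, []) e
      = snd (F 0 1 (edge2 0 0, edge2 (c + k) (c + Suc k))) (0, 1) (x, [])
        (snd (F 0 1 (edge2 0 0, edge2 c (c + k))) (0, 1) (x, []) e)"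
    by (rule cell_triangle[OF _ _ _ _ _ _ P]) (use Suc.prems e v in auto)
  then show ?case
    using Suc \<alpha>[of "c + k"] by (simp add: pull_base_incl_apply[OF x] cell_arr_def)
qed

end

section \<open>Equivariant bundles and isomorphisms over \<open>M \<times> G\<close>\<close>

lemma vmap_1: "(x, [g]) \<in> pts (lev 1) \<Longrightarrow> vmap (Suc 0) (x, [g]) = \<rho> x g"
  by (simp add: vmap_def seg_Suc pts_level)

text \<open>The action is composed of the identification of \<open>E \<times> G\<close> with the
  pullback along \<open>vmap 0\<close>, the isomorphism \<open>\<beta>\<close>, and the projection
  from the pullback along \<open>vmap 1\<close> to \<open>E\<close>; each of them is
  holomorphic.\<close>

lemma equivariant_bundleI:
  assumes E: "holo_bundle M E"
    and \<beta>: "\<beta> \<in> bundle_isos (lev 1) (pull_bundle (lev 1) M (vmap 0) E) (pull_bundle (lev 1) M (vmap 1) E)"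
    and one: "\<And>x e. x \<in> pts M \<Longrightarrow> e \<in> carrier (fibre E x) \<Longrightarrow> \<beta> (x, [\<one>\<^bsub>G\<^esub>]) e = e"
    and mult: "\<And>x e g h. x \<in> pts M \<Longrightarrow> e \<in> carrier (fibre E x) \<Longrightarrow> g \<in> carrier G \<Longrightarrow> h \<in> carrier G \<Longrightarrow>
      \<beta> (\<rho> x g, [h]) (\<beta> (x, [g]) e) = \<beta> (x, [g \<otimes>\<^bsub>G\<^esub> h]) e"
  shows "equivariant_bundle M G N \<rho> E (\<lambda>((x, e), g)\<in>pts (total_space M E) \<times> carrier G. (\<rho> x g, \<beta> (x, [g]) e))"
    (is "equivariant_bundle M G N \<rho> E ?\<Phi>")
proof -
  let ?T = "total_space M E" and ?P0 = "pull_bundle (lev 1) M (vmap 0) E" and ?P1 = "pull_bundle (lev 1) M (vmap 1) E"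
  note AT = holo_atlas_total[OF atlas_M E] and pT = pts_total[OF atlas_M E]
  note ATN = holo_atlas_prod[OF AT atlas_N]
  note P0 = holo_bundle_pull[OF atlas_level atlas_M holo_vmap E]
  have pl: "(x, [g]) \<in> pts (lev 1)" if "x \<in> pts M" "g \<in> carrier G" for x g
    using that by (simp add: pts_level)
  have v0: "vmap 0 (x, [g]) = x" if "x \<in> pts M" "g \<in> carrier G" for x g
    using vmap_0[OF pl[OF that]] by simp
  have v1: "vmap (Suc 0) (x, [g]) = \<rho> x g" if "x \<in> pts M" "g \<in> carrier G" for x g
    by (rule vmap_1[OF pl[OF that]])
  have lin: "clinear (fibre E x) (fibre E (\<rho> x g)) (\<beta> (x, [g]))" if "x \<in> pts M" "g \<in> carrier G" for x g
    using bundle_isosD(3)[OF \<beta> pl[OF that]] pl[OF that] vmap_0[OF pl[OF that]] vmap_1[OF pl[OF that]] by simp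
  have cl: "\<beta> (x, [g]) e \<in> carrier (fibre E (\<rho> x g))"
    if "x \<in> pts M" "g \<in> carrier G" "e \<in> carrier (fibre E x)" for x g e
    using lin[OF that(1,2)] that(3) by (auto simp: clinear_def)
  have "holo_map (prod_mfd ?T N) (total_space (lev 1) ?P0) (\<lambda>z. ((fst (fst z), [snd z]), snd (fst z)))"
  proof (rule holo_map_into_pull[OF atlas_level atlas_M holo_vmap E ATN])
    have f: "holo_map (prod_mfd ?T N) M (\<lambda>z. fst (fst z))"
      by (rule holo_map_compose[OF ATN AT atlas_M holo_map_fst[OF AT atlas_N] holo_total_fst[OF atlas_M E]])
    have "holo_map (prod_mfd ?T N) (power_mfd N (Suc 0)) (\<lambda>z. [snd z])"
      by (rule holo_map_Cons[OF atlas_N ATN holo_map_snd[OF AT atlas_N] holo_map_power_0[OF ATN]])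
    from holo_map_level[OF ATN f this]
    show 1: "holo_map (prod_mfd ?T N) (lev 1) (\<lambda>z. fst ((fst (fst z), [snd z]), snd (fst z)))" by simp
    show "holo_map (prod_mfd ?T N) ?T (\<lambda>z. (vmap 0 (fst ((fst (fst z), [snd z]), snd (fst z))),
        snd ((fst (fst z), [snd z]), snd (fst z))))"
      by (rule holo_map_cong[OF ATN AT _ holo_map_fst[OF AT atlas_N]])
        (auto simp: pT pts_N v0)
  qed
  from holo_map_compose[OF ATN holo_atlas_total[OF atlas_level P0] holo_atlas_total[OF atlas_level P0] this bundle_isosD(6)[OF \<beta>]]
  have "holo_map (prod_mfd ?T N) (total_space (lev 1) ?P1) (\<lambda>z. ((fst (fst z), [snd z]), \<beta> (fst (fst z), [snd z]) (snd (fst z))))"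
    by simp
  from holo_map_compose[OF ATN holo_atlas_total[OF atlas_level P0] AT this
      holo_map_pull_total[OF atlas_level atlas_M holo_vmap E]]
  have "holo_map (prod_mfd ?T N) ?T (\<lambda>z. (vmap 1 (fst (fst z), [snd z]), \<beta> (fst (fst z), [snd z]) (snd (fst z))))"
    by simp
  then have holo: "holo_map (prod_mfd ?T N) ?T ?\<Phi>"
    by (rule holo_map_cong[OF ATN AT, rotated]) (auto simp: pT pts_N v1)
  show ?thesis
    unfolding equivariant_bundle_def Let_def
    using E holo cl lin act_closed
    by (auto simp: pT one mult act_one act_mult intro: clinear_cong[OF holo_bundle_module[OF E] _ lin])
qed

context
  fixes E :: "('m, 'e) vbundle" and \<Phi>
  assumes E: "equivariant_bundle M G N \<rho> E \<Phi>"
begin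

lemma eqv_bundle: "holo_bundle M E"
  using E by (simp add: equivariant_bundle_def Let_def)

lemma eqv_ext: "\<Phi> \<in> extensional (pts (total_space M E) \<times> carrier G)"
  using E by (simp add: equivariant_bundle_def Let_def)

lemma eqv_holo: "holo_map (prod_mfd (total_space M E) N) (total_space M E) \<Phi>"
  using E by (simp add: equivariant_bundle_def Let_def)

lemma eqv_pt: "x \<in> pts M \<Longrightarrow> e \<in> carrier (fibre E x) \<Longrightarrow> (x, e) \<in> pts (total_space M E)"
  by (simp add: pts_total[OF atlas_M eqv_bundle])

lemma eqv_pair:
  assumes "x \<in> pts M" "e \<in> carrier (fibre E x)" "g \<in> carrier G"
  shows "\<Phi> ((x, e), g) = (\<rho> x g, snd (\<Phi> ((x, e), g)))"
proof -
  have "\<forall>p\<in>pts (total_space M E). \<forall>g\<in>carrier G. fst (\<Phi> (p, g)) = \<rho> (fst p) g"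
    using E by (simp add: equivariant_bundle_def Let_def)
  from bspec[OF bspec[OF this eqv_pt[OF assms(1,2)]] assms(3)] show ?thesis by (simp add: prod_eq_iff)
qed

lemma eqv_clinear:
  "x \<in> pts M \<Longrightarrow> g \<in> carrier G \<Longrightarrow> clinear (fibre E x) (fibre E (\<rho> x g)) (\<lambda>e. snd (\<Phi> ((x, e), g)))"
  using E by (simp add: equivariant_bundle_def Let_def)

lemma eqv_closed:
  "x \<in> pts M \<Longrightarrow> e \<in> carrier (fibre E x) \<Longrightarrow> g \<in> carrier G \<Longrightarrow> snd (\<Phi> ((x, e), g)) \<in> carrier (fibre E (\<rho> x g))"
  using eqv_clinear[of x g] by (auto simp: clinear_def)

lemma eqv_one: "x \<in> pts M \<Longrightarrow> e \<in> carrier (fibre E x) \<Longrightarrow> snd (\<Phi> ((x, e), \<one>\<^bsub>G\<^esub>)) = e"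
  using E eqv_pt[of x e] by (simp add: equivariant_bundle_def Let_def)

lemma eqv_mult:
  assumes "x \<in> pts M" "e \<in> carrier (fibre E x)" "g \<in> carrier G" "h \<in> carrier G"
  shows "snd (\<Phi> ((\<rho> x g, snd (\<Phi> ((x, e), g))), h)) = snd (\<Phi> ((x, e), g \<otimes>\<^bsub>G\<^esub> h))"
proof -
  have "\<forall>p\<in>pts (total_space M E). \<forall>g\<in>carrier G. \<forall>h\<in>carrier G. \<Phi> (\<Phi> (p, g), h) = \<Phi> (p, g \<otimes>\<^bsub>G\<^esub> h)"
    using E by (simp add: equivariant_bundle_def Let_def)
  from bspec[OF bspec[OF bspec[OF this eqv_pt[OF assms(1,2)]] assms(3)] assms(4)]
  show ?thesis using eqv_pair[OF assms(1-3)] by simp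
qed

text \<open>Stated for an arbitrary holomorphic \<open>s\<close> that moves vertex \<open>i\<close>
  to vertex \<open>j\<close>, so that it covers the action by a segment and, with \<open>i\<close>
  and \<open>j\<close> exchanged, the action by its inverse.\<close>

lemma holo_act_pull:
  assumes s: "holo_map (lev l) N s" and j: "\<And>P. P \<in> pts (lev l) \<Longrightarrow> \<rho> (vmap i P) (s P) = vmap j P"
  shows "holo_map (total_space (lev l) (pull_bundle (lev l) M (vmap i) E))
    (total_space (lev l) (pull_bundle (lev l) M (vmap j) E))
    (\<lambda>(P, e). (P, snd (\<Phi> ((vmap i P, e), s P))))"
proof -
  let ?Pi = "pull_bundle (lev l) M (vmap i) E" and ?Pj = "pull_bundle (lev l) M (vmap j) E"
  let ?Ti = "total_space (lev l) ?Pi" and ?T = "total_space M E"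
  note Pi = holo_bundle_pull[OF atlas_level atlas_M holo_vmap eqv_bundle]
  note Ai = holo_atlas_total[OF atlas_level Pi] and AT = holo_atlas_total[OF atlas_M eqv_bundle]
  note fst_i = holo_total_fst[OF atlas_level Pi]
  have sN: "s P \<in> carrier G" if "P \<in> pts (lev l)" for P using holo_map_pts[OF s that] by (simp add: pts_N)
  have "holo_map ?Ti (prod_mfd ?T N) (\<lambda>p. (case p of (P, e) \<Rightarrow> (vmap i P, e), s (fst p)))"
    by (rule holo_map_Pair[OF AT atlas_N Ai holo_map_pull_total[OF atlas_level atlas_M holo_vmap eqv_bundle]
          holo_map_compose[OF Ai atlas_level atlas_N fst_i s]])
  from holo_map_compose[OF Ai holo_atlas_prod[OF AT atlas_N] AT this eqv_holo]
  have h: "holo_map ?Ti ?T (\<lambda>p. \<Phi> ((vmap i (fst p), snd p), s (fst p)))" by (simp add: case_prod_unfold)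
  have "holo_map ?Ti ?T (\<lambda>p. (vmap j (fst p), snd (\<Phi> ((vmap i (fst p), snd p), s (fst p)))))"
  proof (rule holo_map_cong[OF Ai AT _ h])
    fix p assume "p \<in> pts ?Ti"
    then have p: "fst p \<in> pts (lev l)" "snd p \<in> carrier (fibre E (vmap i (fst p)))"
      by (auto simp: pts_total[OF atlas_level Pi])
    show "\<Phi> ((vmap i (fst p), snd p), s (fst p)) = (vmap j (fst p), snd (\<Phi> ((vmap i (fst p), snd p), s (fst p))))"
      using eqv_pair[OF vmap_closed[OF p(1)] p(2) sN[OF p(1)]] j[OF p(1)] by simp
  qed
  then have "holo_map ?Ti (total_space (lev l) ?Pj) (\<lambda>p. (fst p, snd (\<Phi> ((vmap i (fst p), snd p), s (fst p)))))"
    by (intro holo_map_into_pull[OF atlas_level atlas_M holo_vmap eqv_bundle Ai]) (simp_all add: fst_i)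
  then show ?thesis by (simp add: case_prod_unfold)
qed

text \<open>The inverse is the action by the inverse group element, which is holomorphic because
  inversion in \<open>G\<close> is.\<close>

lemma act_isos:
  assumes ij: "i \<le> j"
  shows "(\<lambda>P\<in>pts (lev l). \<lambda>e\<in>carrier (fibre E (vmap i P)). snd (\<Phi> ((vmap i P, e), seg i j (snd P))))
    \<in> bundle_isos (lev l) (pull_bundle (lev l) M (vmap i) E) (pull_bundle (lev l) M (vmap j) E)"
    (is "?\<alpha> \<in> _")
proof -
  let ?Pi = "pull_bundle (lev l) M (vmap i) E" and ?Pj = "pull_bundle (lev l) M (vmap j) E"
  note Pi = holo_bundle_pull[OF atlas_level atlas_M holo_vmap eqv_bundle]
  note Ai = holo_atlas_total[OF atlas_level Pi]
  define s where "s P = seg i j (snd P)" for P :: "'m \<times> 'g list"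
  define w where "w P e = snd (\<Phi> ((vmap j P, e), inv\<^bsub>G\<^esub> (s P)))" for P e
  have s: "holo_map (lev l) N s" unfolding s_def by (rule holo_level_seg)
  have sG: "s P \<in> carrier G" if "P \<in> pts (lev l)" for P using holo_map_pts[OF s that] by (simp add: pts_N)
  have sj: "\<rho> (vmap i P) (s P) = vmap j P" if "P \<in> pts (lev l)" for P
    using vmap_act[of "fst P" "snd P" l i j] that ij by (simp add: s_def)
  have si: "\<rho> (vmap j P) (inv\<^bsub>G\<^esub> (s P)) = vmap i P" if "P \<in> pts (lev l)" for P
    using act_mult[OF vmap_closed[OF that, of i] sG[OF that] inv_closed[OF sG[OF that]]]
      act_one[OF vmap_closed[OF that, of i]]
    by (simp add: sj[OF that] r_inv[OF sG[OF that]])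
  have ap: "?\<alpha> P e = snd (\<Phi> ((vmap i P, e), s P))" if "P \<in> pts (lev l)" "e \<in> carrier (fibre E (vmap i P))" for P e
    using that by (simp add: s_def)
  have ac: "?\<alpha> P e \<in> carrier (fibre E (vmap j P))" if "P \<in> pts (lev l)" "e \<in> carrier (fibre E (vmap i P))" for P e
    using eqv_closed[OF vmap_closed[OF that(1)] that(2) sG[OF that(1)]] by (simp only: ap[OF that] sj[OF that(1)])
  have wc: "w P e \<in> carrier (fibre E (vmap i P))" if "P \<in> pts (lev l)" "e \<in> carrier (fibre E (vmap j P))" for P e
    using eqv_closed[OF vmap_closed[OF that(1)] that(2) inv_closed[OF sG[OF that(1)]]]
    by (simp only: w_def si[OF that(1)])
  have wa: "w P (?\<alpha> P e) = e" if "P \<in> pts (lev l)" "e \<in> carrier (fibre E (vmap i P))" for P e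
    using eqv_mult[OF vmap_closed[OF that(1)] that(2) sG[OF that(1)] inv_closed[OF sG[OF that(1)]]]
      eqv_one[OF vmap_closed[OF that(1)] that(2)]
    by (simp only: ap[OF that] w_def sj[OF that(1)] r_inv[OF sG[OF that(1)]])
  have aw: "?\<alpha> P (w P e) = e" if "P \<in> pts (lev l)" "e \<in> carrier (fibre E (vmap j P))" for P e
    unfolding ap[OF that(1) wc[OF that]]
    using eqv_mult[OF vmap_closed[OF that(1)] that(2) inv_closed[OF sG[OF that(1)]] sG[OF that(1)]]
      eqv_one[OF vmap_closed[OF that(1)] that(2)]
    by (simp only: w_def si[OF that(1)] l_inv[OF sG[OF that(1)]])
  have bij: "bij_betw (?\<alpha> P) (carrier (fibre E (vmap i P))) (carrier (fibre E (vmap j P)))" if "P \<in> pts (lev l)" for P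
    by (rule bij_betw_byWitness[where f' = "w P"]) (use wa aw ac wc that in blast)+
  have invw: "inv_into (carrier (fibre E (vmap i P))) (?\<alpha> P) e = w P e"
    if "P \<in> pts (lev l)" "e \<in> carrier (fibre E (vmap j P))" for P e
    by (rule inv_into_f_eq[OF bij_betw_imp_inj_on[OF bij[OF that(1)]] wc[OF that] aw[OF that]])
  show ?thesis
  proof (rule bundle_isosI)
    show "?\<alpha> \<in> extensional (pts (lev l))" by simp
    fix P assume P: "P \<in> pts (lev l)"
    show "?\<alpha> P \<in> extensional (carrier (fibre ?Pi P))" using P by simp
    have "clinear (fibre E (vmap i P)) (fibre E (vmap j P)) (\<lambda>e. snd (\<Phi> ((vmap i P, e), s P)))"
      using eqv_clinear[OF vmap_closed[OF P, of i] sG[OF P]] by (simp only: sj[OF P])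
    then have "clinear (fibre E (vmap i P)) (fibre E (vmap j P)) (?\<alpha> P)"
      by (rule clinear_cong[OF holo_bundle_module[OF eqv_bundle vmap_closed[OF P]], rotated]) (simp only: ap[OF P])
    then show "clinear (fibre ?Pi P) (fibre ?Pj P) (?\<alpha> P)" by (simp only: fibre_pull[OF P])
    show "bij_betw (?\<alpha> P) (carrier (fibre ?Pi P)) (carrier (fibre ?Pj P))"
      using bij[OF P] by (simp only: fibre_pull[OF P])
  next
    show "holo_map (total_space (lev l) ?Pi) (total_space (lev l) ?Pj) (\<lambda>(P, e). (P, ?\<alpha> P e))"
      by (rule holo_map_cong[OF Ai Ai _ holo_act_pull[OF s sj]]) (auto simp: pts_total[OF atlas_level Pi] s_def)
    show "holo_map (total_space (lev l) ?Pj) (total_space (lev l) ?Pi)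
      (\<lambda>(P, e). (P, inv_into (carrier (fibre ?Pi P)) (?\<alpha> P) e))"
    proof (rule holo_map_cong[OF Ai Ai _ holo_act_pull[OF holo_map_inv[OF atlas_level s] si]])
      fix p assume "p \<in> pts (total_space (lev l) ?Pj)"
      then have p: "fst p \<in> pts (lev l)" "snd p \<in> carrier (fibre E (vmap j (fst p)))"
        by (auto simp: pts_total[OF atlas_level Pi])
      show "(case p of (P, e) \<Rightarrow> (P, snd (\<Phi> ((vmap j P, e), inv\<^bsub>G\<^esub> (s P)))))
          = (case p of (P, e) \<Rightarrow> (P, inv_into (carrier (fibre ?Pi P)) (?\<alpha> P) e))"
        using invw[OF p] by (simp only: case_prod_unfold fibre_pull[OF p(1)] w_def)
    qed
  qed
qed

end

end

context lie_action
begin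

section \<open>From cells to equivariant bundles\<close>

context
  fixes F :: "('m \<times> 'g list, 'e) hvb_simplex tot_cell" and n
  assumes F: "F \<in> cells n"
begin

lemma cell_vertex_eq:
  "cell_vertex M G N \<rho> F i = (fst (cell_ob F i),
    \<lambda>((x, e), g)\<in>pts (total_space M (fst (cell_ob F i))) \<times> carrier G. (\<rho> x g, cell_act F i (x, [g]) e),
    snd (cell_ob F i))"
  by (simp add: cell_vertex_def Let_def cell_ob_def[OF F] case_prod_unfold cell_act_def[OF F] edge_map_eq const_map_edge2[simplified])

lemma cell_edge_eq: "cell_edge M F i = pull_iso M base_incl (cell_arr F i (Suc i))"
  by (simp add: cell_edge_def cell_arr_def[OF F] edge_map_eq const_map_edge2[simplified])

text \<open>Over \<open>M \<times> G\<^sup>0\<close> the degenerate edge is an identity; it is also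
  the pullback of the action arrow along the map from \<open>(x, [])\<close> to
  \<open>(x, [1])\<close>.\<close>

lemma cell_act_one:
  assumes i: "i \<le> n" and x: "x \<in> pts M" and e: "e \<in> carrier (fibre (fst (cell_ob F i)) x)"
  shows "cell_act F i (x, [\<one>\<^bsub>G\<^esub>]) e = e"
proof -
  have P: "(x, []) \<in> pts (lev 0)" using base_incl_pts[OF x] by (simp add: base_incl_def)
  have v: "vmap 0 (x, []) = x" using vmap_0[OF P] by simp
  have "snd (F 0 1 (edge2 0 0, edge2 i i)) (0, 1) (x, []) e = e"
    by (rule cell_edge_id[OF F le0 i P]) (simp add: v e)
  then show ?thesis using cell_act_pull[OF F le0 le0 i P] by (simp add: v)
qed

text \<open>The triangle with vertices 0, 1, 2 over the point \<open>(x, [g, h])\<close>: its edges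
  carry \<open>g\<close>, \<open>h\<close> and their product.\<close>

lemma cell_act_mult:
  assumes i: "i \<le> n" and x: "x \<in> pts M" and e: "e \<in> carrier (fibre (fst (cell_ob F i)) x)"
    and g: "g \<in> carrier G" and h: "h \<in> carrier G"
  shows "cell_act F i (\<rho> x g, [h]) (cell_act F i (x, [g]) e) = cell_act F i (x, [g \<otimes>\<^bsub>G\<^esub> h]) e"
proof -
  have P: "(x, [g, h]) \<in> pts (lev 2)" using x g h by (simp add: pts_level)
  have v: "vmap 0 (x, [g, h]) = x" using vmap_0[OF P] by simp
  have s1: "seg 0 1 [g, h] = g" and s2: "seg 1 2 [g, h] = h" and s: "seg 0 2 [g, h] = g \<otimes>\<^bsub>G\<^esub> h"
    using g h by (simp_all add: seg_def list_mult_def numeral_2_eq_2)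
  have v1: "vmap 1 (x, [g, h]) = \<rho> x g" by (simp only: vmap_def prod.case s1)
  have "snd (F 2 1 (edge2 0 2, edge2 i i)) (0, 1) (x, [g, h]) e
      = snd (F 2 1 (edge2 1 2, edge2 i i)) (0, 1) (x, [g, h]) (snd (F 2 1 (edge2 0 1, edge2 i i)) (0, 1) (x, [g, h]) e)"
    by (rule cell_triangle[OF F _ _ _ order_refl order_refl i P]) (use e v in auto)
  then show ?thesis
    using cell_act_pull[OF F _ _ i P, of 0 2] cell_act_pull[OF F _ _ i P, of 1 2] cell_act_pull[OF F _ _ i P, of 0 1]
    unfolding snd_conv s1 s2 s v v1 by simp
qed

lemma cell_vertex_eqv:
  assumes i: "i \<le> n"
  shows "cell_vertex M G N \<rho> F i \<in> eqv_bundles M G N \<rho>"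
proof -
  have "holo_connection M (fst (cell_ob F i)) (snd (cell_ob F i))"
    using cell_ob_obs[OF F i] by (auto simp: case_prod_unfold)
  with equivariant_bundleI[OF cell_ob_bundle[OF F i] cell_act_isos[OF F i] cell_act_one[OF i] cell_act_mult[OF i]]
  show ?thesis unfolding cell_vertex_eq eqv_bundles_def by (simp only: mem_Collect_eq prod.case)
qed

text \<open>The square \<open>[1] \<times> [1]\<close> is cut into two triangles along its diagonal.
  Computing the diagonal arrow over \<open>(x, [g])\<close> from each of them gives
  equivariance.\<close>

lemma cell_edge_eqv:
  assumes i: "i < n"
  shows "cell_edge M F i \<in> eqv_isos M G (cell_vertex M G N \<rho> F i) (cell_vertex M G N \<rho> F (Suc i))"
proof -
  have le: "i \<le> n" "Suc i \<le> n" "i \<le> Suc i" using i by auto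
  note iso = cell_arr_isos[OF F le(3,2)]
  have key: "pull_iso M base_incl (cell_arr F i (Suc i)) (\<rho> x g) (cell_act F i (x, [g]) e)
      = cell_act F (Suc i) (x, [g]) (pull_iso M base_incl (cell_arr F i (Suc i)) x e)"
    if x: "x \<in> pts M" and e: "e \<in> carrier (fibre (fst (cell_ob F i)) x)" and g: "g \<in> carrier G" for x e g
  proof -
    have P: "(x, [g]) \<in> pts (lev 1)" using x g by (simp add: pts_level)
    have v: "vmap 0 (x, [g]) = x" using vmap_0[OF P] by simp
    have v1: "vmap 1 (x, [g]) = \<rho> x g" using vmap_1[OF P] by simp
    have s: "seg 0 1 [g] = g" using g by (simp add: seg_def list_mult_def)
    have e': "e \<in> carrier (fibre (fst (cell_ob F i)) (vmap 0 (x, [g])))" using e v by simp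
    have "snd (F 1 1 (edge2 0 1, edge2 i (Suc i))) (0, 1) (x, [g]) e
      = snd (F 1 1 (edge2 1 1, edge2 i (Suc i))) (0, 1) (x, [g]) (snd (F 1 1 (edge2 0 1, edge2 i i)) (0, 1) (x, [g]) e)"
      by (rule cell_triangle[OF F zero_le_one order_refl order_refl order_refl le(3,2) P e'])
    moreover have "snd (F 1 1 (edge2 0 1, edge2 i (Suc i))) (0, 1) (x, [g]) e
      = snd (F 1 1 (edge2 0 1, edge2 (Suc i) (Suc i))) (0, 1) (x, [g]) (snd (F 1 1 (edge2 0 0, edge2 i (Suc i))) (0, 1) (x, [g]) e)"
      by (rule cell_triangle[OF F order_refl zero_le_one order_refl le(3) order_refl le(2) P e'])
    ultimately show ?thesis
      unfolding cell_arr_pull[OF F order_refl le(3,2) P] cell_arr_pull[OF F zero_le_one le(3,2) P]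
        cell_act_pull[OF F zero_le_one order_refl le(1) P] cell_act_pull[OF F zero_le_one order_refl le(2) P]
        snd_conv s v v1
      by (simp only: pull_base_incl_apply[OF x] pull_base_incl_apply[OF act_closed[OF x g]])
  qed
  note pt = pts_total[OF atlas_M cell_ob_bundle[OF F le(1)]] pts_total[OF atlas_M cell_ob_bundle[OF F le(2)]]
  show ?thesis
    unfolding cell_edge_eq cell_vertex_eq eqv_isos_def prod.case Let_def
  proof (intro CollectI conjI iso ballI)
    fix p g assume p: "p \<in> pts (total_space M (fst (cell_ob F i)))" and g: "g \<in> carrier G"
    obtain x e where pe: "p = (x, e)" by (cases p)
    have x: "x \<in> pts M" and e: "e \<in> carrier (fibre (fst (cell_ob F i)) x)" using p by (simp_all add: pe pt)
    have "(x, pull_iso M base_incl (cell_arr F i (Suc i)) x e) \<in> pts (total_space M (fst (cell_ob F (Suc i))))"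
      using bundle_isosD(5)[OF iso x e] x by (simp add: pt)
    then show "(case (\<lambda>((x, e), g)\<in>pts (total_space M (fst (cell_ob F i))) \<times> carrier G. (\<rho> x g, cell_act F i (x, [g]) e)) (p, g) of
          (x, e) \<Rightarrow> (x, pull_iso M base_incl (cell_arr F i (Suc i)) x e))
        = (\<lambda>((x, e), g)\<in>pts (total_space M (fst (cell_ob F (Suc i)))) \<times> carrier G. (\<rho> x g, cell_act F (Suc i) (x, [g]) e))
          (case p of (x, e) \<Rightarrow> (x, pull_iso M base_incl (cell_arr F i (Suc i)) x e), g)"
      using p g key[OF x e g] by (simp add: pe)
  qed
qed

lemma cell_string_eqv: "cell_string M G N \<rho> n F \<in> eqv_strings M G N \<rho> n"
  using cell_vertex_eqv cell_edge_eqv by (auto simp: cell_string_def eqv_strings_def)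

text \<open>The equality is taken apart in layers: outside the domain both sides are
  \<open>undefined\<close>; inside, objects, arrows, points and fibre elements are compared in turn,
  with extensionality at each layer.\<close>

lemma cell_of_cell_string: "cell_of n (cell_string M G N \<rho> n F) = F"
proof (intro ext)
  fix l p ab
  let ?B = "\<lambda>i\<in>{..n}. cell_vertex M G N \<rho> F i" and ?\<alpha> = "\<lambda>i\<in>{..<n}. cell_edge M F i"
  show "cell_of n (cell_string M G N \<rho> n F) l p ab = F l p ab"
  proof (cases "ab \<in> omaps p l \<times> omaps p n")
    case False
    have "F l p ab = undefined" by (rule PiE_arb[OF cell_PiE[OF F] False])
    moreover have "cell_of n (cell_string M G N \<rho> n F) l p ab = undefined"
      using False by (simp add: cell_of_def cell_string_def)
    ultimately show ?thesis by simp
  next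
    case True
    then obtain a b where ab: "ab = (a, b)" and a: "a \<in> omaps p l" and b: "b \<in> omaps p n" by auto
    note sx = nerve_simplicesD[OF cell_simplex[OF F a b]]
    have bn: "b q \<le> n" if "q \<le> p" for q by (rule omaps_bound[OF b that])
    have lhs: "cell_of n (cell_string M G N \<rho> n F) l p ab =
      (\<lambda>q\<in>{..p}. pull_object (lev l) M (vmap (a q)) (eqv_object (?B (b q))),
       \<lambda>(q, q')\<in>le_pairs p. cell_mor ?B ?\<alpha> l (a q) (a q') (b q) (b q' - b q))"
      using a b by (simp add: cell_of_def cell_string_def ab)
    have "(\<lambda>q\<in>{..p}. pull_object (lev l) M (vmap (a q)) (eqv_object (?B (b q)))) = fst (F l p (a, b))"
    proof (rule extensionalityI[OF restrict_extensional sx(1)])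
      fix q assume "q \<in> {..p}"
      then have q: "q \<le> p" by simp
      then show "(\<lambda>q\<in>{..p}. pull_object (lev l) M (vmap (a q)) (eqv_object (?B (b q)))) q = fst (F l p (a, b)) q"
        using bn[OF q] by (simp add: cell_object[OF F a b q] eqv_object_def cell_vertex_eq)
    qed
    moreover have "(\<lambda>(q, q')\<in>le_pairs p. cell_mor ?B ?\<alpha> l (a q) (a q') (b q) (b q' - b q)) = snd (F l p (a, b))"
    proof (rule extensionalityI[OF restrict_extensional sx(2)])
      fix qq assume "qq \<in> le_pairs p"
      then obtain q q' where qq: "qq = (q, q')" and q: "q \<le> q'" "q' \<le> p" by (auto simp: le_pairs_def)
      have q1: "q \<le> p" using q by simp
      note iso = cell_isos[OF F a b q]
      have le: "a q \<le> a q'" "b q \<le> b q'" using omaps_le[OF a q] omaps_le[OF b q] by simp_all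
      have "cell_mor ?B ?\<alpha> l (a q) (a q') (b q) (b q' - b q) = snd (F l p (a, b)) (q, q')"
      proof (rule extensionalityI[OF _ bundle_isosD(1)[OF iso]])
        show "cell_mor ?B ?\<alpha> l (a q) (a q') (b q) (b q' - b q) \<in> extensional (pts (lev l))"
          by (simp add: cell_mor_def)
        fix P assume P: "P \<in> pts (lev l)"
        note fib = cell_fibre[OF F a b q1 P]
        have Bq: "fst (?B (b q)) = fst (cell_ob F (b q))" using bn[OF q1] by (simp add: cell_vertex_eq)
        show "cell_mor ?B ?\<alpha> l (a q) (a q') (b q) (b q' - b q) P = snd (F l p (a, b)) (q, q') P"
        proof (rule extensionalityI[OF _ bundle_isosD(2)[OF iso P]])
          show "cell_mor ?B ?\<alpha> l (a q) (a q') (b q) (b q' - b q) P \<in> extensional (carrier (fibre (fst (fst (F l p (a, b)) q)) P))"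
            using P by (simp add: cell_mor_def fib Bq del: restrict_apply) (simp add: Bq)
          fix e assume "e \<in> carrier (fibre (fst (fst (F l p (a, b)) q)) P)"
          then have e: "e \<in> carrier (fibre (fst (cell_ob F (b q))) (vmap (a q) P))" by (simp add: fib)
          let ?g = "seg (a q) (a q') (snd P)"
          note x = vmap_closed[OF P, of "a q"]
          have g: "?g \<in> carrier G" using P by (simp add: pts_level)
          have act: "\<rho> (vmap (a q) P) ?g = vmap (a q') P"
            using vmap_act[of "fst P" "snd P" l "a q" "a q'"] P le by simp
          note eqv = cell_vertex_eqv[OF bn[OF q1]]
          \<comment> \<open>The action moves \<open>e\<close> into the fibre over
            \<open>vmap (a q') P\<close>, which is where the chain of isomorphisms starts.\<close>
          have e1: "cell_act F (b q) (vmap (a q) P, [?g]) e \<in> carrier (fibre (fst (cell_ob F (b q))) (vmap (a q') P))"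
          proof -
            have P1: "(vmap (a q) P, [?g]) \<in> pts (lev 1)" using x g by (simp add: pts_level)
            have "vmap 0 (vmap (a q) P, [?g]) = vmap (a q) P" "vmap 1 (vmap (a q) P, [?g]) = vmap (a q') P"
              using vmap_0[OF P1] vmap_1[OF P1] act by simp_all
            then show ?thesis
              using bundle_isosD(5)[OF cell_act_isos[OF F bn[OF q1]] P1, of e] e P1 by simp
          qed
          have "eqv_act (?B (b q)) ((vmap (a q) P, e), ?g) = (vmap (a q') P, cell_act F (b q) (vmap (a q) P, [?g]) e)"
            using bn[OF q1] x e g act
            by (simp add: eqv_act_def cell_vertex_eq pts_total[OF atlas_M cell_ob_bundle[OF F bn[OF q1]]])
          moreover have "cell_mor ?B ?\<alpha> l (a q) (a q') (b q) (b q' - b q) P e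
              = achain ?\<alpha> (b q) (b q' - b q) (vmap (a q') P) (snd (eqv_act (?B (b q)) ((vmap (a q) P, e), ?g)))"
            using P e by (simp only: cell_mor_def Bq restrict_apply')
          ultimately have "cell_mor ?B ?\<alpha> l (a q) (a q') (b q) (b q' - b q) P e
              = achain ?\<alpha> (b q) (b q' - b q) (vmap (a q') P) (cell_act F (b q) (vmap (a q) P, [?g]) e)"
            by (simp only: snd_conv)
          also have "\<dots> = pull_iso M base_incl (cell_arr F (b q) (b q + (b q' - b q))) (vmap (a q') P)
              (cell_act F (b q) (vmap (a q) P, [?g]) e)"
            by (rule cell_arr_chain[symmetric, OF F _ vmap_closed[OF P] e1])
              (use le bn[OF q(2)] in \<open>simp_all add: cell_edge_eq\<close>)
          also have "\<dots> = snd (F l p (a, b)) (q, q') P e"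
            using cell_mor_eq[OF F a b q P e] le by simp
          finally show "cell_mor ?B ?\<alpha> l (a q) (a q') (b q) (b q' - b q) P e = snd (F l p (a, b)) (q, q') P e" .
        qed
      qed
      with \<open>qq \<in> le_pairs p\<close> qq show "(\<lambda>(q, q')\<in>le_pairs p. cell_mor ?B ?\<alpha> l (a q) (a q') (b q) (b q' - b q)) qq
          = snd (F l p (a, b)) qq" by simp
    qed
    ultimately have "cell_of n (cell_string M G N \<rho> n F) l p ab = (fst (F l p (a, b)), snd (F l p (a, b)))"
      unfolding lhs by (simp only:)
    then show ?thesis by (simp only: prod.collapse ab[symmetric])
  qed
qed

end

section \<open>From equivariant bundles to cells\<close>

context
  fixes B :: "nat \<Rightarrow> ('m, 'g, 'e) eqv_data" and \<alpha> and n
  assumes s: "(B, \<alpha>) \<in> eqv_strings M G N \<rho> n"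
begin

lemma string_vertex:
  assumes "c \<le> n"
  shows "equivariant_bundle M G N \<rho> (fst (B c)) (eqv_act (B c))" "eqv_object (B c) \<in> hvb_obs M"
    "fst (eqv_object (B c)) = fst (B c)"
proof -
  have "B c \<in> eqv_bundles M G N \<rho>" using s assms by (auto simp: eqv_strings_def)
  then show "equivariant_bundle M G N \<rho> (fst (B c)) (eqv_act (B c))" "eqv_object (B c) \<in> hvb_obs M"
    "fst (eqv_object (B c)) = fst (B c)"
    by (auto simp: eqv_bundles_def eqv_act_def eqv_object_def intro: eqv_bundle)
qed

lemma string_edge: "i < n \<Longrightarrow> \<alpha> i \<in> eqv_isos M G (B i) (B (Suc i))"
  using s by (simp add: eqv_strings_def)

lemma string_iso: "i < n \<Longrightarrow> \<alpha> i \<in> bundle_isos M (fst (B i)) (fst (B (Suc i)))"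
  using string_edge[of i] by (auto simp: eqv_isos_def case_prod_unfold)

lemma string_eqv:
  assumes i: "i < n" and x: "x \<in> pts M" and e: "e \<in> carrier (fibre (fst (B i)) x)" and g: "g \<in> carrier G"
  shows "\<alpha> i (\<rho> x g) (snd (eqv_act (B i) ((x, e), g))) = snd (eqv_act (B (Suc i)) ((x, \<alpha> i x e), g))"
proof -
  have i': "i \<le> n" using i by simp
  have "\<forall>p\<in>pts (total_space M (fst (B i))). \<forall>g\<in>carrier G.
      (case eqv_act (B i) (p, g) of (x, e) \<Rightarrow> (x, \<alpha> i x e)) = eqv_act (B (Suc i)) (case p of (x, e) \<Rightarrow> (x, \<alpha> i x e), g)"
    using string_edge[OF i] by (simp add: eqv_isos_def case_prod_unfold eqv_act_def Let_def)
  from bspec[OF bspec[OF this eqv_pt[OF string_vertex(1)[OF i'] x e]] g]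
  have "(case eqv_act (B i) ((x, e), g) of (x, e) \<Rightarrow> (x, \<alpha> i x e)) = eqv_act (B (Suc i)) ((x, \<alpha> i x e), g)"
    by simp
  from arg_cong[OF this, of snd] show ?thesis
    using arg_cong[OF eqv_pair[OF string_vertex(1)[OF i'] x e g], of fst] by (simp add: case_prod_unfold)
qed

lemma achain_closed:
  "x \<in> pts M \<Longrightarrow> e \<in> carrier (fibre (fst (B c)) x) \<Longrightarrow> c + k \<le> n \<Longrightarrow>
    achain \<alpha> c k x e \<in> carrier (fibre (fst (B (c + k))) x)"
  by (induction k) (simp_all add: bundle_isosD(5)[OF string_iso])

lemma achain_eqv:
  assumes x: "x \<in> pts M" and e: "e \<in> carrier (fibre (fst (B c)) x)" and g: "g \<in> carrier G"
  shows "c + k \<le> n \<Longrightarrow> achain \<alpha> c k (\<rho> x g) (snd (eqv_act (B c) ((x, e), g)))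
    = snd (eqv_act (B (c + k)) ((x, achain \<alpha> c k x e), g))"
proof (induction k)
  case (Suc k)
  then show ?case using string_eqv[OF _ x achain_closed[OF x e, of k] g] by simp
qed simp

lemma achain_isos:
  "c + k \<le> n \<Longrightarrow> (\<lambda>x\<in>pts M. \<lambda>e\<in>carrier (fibre (fst (B c)) x). achain \<alpha> c k x e)
    \<in> bundle_isos M (fst (B c)) (fst (B (c + k)))"
proof (induction k)
  case 0
  then have c: "c \<le> n" by simp
  show ?case
    using bundle_isos_id[OF atlas_M eqv_bundle[OF string_vertex(1)[OF c]]]
    by (simp only: achain.simps add_0_right)
next
  case (Suc k)
  let ?A = "\<lambda>x\<in>pts M. \<lambda>e\<in>carrier (fibre (fst (B c)) x). achain \<alpha> c k x e"
  have k: "c \<le> n" "c + k \<le> n" "Suc (c + k) \<le> n" "c + k < n" using Suc.prems by auto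
  note b = eqv_bundle[OF string_vertex(1)[OF k(1)]] eqv_bundle[OF string_vertex(1)[OF k(2)]]
    eqv_bundle[OF string_vertex(1)[OF k(3)]]
  have "(\<lambda>x\<in>pts M. compose (carrier (fibre (fst (B c)) x)) (\<alpha> (c + k) x) (?A x))
      \<in> bundle_isos M (fst (B c)) (fst (B (Suc (c + k))))"
    by (rule bundle_isos_comp[OF atlas_M b Suc.IH[OF k(2)] string_iso[OF k(4)]])
  also have "(\<lambda>x\<in>pts M. compose (carrier (fibre (fst (B c)) x)) (\<alpha> (c + k) x) (?A x))
      = (\<lambda>x\<in>pts M. \<lambda>e\<in>carrier (fibre (fst (B c)) x). achain \<alpha> c (Suc k) x e)"
    unfolding compose_def by (intro restrict_ext) simp
  finally show ?case by (simp only: add_Suc_right)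
qed

lemma cell_mor_apply:
  "P \<in> pts (lev l) \<Longrightarrow> e \<in> carrier (fibre (fst (B c)) (vmap i P)) \<Longrightarrow> cell_mor B \<alpha> l i j c k P e
    = achain \<alpha> c k (vmap j P) (snd (eqv_act (B c) ((vmap i P, e), seg i j (snd P))))"
  by (simp add: cell_mor_def)

lemma seg_level_closed: "P \<in> pts (lev l) \<Longrightarrow> seg i j (snd P) \<in> carrier G"
  by (simp add: pts_level)

lemma vmap_seg: "P \<in> pts (lev l) \<Longrightarrow> i \<le> j \<Longrightarrow> \<rho> (vmap i P) (seg i j (snd P)) = vmap j P"
  using vmap_act[of "fst P" "snd P" l i j] by simp

text \<open>A composite of \<open>act_isos\<close> with the pullback of \<open>achain_isos\<close>
  along the end vertex. The remaining work is that this composite is literally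
  \<open>cell_mor\<close>, with the same restrictions.\<close>

lemma cell_mor_isos:
  assumes ij: "i \<le> j" and k: "c + k \<le> n"
  shows "cell_mor B \<alpha> l i j c k \<in> bundle_isos (lev l) (pull_bundle (lev l) M (vmap i) (fst (B c)))
    (pull_bundle (lev l) M (vmap j) (fst (B (c + k))))"
proof -
  have c: "c \<le> n" using k by simp
  note E = string_vertex(1)[OF c] and E' = string_vertex(1)[OF k]
  note b = eqv_bundle[OF E] eqv_bundle[OF E']
  note pb = holo_bundle_pull[OF atlas_level atlas_M holo_vmap b(1)] holo_bundle_pull[OF atlas_level atlas_M holo_vmap b(2)]
  let ?A = "\<lambda>x\<in>pts M. \<lambda>e\<in>carrier (fibre (fst (B c)) x). achain \<alpha> c k x e"
  let ?g = "\<lambda>P\<in>pts (lev l). \<lambda>e\<in>carrier (fibre (fst (B c)) (vmap i P)).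
    snd (eqv_act (B c) ((vmap i P, e), seg i j (snd P)))"
  have "(\<lambda>P\<in>pts (lev l). compose (carrier (fibre (pull_bundle (lev l) M (vmap i) (fst (B c))) P))
      (pull_iso (lev l) (vmap j) ?A P) (?g P)) \<in> bundle_isos (lev l) (pull_bundle (lev l) M (vmap i) (fst (B c)))
    (pull_bundle (lev l) M (vmap j) (fst (B (c + k))))"
    by (rule bundle_isos_comp[OF atlas_level pb(1,1,2) act_isos[OF E ij]
          pull_iso_bundle_isos[OF atlas_level atlas_M holo_vmap b achain_isos[OF k]]])
  also have "(\<lambda>P\<in>pts (lev l). compose (carrier (fibre (pull_bundle (lev l) M (vmap i) (fst (B c))) P))
      (pull_iso (lev l) (vmap j) ?A P) (?g P)) = cell_mor B \<alpha> l i j c k"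
    unfolding cell_mor_def
  proof (rule restrict_ext)
    fix P assume P: "P \<in> pts (lev l)"
    show "compose (carrier (fibre (pull_bundle (lev l) M (vmap i) (fst (B c))) P)) (pull_iso (lev l) (vmap j) ?A P) (?g P)
      = (\<lambda>e\<in>carrier (fibre (fst (B c)) (vmap i P)). achain \<alpha> c k (vmap j P) (snd (eqv_act (B c) ((vmap i P, e), seg i j (snd P)))))"
      unfolding compose_def fibre_pull[OF P]
    proof (rule restrict_ext)
      fix e assume e: "e \<in> carrier (fibre (fst (B c)) (vmap i P))"
      have "snd (eqv_act (B c) ((vmap i P, e), seg i j (snd P))) \<in> carrier (fibre (fst (B c)) (vmap j P))"
        using eqv_closed[OF E vmap_closed[OF P] e seg_level_closed[OF P, of i j]] by (simp only: vmap_seg[OF P ij])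
      then show "pull_iso (lev l) (vmap j) ?A P (?g P e)
          = achain \<alpha> c k (vmap j P) (snd (eqv_act (B c) ((vmap i P, e), seg i j (snd P))))"
        using P e vmap_closed[OF P] by (simp add: pull_iso_def)
    qed
  qed
  finally show ?thesis .
qed

lemma cell_mor_id:
  assumes c: "c \<le> n"
  shows "cell_mor B \<alpha> l i i c 0 = (\<lambda>P\<in>pts (lev l). \<lambda>e\<in>carrier (fibre (fst (B c)) (vmap i P)). e)"
  unfolding cell_mor_def
  by (intro restrict_ext) (simp add: eqv_one[OF string_vertex(1)[OF c] vmap_closed])

text \<open>The group element splits by associativity of the action and the chain by
  \<open>achain_add\<close>. Then the second half of the action has to move past the first half of
  the chain, which is equivariance.\<close>

lemma cell_mor_comp:
  assumes ij: "i \<le> j" "j \<le> k" and c: "c + u + w \<le> n" and P: "P \<in> pts (lev l)"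
    and e: "e \<in> carrier (fibre (fst (B c)) (vmap i P))"
  shows "cell_mor B \<alpha> l i k c (u + w) P e = cell_mor B \<alpha> l j k (c + u) w P (cell_mor B \<alpha> l i j c u P e)"
proof -
  have cn: "c \<le> n" "c + u \<le> n" using c by auto
  note E = string_vertex(1)[OF cn(1)]
  let ?g = "seg i j (snd P)" and ?h = "seg j k (snd P)"
  let ?e = "snd (eqv_act (B c) ((vmap i P, e), ?g))"
  note x = vmap_closed[OF P] and g = seg_level_closed[OF P]
  have gs: "set (snd P) \<subseteq> carrier G" using P by (simp add: pts_level)
  have e1: "?e \<in> carrier (fibre (fst (B c)) (vmap j P))"
    using eqv_closed[OF E x e g[of i j]] by (simp only: vmap_seg[OF P ij(1)])
  have e2: "achain \<alpha> c u (vmap j P) ?e \<in> carrier (fibre (fst (B (c + u))) (vmap j P))"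
    by (rule achain_closed[OF x e1 cn(2)])
  have "snd (eqv_act (B c) ((vmap i P, e), seg i k (snd P))) = snd (eqv_act (B c) ((vmap j P, ?e), ?h))"
    using eqv_mult[OF E x e g[of i j] g[of j k]] by (simp only: vmap_seg[OF P ij(1)] seg_append[OF gs ij])
  then have "cell_mor B \<alpha> l i k c (u + w) P e
      = achain \<alpha> (c + u) w (vmap k P) (achain \<alpha> c u (vmap k P) (snd (eqv_act (B c) ((vmap j P, ?e), ?h))))"
    by (simp add: cell_mor_apply[OF P e] achain_add)
  also have "achain \<alpha> c u (vmap k P) (snd (eqv_act (B c) ((vmap j P, ?e), ?h)))
      = snd (eqv_act (B (c + u)) ((vmap j P, achain \<alpha> c u (vmap j P) ?e), ?h))"
    using achain_eqv[OF x e1 g[of j k] cn(2)] by (simp only: vmap_seg[OF P ij(2)])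
  also have "achain \<alpha> (c + u) w (vmap k P) (snd (eqv_act (B (c + u)) ((vmap j P, achain \<alpha> c u (vmap j P) ?e), ?h)))
      = cell_mor B \<alpha> l j k (c + u) w P (cell_mor B \<alpha> l i j c u P e)"
    by (simp only: cell_mor_apply[OF P e] cell_mor_apply[OF P e2])
  finally show ?thesis .
qed

lemma cell_of_apply:
  "a \<in> omaps p l \<Longrightarrow> b \<in> omaps p n \<Longrightarrow> cell_of n (B, \<alpha>) l p (a, b) =
    (\<lambda>q\<in>{..p}. pull_object (lev l) M (vmap (a q)) (eqv_object (B (b q))),
     \<lambda>(q, q')\<in>le_pairs p. cell_mor B \<alpha> l (a q) (a q') (b q) (b q' - b q))"
  by (simp add: cell_of_def)

lemma cell_of_simplex:
  assumes a: "a \<in> omaps p l" and b: "b \<in> omaps p n"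
  shows "cell_of n (B, \<alpha>) l p (a, b) \<in> simplices (nerve (hvb_groupoid (lev l))) p"
proof -
  let ?X = "\<lambda>q\<in>{..p}. pull_object (lev l) M (vmap (a q)) (eqv_object (B (b q)))"
  let ?f = "\<lambda>(q, q')\<in>le_pairs p. cell_mor B \<alpha> l (a q) (a q') (b q) (b q' - b q)"
  note bn = omaps_bound[OF b]
  have ob: "pull_object (lev l) M (vmap (a q)) (eqv_object (B (b q))) \<in> hvb_obs (lev l)" if "q \<le> p" for q
    by (rule pull_object_obs[OF atlas_level atlas_M holo_vmap string_vertex(2)[OF bn[OF that]]])
  have fX: "fst (?X q) = pull_bundle (lev l) M (vmap (a q)) (fst (B (b q)))" if "q \<le> p" for q
    using that by (simp add: string_vertex(3)[OF bn[OF that]])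
  have f: "?f (q, q') = cell_mor B \<alpha> l (a q) (a q') (b q) (b q' - b q)" if "q \<le> q'" "q' \<le> p" for q q'
    using that by (simp add: le_pairs_def)
  have X: "?X \<in> {..p} \<rightarrow>\<^sub>E Ob (hvb_groupoid (lev l))"
    using ob by (auto simp: hvb_groupoid_def)
  have h: "?f \<in> extensional (le_pairs p)" by simp
  have hom: "?f (q, q') \<in> Hom (hvb_groupoid (lev l)) (?X q) (?X q')" if q: "q \<le> q'" "q' \<le> p" for q q'
  proof -
    have le: "a q \<le> a q'" "b q \<le> b q'" "b q' \<le> n" using omaps_le[OF a q] omaps_le[OF b q] bn[OF q(2)] by auto
    have "?f (q, q') \<in> bundle_isos (lev l) (fst (?X q)) (fst (?X q'))"
      using cell_mor_isos[OF le(1), of "b q" "b q' - b q" l] le q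
      by (simp only: f[OF q] fX[OF q(2)] fX[OF order_trans[OF q]]) simp
    then show ?thesis by (simp only: hvb_groupoid_def cat_data.simps case_prod_unfold)
  qed
  have id: "?f (q, q) = Id (hvb_groupoid (lev l)) (?X q)" if q: "q \<le> p" for q
  proof -
    have "?f (q, q) = (\<lambda>P\<in>pts (lev l). \<lambda>e\<in>carrier (fibre (fst (B (b q))) (vmap (a q) P)). e)"
      using cell_mor_id[OF bn[OF q], of l "a q"] by (simp only: f[OF order_refl q]) simp
    also have "\<dots> = (\<lambda>P\<in>pts (lev l). \<lambda>e\<in>carrier (fibre (fst (?X q)) P). e)"
      unfolding fX[OF q] by (rule restrict_ext) simp
    finally show ?thesis by (simp only: hvb_groupoid_def cat_data.simps case_prod_unfold)
  qed
  have comp: "?f (q, q'') = Comp (hvb_groupoid (lev l)) (?X q) (?X q') (?X q'') (?f (q', q'')) (?f (q, q'))"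
    if q: "q \<le> q'" "q' \<le> q''" "q'' \<le> p" for q q' q''
  proof -
    have q': "q' \<le> p" "q \<le> p" "q \<le> q''" using q by auto
    have le: "a q \<le> a q'" "a q' \<le> a q''" "b q \<le> b q'" "b q' \<le> b q''" "b q'' \<le> n"
      using omaps_le[OF a] omaps_le[OF b] bn q q' by auto
    have cn: "b q + (b q' - b q) + (b q'' - b q') \<le> n" using le by simp
    \<comment> \<open>Subtraction on naturals is truncated; these identities hold because
      \<open>b\<close> is monotone.\<close>
    have d: "b q'' - b q = (b q' - b q) + (b q'' - b q')" "b q + (b q' - b q) = b q'" using le by auto
    have "?f (q, q'') = (\<lambda>P\<in>pts (lev l). compose (carrier (fibre (fst (?X q)) P)) (?f (q', q'') P) (?f (q, q') P))"
    proof -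
      have "cell_mor B \<alpha> l (a q) (a q'') (b q) (b q'' - b q)
          = (\<lambda>P\<in>pts (lev l). cell_mor B \<alpha> l (a q) (a q'') (b q) (b q'' - b q) P)"
        unfolding cell_mor_def by (rule restrict_ext) simp
      also have "\<dots> = (\<lambda>P\<in>pts (lev l). compose (carrier (fibre (fst (B (b q))) (vmap (a q) P)))
          (cell_mor B \<alpha> l (a q') (a q'') (b q') (b q'' - b q') P) (cell_mor B \<alpha> l (a q) (a q') (b q) (b q' - b q) P))"
      proof (rule restrict_ext)
        fix P assume P: "P \<in> pts (lev l)"
        have "cell_mor B \<alpha> l (a q) (a q'') (b q) (b q'' - b q) P
          = (\<lambda>e\<in>carrier (fibre (fst (B (b q))) (vmap (a q) P)). cell_mor B \<alpha> l (a q) (a q'') (b q) (b q'' - b q) P e)"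
        proof -
          have "cell_mor B \<alpha> l (a q) (a q'') (b q) (b q'' - b q) P
              \<in> extensional (carrier (fibre (fst (B (b q))) (vmap (a q) P)))"
            using P by (simp add: cell_mor_def)
          then show ?thesis by (rule extensional_restrict[symmetric])
        qed
        also have "\<dots> = compose (carrier (fibre (fst (B (b q))) (vmap (a q) P)))
          (cell_mor B \<alpha> l (a q') (a q'') (b q') (b q'' - b q') P) (cell_mor B \<alpha> l (a q) (a q') (b q) (b q' - b q) P)"
          unfolding compose_def
        proof (rule restrict_ext)
          fix e assume e: "e \<in> carrier (fibre (fst (B (b q))) (vmap (a q) P))"
          show "cell_mor B \<alpha> l (a q) (a q'') (b q) (b q'' - b q) P e = cell_mor B \<alpha> l (a q') (a q'') (b q') (b q'' - b q') P
              (cell_mor B \<alpha> l (a q) (a q') (b q) (b q' - b q) P e)"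
            using cell_mor_comp[OF le(1,2) cn P e] by (simp only: d)
        qed
        finally show "cell_mor B \<alpha> l (a q) (a q'') (b q) (b q'' - b q) P = compose (carrier (fibre (fst (B (b q))) (vmap (a q) P)))
          (cell_mor B \<alpha> l (a q') (a q'') (b q') (b q'' - b q') P) (cell_mor B \<alpha> l (a q) (a q') (b q) (b q' - b q) P)" .
      qed
      also have "\<dots> = (\<lambda>P\<in>pts (lev l). compose (carrier (fibre (fst (?X q)) P)) (?f (q', q'') P) (?f (q, q') P))"
        unfolding fX[OF q'(2)] f[OF q(2,3)] f[OF q(1) q'(1)] by (rule restrict_ext) simp
      finally show ?thesis unfolding f[OF q'(3) q(3)] .
    qed
    then show ?thesis by (simp only: hvb_groupoid_def cat_data.simps case_prod_unfold)
  qed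
  show ?thesis
    unfolding cell_of_apply[OF a b] by (rule nerve_simplicesI[OF X h hom id comp])
qed

text \<open>Naturality in the degree is mere reindexing. Naturality in the level is strict
  functoriality of pullbacks for objects, and for arrows the two facts \<open>vmap_quot_map\<close>
  and \<open>seg_quot_map\<close>.\<close>

lemma cell_of_cells: "cell_of n (B, \<alpha>) \<in> cells n"
  unfolding cells_iff
proof (intro conjI allI ballI)
  fix l p
  show "cell_of n (B, \<alpha>) l p \<in> omaps p l \<times> omaps p n \<rightarrow>\<^sub>E simplices (nerve (hvb_groupoid (lev l))) p"
  proof (rule PiE_I)
    show "cell_of n (B, \<alpha>) l p x \<in> simplices (nerve (hvb_groupoid (lev l))) p" if "x \<in> omaps p l \<times> omaps p n" for x
      using that cell_of_simplex by auto
    show "cell_of n (B, \<alpha>) l p x = undefined" if "x \<notin> omaps p l \<times> omaps p n" for x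
      using that by (simp add: cell_of_def)
  qed
next
  fix l k m \<theta> a b assume \<theta>: "\<theta> \<in> omaps k m" and a: "a \<in> omaps m l" and b: "b \<in> omaps m n"
  have "\<theta> i \<le> m" if "i \<le> k" for i by (rule omaps_bound[OF \<theta> that])
  moreover have "(\<theta> i, \<theta> j) \<in> le_pairs m" if "(i, j) \<in> le_pairs k" for i j
    using that omaps_le[OF \<theta>, of i j] omaps_bound[OF \<theta>, of j] by (simp add: le_pairs_def)
  ultimately show "cell_of n (B, \<alpha>) l k (compose {..k} a \<theta>, compose {..k} b \<theta>)
      = sact (nerve (hvb_groupoid (lev l))) k m \<theta> (cell_of n (B, \<alpha>) l m (a, b))"
    unfolding cell_of_apply[OF a b] cell_of_apply[OF omaps_compose[OF a \<theta>] omaps_compose[OF b \<theta>]] sact_nerve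
    by (auto simp: compose_def le_pairs_def intro!: restrict_ext)
next
  fix k m \<theta> p a b assume \<theta>: "\<theta> \<in> omaps k m" and a: "a \<in> omaps p k" and b: "b \<in> omaps p n"
  note bn = omaps_bound[OF b] and ak = omaps_bound[OF a]
  let ?Q = "quot_map G \<rho> k \<theta>"
  have ob: "pull_object (lev m) M (vmap (\<theta> (a q))) (eqv_object (B (b q)))
      = pull_object (lev m) (lev k) ?Q (pull_object (lev k) M (vmap (a q)) (eqv_object (B (b q))))" if q: "q \<le> p" for q
  proof -
    note O = string_vertex(2)[OF bn[OF q]]
    have "pull_object (lev m) (lev k) ?Q (pull_object (lev k) M (vmap (a q)) (eqv_object (B (b q))))
      = pull_object (lev m) M (\<lambda>P. vmap (a q) (?Q P)) (eqv_object (B (b q)))"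
      by (rule pull_object_compose[OF atlas_level atlas_level atlas_M holo_quot_map holo_vmap O])
    \<comment> \<open>The composite with the structure map equals
      \<open>vmap (\<theta> (a q))\<close> only on the points of the manifold, so the congruence
      lemma takes the place of rewriting.\<close>
    also have "\<dots> = pull_object (lev m) M (vmap (\<theta> (a q))) (eqv_object (B (b q)))"
      by (rule pull_object_cong[OF atlas_level atlas_M holo_map_compose[OF atlas_level atlas_level atlas_M holo_quot_map holo_vmap] O])
        (rule vmap_quot_map[OF \<theta> _ ak[OF q]])
    finally show ?thesis by simp
  qed
  have mor: "cell_mor B \<alpha> m (\<theta> i) (\<theta> j) c d = pull_iso (lev m) ?Q (cell_mor B \<alpha> k i j c d)"
    if ij: "i \<le> j" "j \<le> k" for i j c d
    unfolding pull_iso_def cell_mor_def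
  proof (rule restrict_ext)
    fix P assume P: "P \<in> pts (lev m)"
    have v: "vmap i (?Q P) = vmap (\<theta> i) P" "vmap j (?Q P) = vmap (\<theta> j) P"
      using vmap_quot_map[OF \<theta> P] ij by simp_all
    have sg: "seg i j (snd (?Q P)) = seg (\<theta> i) (\<theta> j) (snd P)"
      using seg_quot_map[OF \<theta> _ ij, of "snd P"] P by (cases P) (simp add: quot_map_eq pts_level del: upt_Suc)
    show "(\<lambda>e\<in>carrier (fibre (fst (B c)) (vmap (\<theta> i) P)).
        achain \<alpha> c d (vmap (\<theta> j) P) (snd (eqv_act (B c) ((vmap (\<theta> i) P, e), seg (\<theta> i) (\<theta> j) (snd P)))))
      = (\<lambda>P\<in>pts (lev k). \<lambda>e\<in>carrier (fibre (fst (B c)) (vmap i P)).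
          achain \<alpha> c d (vmap j P) (snd (eqv_act (B c) ((vmap i P, e), seg i j (snd P))))) (?Q P)"
      using quot_map_pts[OF P] by (simp add: v sg)
  qed
  show "cell_of n (B, \<alpha>) m p (compose {..p} \<theta> a, b)
      = HVB_pull (lev m) (lev k) ?Q p (cell_of n (B, \<alpha>) k p (a, b))"
    unfolding cell_of_apply[OF a b] cell_of_apply[OF omaps_compose[OF \<theta> a] b] HVB_pull_def nerve_map_def prod.case
  proof (intro arg_cong2[of _ _ _ _ Pair] restrict_ext, goal_cases)
    case (1 q)
    then have q: "q \<le> p" by simp
    then show ?case using ob[OF q] by (simp add: compose_omaps_apply)
  next
    case (2 qq)
    then obtain q q' where qq: "qq = (q, q')" and q: "q \<le> q'" "q' \<le> p" by (auto simp: le_pairs_def)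
    have q1: "q \<le> p" using q by simp
    show ?case
      using mor[OF omaps_le[OF a q] ak[OF q(2)]] 2 by (simp add: qq compose_omaps_apply[OF q1] compose_omaps_apply[OF q(2)])
  qed
qed

text \<open>Bundles are read back through the section \<open>base_incl\<close> of
  \<open>vmap 0\<close>. The action is the arrow with empty chain over \<open>(x, [g])\<close>, and
  an isomorphism of the string is the arrow with chain of length 1 over \<open>(x, [])\<close>,
  where the group element is the unit.\<close>

lemma cell_string_cell_of: "cell_string M G N \<rho> n (cell_of n (B, \<alpha>)) = (B, \<alpha>)"
proof -
  let ?F = "cell_of n (B, \<alpha>)"
  have o0: "const_map 0 0 \<in> omaps 0 0" "edge2 0 0 \<in> omaps 1 0" "edge2 0 1 \<in> omaps 1 1"
    by (rule const_map_omaps edge2_omaps; simp)+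
  have le1: "(0, 1) \<in> le_pairs 1" by (simp add: le_pairs_def)
  have BE: "B \<in> extensional {..n}" and \<alpha>E: "\<alpha> \<in> extensional {..<n}"
    using s by (auto simp: eqv_strings_def PiE_def)
  have vertex: "cell_vertex M G N \<rho> ?F i = B i" if i: "i \<le> n" for i
  proof -
    obtain E \<Phi> D where Bi: "B i = (E, \<Phi>, D)" by (cases "B i")
    note v = string_vertex[OF i, unfolded Bi eqv_act_def eqv_object_def prod.case fst_conv]
    have oi: "const_map 0 i \<in> omaps 0 n" "edge2 i i \<in> omaps 1 n" using i by (rule_tac [!] const_map_omaps edge2_omaps; simp)+
    have "fst (?F 0 0 (const_map 0 0, const_map 0 i)) 0 = pull_object (lev 0) M (vmap 0) (E, D)"
      by (simp add: cell_of_apply[OF o0(1) oi(1)] const_map_0 Bi eqv_object_def)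
    then have cell_ob: "cell_ob ?F i = (E, D)"
      unfolding cell_ob_def[OF cell_of_cells] using pull_base_incl_vmap[OF v(2)] by simp
    have act: "cell_act ?F i = cell_mor B \<alpha> 1 0 1 i 0"
      unfolding cell_act_def[OF cell_of_cells] using le1 by (simp only: cell_of_apply[OF o0(3) oi(2)] edge2_0 edge2_1 snd_conv restrict_apply' prod.case diff_self_eq_0)
    have "(\<lambda>((x, e), g)\<in>pts (total_space M E) \<times> carrier G. (\<rho> x g, cell_act ?F i (x, [g]) e)) = \<Phi>"
    proof (rule extensionalityI[OF restrict_extensional eqv_ext[OF v(1)]])
      fix q assume q: "q \<in> pts (total_space M E) \<times> carrier G"
      then obtain x e g where qe: "q = ((x, e), g)" and x: "x \<in> pts M" and e: "e \<in> carrier (fibre E x)" and g: "g \<in> carrier G"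
        by (auto simp: pts_total[OF atlas_M eqv_bundle[OF v(1)]])
      have P: "(x, [g]) \<in> pts (lev 1)" using x g by (simp add: pts_level)
      have v0: "vmap 0 (x, [g]) = x" using vmap_0[OF P] by simp
      have sg: "seg 0 1 [g] = g" using g by (simp add: seg_def list_mult_def)
      have "cell_act ?F i (x, [g]) e = snd (\<Phi> ((x, e), g))"
        using cell_mor_apply[OF P, of e i 0 1 0] e unfolding act by (simp add: v0 Bi eqv_act_def sg[simplified])
      then show "(\<lambda>((x, e), g)\<in>pts (total_space M E) \<times> carrier G. (\<rho> x g, cell_act ?F i (x, [g]) e)) q = \<Phi> q"
        using q eqv_pair[OF v(1) x e g] by (simp add: qe)
    qed
    then show ?thesis unfolding cell_vertex_eq[OF cell_of_cells] cell_ob Bi by simp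
  qed
  have edge: "cell_edge M ?F i = \<alpha> i" if i: "i < n" for i
  proof -
    have oi: "edge2 i (Suc i) \<in> omaps 1 n" using i by (intro edge2_omaps) auto
    have i': "i \<le> n" using i by simp
    note iso = string_iso[OF i]
    have c: "cell_arr ?F i (Suc i) = cell_mor B \<alpha> 0 0 0 i 1"
      unfolding cell_arr_def[OF cell_of_cells] using le1 by (simp only: cell_of_apply[OF o0(2) oi] edge2_0 edge2_1 snd_conv restrict_apply' prod.case) simp
    show ?thesis
      unfolding cell_edge_eq[OF cell_of_cells]
    proof (rule extensionalityI[OF _ bundle_isosD(1)[OF iso]])
      show "pull_iso M base_incl (cell_arr ?F i (Suc i)) \<in> extensional (pts M)" by (simp add: pull_iso_def)
      fix x assume x: "x \<in> pts M"
      have P: "(x, []) \<in> pts (lev 0)" using base_incl_pts[OF x] by (simp add: base_incl_def)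
      have v0: "vmap 0 (x, []) = x" using vmap_0[OF P] by simp
      show "pull_iso M base_incl (cell_arr ?F i (Suc i)) x = \<alpha> i x"
        unfolding pull_base_incl_apply[OF x] c
      proof (rule extensionalityI[OF _ bundle_isosD(2)[OF iso x]])
        show "cell_mor B \<alpha> 0 0 0 i 1 (x, []) \<in> extensional (carrier (fibre (fst (B i)) x))"
          using P by (simp add: cell_mor_def v0)
        fix e assume e: "e \<in> carrier (fibre (fst (B i)) x)"
        show "cell_mor B \<alpha> 0 0 0 i 1 (x, []) e = \<alpha> i x e"
          using cell_mor_apply[OF P, of e i 0 0 1] e eqv_one[OF string_vertex(1)[OF i'] x e] by (simp add: v0)
      qed
    qed
  qed
  show ?thesis
    unfolding cell_string_def
    by (intro arg_cong2[of _ _ _ _ Pair] extensionalityI[OF restrict_extensional BE]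
        extensionalityI[OF restrict_extensional \<alpha>E]) (simp_all add: vertex edge)
qed

end

lemma bij_betw_cell_string: "bij_betw (cell_string M G N \<rho> n) (cells n) (eqv_strings M G N \<rho> n)"
proof (rule bij_betw_byWitness[where f' = "cell_of n"])
  show "\<forall>F\<in>cells n. cell_of n (cell_string M G N \<rho> n F) = F" using cell_of_cell_string by blast
  show "\<forall>s\<in>eqv_strings M G N \<rho> n. cell_string M G N \<rho> n (cell_of n s) = s" using cell_string_cell_of by auto
  show "cell_string M G N \<rho> n ` cells n \<subseteq> eqv_strings M G N \<rho> n" using cell_string_eqv by blast
  show "cell_of n ` eqv_strings M G N \<rho> n \<subseteq> cells n" using cell_of_cells by auto
qed

text \<open>A string of length 0 contains no isomorphism, and the only extensional function on the
  empty set is \<open>\<lambda>_. undefined\<close>.\<close>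

lemma bij_betw_eqv_strings_0: "bij_betw (\<lambda>(B, \<alpha>). B 0) (eqv_strings M G N \<rho> 0) (eqv_bundles M G N \<rho>)"
proof (rule bij_betw_byWitness[where f' = "\<lambda>b. (\<lambda>i\<in>{..0::nat}. b, \<lambda>_. undefined)"])
  show "\<forall>s\<in>eqv_strings M G N \<rho> 0. (\<lambda>i\<in>{..0}. (case s of (B, \<alpha>) \<Rightarrow> B 0), \<lambda>_. undefined) = s"
  proof
    fix s assume s: "s \<in> eqv_strings M G N \<rho> 0"
    obtain B \<alpha> where se: "s = (B, \<alpha>)" by (cases s)
    have B: "B \<in> extensional {..0}" and \<alpha>: "\<alpha> \<in> extensional {..<0}"
      using s by (simp_all add: se eqv_strings_def PiE_def)
    have "(\<lambda>i\<in>{..0}. B 0) = B" by (rule extensionalityI[OF restrict_extensional B]) simp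
    moreover have "(\<lambda>_. undefined) = \<alpha>" using extensional_arb[OF \<alpha>] by auto
    ultimately show "(\<lambda>i\<in>{..0}. (case s of (B, \<alpha>) \<Rightarrow> B 0), \<lambda>_. undefined) = s" by (simp only: se prod.case)
  qed
  show "\<forall>b\<in>eqv_bundles M G N \<rho>. (case (\<lambda>i\<in>{..0::nat}. b, \<lambda>_. undefined) of (B, \<alpha>) \<Rightarrow> B 0) = b" by simp
  show "(\<lambda>(B, \<alpha>). B 0) ` eqv_strings M G N \<rho> 0 \<subseteq> eqv_bundles M G N \<rho>"
  proof (rule image_subsetI)
    fix s assume s: "s \<in> eqv_strings M G N \<rho> 0"
    obtain B \<alpha> where se: "s = (B, \<alpha>)" by (cases s)
    have "B \<in> {..0} \<rightarrow>\<^sub>E eqv_bundles M G N \<rho>" using s by (simp add: se eqv_strings_def)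
    from PiE_mem[OF this, of 0] show "(case s of (B, \<alpha>) \<Rightarrow> B 0) \<in> eqv_bundles M G N \<rho>" by (simp add: se)
  qed
  show "(\<lambda>b. (\<lambda>i\<in>{..0::nat}. b, \<lambda>_. undefined)) ` eqv_bundles M G N \<rho> \<subseteq> eqv_strings M G N \<rho> 0"
    by (rule image_subsetI) (simp add: eqv_strings_def)
qed

lemma bij_betw_cell_vertex: "bij_betw (\<lambda>F :: ('m \<times> 'g list, 'e) hvb_simplex tot_cell. cell_vertex M G N \<rho> F 0) (cells 0) (eqv_bundles M G N \<rho>)"
proof -
  have "(\<lambda>(B, \<alpha>). B 0) \<circ> cell_string M G N \<rho> 0 = (\<lambda>F :: ('m \<times> 'g list, 'e) hvb_simplex tot_cell. cell_vertex M G N \<rho> F 0)"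
    by (rule ext) (simp add: cell_string_def)
  moreover have "bij_betw ((\<lambda>(B, \<alpha>). B 0) \<circ> cell_string M G N \<rho> 0)
      (cells 0 :: ('m \<times> 'g list, 'e) hvb_simplex tot_cell set) (eqv_bundles M G N \<rho>)"
    by (rule bij_betw_trans[OF bij_betw_cell_string bij_betw_eqv_strings_0])
  ultimately show ?thesis by (simp only:)
qed

end

theorem proposition5p3:
  fixes M :: "'m cmfd" and G :: "'g monoid" and N :: "'g cmfd" and \<rho> :: "'m \<Rightarrow> 'g \<Rightarrow> 'm"
  assumes "complex_manifold M"
    and "complex_lie_group G N"
    and "holo_right_action M G N \<rho>"
  shows "bij_betw (\<lambda>F. cell_vertex M G N \<rho> F 0)
           (simplices (Tot (HVB_quot M G N \<rho> :: ('m \<times> 'g list, 'e) hvb_simplex csset)) 0)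
           (eqv_bundles M G N \<rho>)
       \<and> (\<forall>n. bij_betw (cell_string M G N \<rho> n)
           (simplices (Tot (HVB_quot M G N \<rho> :: ('m \<times> 'g list, 'e) hvb_simplex csset)) n)
           (eqv_strings M G N \<rho> n))"
proof -
  interpret lie_action M G N \<rho> by (rule lie_action.intro) (rule assms)+
  show ?thesis by (intro conjI allI bij_betw_cell_vertex bij_betw_cell_string)
qed

end
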